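(* Let $\kappa$ be a constant real $3\times3$ matrix (the velocity gradient), $\mathbf D=\frac12(\kappa+\kappa^T)$, $\mathbf\Omega=\frac12(\kappa^T-\kappa)$ (so $\kappa=\mathbf D-\mathbf\Omega$). Let $h_{\eta,\mathbf n}$ be a stable critical point of $A[f]$, and let $\mathbf n(t)$ be a solution of $$\mathbf n\times\Big(\frac{\partial\mathbf n}{\partial t}+\mathbf\Omega\cdot\mathbf n-\lambda\,\mathbf D\cdot\mathbf n\Big)=0$$ with initial data $\mathbf n_0\in\mathbb S^2$ and with $\lambda$ given by $$\lambda=\lambda(\alpha)=\frac{\big\langle3(\mathbf m\cdot\mathbf n)^2-1\big\rangle_{h_{\eta,\mathbf n}}}{\big\langle g_0\frac{du_0}{d\theta}\big\rangle_{h_{\eta,\mathbf n}}},\qquad u_0=\mathcal Uh_{\eta,\mathbf n},$$ where $g_0$ is a solution of the equation (G) of the context. Assume that the initial data $f_0^\varepsilon\in H^1(\mathbb S^2)$ with $\int_{\mathbb S^2}f_0^\varepsilon\,d\mathbf m=1$ takes the form $$f^{\varepsilon}_0(\mathbf m)=h_{\eta,\mathbf n_0}(\mathbf m)+\sum_{k=1}^3\varepsilon^kf_{k}(\mathbf m,0)+\varepsilon^2f_{R,0}^\varepsilon(\mathbf m),$$ where $f_k(\mathbf m,t)$ $(k=1,2,3)$ are the smooth functions of the Hilbert expansion, i.e. mean-zero in $\mathbf m$ and satisfying, together with $f_0(\mathbf m,t)=h_{\eta,\mathbf n(t)}(\mathbf m)$, the equations (H1)--(H3) of the context, and where $\|f^\varepsilon_{R,0}\|_{H^{-1}(\mathbb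 S^2)}\le C$. Then for any $T>0$ there exists $\varepsilon_0>0$ such that for each $0<\varepsilon<\varepsilon_0$ the solution $f^\varepsilon(\mathbf m,t)$, with initial data $f_0^\varepsilon$, of $$\frac{\partial f^\varepsilon}{\partial t}=\frac1\varepsilon\mathcal R\cdot\big(\mathcal Rf^\varepsilon+f^\varepsilon\mathcal R\,\mathcal Uf^\varepsilon\big)-\mathcal R\cdot\big(\mathbf m\times(\mathbf D-\mathbf\Omega)\cdot\mathbf m\,f^\varepsilon\big)$$ takes the form $$f^\varepsilon(\mathbf m,t)=h_{\eta,\mathbf n(t)}(\mathbf m)+\sum_{k=1}^3\varepsilon^kf_k(\mathbf m,t)+\varepsilon^2f^\varepsilon_R(\mathbf m,t),$$ where $f_R^\varepsilon$ satisfies $$\|f_R^\varepsilon(t)\|_{H^{-1}(\mathbb S^2)}\le C\qquad\text{for any }t\in[0,T].$$ (The constants $C$ do not depend on $\varepsilon$.)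
   Context: $\mathbb S^2\subset\mathbb R^3$ is the unit sphere with surface measure $d\mathbf m$; $\mathcal R=\mathbf m\times\nabla_{\mathbf m}$ is the rotational gradient ($\nabla_{\mathbf m}$ the surface gradient); $\langle\cdot\rangle_f=\int_{\mathbb S^2}(\cdot)f\,d\mathbf m$. For the parameter $\alpha>0$, $\mathcal Uf(\mathbf m)=\alpha\int_{\mathbb S^2}|\mathbf m\times\mathbf m'|^2f(\mathbf m')\,d\mathbf m'$. The expression $\mathbf m\times\kappa\cdot\mathbf m$ means $\mathbf m\times(\kappa\mathbf m)$. The energy is $A[f]=\int_{\mathbb S^2}\big(f\ln f+\frac12f\,\mathcal Uf\big)d\mathbf m$. A function $h$ is a critical point of $A[f]$ if $\ln h+\mathcal Uh$ is constant; it is stable if $\int_{\mathbb S^2}\big(\frac\phi h+\mathcal U\phi\big)\phi\,d\mathbf m\ge0$ for all $\phi\in L^2(\mathbb S^2)$ with $\int_{\mathbb S^2}\phi\,d\mathbf m=0$. All critical points of unit mass have the form $h_{\eta,\mathbf n}(\mathbf m)=e^{\eta(\mathbf m\cdot\mathbf n)^2}/\int_{\mathbb S^2}e^{\eta(\mathbf m'\cdot\mathbf n)^2}d\mathbf m'$ with $\mathbf n\in\mathbb S^2$ arbitrary and $\eta$ a real number depending on $\alpha$. With $\theta$ the angle between $\mathbf m$ and $\mathbf n$, $u_0=\mathcal Uh_{\eta,\mathbf n}$ is a function of $\theta$ and $g_0=g_0(\theta)$; equation (G) is $$\frac1{\sin\theta}\frac{d}{d\theta}\Big(\sin\theta\frac{dg_0}{d\theta}\Big)-\frac{g_0}{\sin^2\theta}-\frac{du_0}{d\theta}\frac{dg_0}{d\theta}=-\frac{du_0}{d\theta}.$$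 Let $\mathcal G_{\mathbf n}f=\mathcal R\cdot(\mathcal Rf+h_{\eta,\mathbf n}\mathcal R\,\mathcal Uf+f\,\mathcal R\,\mathcal Uh_{\eta,\mathbf n})$. The equations of the Hilbert expansion are (H1) $\partial_tf_0=\mathcal G_{\mathbf n(t)}f_1-\mathcal R\cdot(\mathbf m\times\kappa\cdot\mathbf m\,f_0)$, (H2) $\partial_tf_1=\mathcal G_{\mathbf n(t)}f_2+\mathcal R\cdot(f_1\mathcal R\,\mathcal Uf_1)-\mathcal R\cdot(\mathbf m\times\kappa\cdot\mathbf m\,f_1)$, (H3) $\partial_tf_2=\mathcal G_{\mathbf n(t)}f_3+\mathcal R\cdot(f_1\mathcal R\,\mathcal Uf_2)+\mathcal R\cdot(f_2\mathcal R\,\mathcal Uf_1)-\mathcal R\cdot(\mathbf m\times\kappa\cdot\mathbf m\,f_2)$. For $f_0^\varepsilon\in H^1(\mathbb S^2)$ the kinetic equation has a unique global solution $f^\varepsilon\in C([0,\infty);H^1(\mathbb S^2))\cap L^2(0,T;H^2(\mathbb S^2))$ for every $T<\infty$; this is the solution meant. *)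

theory Defs
  imports "HOL-Analysis.Analysis"
begin

section \<open>The unit sphere and the rotational gradient\<close>

text \<open>
  A function on the unit sphere is represented by a function on the ambient space of which only
  the values on the sphere matter.  The library function \<^term>\<open>sgn\<close> is the radial projection
  \<open>x \<mapsto> x / |x|\<close>.
\<close>

abbreviation S2 :: "(real^3) set" where
  "S2 \<equiv> sphere 0 1"

text \<open>
  The surface measure in polar coordinates: the area of \<open>A\<close> is three times the volume of the
  cone \<open>{r m | 0 < r < 1, m \<in> A}\<close>, since \<open>\<integral>\<^sub>0\<^sup>1 r\<^sup>2 dr = 1/3\<close>.
\<close>

definition surf :: "(real^3) measure" where
  "surf = scale_measure 3 (distr (restrict_space lborel (ball 0 1 - {0})) (restrict_space borel S2) sgn)"

text \<open>
  On the sphere the surface gradient is the ambient gradient of the extension which is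
  homogeneous of degree 0.
\<close>

definition surface_grad :: "(real^3 \<Rightarrow> real) \<Rightarrow> real^3 \<Rightarrow> real^3" where
  "surface_grad f m = (\<chi> i. frechet_derivative (\<lambda>x. f (sgn x)) (at m) (axis i 1))"

definition rgrad :: "(real^3 \<Rightarrow> real) \<Rightarrow> real^3 \<Rightarrow> real^3" where
  "rgrad f m = cross3 m (surface_grad f m)"

definition rdiv :: "(real^3 \<Rightarrow> real^3) \<Rightarrow> real^3 \<Rightarrow> real" where
  "rdiv F m = (\<Sum>i\<in>UNIV. rgrad (\<lambda>x. F x $ i) m $ i)"


section \<open>Smooth functions\<close>

text \<open>\<open>Ck_on k S f\<close> is meant for open \<open>S\<close>: all iterated directional derivatives up to order \<open>k\<close>
  exist and are continuous.\<close>

primrec Ck_on :: "nat \<Rightarrow> 'a::euclidean_space set \<Rightarrow> ('a \<Rightarrow> real) \<Rightarrow> bool" where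
  "Ck_on 0 S f = continuous_on S f"
| "Ck_on (Suc k) S f =
    (f differentiable_on S \<and> (\<forall>v. Ck_on k S (\<lambda>x. frechet_derivative f (at x) v)))"

definition smooth_on :: "'a::euclidean_space set \<Rightarrow> ('a \<Rightarrow> real) \<Rightarrow> bool" where
  "smooth_on S f \<longleftrightarrow> (\<forall>k. Ck_on k S f)"

definition sphere_smooth :: "(real^3 \<Rightarrow> real) \<Rightarrow> bool" where
  "sphere_smooth f \<longleftrightarrow> smooth_on (- {0}) (\<lambda>x. f (sgn x))"

text \<open>Joint smoothness on \<open>S2 \<times> [0,\<infinity>)\<close>, up to the boundary \<open>t = 0\<close>: there is a smooth extension to
  all times.\<close>

definition sphere_time_smooth :: "(real \<Rightarrow> real^3 \<Rightarrow> real) \<Rightarrow> bool" where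
  "sphere_time_smooth f \<longleftrightarrow>
     (\<exists>E :: (real^3) \<times> real \<Rightarrow> real. smooth_on ((- {0}) \<times> UNIV) E \<and>
        (\<forall>x t. x \<noteq> 0 \<and> t \<ge> 0 \<longrightarrow> E (x, t) = f t (sgn x)))"


section \<open>Sobolev spaces on the sphere\<close>

definition sphere_L2 :: "(real^3 \<Rightarrow> real) \<Rightarrow> bool" where
  "sphere_L2 f \<longleftrightarrow> f \<in> borel_measurable surf \<and> integrable surf (\<lambda>m. (f m)\<^sup>2)"

text \<open>
  The components of the rotational gradient generate rotations about the coordinate axes, so they
  are antisymmetric with respect to the surface measure and there is no curvature term in the
  integration by parts formula.  Moreover \<open>|\<R> f| = |\<nabla> f|\<close> on the sphere, so the norm of
  \<open>H\<^sup>1\<close> below is the usual one.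
\<close>

definition has_weak_rgrad :: "(real^3 \<Rightarrow> real) \<Rightarrow> (real^3 \<Rightarrow> real^3) \<Rightarrow> bool" where
  "has_weak_rgrad f G \<longleftrightarrow>
     (\<forall>i. sphere_L2 (\<lambda>m. G m $ i)) \<and>
     (\<forall>\<phi>. sphere_smooth \<phi> \<longrightarrow>
        (\<forall>i. (LINT m|surf. f m * rgrad \<phi> m $ i) = - (LINT m|surf. G m $ i * \<phi> m)))"

definition weak_rgrad :: "(real^3 \<Rightarrow> real) \<Rightarrow> real^3 \<Rightarrow> real^3" where
  "weak_rgrad f = (SOME G. has_weak_rgrad f G)"

definition sphere_H1 :: "(real^3 \<Rightarrow> real) \<Rightarrow> bool" where
  "sphere_H1 f \<longleftrightarrow> sphere_L2 f \<and> (\<exists>G. has_weak_rgrad f G)"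

definition sphere_H1_norm :: "(real^3 \<Rightarrow> real) \<Rightarrow> real" where
  "sphere_H1_norm f =
     sqrt ((LINT m|surf. (f m)\<^sup>2) + (LINT m|surf. (norm (weak_rgrad f m))\<^sup>2))"

definition sphere_H2 :: "(real^3 \<Rightarrow> real) \<Rightarrow> bool" where
  "sphere_H2 f \<longleftrightarrow> sphere_H1 f \<and> (\<forall>i. sphere_H1 (\<lambda>m. weak_rgrad f m $ i))"

definition sphere_H2_norm :: "(real^3 \<Rightarrow> real) \<Rightarrow> real" where
  "sphere_H2_norm f =
     sqrt ((LINT m|surf. (f m)\<^sup>2) + (\<Sum>i\<in>UNIV. (sphere_H1_norm (\<lambda>m. weak_rgrad f m $ i))\<^sup>2))"

text \<open>The norm of the dual of \<open>H\<^sup>1\<close>, for the functionals that are given by an \<open>L\<^sup>2\<close> function.\<close>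

definition sphere_Hm1_norm :: "(real^3 \<Rightarrow> real) \<Rightarrow> ereal" where
  "sphere_Hm1_norm f =
     (if sphere_L2 f
      then SUP \<phi>\<in>{\<phi>. sphere_H1 \<phi> \<and> sphere_H1_norm \<phi> \<le> 1}. ereal \<bar>LINT m|surf. f m * \<phi> m\<bar>
      else \<infinity>)"


section \<open>The interaction potential and its critical points\<close>

definition mean_field :: "real \<Rightarrow> (real^3 \<Rightarrow> real) \<Rightarrow> real^3 \<Rightarrow> real" where
  "mean_field \<alpha> f m = \<alpha> * (LINT m'|surf. (norm (cross3 m m'))\<^sup>2 * f m')"

definition avg :: "(real^3 \<Rightarrow> real) \<Rightarrow> (real^3 \<Rightarrow> real) \<Rightarrow> real" where
  "avg f g = (LINT m|surf. g m * f m)"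

definition equilibrium :: "real \<Rightarrow> real^3 \<Rightarrow> real^3 \<Rightarrow> real" where
  "equilibrium \<eta> n m = exp (\<eta> * (m \<bullet> n)\<^sup>2) / (LINT m'|surf. exp (\<eta> * (m' \<bullet> n)\<^sup>2))"

text \<open>
  The energy is \<open>A[f] = \<integral> (f ln f + f (mean_field \<alpha> f) / 2)\<close>.  Its critical points under the mass
  constraint are given by the Euler-Lagrange equation, stability by the second variation.
\<close>

definition critical_point :: "real \<Rightarrow> (real^3 \<Rightarrow> real) \<Rightarrow> bool" where
  "critical_point \<alpha> h \<longleftrightarrow> (\<exists>c. \<forall>m\<in>S2. ln (h m) + mean_field \<alpha> h m = c)"

definition stable_point :: "real \<Rightarrow> (real^3 \<Rightarrow> real) \<Rightarrow> bool" where
  "stable_point \<alpha> h \<longleftrightarrow>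
     (\<forall>\<phi>. sphere_L2 \<phi> \<and> (LINT m|surf. \<phi> m) = 0 \<longrightarrow>
        0 \<le> (LINT m|surf. (\<phi> m / h m + mean_field \<alpha> \<phi> m) * \<phi> m))"

text \<open>\<open>u\<close> is the profile, as a function of the angle from \<open>n\<close>, of a function that is axially
  symmetric about \<open>n\<close>.\<close>

definition angular_profile :: "real^3 \<Rightarrow> (real^3 \<Rightarrow> real) \<Rightarrow> (real \<Rightarrow> real) \<Rightarrow> bool" where
  "angular_profile n f u \<longleftrightarrow> (\<forall>m\<in>S2. f m = u (arccos (m \<bullet> n)))"

definition solves_g0_equation :: "(real \<Rightarrow> real) \<Rightarrow> (real \<Rightarrow> real) \<Rightarrow> bool" where
  "solves_g0_equation u g \<longleftrightarrow>
     (\<forall>\<theta>\<in>{0<..<pi}.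
        g differentiable (at \<theta>) \<and> deriv g differentiable (at \<theta>) \<and>
        1 / sin \<theta> * deriv (\<lambda>x. sin x * deriv g x) \<theta> - g \<theta> / (sin \<theta>)\<^sup>2 - deriv u \<theta> * deriv g \<theta>
          = - deriv u \<theta>)"


section \<open>Director dynamics\<close>

definition strain :: "real^3^3 \<Rightarrow> real^3^3" where
  "strain \<kappa> = (1/2) *\<^sub>R (\<kappa> + transpose \<kappa>)"

definition vorticity :: "real^3^3 \<Rightarrow> real^3^3" where
  "vorticity \<kappa> = (1/2) *\<^sub>R (transpose \<kappa> - \<kappa>)"

text \<open>The equation itself does not constrain \<open>|n|\<close>; that \<open>n\<close> takes values in the sphere is part of
  the notion of solution.\<close>

definition director_solution ::
    "real^3^3 \<Rightarrow> real^3^3 \<Rightarrow> real \<Rightarrow> real^3 \<Rightarrow> (real \<Rightarrow> real^3) \<Rightarrow> bool" where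
  "director_solution D \<Omega> lam n0 n \<longleftrightarrow>
     n 0 = n0 \<and> (\<forall>t\<ge>0. n t \<in> S2) \<and>
     (\<forall>t\<ge>0. \<exists>n'. (n has_vector_derivative n') (at t within {0..}) \<and>
        cross3 (n t) (n' + \<Omega> *v n t - lam *\<^sub>R (D *v n t)) = 0)"


section \<open>The Hilbert expansion\<close>

definition linearized :: "real \<Rightarrow> (real^3 \<Rightarrow> real) \<Rightarrow> (real^3 \<Rightarrow> real) \<Rightarrow> real^3 \<Rightarrow> real" where
  "linearized \<alpha> h f =
     rdiv (\<lambda>m. rgrad f m + h m *\<^sub>R rgrad (mean_field \<alpha> f) m + f m *\<^sub>R rgrad (mean_field \<alpha> h) m)"

definition interaction ::
    "real \<Rightarrow> (real^3 \<Rightarrow> real) \<Rightarrow> (real^3 \<Rightarrow> real) \<Rightarrow> real^3 \<Rightarrow> real" where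
  "interaction \<alpha> f g = rdiv (\<lambda>m. f m *\<^sub>R rgrad (mean_field \<alpha> g) m)"

definition transport :: "real^3^3 \<Rightarrow> (real^3 \<Rightarrow> real) \<Rightarrow> real^3 \<Rightarrow> real" where
  "transport \<kappa> f = rdiv (\<lambda>m. f m *\<^sub>R cross3 m (\<kappa> *v m))"

definition hilbert_expansion ::
    "real \<Rightarrow> real \<Rightarrow> real^3^3 \<Rightarrow> (real \<Rightarrow> real^3) \<Rightarrow> (nat \<Rightarrow> real \<Rightarrow> real^3 \<Rightarrow> real) \<Rightarrow> bool" where
  "hilbert_expansion \<alpha> \<eta> \<kappa> n f \<longleftrightarrow>
     (\<forall>k\<in>{1..3}. sphere_time_smooth (f k) \<and> (\<forall>t\<ge>0. (LINT m|surf. f k t m) = 0)) \<and>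
     (\<forall>t\<ge>0. \<forall>m\<in>S2.
        ((\<lambda>s. equilibrium \<eta> (n s) m) has_real_derivative
           linearized \<alpha> (equilibrium \<eta> (n t)) (f 1 t) m
           - transport \<kappa> (equilibrium \<eta> (n t)) m) (at t within {0..}) \<and>
        ((\<lambda>s. f 1 s m) has_real_derivative
           linearized \<alpha> (equilibrium \<eta> (n t)) (f 2 t) m
           + interaction \<alpha> (f 1 t) (f 1 t) m
           - transport \<kappa> (f 1 t) m) (at t within {0..}) \<and>
        ((\<lambda>s. f 2 s m) has_real_derivative
           linearized \<alpha> (equilibrium \<eta> (n t)) (f 3 t) m
           + interaction \<alpha> (f 1 t) (f 2 t) m + interaction \<alpha> (f 2 t) (f 1 t) m
           - transport \<kappa> (f 2 t) m) (at t within {0..}))"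


section \<open>The kinetic equation\<close>

definition kinetic_flux ::
    "real \<Rightarrow> real^3^3 \<Rightarrow> real \<Rightarrow> (real^3 \<Rightarrow> real) \<Rightarrow> real^3 \<Rightarrow> real^3" where
  "kinetic_flux \<alpha> \<kappa> \<epsilon> f m =
     (1/\<epsilon>) *\<^sub>R (weak_rgrad f m + f m *\<^sub>R rgrad (mean_field \<alpha> f) m) - f m *\<^sub>R cross3 m (\<kappa> *v m)"

text \<open>
  Solutions in \<open>C([0,\<infinity>); H\<^sup>1) \<inter> L\<^sup>2(0,T; H\<^sup>2)\<close> for every \<open>T\<close>.  The equation \<open>\<partial>\<^sub>t f = \<R> \<cdot> flux\<close> is
  required in the sense of distributions on the sphere, integrated in time.
\<close>

definition kinetic_solution ::
    "real \<Rightarrow> real^3^3 \<Rightarrow> real \<Rightarrow> (real^3 \<Rightarrow> real) \<Rightarrow> (real \<Rightarrow> real^3 \<Rightarrow> real) \<Rightarrow> bool" where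
  "kinetic_solution \<alpha> \<kappa> \<epsilon> f0 f \<longleftrightarrow>
     (\<forall>t\<ge>0. sphere_H1 (f t)) \<and>
     (\<forall>t\<ge>0. ((\<lambda>s. sphere_H1_norm (\<lambda>m. f s m - f t m)) \<longlongrightarrow> 0) (at t within {0..})) \<and>
     (\<forall>T>0. (AE t in lebesgue_on {0..T}. sphere_H2 (f t)) \<and>
            integrable (lebesgue_on {0..T}) (\<lambda>t. (sphere_H2_norm (f t))\<^sup>2)) \<and>
     (AE m in surf. f 0 m = f0 m) \<and>
     (\<forall>\<phi>. sphere_smooth \<phi> \<longrightarrow>
        (\<forall>t\<ge>0. (LINT m|surf. f t m * \<phi> m) =
           (LINT m|surf. f0 m * \<phi> m)
           - integral {0..t} (\<lambda>s. LINT m|surf. kinetic_flux \<alpha> \<kappa> \<epsilon> (f s) m \<bullet> rgrad \<phi> m)))"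

end

theory Submission
  imports Defs
begin

text \<open>The remainder is measured by a weighted dual energy.  Write \<open>r = (f\<^sub>\<epsilon> - h - \<Sum> \<epsilon>\<^sup>k f\<^sub>k) / \<epsilon>\<^sup>2\<close> and
    \<open>E = sup {2 \<integral> r \<phi> - \<integral> h |\<R> \<phi>|\<^sup>2 | \<phi> smooth}\<close>,
  with the equilibrium \<open>h\<close> at the current director as weight.  Since \<open>h\<close> lies between two positive constants that depend on
  \<open>\<eta>\<close> only, \<open>E\<close> is comparable to the square of the norm of \<open>r\<close> in the dual of \<open>H\<^sup>1\<close>
  (\<open>Hm1_norm_le\<close>, \<open>initial_energy\<close>), and it suffices to bound \<open>E\<close> on \<open>[0,T]\<close> uniformly in \<open>\<epsilon>\<close>.

  The expansion cancels all terms of the equation up to order \<open>\<epsilon>\<^sup>2\<close>, which leaves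
    \<open>\<partial>\<^sub>t r = (1/\<epsilon>) \<G> r + \<R> \<cdot> (F \<R> U r) - \<R> \<cdot> (r m \<times> L m) + O(\<epsilon>)\<close>,
  where \<open>F = f\<^sub>1 + \<epsilon> f\<^sub>2 + \<epsilon>\<^sup>2 f\<^sub>3\<close> and \<open>L\<close> is a linear map of \<open>\<real>\<^sup>3\<close> (\<open>V_expansion\<close>, \<open>rate_identity\<close>).  To first order
  \<open>E\<close> changes by twice the pairing of the right hand side with a maximizer \<open>\<phi>\<close>, that is, with the solution of \<open>- \<R> \<cdot> (h \<R> \<phi>) = r\<close>.

  The singular term has a sign.  Because \<open>h\<close> is critical, \<open>\<G> r = \<R> \<cdot> (h \<R> (r/h + U r))\<close>, so its pairing with
  \<open>\<phi>\<close> is \<open>- \<integral> r (r/h + U r)\<close>, and this is nonpositive by stability (\<open>lin_flux_dissipation\<close>).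

  The other terms have to be bounded by \<open>E\<close> alone, as there is no bound on the \<open>L\<^sup>2\<close> norm of \<open>r\<close>.
  The potential \<open>U r\<close> depends on \<open>r\<close> through its second moments only, and these are pairings with smooth functions, hence at
  most a multiple of \<open>\<surd>E\<close> (\<open>qop_dual_bound\<close>).  The transport term \<open>\<integral> r (m \<times> L m) \<cdot> \<R> \<phi>\<close> looks like the product of \<open>r\<close> with
  a gradient, but it is an inner variation: compare the maximizer \<open>\<phi>\<close> with \<open>\<phi>\<close> composed with the
  map of the sphere that \<open>1 + \<sigma> L\<close> induces.  The supremum does not increase, and the weighted Dirichlet integral changes
  by a factor \<open>1 + O(\<sigma>)\<close>, so that the term is at most a constant times \<open>|L| E\<close> (\<open>inner_variation\<close>).  The quadratic term of the
  equation is part of it: its contribution to \<open>L\<close> has size \<open>\<epsilon> \<surd>E\<close>.  Altogether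
  \<open>E' \<le> K (1 + E + \<epsilon> E \<surd>E)\<close>, and a comparison with an exponential function concludes the proof for all \<open>\<epsilon>\<close>
  that are small compared to its value at \<open>T\<close> (\<open>remainder_bound\<close>).

  Maximizers would have to be constructed and shown to be smooth.  Instead, near-maximizers up to \<open>s\<^sup>2\<close> are used over a time
  step \<open>s\<close>, where an error \<open>o(s)\<close> is harmless; this gives a bound on the backward difference quotients of
  \<open>E\<close> (\<open>E_left\<close>), which together with one-sided continuity (\<open>E_right\<close>) is enough for a comparison principle (\<open>comparison\<close>).  The passage
  between smooth functions and the Sobolev spaces uses convolution with powers of \<open>1 + m \<cdot> m'\<close>.  These kernels
  also give the Poincare inequality, because their Laplacians telescope.\<close>

section \<open>The surface measure under linear maps\<close>

lemma nn_integral_lborel_linear: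
  fixes M :: "(real, 'n::{finite,wellorder}) vec \<Rightarrow> (real, 'n) vec"
  assumes lin: "linear M" and inj: "inj M" and g: "g \<in> borel_measurable borel"
  shows "(\<integral>\<^sup>+x. g x \<partial>lborel) = ennreal \<bar>det (matrix M)\<bar> * (\<integral>\<^sup>+x. g (M x) \<partial>lborel)"
proof -
  let ?d = "\<bar>det (matrix M)\<bar>"
  have surj: "surj M" using linear_inj_imp_surj[OF lin inj] .
  have cM: "continuous_on UNIV M" using lin by (simp add: linear_continuous_on linear_linear)
  have M[measurable]: "M \<in> borel_measurable borel" using cM by (rule borel_measurable_continuous_onI)
  obtain N where N: "linear N" "\<And>x. N (M x) = x" "\<And>x. M (N x) = x"
    using linear_injective_left_inverse[OF lin inj] linear_surjective_right_inverse[OF lin surj]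
    by (metis comp_apply id_apply lin linear_inverse_left)
  have "lborel = scale_measure (ennreal ?d) (distr lborel borel M)"
  proof (rule lborel_eqI)
    fix l u :: "(real, 'n) vec" assume lu: "\<And>b. b \<in> Basis \<Longrightarrow> l \<bullet> b \<le> u \<bullet> b"
    have pre: "M -` box l u = N ` box l u" using N by (metis bij_image_Collect_eq bij_vimage_eq_inv_image bijI' inv_equality)
    have box: "box l u \<in> lmeasurable" by simp
    have Nb: "N ` box l u \<in> lmeasurable" using measurable_linear_image[OF N(1) box] .
    have MN: "M ` N ` box l u = box l u" using N by (simp add: image_image)
    have Nbo: "N ` box l u \<in> sets borel"
      unfolding pre[symmetric] by (intro borel_open open_vimage cM open_box)
    have "emeasure (scale_measure (ennreal ?d) (distr lborel borel M)) (box l u)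
        = ennreal ?d * emeasure lborel (N ` box l u)"
      by (simp add: emeasure_distr pre)
    also have "emeasure lborel (N ` box l u) = ennreal (measure lebesgue (N ` box l u))"
      using Nb Nbo emeasure_eq_measure2[OF Nb] by simp
    also have "ennreal ?d * \<dots> = ennreal (?d * measure lebesgue (N ` box l u))"
      by (simp add: ennreal_mult')
    also have "\<dots> = ennreal (measure lebesgue (box l u))"
      using measure_linear_image[OF lin Nb] by (simp add: MN)
    also have "\<dots> = ennreal (\<Prod>b\<in>Basis. (u - l) \<bullet> b)"
      using lu by (simp add: measure_lborel_box_eq)
    finally show "emeasure (scale_measure (ennreal ?d) (distr lborel borel M)) (box l u)
        = ennreal (\<Prod>b\<in>Basis. (u - l) \<bullet> b)" .
  qed simp
  then have "(\<integral>\<^sup>+x. g x \<partial>lborel) = (\<integral>\<^sup>+x. g x \<partial>(scale_measure (ennreal ?d) (distr lborel borel M)))"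
    by metis
  also have "\<dots> = ennreal ?d * (\<integral>\<^sup>+x. g x \<partial>(distr lborel borel M))"
    using g by (subst nn_integral_scale_measure) auto
  also have "(\<integral>\<^sup>+x. g x \<partial>(distr lborel borel M)) = (\<integral>\<^sup>+x. g (M x) \<partial>lborel)"
    using g by (subst nn_integral_distr) auto
  finally show ?thesis .
qed

lemma space_surf [simp]: "space surf = S2"
  by (simp add: surf_def space_scale_measure space_restrict_space)

lemma sets_surf [measurable_cong]: "sets surf = sets (restrict_space borel S2)"
  by (simp add: surf_def)

lemma borel_measurable_surf_iff:
  fixes g :: "real^3 \<Rightarrow> ennreal"
  shows "g \<in> borel_measurable surf \<longleftrightarrow> (\<lambda>x. g x * indicator S2 x) \<in> borel_measurable borel"
proof -
  have "g \<in> borel_measurable surf \<longleftrightarrow> g \<in> borel_measurable (restrict_space borel S2)"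
    by (simp add: measurable_cong_sets[OF sets_surf refl])
  also have "\<dots> \<longleftrightarrow> (\<lambda>x. g x * indicator S2 x) \<in> borel_measurable borel"
    by (subst borel_measurable_restrict_space_iff_ennreal) (auto simp: mult.commute)
  finally show ?thesis .
qed

lemma sgn_in_S2: "x \<noteq> 0 \<Longrightarrow> sgn x \<in> S2" for x :: "real^3"
  by (simp add: norm_sgn)

lemma sgn_S2 [simp]: "m \<in> S2 \<Longrightarrow> sgn m = m" for m :: "real^3"
  by (simp add: sgn_div_norm)

lemma sgn_measurable [measurable]: "sgn \<in> borel_measurable (borel :: (real^3) measure)"
  unfolding sgn_div_norm by measurable

lemma sgn_measurable_S2:
  "sgn \<in> restrict_space lborel (ball 0 1 - {0}) \<rightarrow>\<^sub>M restrict_space borel S2"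
proof (rule measurable_restrict_space2)
  show "sgn \<in> space (restrict_space lborel (ball 0 1 - {0 :: real^3})) \<rightarrow> S2"
    using sgn_in_S2 by (auto simp: space_restrict_space)
  show "sgn \<in> restrict_space lborel (ball 0 1 - {0 :: real^3}) \<rightarrow>\<^sub>M borel"
    by (rule measurable_restrict_space1) simp
qed

lemma measurable_sgn_ball:
  fixes g :: "real^3 \<Rightarrow> ennreal"
  assumes "g \<in> borel_measurable surf"
  shows "(\<lambda>x. g (sgn x) * indicator (ball 0 r - {0}) x) \<in> borel_measurable borel"
proof -
  let ?g = "\<lambda>x. g x * indicator S2 x"
  have "?g \<in> borel_measurable borel" using assms by (simp add: borel_measurable_surf_iff)
  from measurable_compose[OF sgn_measurable this]
  have "(\<lambda>x. ?g (sgn x) * indicator (ball 0 r - {0}) x) \<in> borel_measurable borel"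
    by (rule borel_measurable_times_ennreal) (intro borel_measurable_indicator borel_open open_delete open_ball)
  also have "(\<lambda>x. ?g (sgn x) * indicator (ball 0 r - {0}) x) = (\<lambda>x. g (sgn x) * indicator (ball 0 r - {0}) x)"
    using sgn_in_S2 by (auto simp: fun_eq_iff indicator_def)
  finally show ?thesis .
qed

lemma nn_integral_surf:
  assumes "g \<in> borel_measurable surf"
  shows "(\<integral>\<^sup>+m. g m \<partial>surf) = 3 * (\<integral>\<^sup>+x. g (sgn x) * indicator (ball 0 1 - {0}) x \<partial>lborel)"
proof -
  have g: "g \<in> borel_measurable (restrict_space borel S2)"
    using assms by (simp add: measurable_cong_sets[OF sets_surf refl])
  have "(\<integral>\<^sup>+m. g m \<partial>surf) = 3 * (\<integral>\<^sup>+x. g (sgn x) \<partial>restrict_space lborel (ball 0 1 - {0}))"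
    unfolding surf_def using g sgn_measurable_S2
    by (subst nn_integral_scale_measure) (auto simp: nn_integral_distr)
  also have "(\<integral>\<^sup>+x. g (sgn x) \<partial>restrict_space lborel (ball 0 1 - {0}))
      = (\<integral>\<^sup>+x. g (sgn x) * indicator (ball 0 1 - {0}) x \<partial>lborel)"
    by (subst nn_integral_restrict_space) auto
  finally show ?thesis .
qed

text \<open>The integrand is homogeneous of degree 0, so only the volume element scales.\<close>

lemma nn_integral_scaled_ball:
  assumes g: "g \<in> borel_measurable surf" and r: "r > 0"
  shows "(\<integral>\<^sup>+x. g (sgn x) * indicator (ball 0 r - {0}) x \<partial>lborel)
     = ennreal (r^3) * (\<integral>\<^sup>+x. g (sgn x) * indicator (ball 0 1 - {0}) x \<partial>lborel)"
proof -
  let ?M = "\<lambda>x::real^3. r *\<^sub>R x"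
  have "(\<integral>\<^sup>+x. g (sgn x) * indicator (ball 0 r - {0}) x \<partial>lborel)
     = ennreal \<bar>det (matrix ?M)\<bar> * (\<integral>\<^sup>+x. g (sgn (?M x)) * indicator (ball 0 r - {0}) (?M x) \<partial>lborel)"
    using r by (intro nn_integral_lborel_linear measurable_sgn_ball g) (auto simp: linear_iff algebra_simps inj_on_def)
  also have "det (matrix ?M) = r^3"
    by (simp add: det_3 matrix_def axis_def power3_eq_cube)
  also have "(\<lambda>x. g (sgn (?M x)) * indicator (ball 0 r - {0}) (?M x))
      = (\<lambda>x. g (sgn x) * indicator (ball 0 1 - {0}) x)"
    using r by (auto simp: fun_eq_iff indicator_def sgn_scaleR abs_mult)
  finally show ?thesis using r by simp
qed

text \<open>The map that a linear map induces on the sphere distorts areas by at most the ratio of the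
  extreme stretchings, cubed: the cone over a set is mapped into a ball of radius \<open>b\<close>, while the
  determinant is at least \<open>a\<^sup>3\<close>.\<close>

lemma nn_integral_surf_linear_le:
  fixes M :: "real^3 \<Rightarrow> real^3"
  assumes lin: "linear M" and a: "a > 0" and lower: "\<And>x. a * norm x \<le> norm (M x)"
    and upper: "\<And>x. norm (M x) \<le> b * norm x" and g: "g \<in> borel_measurable surf"
  shows "(\<integral>\<^sup>+m. g (sgn (M m)) \<partial>surf) \<le> ennreal ((b/a)^3) * (\<integral>\<^sup>+m. g m \<partial>surf)"
proof -
  let ?d = "\<bar>det (matrix M)\<bar>"
  have ab: "a \<le> b" using lower[of "axis 1 1"] upper[of "axis 1 1"] by simp
  have b: "b > 0" using a ab by simp
  have M0: "M x = 0 \<longleftrightarrow> x = 0" for x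
    using lower[of x] a lin by (auto simp: linear_0 mult_le_0_iff)
  have inj: "inj M" using lin M0 by (simp add: linear_injective_0)
  have surj: "surj M" using linear_inj_imp_surj[OF lin inj] .
  have M[measurable]: "M \<in> borel_measurable borel"
    using lin by (intro borel_measurable_continuous_onI) (simp add: linear_continuous_on linear_linear)
  have m1: "(\<lambda>m. g (sgn (M m))) \<in> borel_measurable surf"
  proof -
    have "(\<lambda>m. sgn (M m)) \<in> measurable (restrict_space borel S2) (restrict_space borel S2)"
      using M0 by (intro measurable_restrict_space2 measurable_restrict_space1)
        (auto simp: space_restrict_space norm_sgn)
    with g show ?thesis by (auto simp: measurable_cong_sets[OF sets_surf refl] intro: measurable_compose)
  qed
  have "ennreal ?d * (\<integral>\<^sup>+x. g (sgn (M x)) * indicator (ball 0 1 - {0}) x \<partial>lborel)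
      \<le> ennreal ?d * (\<integral>\<^sup>+x. g (sgn (M x)) * indicator (ball 0 b - {0}) (M x) \<partial>lborel)"
  proof (rule mult_left_mono[OF nn_integral_mono])
    fix x show "g (sgn (M x)) * indicator (ball 0 1 - {0}) x \<le> g (sgn (M x)) * indicator (ball 0 b - {0}) (M x)"
    proof (cases "x \<in> ball 0 1 - {0}")
      case True
      then have "norm (M x) < b" using upper[of x] b
        by (metis Diff_iff dist_0_norm mem_ball mult.commute mult_less_cancel_left2 order.strict_trans1 linorder_not_le)
      then show ?thesis using True M0 by simp
    qed simp
  qed simp
  also have "\<dots> = (\<integral>\<^sup>+x. g (sgn x) * indicator (ball 0 b - {0}) x \<partial>lborel)"
    using lin inj by (intro nn_integral_lborel_linear[symmetric] measurable_sgn_ball g)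
  also have "\<dots> = ennreal (b^3) * (\<integral>\<^sup>+x. g (sgn x) * indicator (ball 0 1 - {0}) x \<partial>lborel)"
    using g b by (rule nn_integral_scaled_ball)
  also have "(\<lambda>x. g (sgn (M x)) * indicator (ball 0 1 - {0}) x) = (\<lambda>x. g (sgn (M (sgn x))) * indicator (ball 0 1 - {0}) x)"
    using lin by (auto simp: fun_eq_iff sgn_div_norm linear_scale sgn_scaleR indicator_def field_simps)
  finally have 1: "ennreal ?d * (\<integral>\<^sup>+m. g (sgn (M m)) \<partial>surf) \<le> ennreal (b^3) * (\<integral>\<^sup>+m. g m \<partial>surf)"
    using mult_left_mono[of _ _ "3::ennreal"]
    by (simp add: nn_integral_surf[OF g] nn_integral_surf[OF m1] sgn_scaleR mult.left_commute)
  have d: "a^3 \<le> ?d"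
  proof -
    have "ball 0 a \<subseteq> M ` ball 0 1"
    proof
      fix y :: "real^3" assume y: "y \<in> ball 0 a"
      obtain x where x: "y = M x" using surj by auto
      have "a * norm x < a" using lower[of x] y x by simp
      then show "y \<in> M ` ball 0 1" using a x by simp
    qed
    then have "measure lebesgue (ball (0::real^3) a) \<le> measure lebesgue (M ` ball 0 1)"
      using measurable_linear_image[OF lin, of "ball 0 1"] by (intro measure_mono_fmeasurable) auto
    also have "\<dots> = ?d * measure lebesgue (ball (0::real^3) 1)"
      by (intro measure_linear_image lin) simp
    also have "measure lebesgue (ball (0::real^3) a) = a^3 * measure lebesgue (ball (0::real^3) 1)"
      using a content_ball_conv_unit_ball[of a "0 :: real^3"] by simp
    finally show ?thesis using content_ball_pos[of 1 "0 :: real^3"] by simp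
  qed
  have "ennreal (a^3) * (\<integral>\<^sup>+m. g (sgn (M m)) \<partial>surf) \<le> ennreal ?d * (\<integral>\<^sup>+m. g (sgn (M m)) \<partial>surf)"
    using d by (intro mult_right_mono ennreal_leI) auto
  with 1 have "ennreal (a^3) * (\<integral>\<^sup>+m. g (sgn (M m)) \<partial>surf) \<le> ennreal (b^3) * (\<integral>\<^sup>+m. g m \<partial>surf)" by simp
  then have "ennreal (1/a^3) * (ennreal (a^3) * (\<integral>\<^sup>+m. g (sgn (M m)) \<partial>surf))
      \<le> ennreal (1/a^3) * (ennreal (b^3) * (\<integral>\<^sup>+m. g m \<partial>surf))" by (rule mult_left_mono) simp
  then show ?thesis using a b
    by (simp add: mult.assoc[symmetric] ennreal_mult'[symmetric] power_divide)
qed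

text \<open>The preceding bound for the inverse map.\<close>

lemma nn_integral_surf_linear_ge:
  fixes M :: "real^3 \<Rightarrow> real^3"
  assumes lin: "linear M" and a: "a > 0" and lower: "\<And>x. a * norm x \<le> norm (M x)"
    and upper: "\<And>x. norm (M x) \<le> b * norm x" and g: "g \<in> borel_measurable surf"
  shows "(\<integral>\<^sup>+m. g m \<partial>surf) \<le> ennreal ((b/a)^3) * (\<integral>\<^sup>+m. g (sgn (M m)) \<partial>surf)"
proof -
  have ab: "a \<le> b" using lower[of "axis 1 1"] upper[of "axis 1 1"] by simp
  have b: "b > 0" using a ab by simp
  have M0: "M x = 0 \<longleftrightarrow> x = 0" for x
    using lower[of x] a lin by (auto simp: linear_0 mult_le_0_iff)
  have inj: "inj M" using lin M0 by (simp add: linear_injective_0)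
  obtain N where N: "linear N" "\<And>x. N (M x) = x" "\<And>x. M (N x) = x"
    using linear_injective_isomorphism[OF lin inj] by auto
  have N1: "1/b * norm x \<le> norm (N x)" "norm (N x) \<le> 1/a * norm x" for x
    using lower[of "N x"] upper[of "N x"] a b by (simp_all add: N field_simps)
  have M[measurable]: "M \<in> borel_measurable borel"
    using lin by (intro borel_measurable_continuous_onI) (simp add: linear_continuous_on linear_linear)
  have m1: "(\<lambda>m. g (sgn (M m))) \<in> borel_measurable surf"
  proof -
    have "(\<lambda>m. sgn (M m)) \<in> measurable (restrict_space borel S2) (restrict_space borel S2)"
      using M0 by (intro measurable_restrict_space2 measurable_restrict_space1)
        (auto simp: space_restrict_space norm_sgn)
    with g show ?thesis by (auto simp: measurable_cong_sets[OF sets_surf refl] intro: measurable_compose)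
  qed
  have "(\<integral>\<^sup>+m. g m \<partial>surf) = (\<integral>\<^sup>+m. g (sgn (M (sgn (N m)))) \<partial>surf)"
  proof (rule nn_integral_cong)
    fix m :: "real^3" assume "m \<in> space surf"
    then have m: "norm m = 1" by simp
    then have "N m \<noteq> 0" using N(3)[of m] lin by (auto simp: linear_0)
    then have "sgn (M (sgn (N m))) = m" using m lin
      by (simp add: sgn_div_norm linear_scale N sgn_scaleR)
    then show "g m = g (sgn (M (sgn (N m))))" by simp
  qed
  also have "\<dots> \<le> ennreal ((1/a/(1/b))^3) * (\<integral>\<^sup>+m. g (sgn (M m)) \<partial>surf)"
    using nn_integral_surf_linear_le[OF N(1) _ N1 m1] b by simp
  finally show ?thesis by simp
qed

section \<open>Integration on the sphere\<close>

lemma emeasure_surf_S2: "emeasure surf S2 = ennreal (3 * measure lebesgue (ball (0::real^3) 1))"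
proof -
  have "emeasure surf S2 = (\<integral>\<^sup>+m. 1 \<partial>surf)" by simp
  also have "\<dots> = 3 * (\<integral>\<^sup>+x. 1 * indicator (ball 0 1 - {0}) x \<partial>(lborel :: (real^3) measure))"
    by (rule nn_integral_surf) simp
  also have "(\<integral>\<^sup>+x. 1 * indicator (ball 0 1 - {0}) x \<partial>(lborel :: (real^3) measure)) = emeasure lborel (ball (0::real^3) 1 - {0})"
  proof -
    have "ball 0 1 - {0::real^3} \<in> sets lborel" by (auto intro!: borel_open open_delete)
    then show ?thesis by simp
  qed
  also have "\<dots> = emeasure lborel (ball (0::real^3) 1)"
    by (subst emeasure_Diff) auto
  also have "\<dots> = ennreal (measure lebesgue (ball (0::real^3) 1))"
    using emeasure_eq_measure2[of "ball (0::real^3) 1" lebesgue] by simp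
  finally show ?thesis by (simp add: ennreal_mult')
qed

interpretation surf: finite_measure surf
  by standard (simp add: emeasure_surf_S2)

definition area :: real where "area = measure surf S2"

lemma area_pos: "area > 0"
  using content_ball_pos[of 1 "0 :: real^3"] by (simp add: area_def measure_def emeasure_surf_S2)

lemma LINT_const [simp]: "(LINT m|surf. c) = area *\<^sub>R (c :: 'b::euclidean_space)"
  by (simp add: area_def)

lemma LINT_cong_S2: "(\<And>m. norm m = 1 \<Longrightarrow> f m = g m) \<Longrightarrow> (LINT m|surf. f m) = (LINT m|surf. g m)"
  by (rule Bochner_Integration.integral_cong) auto

lemma integrable_cong_S2: "(\<And>m. norm m = 1 \<Longrightarrow> f m = g m) \<Longrightarrow> integrable surf f \<longleftrightarrow> integrable surf g"
  by (rule Bochner_Integration.integrable_cong) auto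

lemma measurable_cong_S2: "(\<And>m. norm m = 1 \<Longrightarrow> f m = g m) \<Longrightarrow> f \<in> measurable surf N \<longleftrightarrow> g \<in> measurable surf N"
  by (rule measurable_cong) auto

lemma measurable_surf_continuous:
  fixes f :: "real^3 \<Rightarrow> 'b::topological_space"
  assumes "continuous_on S2 f" shows "f \<in> borel_measurable surf"
  using borel_measurable_continuous_on_restrict[OF assms] by (simp add: measurable_cong_sets[OF sets_surf refl])

lemma measurable_surf_borel: "f \<in> borel_measurable borel \<Longrightarrow> f \<in> borel_measurable surf"
  by (simp add: measurable_cong_sets[OF sets_surf refl] measurable_restrict_space1)

lemma continuous_S2_bounded:
  fixes f :: "real^3 \<Rightarrow> 'b::real_normed_vector"
  assumes "continuous_on S2 f"
  obtains K where "K > 0" "\<And>m. norm m = 1 \<Longrightarrow> norm (f m) \<le> K"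
proof -
  have "bounded (f ` S2)" by (intro compact_imp_bounded compact_continuous_image assms compact_sphere)
  then obtain K where "K > 0" "\<And>x. x \<in> f ` S2 \<Longrightarrow> norm x \<le> K" by (auto simp: bounded_pos)
  then show thesis by (intro that[of K]) auto
qed

lemma integrable_surf_bounded:
  fixes f :: "real^3 \<Rightarrow> 'b::euclidean_space"
  assumes "f \<in> borel_measurable surf" "\<And>m. norm m = 1 \<Longrightarrow> norm (f m) \<le> K"
  shows "integrable surf f"
  using assms by (intro surf.integrable_const_bound[where B=K]) (auto intro!: AE_I2)

lemma integrable_surf_continuous:
  fixes f :: "real^3 \<Rightarrow> 'b::euclidean_space"
  assumes "continuous_on S2 f" shows "integrable surf f"
  using continuous_S2_bounded[OF assms] by (metis integrable_surf_bounded measurable_surf_continuous assms)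

subsection \<open>Linear maps\<close>

text \<open>Linear maps act on functions on the sphere by composition with the radial projection of their values.  The constant
  \<open>q\<close> below bounds the distortion of the area in both directions.\<close>

locale near_isometry =
  fixes M :: "real^3 \<Rightarrow> real^3" and a b :: real
  assumes lin: "linear M" and a: "a > 0" and lower: "\<And>x. a * norm x \<le> norm (M x)"
    and upper: "\<And>x. norm (M x) \<le> b * norm x"
begin

lemma ab: "a \<le> b"
  using lower[of "axis 1 1"] upper[of "axis 1 1"] by simp

definition "q = (b/a)^3"

lemma q1: "q \<ge> 1"
  unfolding q_def using a ab by (simp add: field_simps)

lemma M0: "M x = 0 \<longleftrightarrow> x = 0"
  using lower[of x] a lin by (auto simp: linear_0 mult_le_0_iff)

lemma sgn_M_measurable: "(\<lambda>m. sgn (M m)) \<in> measurable surf surf"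
proof -
  have [measurable]: "M \<in> borel_measurable borel"
    using lin by (intro borel_measurable_continuous_onI) (simp add: linear_continuous_on linear_linear)
  have "(\<lambda>m. sgn (M m)) \<in> measurable (restrict_space borel S2) (restrict_space borel S2)"
    using M0 by (intro measurable_restrict_space2 measurable_restrict_space1)
      (auto simp: space_restrict_space norm_sgn)
  then show ?thesis by (simp add: measurable_cong_sets[OF sets_surf sets_surf])
qed

lemma comp_measurable: "g \<in> measurable surf N \<Longrightarrow> (\<lambda>m. g (sgn (M m))) \<in> measurable surf N"
  using sgn_M_measurable by (rule measurable_compose)

lemma comp_integrable:
  fixes g :: "real^3 \<Rightarrow> 'b::euclidean_space"
  assumes "integrable surf g" shows "integrable surf (\<lambda>m. g (sgn (M m)))"
  unfolding integrable_iff_bounded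
proof
  show "(\<lambda>m. g (sgn (M m))) \<in> borel_measurable surf" using assms by (intro comp_measurable) auto
  have "(\<integral>\<^sup>+m. ennreal (norm (g (sgn (M m)))) \<partial>surf) \<le> ennreal ((b/a)^3) * (\<integral>\<^sup>+m. ennreal (norm (g m)) \<partial>surf)"
    using assms by (intro nn_integral_surf_linear_le lin a lower upper) auto
  also have "\<dots> < \<infinity>" using assms by (simp add: integrable_iff_bounded ennreal_mult_less_top)
  finally show "(\<integral>\<^sup>+m. ennreal (norm (g (sgn (M m)))) \<partial>surf) < \<infinity>" .
qed

lemma LINT_comp_le:
  fixes g :: "real^3 \<Rightarrow> real"
  assumes g: "integrable surf g" and nn: "\<And>m. norm m = 1 \<Longrightarrow> g m \<ge> 0"
  shows "(LINT m|surf. g (sgn (M m))) \<le> q * (LINT m|surf. g m)"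
    and "(LINT m|surf. g m) \<le> q * (LINT m|surf. g (sgn (M m)))"
proof -
  have nn': "AE m in surf. 0 \<le> g (sgn (M m))" "AE m in surf. 0 \<le> g m"
    by (auto intro!: AE_I2 nn simp: norm_sgn M0)
  have "ennreal (LINT m|surf. g (sgn (M m))) = (\<integral>\<^sup>+m. ennreal (g (sgn (M m))) \<partial>surf)"
    by (rule nn_integral_eq_integral[OF comp_integrable[OF g] nn'(1), symmetric])
  also have "\<dots> \<le> ennreal q * (\<integral>\<^sup>+m. ennreal (g m) \<partial>surf)"
    unfolding q_def using g by (intro nn_integral_surf_linear_le lin a lower upper) auto
  also have "(\<integral>\<^sup>+m. ennreal (g m) \<partial>surf) = ennreal (LINT m|surf. g m)"
    by (rule nn_integral_eq_integral[OF g nn'(2)])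
  finally show "(LINT m|surf. g (sgn (M m))) \<le> q * (LINT m|surf. g m)"
    using q1 integral_nonneg_AE[OF nn'(2)] by (simp add: ennreal_mult'[symmetric])
  have "ennreal (LINT m|surf. g m) = (\<integral>\<^sup>+m. ennreal (g m) \<partial>surf)"
    by (rule nn_integral_eq_integral[OF g nn'(2), symmetric])
  also have "\<dots> \<le> ennreal q * (\<integral>\<^sup>+m. ennreal (g (sgn (M m))) \<partial>surf)"
    unfolding q_def using g by (intro nn_integral_surf_linear_ge lin a lower upper) auto
  also have "(\<integral>\<^sup>+m. ennreal (g (sgn (M m))) \<partial>surf) = ennreal (LINT m|surf. g (sgn (M m)))"
    by (rule nn_integral_eq_integral[OF comp_integrable[OF g] nn'(1)])
  finally show "(LINT m|surf. g m) \<le> q * (LINT m|surf. g (sgn (M m)))"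
    using q1 integral_nonneg_AE[OF nn'(1)] by (simp add: ennreal_mult'[symmetric])
qed

text \<open>The function is split into its positive and negative parts, for each of which the area distortion is a factor between
  \<open>1/q\<close> and \<open>q\<close>.\<close>

lemma LINT_comp_diff:
  fixes g :: "real^3 \<Rightarrow> real"
  assumes g: "integrable surf g"
  shows "\<bar>(LINT m|surf. g (sgn (M m))) - (LINT m|surf. g m)\<bar> \<le> (q - 1) * (LINT m|surf. \<bar>g m\<bar>)"
proof -
  have pos: "\<bar>(LINT m|surf. u (sgn (M m))) - (LINT m|surf. u m)\<bar> \<le> (q - 1) * (LINT m|surf. u m)"
    if u: "integrable surf u" "\<And>m. u m \<ge> 0" for u :: "real^3 \<Rightarrow> real"
  proof -
    let ?I = "LINT m|surf. u m" and ?J = "LINT m|surf. u (sgn (M m))"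
    have 1: "?J \<le> q * ?I" "?I \<le> q * ?J" using LINT_comp_le[OF u(1)] u(2) by auto
    have I: "?I \<ge> 0" using u by (intro integral_nonneg_AE) auto
    have "?I - ?J \<le> (q - 1) * ?I"
    proof (cases "?J \<le> ?I")
      case True
      then have "(q - 1) * ?J \<le> (q - 1) * ?I" using q1 by (intro mult_left_mono) auto
      with 1 show ?thesis by (simp add: algebra_simps)
    next
      case False
      then show ?thesis using q1 I by (smt (verit) mult_nonneg_nonneg)
    qed
    with 1 show ?thesis by (simp add: algebra_simps abs_le_iff)
  qed
  let ?p = "\<lambda>m. max 0 (g m)" and ?n = "\<lambda>m. max 0 (- g m)"
  have ip: "integrable surf ?p" "integrable surf ?n" using g by auto
  have d: "g m = ?p m - ?n m" "\<bar>g m\<bar> = ?p m + ?n m" for m by auto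
  have 1: "(LINT m|surf. g (sgn (M m))) = (LINT m|surf. ?p (sgn (M m))) - (LINT m|surf. ?n (sgn (M m)))"
    using comp_integrable[OF ip(1)] comp_integrable[OF ip(2)] by (subst d(1)) (simp add: Bochner_Integration.integral_diff)
  have 2: "(LINT m|surf. g m) = (LINT m|surf. ?p m) - (LINT m|surf. ?n m)"
    using ip by (subst d(1)) (simp add: Bochner_Integration.integral_diff)
  have 3: "(LINT m|surf. \<bar>g m\<bar>) = (LINT m|surf. ?p m) + (LINT m|surf. ?n m)"
    using ip by (subst d(2)) (simp add: Bochner_Integration.integral_add)
  show ?thesis using pos[OF ip(1)] pos[OF ip(2)] unfolding 1 2 3 by (simp add: algebra_simps abs_le_iff)
qed

end

lemma LINT_orthogonal:
  fixes g :: "real^3 \<Rightarrow> real"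
  assumes Q: "orthogonal_transformation Q" and g: "integrable surf g"
  shows "(LINT m|surf. g (Q m)) = (LINT m|surf. g m)"
proof -
  interpret near_isometry Q 1 1
    using Q by unfold_locales (auto simp: orthogonal_transformation intro: linear_add linear_scale)
  have "(LINT m|surf. g (Q m)) = (LINT m|surf. g (sgn (Q m)))"
    using Q by (intro LINT_cong_S2) (auto simp: orthogonal_transformation sgn_div_norm)
  then show ?thesis using LINT_comp_diff[OF g] by (simp add: q_def)
qed

subsection \<open>Square integrable functions\<close>

text \<open>The same notion for functions with values in a Euclidean space, to treat functions and vector fields alike.\<close>

definition L2 :: "(real^3 \<Rightarrow> 'b::euclidean_space) \<Rightarrow> bool" where
  "L2 f \<longleftrightarrow> f \<in> borel_measurable surf \<and> integrable surf (\<lambda>m. (norm (f m))\<^sup>2)"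

definition l2norm :: "(real^3 \<Rightarrow> 'b::euclidean_space) \<Rightarrow> real" where
  "l2norm f = sqrt (LINT m|surf. (norm (f m))\<^sup>2)"

lemma sphere_L2_iff: "sphere_L2 f \<longleftrightarrow> L2 f"
  by (simp add: sphere_L2_def L2_def)

lemma L2_measurable: "L2 f \<Longrightarrow> f \<in> borel_measurable surf"
  by (simp add: L2_def)

lemma l2norm_nonneg [simp]: "l2norm f \<ge> 0"
  by (simp add: l2norm_def)

lemma l2norm_power2: "(l2norm f)\<^sup>2 = (LINT m|surf. (norm (f m))\<^sup>2)"
  by (simp add: l2norm_def)

lemma L2_cong_S2: "(\<And>m. norm m = 1 \<Longrightarrow> f m = g m) \<Longrightarrow> L2 f \<longleftrightarrow> L2 g"
  unfolding L2_def using measurable_cong_S2[of f g borel] integrable_cong_S2[of "\<lambda>m. (norm (f m))\<^sup>2" "\<lambda>m. (norm (g m))\<^sup>2"] by auto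

lemma l2norm_cong_S2: "(\<And>m. norm m = 1 \<Longrightarrow> f m = g m) \<Longrightarrow> l2norm f = l2norm g"
  unfolding l2norm_def using LINT_cong_S2[of "\<lambda>m. (norm (f m))\<^sup>2" "\<lambda>m. (norm (g m))\<^sup>2"] by auto

lemma L2_continuous: "continuous_on S2 f \<Longrightarrow> L2 f"
  unfolding L2_def by (auto intro!: measurable_surf_continuous integrable_surf_continuous continuous_intros)

lemma L2_inner_integrable:
  assumes "L2 f" "L2 g" shows "integrable surf (\<lambda>m. f m \<bullet> g m)"
proof (rule Bochner_Integration.integrable_bound)
  show "integrable surf (\<lambda>m. (norm (f m))\<^sup>2 + (norm (g m))\<^sup>2)" using assms by (auto simp: L2_def)
  show "(\<lambda>m. f m \<bullet> g m) \<in> borel_measurable surf" using assms by (auto simp: L2_def)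
  have "\<bar>f m \<bullet> g m\<bar> \<le> (norm (f m))\<^sup>2 + (norm (g m))\<^sup>2" for m
    using Cauchy_Schwarz_ineq2[of "f m" "g m"] sum_squares_bound[of "norm (f m)" "norm (g m)"]
      zero_le_power2[of "norm (f m)"] zero_le_power2[of "norm (g m)"] by linarith
  then show "AE m in surf. norm (f m \<bullet> g m) \<le> norm ((norm (f m))\<^sup>2 + (norm (g m))\<^sup>2)" by auto
qed

lemma L2_mult_integrable: "L2 f \<Longrightarrow> L2 g \<Longrightarrow> integrable surf (\<lambda>m. f m * g m)" for f g :: "real^3 \<Rightarrow> real"
  using L2_inner_integrable[of f g] by simp

lemma L2_bound:
  assumes "f \<in> borel_measurable surf" "L2 g" "\<And>m. norm m = 1 \<Longrightarrow> norm (f m) \<le> c * norm (g m)"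
  shows "L2 f" "c \<ge> 0 \<Longrightarrow> l2norm f \<le> c * l2norm g"
proof -
  have le: "(norm (f m))\<^sup>2 \<le> c\<^sup>2 * (norm (g m))\<^sup>2" if "norm m = 1" for m
    using power_mono[OF assms(3)[OF that], of 2] by (simp add: power_mult_distrib)
  have i: "integrable surf (\<lambda>m. c\<^sup>2 * (norm (g m))\<^sup>2)" using assms by (auto simp: L2_def)
  show L: "L2 f" unfolding L2_def using assms(1) le
    by (auto intro!: Bochner_Integration.integrable_bound[OF i] AE_I2)
  have "(LINT m|surf. (norm (f m))\<^sup>2) \<le> (LINT m|surf. c\<^sup>2 * (norm (g m))\<^sup>2)"
    using le L by (intro integral_mono i) (auto simp: L2_def)
  then have "(l2norm f)\<^sup>2 \<le> c\<^sup>2 * (l2norm g)\<^sup>2" by (simp add: l2norm_power2)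
  then show "l2norm f \<le> c * l2norm g" if "c \<ge> 0"
    using that by (metis l2norm_nonneg mult_nonneg_nonneg power2_le_imp_le power_mult_distrib)
qed

lemma L2_integrable: assumes "L2 f" shows "integrable surf f"
proof (rule Bochner_Integration.integrable_bound)
  show "integrable surf (\<lambda>m. 1 + (norm (f m))\<^sup>2)" using assms by (auto simp: L2_def)
  have "norm (f m) \<le> 1 + (norm (f m))\<^sup>2" for m
    using sum_squares_bound[of 1 "norm (f m)"] norm_ge_zero[of "f m"] zero_le_power2[of "norm (f m)"] unfolding one_power2 mult_1_right by linarith
  then show "AE m in surf. norm (f m) \<le> norm (1 + (norm (f m))\<^sup>2)" by auto
qed (use assms in \<open>auto simp: L2_def\<close>)

lemma L2_scaleR: "L2 f \<Longrightarrow> L2 (\<lambda>m. c *\<^sub>R f m)"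
  by (auto simp: L2_def power_mult_distrib)

lemma L2_cmult: "L2 f \<Longrightarrow> L2 (\<lambda>m. c * f m)" for f :: "real^3 \<Rightarrow> real"
  using L2_scaleR[of f c] by simp

lemma L2_uminus: "L2 f \<Longrightarrow> L2 (\<lambda>m. - f m)"
  by (auto simp: L2_def)

lemma L2_const: "L2 (\<lambda>m. c)"
  by (auto simp: L2_def)

lemma L2_add: assumes "L2 f" "L2 g" shows "L2 (\<lambda>m. f m + g m)"
  unfolding L2_def
proof
  have eq: "(norm (f m + g m))\<^sup>2 = (norm (f m))\<^sup>2 + 2 * (f m \<bullet> g m) + (norm (g m))\<^sup>2" for m
    by (simp add: power2_norm_eq_inner inner_add_left inner_add_right inner_commute)
  show "integrable surf (\<lambda>m. (norm (f m + g m))\<^sup>2)" unfolding eq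
    using assms L2_inner_integrable[OF assms] by (auto simp: L2_def)
qed (use assms in \<open>auto simp: L2_def\<close>)

lemma L2_diff: "L2 f \<Longrightarrow> L2 g \<Longrightarrow> L2 (\<lambda>m. f m - g m)"
  using L2_add[OF _ L2_uminus, of f g] by simp

lemma L2_sum: "finite I \<Longrightarrow> (\<And>i. i \<in> I \<Longrightarrow> L2 (f i)) \<Longrightarrow> L2 (\<lambda>m. \<Sum>i\<in>I. f i m)"
  by (induction I rule: finite_induct) (auto intro: L2_add L2_const)

lemma l2norm_add_power2:
  assumes "L2 f" "L2 g"
  shows "(l2norm (\<lambda>m. f m + g m))\<^sup>2 = (l2norm f)\<^sup>2 + 2 * (LINT m|surf. f m \<bullet> g m) + (l2norm g)\<^sup>2"
proof -
  have eq: "(norm (f m + g m))\<^sup>2 = (norm (f m))\<^sup>2 + 2 * (f m \<bullet> g m) + (norm (g m))\<^sup>2" for m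
    by (simp add: power2_norm_eq_inner inner_add_left inner_add_right inner_commute)
  show ?thesis unfolding l2norm_power2 eq using assms L2_inner_integrable[OF assms] by (simp add: L2_def)
qed

lemma l2norm_scaleR: "l2norm (\<lambda>m. c *\<^sub>R f m) = \<bar>c\<bar> * l2norm f"
  by (simp add: l2norm_def power_mult_distrib real_sqrt_mult)

lemma l2norm_cmult: "l2norm (\<lambda>m. c * f m) = \<bar>c\<bar> * l2norm f" for f :: "real^3 \<Rightarrow> real"
  using l2norm_scaleR[of c f] by simp

lemma l2norm_uminus: "l2norm (\<lambda>m. - f m) = l2norm f"
  by (simp add: l2norm_def)

lemma l2norm_const: "l2norm (\<lambda>m. c) = sqrt area * norm c"
  by (simp add: l2norm_def real_sqrt_mult area_def)

lemma L2_Cauchy_Schwarz: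
  assumes f: "L2 f" and g: "L2 g"
  shows "\<bar>LINT m|surf. f m \<bullet> g m\<bar> \<le> l2norm f * l2norm g"
proof -
  define A B P where "A = (l2norm f)\<^sup>2" and "B = (l2norm g)\<^sup>2" and "P = (LINT m|surf. f m \<bullet> g m)"
  have quad: "0 \<le> A * x\<^sup>2 + 2 * P * x + B" for x
    using l2norm_add_power2[OF L2_scaleR[OF f, of x] g] zero_le_power2[of "l2norm (\<lambda>m. x *\<^sub>R f m + g m)"]
    by (simp add: l2norm_scaleR A_def B_def P_def power_mult_distrib algebra_simps)
  have "P\<^sup>2 \<le> A * B"
  proof (cases "A = 0")
    case True
    have "P = 0"
    proof (rule ccontr)
      assume "P \<noteq> 0"
      then show False using quad[of "- (B + 1) / (2 * P)"] True by simp
    qed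
    then show ?thesis using True by simp
  next
    case False
    then have A: "A > 0" by (simp add: A_def)
    have "0 \<le> A * (A * (- P / A)\<^sup>2 + 2 * P * (- P / A) + B)" using quad[of "- P / A"] A by simp
    also have "\<dots> = A * B - P\<^sup>2" using A by (simp add: power2_eq_square field_simps)
    finally show ?thesis by simp
  qed
  then have "\<bar>P\<bar>\<^sup>2 \<le> (l2norm f * l2norm g)\<^sup>2" by (simp add: A_def B_def power_mult_distrib)
  then show ?thesis unfolding P_def by (rule power2_le_imp_le) simp
qed

lemma L2_Cauchy_Schwarz_real:
  fixes f g :: "real^3 \<Rightarrow> real"
  assumes "L2 f" "L2 g" shows "\<bar>LINT m|surf. f m * g m\<bar> \<le> l2norm f * l2norm g"
  using L2_Cauchy_Schwarz[OF assms] by simp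

lemma l2norm_triangle:
  assumes "L2 f" "L2 g" shows "l2norm (\<lambda>m. f m + g m) \<le> l2norm f + l2norm g"
proof -
  have "(l2norm (\<lambda>m. f m + g m))\<^sup>2 \<le> (l2norm f + l2norm g)\<^sup>2"
    using L2_Cauchy_Schwarz[OF assms] by (simp add: l2norm_add_power2[OF assms] power2_sum)
  then show ?thesis by (rule power2_le_imp_le) simp
qed

lemma l2norm_triangle_diff:
  assumes "L2 f" "L2 g" shows "l2norm (\<lambda>m. f m - g m) \<le> l2norm f + l2norm g"
  using l2norm_triangle[OF assms(1) L2_uminus[OF assms(2)]] by (simp add: l2norm_uminus)

lemma l2norm_diff_triangle:
  assumes "L2 f" "L2 g" "L2 h"
  shows "l2norm (\<lambda>m. f m - h m) \<le> l2norm (\<lambda>m. f m - g m) + l2norm (\<lambda>m. g m - h m)"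
  using l2norm_triangle[OF L2_diff[OF assms(1,2)] L2_diff[OF assms(2,3)]] by simp

lemma l2norm_diff_commute: "l2norm (\<lambda>m. f m - g m) = l2norm (\<lambda>m. g m - f m)"
  by (simp add: l2norm_def norm_minus_commute)

lemma l2norm_eq_0: assumes "L2 f" "l2norm f = 0" shows "AE m in surf. f m = 0"
proof -
  have "AE m in surf. (norm (f m))\<^sup>2 = 0"
    using assms by (subst integral_nonneg_eq_0_iff_AE[symmetric]) (auto simp: L2_def l2norm_def)
  then show ?thesis by simp
qed

lemma L2_vec_iff: "L2 F \<longleftrightarrow> (\<forall>i. L2 (\<lambda>m. F m $ i))" for F :: "real^3 \<Rightarrow> real^3"
proof
  assume F: "L2 F"
  have "L2 (\<lambda>m. F m $ i)" for i
  proof (rule L2_bound(1)[OF _ F])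
    show "(\<lambda>m. F m $ i) \<in> borel_measurable surf" 
      using borel_measurable_inner[OF L2_measurable[OF F] borel_measurable_const[of "axis i 1"]] by (simp add: inner_axis)
    show "norm (F m $ i) \<le> 1 * norm (F m)" for m using component_le_norm_cart[of "F m" i] by simp
  qed
  then show "\<forall>i. L2 (\<lambda>m. F m $ i)" by blast
next
  assume F: "\<forall>i. L2 (\<lambda>m. F m $ i)"
  have eq: "F = (\<lambda>m. \<Sum>i\<in>UNIV. (F m $ i) *\<^sub>R axis i 1)"
    by (rule ext) (simp only: scalar_mult_eq_scaleR[symmetric] basis_expansion)
  have "L2 (\<lambda>m. (F m $ i) *\<^sub>R (axis i 1 :: real^3))" for i
  proof (rule L2_bound(1)[where g="\<lambda>m. F m $ i" and c=1])
    show "(\<lambda>m. (F m $ i) *\<^sub>R (axis i 1 :: real^3)) \<in> borel_measurable surf"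
      using F by (intro borel_measurable_scaleR) (auto simp: L2_def)
  qed (use F in auto)
  then have "L2 (\<lambda>m. \<Sum>i\<in>UNIV. (F m $ i) *\<^sub>R (axis i 1 :: real^3))" by (intro L2_sum) auto
  then show "L2 F" using eq by simp
qed

context near_isometry begin

lemma L2_comp:
  assumes "L2 f" shows "L2 (\<lambda>m. f (sgn (M m)))" "l2norm (\<lambda>m. f (sgn (M m))) \<le> sqrt q * l2norm f"
proof -
  have i: "integrable surf (\<lambda>m. (norm (f m))\<^sup>2)" using assms by (simp add: L2_def)
  show "L2 (\<lambda>m. f (sgn (M m)))"
    unfolding L2_def using comp_measurable[OF L2_measurable[OF assms]] comp_integrable[OF i] by blast
  show "l2norm (\<lambda>m. f (sgn (M m))) \<le> sqrt q * l2norm f"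
    unfolding l2norm_def real_sqrt_mult[symmetric] using LINT_comp_le(1)[OF i] by simp
qed

end

section \<open>Smooth functions\<close>

subsection \<open>Closure properties\<close>

lemma frechet_derivative_works_at: "f differentiable (at x) \<Longrightarrow> (f has_derivative frechet_derivative f (at x)) (at x)"
  by (simp add: frechet_derivative_works[symmetric])

lemma Ck_on_SucD:
  assumes "open S" "Ck_on (Suc k) S f" "x \<in> S"
  shows "(f has_derivative frechet_derivative f (at x)) (at x)"
  using assms by (auto intro!: frechet_derivative_works_at simp: differentiable_on_eq_differentiable_at)

lemma Ck_on_cong:
  assumes S: "open S" and eq: "\<And>x. x \<in> S \<Longrightarrow> f x = g x" and f: "Ck_on k S f"
  shows "Ck_on k S g"
  using eq f
proof (induction k arbitrary: f g)
  case 0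
  then show ?case using continuous_on_cong[of S S f g] by simp
next
  case (Suc k)
  have d: "f differentiable (at x)" if "x \<in> S" for x
    using Suc.prems(2) that S by (simp add: differentiable_on_eq_differentiable_at)
  have eq: "frechet_derivative f (at x) = frechet_derivative g (at x)" if "x \<in> S" for x
    using frechet_derivative_transform_within_open[OF d[OF that] S that] Suc.prems(1) by auto
  have "g differentiable (at x)" if "x \<in> S" for x
    using has_derivative_transform_within_open[OF frechet_derivative_works_at[OF d[OF that]] S that] Suc.prems(1)
    by (auto simp: differentiable_def)
  then have "g differentiable_on S" using S by (simp add: differentiable_on_eq_differentiable_at)
  moreover have "Ck_on k S (\<lambda>x. frechet_derivative g (at x) v)" for v
    using Suc.IH[of "\<lambda>x. frechet_derivative f (at x) v" "\<lambda>x. frechet_derivative g (at x) v"] eq Suc.prems(2) by simp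
  ultimately show ?case by simp
qed

lemma Ck_on_SucI:
  assumes S: "open S" and d: "\<And>x. x \<in> S \<Longrightarrow> (f has_derivative f' x) (at x)"
    and c: "\<And>v. Ck_on k S (\<lambda>x. f' x v)"
  shows "Ck_on (Suc k) S f"
proof -
  have "f differentiable_on S" using S d by (auto simp: differentiable_on_eq_differentiable_at differentiable_def)
  moreover have "Ck_on k S (\<lambda>x. frechet_derivative f (at x) v)" for v
    by (rule Ck_on_cong[OF S _ c]) (simp add: frechet_derivative_at[OF d, symmetric])
  ultimately show ?thesis by simp
qed

lemma Ck_on_pred: "open S \<Longrightarrow> Ck_on (Suc k) S f \<Longrightarrow> Ck_on k S f"
proof (induction k arbitrary: f)
  case 0
  then show ?case by (simp add: differentiable_imp_continuous_on)
qed auto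

lemma Ck_on_continuous: "open S \<Longrightarrow> Ck_on k S f \<Longrightarrow> continuous_on S f"
  by (induction k) (auto intro: differentiable_imp_continuous_on)

lemma Ck_on_const: "open S \<Longrightarrow> Ck_on k S (\<lambda>x. c)"
proof (induction k arbitrary: c)
  case (Suc k)
  show ?case
    by (rule Ck_on_SucI[OF Suc.prems has_derivative_const Suc.IH[OF Suc.prems]])
qed simp

lemma Ck_on_linear: "open S \<Longrightarrow> bounded_linear f \<Longrightarrow> Ck_on k S f"
proof (cases k)
  case 0
  assume "bounded_linear f" then show ?thesis using 0 by (simp add: linear_continuous_on)
next
  case (Suc j)
  assume "open S" "bounded_linear f"
  then show ?thesis unfolding Suc
    by (intro Ck_on_SucI[where f'="\<lambda>x. f"] bounded_linear_imp_has_derivative Ck_on_const)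
qed

lemma Ck_on_add: "open S \<Longrightarrow> Ck_on k S f \<Longrightarrow> Ck_on k S g \<Longrightarrow> Ck_on k S (\<lambda>x. f x + g x)"
proof (induction k arbitrary: f g)
  case (Suc k)
  show ?case
  proof (rule Ck_on_SucI[OF Suc.prems(1)])
    show "((\<lambda>x. f x + g x) has_derivative (\<lambda>v. frechet_derivative f (at x) v + frechet_derivative g (at x) v)) (at x)"
      if "x \<in> S" for x
      using that Suc.prems by (intro has_derivative_add Ck_on_SucD)
    show "Ck_on k S (\<lambda>x. frechet_derivative f (at x) v + frechet_derivative g (at x) v)" for v
      using Suc.prems by (intro Suc.IH) simp_all
  qed
qed (simp add: continuous_on_add)

lemma Ck_on_mult: "open S \<Longrightarrow> Ck_on k S f \<Longrightarrow> Ck_on k S g \<Longrightarrow> Ck_on k S (\<lambda>x. f x * g x)"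
proof (induction k arbitrary: f g)
  case (Suc k)
  note pred = Ck_on_pred[OF Suc.prems(1,2)] Ck_on_pred[OF Suc.prems(1,3)]
  show ?case
  proof (rule Ck_on_SucI[OF Suc.prems(1)])
    show "((\<lambda>x. f x * g x) has_derivative (\<lambda>v. f x * frechet_derivative g (at x) v + frechet_derivative f (at x) v * g x)) (at x)"
      if "x \<in> S" for x
      using that Suc.prems by (intro has_derivative_mult Ck_on_SucD)
    show "Ck_on k S (\<lambda>x. f x * frechet_derivative g (at x) v + frechet_derivative f (at x) v * g x)" for v
      using Suc.prems pred by (intro Ck_on_add Suc.IH) simp_all
  qed
qed (simp add: continuous_on_mult)

lemma Ck_on_exp: "open S \<Longrightarrow> Ck_on k S f \<Longrightarrow> Ck_on k S (\<lambda>x. exp (f x))"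
proof (induction k arbitrary: f)
  case (Suc k)
  show ?case
  proof (rule Ck_on_SucI[OF \<open>open S\<close>])
    show "((\<lambda>x. exp (f x)) has_derivative (\<lambda>v. exp (f x) * frechet_derivative f (at x) v)) (at x)" if "x \<in> S" for x
      using Ck_on_SucD[OF Suc.prems that] by (auto intro!: derivative_eq_intros)
    show "Ck_on k S (\<lambda>x. exp (f x) * frechet_derivative f (at x) v)" for v
      using Suc.prems Ck_on_pred[OF Suc.prems] by (intro Ck_on_mult Suc.IH) simp_all
  qed
qed (simp add: continuous_on_exp)

lemma Ck_on_inverse_norm: "Ck_on k (- {0 :: 'a::euclidean_space}) (\<lambda>x. inverse (norm x))"
proof (induction k)
  case 0
  show ?case by (auto intro!: continuous_intros)
next
  case (Suc k)
  have o: "open (- {0 :: 'a})" by auto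
  show ?case
  proof (rule Ck_on_SucI[OF o])
    show "((\<lambda>x. inverse (norm x)) has_derivative (\<lambda>v. (inverse (norm x) * (inverse (norm x) * inverse (norm x))) * - (x \<bullet> v))) (at x)"
      if "x \<in> - {0}" for x :: 'a
    proof -
      have n: "(norm has_derivative (\<lambda>v. v \<bullet> sgn x)) (at x)" using has_derivative_norm[of x] that by simp
      show ?thesis using that by (auto intro!: derivative_eq_intros n simp: sgn_div_norm inner_commute field_simps)
    qed
    show "Ck_on k (- {0 :: 'a}) (\<lambda>x. (inverse (norm x) * (inverse (norm x) * inverse (norm x))) * - (x \<bullet> v))" for v
      by (intro Ck_on_mult o Suc.IH Ck_on_linear bounded_linear_minus bounded_linear_inner_left)
  qed
qed

lemma Ck_on_affine:
  fixes M :: "'a::euclidean_space \<Rightarrow> 'b::euclidean_space"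
  assumes "open S" "open T" "bounded_linear M" "\<And>x. x \<in> S \<Longrightarrow> M x + c \<in> T" "Ck_on k T f"
  shows "Ck_on k S (\<lambda>x. f (M x + c))"
  using assms(5)
proof (induction k arbitrary: f)
  case 0
  then have "continuous_on T f" by simp
  have "continuous_on S (\<lambda>x. M x + c)"
    using assms(3) by (intro continuous_intros linear_continuous_on)
  with \<open>continuous_on T f\<close> show ?case using assms(4)
    by (auto intro: continuous_on_compose2[of T f])
next
  case (Suc k)
  show ?case
  proof (rule Ck_on_SucI[OF assms(1)])
    fix x assume x: "x \<in> S"
    have "((\<lambda>x. M x + c) has_derivative M) (at x)"
      using assms(3) by (auto intro!: derivative_eq_intros bounded_linear_imp_has_derivative)
    moreover have "(f has_derivative frechet_derivative f (at (M x + c))) (at (M x + c))"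
      by (rule Ck_on_SucD[OF assms(2) Suc.prems assms(4)[OF x]])
    ultimately show "((\<lambda>x. f (M x + c)) has_derivative (\<lambda>v. frechet_derivative f (at (M x + c)) (M v))) (at x)"
      using diff_chain_at[of "\<lambda>x. M x + c" M x f] by (simp add: o_def)
  next
    fix v show "Ck_on k S (\<lambda>x. frechet_derivative f (at (M x + c)) (M v))"
      using Suc.IH[of "\<lambda>y. frechet_derivative f (at y) (M v)"] Suc.prems by simp
  qed
qed

lemma smooth_on_frechet: "smooth_on S f \<Longrightarrow> smooth_on S (\<lambda>x. frechet_derivative f (at x) v)"
  unfolding smooth_on_def by (metis Ck_on.simps(2))

lemma smooth_on_has_derivative:
  "smooth_on S f \<Longrightarrow> open S \<Longrightarrow> x \<in> S \<Longrightarrow> (f has_derivative frechet_derivative f (at x)) (at x)"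
  unfolding smooth_on_def by (blast intro: Ck_on_SucD)

lemma smooth_on_continuous: "smooth_on S f \<Longrightarrow> open S \<Longrightarrow> continuous_on S f"
  unfolding smooth_on_def by (blast intro: Ck_on_continuous)

subsection \<open>Smooth functions on the sphere\<close>

lemma open_punctured [simp]: "open (- {0 :: real^3})"
  by auto

lemma sphere_smooth_const: "sphere_smooth (\<lambda>x. c)"
  by (simp add: sphere_smooth_def smooth_on_def Ck_on_const)

lemma sphere_smooth_add: "sphere_smooth f \<Longrightarrow> sphere_smooth g \<Longrightarrow> sphere_smooth (\<lambda>x. f x + g x)"
  by (simp add: sphere_smooth_def smooth_on_def Ck_on_add)

lemma sphere_smooth_mult: "sphere_smooth f \<Longrightarrow> sphere_smooth g \<Longrightarrow> sphere_smooth (\<lambda>x. f x * g x)"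
  by (simp add: sphere_smooth_def smooth_on_def Ck_on_mult)

lemma sphere_smooth_exp: "sphere_smooth f \<Longrightarrow> sphere_smooth (\<lambda>x. exp (f x))"
  by (simp add: sphere_smooth_def smooth_on_def Ck_on_exp)

lemma sphere_smooth_cmult: "sphere_smooth f \<Longrightarrow> sphere_smooth (\<lambda>x. c * f x)"
  by (intro sphere_smooth_mult sphere_smooth_const)

lemma sphere_smooth_uminus: "sphere_smooth f \<Longrightarrow> sphere_smooth (\<lambda>x. - f x)"
  using sphere_smooth_cmult[of f "-1"] by simp

lemma sphere_smooth_diff: "sphere_smooth f \<Longrightarrow> sphere_smooth g \<Longrightarrow> sphere_smooth (\<lambda>x. f x - g x)"
  using sphere_smooth_add[OF _ sphere_smooth_uminus, of f g] by simp

lemma sphere_smooth_sum: "finite I \<Longrightarrow> (\<And>i. i \<in> I \<Longrightarrow> sphere_smooth (f i)) \<Longrightarrow> sphere_smooth (\<lambda>x. \<Sum>i\<in>I. f i x)"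
  by (induction I rule: finite_induct) (auto intro: sphere_smooth_add sphere_smooth_const)

lemma sphere_smooth_power: "sphere_smooth f \<Longrightarrow> sphere_smooth (\<lambda>x. f x ^ j)"
  by (induction j) (auto intro: sphere_smooth_mult sphere_smooth_const)

lemma sphere_smooth_linear:
  assumes "bounded_linear (f :: real^3 \<Rightarrow> real)" shows "sphere_smooth f"
proof -
  have "f (sgn x) = inverse (norm x) * f x" for x
    using assms by (simp add: sgn_div_norm linear_scale bounded_linear.linear)
  then show ?thesis using assms
    by (simp add: sphere_smooth_def smooth_on_def Ck_on_mult Ck_on_inverse_norm Ck_on_linear)
qed

lemma sphere_smooth_component: "sphere_smooth (\<lambda>x. x $ i)"
  by (intro sphere_smooth_linear bounded_linear_vec_nth)

lemma sphere_smooth_inner: "sphere_smooth (\<lambda>x. x \<bullet> a)"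
  by (intro sphere_smooth_linear bounded_linear_inner_left)

lemma sphere_smooth_cong: "(\<And>m. norm m = 1 \<Longrightarrow> f m = g m) \<Longrightarrow> sphere_smooth f \<Longrightarrow> sphere_smooth g"
  unfolding sphere_smooth_def smooth_on_def
  by (intro allI) (rule Ck_on_cong[where f="\<lambda>x. f (sgn x)"], auto simp: norm_sgn)

lemma sphere_smooth_polynomial: "real_polynomial_function p \<Longrightarrow> sphere_smooth p"
  by (induction p rule: real_polynomial_function.induct)
    (auto intro: sphere_smooth_linear sphere_smooth_const sphere_smooth_add sphere_smooth_mult)

lemma sphere_smooth_comp_linear:
  assumes f: "sphere_smooth f" and M: "linear M" "\<And>x. M x = 0 \<Longrightarrow> x = 0"
  shows "sphere_smooth (\<lambda>x. f (sgn (M x)))"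
proof -
  have bl: "bounded_linear M" using M by (simp add: linear_linear)
  have eq: "sgn (M (sgn x)) = sgn (M x)" if "x \<in> - {0}" for x
    using that M(1) by (simp add: sgn_div_norm linear_scale field_simps)
  have "Ck_on k (- {0}) (\<lambda>x. f (sgn (M x + 0)))" for k
    using f M(2) by (intro Ck_on_affine[OF _ _ bl, where T="- {0}"]) (auto simp: sphere_smooth_def smooth_on_def)
  then have "Ck_on k (- {0}) (\<lambda>x. f (sgn (M x)))" for k by simp
  then show ?thesis unfolding sphere_smooth_def smooth_on_def
    by (intro allI) (rule Ck_on_cong[where f="\<lambda>x. f (sgn (M x))"], auto simp: eq)
qed

subsection \<open>The rotational gradient of smooth functions\<close>

text \<open>The condition under which the derivatives in \<open>surface_grad\<close> are not default values.\<close>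

definition Dhat :: "(real^3 \<Rightarrow> real) \<Rightarrow> real^3 \<Rightarrow> bool" where
  "Dhat f x \<longleftrightarrow> (\<lambda>y. f (sgn y)) differentiable (at x)"

lemma linear_eq_inner_vec:
  fixes f :: "real^3 \<Rightarrow> real"
  assumes "linear f" shows "f v = (\<chi> i. f (axis i 1)) \<bullet> v"
proof -
  have "f v = f (\<Sum>i\<in>UNIV. v $ i *\<^sub>R axis i 1)" by (simp add: basis_expansion scalar_mult_eq_scaleR[symmetric])
  also have "\<dots> = (\<Sum>i\<in>UNIV. v $ i * f (axis i 1))" using assms by (simp add: linear_sum linear_scale)
  also have "\<dots> = (\<chi> i. f (axis i 1)) \<bullet> v" by (simp add: inner_vec_def mult.commute)
  finally show ?thesis .
qed

lemma Dhat_has_derivative: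
  assumes "Dhat f x" shows "((\<lambda>y. f (sgn y)) has_derivative (\<lambda>v. surface_grad f x \<bullet> v)) (at x)"
proof -
  have d: "((\<lambda>y. f (sgn y)) has_derivative frechet_derivative (\<lambda>y. f (sgn y)) (at x)) (at x)"
    using assms by (intro frechet_derivative_works_at) (simp add: Dhat_def)
  have "frechet_derivative (\<lambda>y. f (sgn y)) (at x) = (\<lambda>v. surface_grad f x \<bullet> v)"
    unfolding surface_grad_def using has_derivative_linear[OF d] by (intro ext linear_eq_inner_vec)
  with d show ?thesis by simp
qed

lemma surface_grad_eqI:
  assumes "((\<lambda>y. f (sgn y)) has_derivative (\<lambda>v. p \<bullet> v)) (at x)"
  shows "Dhat f x" "surface_grad f x = p"
proof -
  show D: "Dhat f x" using assms by (auto simp: Dhat_def differentiable_def)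
  have "(\<lambda>v. p \<bullet> v) = (\<lambda>v. surface_grad f x \<bullet> v)"
    by (rule has_derivative_unique[OF assms Dhat_has_derivative[OF D]])
  then have "(p - surface_grad f x) \<bullet> v = 0" for v by (metis inner_diff_left right_minus_eq)
  then show "surface_grad f x = p" using inner_eq_zero_iff[of "p - surface_grad f x"] by auto
qed

lemma sphere_smooth_Dhat: "sphere_smooth f \<Longrightarrow> x \<noteq> 0 \<Longrightarrow> Dhat f x"
  using smooth_on_has_derivative[of "- {0}" "\<lambda>y. f (sgn y)" x]
  by (auto simp: Dhat_def differentiable_def sphere_smooth_def)

text \<open>The extension of degree 0 has a gradient that is homogeneous of degree \<open>-1\<close>.\<close>

lemma surface_grad_scale:
  assumes f: "Dhat f (c *\<^sub>R x)" and c: "c > 0"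
  shows "Dhat f x" "surface_grad f x = c *\<^sub>R surface_grad f (c *\<^sub>R x)"
proof -
  have "((\<lambda>y. f (sgn (c *\<^sub>R y))) has_derivative (\<lambda>v. surface_grad f (c *\<^sub>R x) \<bullet> (c *\<^sub>R v))) (at x)"
    using diff_chain_at[of "\<lambda>y. c *\<^sub>R y" "\<lambda>y. c *\<^sub>R y" x "\<lambda>y. f (sgn y)", OF _ Dhat_has_derivative[OF f]]
    by (simp add: o_def has_derivative_scaleR_right)
  then have "((\<lambda>y. f (sgn y)) has_derivative (\<lambda>v. (c *\<^sub>R surface_grad f (c *\<^sub>R x)) \<bullet> v)) (at x)"
    using c by (simp add: sgn_scaleR)
  from surface_grad_eqI[OF this]
  show "Dhat f x" "surface_grad f x = c *\<^sub>R surface_grad f (c *\<^sub>R x)" by simp_all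
qed

lemma surface_grad_sgn:
  assumes "Dhat f (sgn x)" "x \<noteq> 0" shows "Dhat f x" "surface_grad f (sgn x) = norm x *\<^sub>R surface_grad f x"
  using surface_grad_scale[of f "inverse (norm x)" x] assms by (auto simp: sgn_div_norm)

text \<open>The extension is constant along rays.\<close>

lemma surface_grad_orthogonal:
  assumes "Dhat f x" "x \<noteq> 0" shows "surface_grad f x \<bullet> x = 0"
proof -
  have "((\<lambda>t::real. x + t *\<^sub>R x) has_derivative (\<lambda>t. t *\<^sub>R x)) (at 0)"
    by (auto intro!: derivative_eq_intros)
  then have "((\<lambda>t::real. f (sgn (x + t *\<^sub>R x))) has_derivative (\<lambda>t. surface_grad f x \<bullet> (t *\<^sub>R x))) (at 0)"
    using diff_chain_at[of "\<lambda>t::real. x + t *\<^sub>R x" "\<lambda>t. t *\<^sub>R x" 0 "\<lambda>y. f (sgn y)" "\<lambda>v. surface_grad f x \<bullet> v"]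
      Dhat_has_derivative[OF assms(1)]
    by (simp add: o_def)
  moreover have "((\<lambda>t::real. f (sgn (x + t *\<^sub>R x))) has_derivative (\<lambda>t. 0)) (at 0)"
  proof (rule has_derivative_transform_within_open[where s="{-1<..<1}" and f="\<lambda>t. f (sgn x)"])
    fix t :: real assume "t \<in> {-1<..<1}"
    then have "x + t *\<^sub>R x = (1 + t) *\<^sub>R x" "1 + t > 0" by (auto simp: algebra_simps)
    then show "f (sgn x) = f (sgn (x + t *\<^sub>R x))" by (simp add: sgn_scaleR)
  qed auto
  ultimately have "(\<lambda>t::real. surface_grad f x \<bullet> (t *\<^sub>R x)) = (\<lambda>t. 0)" by (rule has_derivative_unique)
  from fun_cong[OF this, of 1] show ?thesis by simp
qed

lemma cross3_norm_orthogonal: "p \<bullet> m = 0 \<Longrightarrow> norm m = 1 \<Longrightarrow> norm (cross3 m p) = norm p"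
  using norm_cross_dot[of m p] by (simp add: inner_commute power2_eq_iff_nonneg)

lemma norm_rgrad: "Dhat f m \<Longrightarrow> norm m = 1 \<Longrightarrow> norm (rgrad f m) = norm (surface_grad f m)"
  unfolding rgrad_def by (intro cross3_norm_orthogonal surface_grad_orthogonal) auto

lemma rgrad_sgn: "Dhat f (sgn x) \<Longrightarrow> x \<noteq> 0 \<Longrightarrow> rgrad f (sgn x) = cross3 x (surface_grad f x)"
  using surface_grad_sgn[of f x] by (simp add: rgrad_def sgn_div_norm cross_mult_left cross_mult_right)

lemma sphere_smooth_rgrad: assumes f: "sphere_smooth f" shows "sphere_smooth (\<lambda>x. rgrad f x $ i)"
proof -
  have c: "Ck_on k (- {0}) (\<lambda>x. surface_grad f x $ j)" for k j
  proof -
    have "surface_grad f x $ j = frechet_derivative (\<lambda>y. f (sgn y)) (at x) (axis j 1)" for x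
      by (simp add: surface_grad_def)
    then show ?thesis using f smooth_on_frechet[of "- {0}" "\<lambda>y. f (sgn y)" "axis j 1"]
      by (simp add: sphere_smooth_def smooth_on_def)
  qed
  have x: "Ck_on k (- {0}) (\<lambda>x::real^3. x $ j)" for k j
    by (intro Ck_on_linear bounded_linear_vec_nth) auto
  have "\<exists>j l. \<forall>x p :: real^3. cross3 x p $ i = x $ j * p $ l + (-1) * (x $ l * p $ j)"
  proof -
    consider "i = 1" | "i = 2" | "i = 3" using exhaust_3[of i] by blast
    then show ?thesis
    proof cases
      case 1 then show ?thesis by (intro exI[of _ 2] exI[of _ 3]) (simp add: cross3_simps)
    next
      case 2 then show ?thesis by (intro exI[of _ 3] exI[of _ 1]) (simp add: cross3_simps)
    next
      case 3 then show ?thesis by (intro exI[of _ 1] exI[of _ 2]) (simp add: cross3_simps)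
    qed
  qed
  then obtain j l where "\<And>x p :: real^3. cross3 x p $ i = x $ j * p $ l + (-1) * (x $ l * p $ j)" by blast
  then have d: "(\<lambda>x. cross3 x (surface_grad f x) $ i) =
     (\<lambda>x. x $ j * surface_grad f x $ l + (-1) * (x $ l * surface_grad f x $ j))" by blast
  have "Ck_on k (- {0}) (\<lambda>x. cross3 x (surface_grad f x) $ i)" for k
    unfolding d by (intro Ck_on_add Ck_on_mult Ck_on_const c x) auto
  then show ?thesis unfolding sphere_smooth_def smooth_on_def
    by (intro allI) (rule Ck_on_cong[where f="\<lambda>x. cross3 x (surface_grad f x) $ i"],
      auto intro!: rgrad_sgn[symmetric] sphere_smooth_Dhat[OF f] simp: sgn_zero_iff rgrad_sgn sphere_smooth_Dhat[OF f])
qed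

lemma sphere_smooth_continuous: assumes "sphere_smooth f" shows "continuous_on S2 f"
proof -
  have "continuous_on (- {0}) (\<lambda>x. f (sgn x))"
    using assms by (auto simp: sphere_smooth_def intro: smooth_on_continuous)
  then have "continuous_on S2 (\<lambda>x. f (sgn x))" by (rule continuous_on_subset) auto
  also have "?this \<longleftrightarrow> ?thesis" by (rule continuous_on_cong) auto
  finally show ?thesis .
qed

lemma continuous_on_vec_iff: "continuous_on S F \<longleftrightarrow> (\<forall>i. continuous_on S (\<lambda>x. F x $ i))" for F :: "'a::topological_space \<Rightarrow> real^'n"
  by (auto intro: continuous_intros continuous_on_vec_lambda[where f="\<lambda>i x. F x $ i", simplified])

lemma rgrad_continuous: "sphere_smooth f \<Longrightarrow> continuous_on S2 (rgrad f)"
  unfolding continuous_on_vec_iff by (intro allI sphere_smooth_continuous sphere_smooth_rgrad)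

text \<open>Any differentiable function near the sphere may be used in place of the homogeneous extension, because the two gradients
  differ by a multiple of \<open>m\<close>, which the cross product annihilates.\<close>

lemma rgrad_ambient:
  assumes "(P has_derivative (\<lambda>v. p \<bullet> v)) (at m)" "norm m = 1"
  shows "Dhat P m" "rgrad P m = cross3 m p"
proof -
  have s: "(sgn has_derivative (\<lambda>v. v - (m \<bullet> v) *\<^sub>R m)) (at m)"
  proof -
    have n: "(norm has_derivative (\<lambda>v. v \<bullet> sgn m)) (at m)" using has_derivative_norm[of m] assms(2) by force
    have "m \<noteq> 0" using assms(2) by auto
    then show ?thesis unfolding sgn_div_norm using assms(2)
      by (auto intro!: derivative_eq_intros n simp: sgn_div_norm inner_commute)
  qed
  have "((\<lambda>y. P (sgn y)) has_derivative (\<lambda>v. p \<bullet> (v - (m \<bullet> v) *\<^sub>R m))) (at m)"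
    using diff_chain_at[OF s, of P "\<lambda>v. p \<bullet> v"] assms by (simp add: o_def)
  also have "(\<lambda>v. p \<bullet> (v - (m \<bullet> v) *\<^sub>R m)) = (\<lambda>v. (p - (p \<bullet> m) *\<^sub>R m) \<bullet> v)"
    by (auto simp: inner_diff_left inner_diff_right)
  finally have D: "Dhat P m" "surface_grad P m = p - (p \<bullet> m) *\<^sub>R m" by (auto intro: surface_grad_eqI)
  have "cross3 m (p - c *\<^sub>R m) = cross3 m p" for c by (simp add: cross3_simps forall_3)
  with D show "Dhat P m" "rgrad P m = cross3 m p" by (auto simp: rgrad_def)
qed

lemma rgrad_cong_S2:
  assumes "\<And>m. norm m = 1 \<Longrightarrow> f m = g m" "norm m = 1" shows "rgrad f m = rgrad g m"
proof -
  have "((\<lambda>x. f (sgn x)) has_derivative D) (at m) \<Longrightarrow> ((\<lambda>x. g (sgn x)) has_derivative D) (at m)"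
    if "\<And>m. norm m = 1 \<Longrightarrow> f m = g m" for D and f g :: "real^3 \<Rightarrow> real"
    by (rule has_derivative_transform_within_open[where s="- {0}" and f="\<lambda>x. f (sgn x)"])
      (use assms(2) that in \<open>auto simp: norm_sgn\<close>)
  then have "((\<lambda>x. f (sgn x)) has_derivative D) (at m) \<longleftrightarrow> ((\<lambda>x. g (sgn x)) has_derivative D) (at m)" for D
    using assms(1) by metis
  then show ?thesis by (simp add: rgrad_def surface_grad_def frechet_derivative_def)
qed

lemma Dhat_S2: "sphere_smooth f \<Longrightarrow> norm m = 1 \<Longrightarrow> Dhat f m"
  by (rule sphere_smooth_Dhat) auto

lemma rgrad_add:
  assumes "sphere_smooth f" "sphere_smooth g" "norm m = 1"
  shows "rgrad (\<lambda>x. f x + g x) m = rgrad f m + rgrad g m"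
proof -
  have "((\<lambda>y. f (sgn y) + g (sgn y)) has_derivative (\<lambda>v. (surface_grad f m + surface_grad g m) \<bullet> v)) (at m)"
    unfolding inner_add_left using assms by (intro has_derivative_add Dhat_has_derivative Dhat_S2)
  then show ?thesis using surface_grad_eqI[where f="\<lambda>x. f x + g x"] by (simp add: rgrad_def cross_add_right)
qed

lemma rgrad_mult:
  assumes "sphere_smooth f" "sphere_smooth g" "norm m = 1"
  shows "rgrad (\<lambda>x. f x * g x) m = f m *\<^sub>R rgrad g m + g m *\<^sub>R rgrad f m"
proof -
  have "((\<lambda>y. f (sgn y) * g (sgn y)) has_derivative (\<lambda>v. f (sgn m) * (surface_grad g m \<bullet> v) + (surface_grad f m \<bullet> v) * g (sgn m))) (at m)"
    using assms by (intro has_derivative_mult Dhat_has_derivative Dhat_S2)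
  also have "(\<lambda>v. f (sgn m) * (surface_grad g m \<bullet> v) + (surface_grad f m \<bullet> v) * g (sgn m))
      = (\<lambda>v. (f m *\<^sub>R surface_grad g m + g m *\<^sub>R surface_grad f m) \<bullet> v)"
    using assms by (auto simp: inner_add_left algebra_simps)
  finally show ?thesis using surface_grad_eqI[where f="\<lambda>x. f x * g x"] by (simp add: rgrad_def cross_add_right cross_mult_right)
qed

lemma rgrad_const: "norm m = 1 \<Longrightarrow> rgrad (\<lambda>x. c) m = 0"
  using rgrad_ambient(2)[where P="\<lambda>x. c" and p=0] by simp

lemma rgrad_cmult: "sphere_smooth f \<Longrightarrow> norm m = 1 \<Longrightarrow> rgrad (\<lambda>x. c * f x) m = c *\<^sub>R rgrad f m"
  using rgrad_mult[OF sphere_smooth_const, of f m c] by (simp add: rgrad_const)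

lemma rgrad_diff:
  assumes "sphere_smooth f" "sphere_smooth g" "norm m = 1"
  shows "rgrad (\<lambda>x. f x - g x) m = rgrad f m - rgrad g m"
  using rgrad_add[OF assms(1) sphere_smooth_cmult[OF assms(2)] assms(3), of "-1"]
    rgrad_cmult[OF assms(2,3), of "-1"] by simp

lemma rgrad_exp:
  assumes "sphere_smooth f" "norm m = 1"
  shows "rgrad (\<lambda>x. exp (f x)) m = exp (f m) *\<^sub>R rgrad f m"
proof -
  have "((\<lambda>y. exp (f (sgn y))) has_derivative (\<lambda>v. exp (f (sgn m)) * (surface_grad f m \<bullet> v))) (at m)"
    using Dhat_has_derivative[OF Dhat_S2[OF assms]] by (auto intro!: derivative_eq_intros)
  then have "((\<lambda>y. exp (f (sgn y))) has_derivative (\<lambda>v. (exp (f m) *\<^sub>R surface_grad f m) \<bullet> v)) (at m)"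
    using assms by (simp add: inner_scaleR_left)
  from surface_grad_eqI(2)[OF this] show ?thesis by (simp add: rgrad_def cross_mult_right)
qed

text \<open>The flux \<open>m \<times> v\<close> tested with \<open>\<R> f\<close> is the derivative of \<open>f\<close> in the direction \<open>v\<close>; in this form the transport terms
  become inner variations.\<close>

lemma cross3_transport_inner:
  assumes "Dhat f m" "norm m = 1" shows "cross3 m v \<bullet> rgrad f m = surface_grad f m \<bullet> v"
proof -
  have "m \<noteq> 0" using assms(2) by auto
  then have o: "m \<bullet> surface_grad f m = 0" using surface_grad_orthogonal[OF assms(1)] by (simp add: inner_commute)
  have "cross3 m v \<bullet> cross3 m p = (m \<bullet> m) * (v \<bullet> p) - (m \<bullet> v) * (m \<bullet> p)" for p
    by (simp add: cross3_simps)
  from this[of "surface_grad f m"] show ?thesis using assms o by (simp add: rgrad_def inner_commute[of v] dot_square_norm)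
qed

section \<open>Integration by parts\<close>

lemma norm_surface_grad:
  assumes "sphere_smooth f" "y \<noteq> 0"
  shows "norm (surface_grad f y) = norm (rgrad f (sgn y)) / norm y"
proof -
  have D: "Dhat f (sgn y)" using assms by (intro sphere_smooth_Dhat) (auto simp: sgn_zero_iff)
  have "norm (rgrad f (sgn y)) = norm (surface_grad f (sgn y))"
    using D assms(2) by (intro norm_rgrad) (auto simp: norm_sgn)
  then show ?thesis using surface_grad_sgn(2)[OF D assms(2)] assms(2) by simp
qed

lemma sphere_path_derivative:
  assumes f: "sphere_smooth f" and nz: "m + t *\<^sub>R v \<noteq> 0"
  shows "((\<lambda>t. f (sgn (m + t *\<^sub>R v))) has_real_derivative surface_grad f (m + t *\<^sub>R v) \<bullet> v) (at t)"
proof -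
  have "((\<lambda>t. m + t *\<^sub>R v) has_derivative (\<lambda>s. s *\<^sub>R v)) (at t)"
    by (auto intro!: derivative_eq_intros)
  from diff_chain_at[OF this Dhat_has_derivative[OF sphere_smooth_Dhat[OF f nz]]]
  show ?thesis
    by (simp add: has_field_derivative_def o_def mult_commute_abs)
qed

lemma bounded_rgrad:
  assumes "sphere_smooth f" obtains K where "K > 0" "\<And>m. norm m = 1 \<Longrightarrow> norm (rgrad f m) \<le> K"
  using continuous_S2_bounded[OF rgrad_continuous[OF assms]] by blast

text \<open>The \<open>i\<close>-th component of \<open>\<R> u\<close> is the derivative of \<open>u\<close> under rotation about the \<open>i\<close>-th axis, and rotations preserve the integral.
  The linear maps \<open>x + s e \<times> x\<close> may replace the rotations, since they distort areas only to second order in \<open>s\<close>.\<close>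

lemma LINT_rgrad_zero:
  assumes u: "sphere_smooth u" shows "(LINT m|surf. rgrad u m $ i) = 0"
proof -
  define e :: "real^3" where "e = axis i 1"
  have ne: "norm e = 1" by (simp add: e_def)
  define M where "M s x = x + s *\<^sub>R cross3 e x" for s :: real and x :: "real^3"
  have nM: "(norm (M s x))\<^sup>2 = (norm x)\<^sup>2 + s\<^sup>2 * (norm (cross3 e x))\<^sup>2" for s x
    unfolding M_def power2_norm_eq_inner
    by (simp add: inner_add_left inner_add_right dot_cross_self power2_eq_square)
  have lin: "linear (M s)" for s
    unfolding M_def by (auto intro!: linearI simp: cross_add_right cross_mult_right algebra_simps)
  have cr: "norm (cross3 e x) \<le> norm x" for x
  proof (rule power2_le_imp_le)
    show "(norm (cross3 e x))\<^sup>2 \<le> (norm x)\<^sup>2" 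
      using norm_cross_dot[of e x] zero_le_power2[of "e \<bullet> x"] unfolding ne mult_1 by linarith
  qed simp
  have lower: "1 * norm x \<le> norm (M s x)" for s x
  proof (rule power2_le_imp_le)
    show "(1 * norm x)\<^sup>2 \<le> (norm (M s x))\<^sup>2" using nM[of s x] by simp
  qed simp
  have upper: "norm (M s x) \<le> sqrt (1 + s\<^sup>2) * norm x" for s x
  proof (rule power2_le_imp_le)
    have "s\<^sup>2 * (norm (cross3 e x))\<^sup>2 \<le> s\<^sup>2 * (norm x)\<^sup>2" using cr[of x] by (intro mult_left_mono power_mono) auto
    then show "(norm (M s x))\<^sup>2 \<le> (sqrt (1 + s\<^sup>2) * norm x)\<^sup>2" by (simp add: nM power_mult_distrib algebra_simps)
  qed simp
  have iu: "integrable surf u" using u by (intro integrable_surf_continuous sphere_smooth_continuous)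
  define A where "A = (LINT m|surf. \<bar>u m\<bar>)"
  have A: "A \<ge> 0" unfolding A_def by (intro integral_nonneg_AE) auto
  (* the stretchings of M s lie between 1 and sqrt (1 + s^2), so the area changes by O(s^2) *)
  have diff: "\<bar>(LINT m|surf. u (sgn (M s m))) - (LINT m|surf. u m)\<bar> \<le> 3 * s\<^sup>2 * A" if s: "\<bar>s\<bar> \<le> 1" for s
  proof -
    interpret near_isometry "M s" 1 "sqrt (1 + s\<^sup>2)"
      by unfold_locales (use lin[of s] lower upper in \<open>auto simp: linear_add linear_scale\<close>)
    have "s\<^sup>2 \<le> 1" using s by (simp add: abs_square_le_1)
    then have "s\<^sup>2 * s\<^sup>2 \<le> s\<^sup>2" using mult_left_mono[of "s\<^sup>2" 1 "s\<^sup>2"] by simp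
    moreover have "q \<le> sqrt (1 + s\<^sup>2) ^ 4" unfolding q_def by (simp add: power_increasing)
    moreover have "sqrt (1 + s\<^sup>2) ^ 4 = (1 + s\<^sup>2)\<^sup>2"
    proof -
      have "sqrt (1 + s\<^sup>2) ^ 4 = ((sqrt (1 + s\<^sup>2))\<^sup>2)\<^sup>2" unfolding power_mult[symmetric] by simp
      then show ?thesis by simp
    qed
    ultimately have "q - 1 \<le> 3 * s\<^sup>2" by (simp add: power2_eq_square algebra_simps)
    then show ?thesis using LINT_comp_diff[OF iu] mult_right_mono[OF _ A] unfolding A_def by fastforce
  qed
  obtain K where K: "K > 0" "\<And>m. norm m = 1 \<Longrightarrow> norm (rgrad u m) \<le> K" using bounded_rgrad[OF u] by blast
  define s where "s k = 1 / real (Suc k)" for k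
  have s: "s k > 0" "s k \<le> 1" for k by (auto simp: s_def)
  have s0: "s \<longlonglongrightarrow> 0" unfolding s_def by (rule LIMSEQ_Suc[OF lim_1_over_n])
  define d where "d k m = (u (sgn (M (s k) m)) - u m) / s k" for k m
  have Mi: "integrable surf (\<lambda>m. u (sgn (M (s k) m)))" for k
  proof -
    interpret near_isometry "M (s k)" 1 "sqrt (1 + (s k)\<^sup>2)"
      by unfold_locales (use lin[of "s k"] lower upper in \<open>auto simp: linear_add linear_scale\<close>)
    show ?thesis by (rule comp_integrable[OF iu])
  qed
  have "(\<lambda>k. LINT m|surf. d k m) \<longlonglongrightarrow> (LINT m|surf. rgrad u m $ i)"
  proof (rule integral_dominated_convergence)
    show "(\<lambda>m. rgrad u m $ i) \<in> borel_measurable surf"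
      by (intro measurable_surf_continuous sphere_smooth_continuous sphere_smooth_rgrad u)
    show "d k \<in> borel_measurable surf" for k unfolding d_def using Mi[of k] iu by auto
    show "integrable surf (\<lambda>m. K)" by simp
    show "AE m in surf. (\<lambda>k. d k m) \<longlonglongrightarrow> rgrad u m $ i"
    proof (rule AE_I2)
      fix m assume "m \<in> space surf" then have m: "norm m = 1" by simp
      then have m0: "m + 0 *\<^sub>R cross3 e m \<noteq> 0" by auto
      from sphere_path_derivative[OF u m0]
      have "((\<lambda>h. (u (sgn (m + h *\<^sub>R cross3 e m)) - u m) / h) \<longlongrightarrow> surface_grad u m \<bullet> cross3 e m) (at 0)"
        using m by (simp add: DERIV_def)
      then have "((\<lambda>k. (u (sgn (m + s k *\<^sub>R cross3 e m)) - u m) / s k) \<longlongrightarrow> surface_grad u m \<bullet> cross3 e m) sequentially"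
        by (rule filterlim_compose) (use s s0 in \<open>auto simp: filterlim_at intro!: always_eventually\<close>, metis less_irrefl)
      moreover have "surface_grad u m \<bullet> cross3 e m = rgrad u m $ i"
      proof -
        have "p \<bullet> cross3 e m = e \<bullet> cross3 m p" for p by (simp add: cross3_simps)
        then show ?thesis by (simp add: rgrad_def e_def inner_axis' )
      qed
      ultimately show "(\<lambda>k. d k m) \<longlonglongrightarrow> rgrad u m $ i" by (simp add: d_def M_def)
    qed
    show "AE m in surf. norm (d k m) \<le> K" for k
    proof (rule AE_I2)
      fix m assume "m \<in> space surf" then have m: "norm m = 1" by simp
      let ?y = "\<lambda>t. m + t *\<^sub>R cross3 e m"
      have y1: "norm (?y t) \<ge> 1" for t using lower[of m t] m by (simp add: M_def)
      then have y0: "?y t \<noteq> 0" for t by (metis norm_zero not_one_le_zero)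
      obtain \<xi> where "u (sgn (?y (s k))) - u (sgn (?y 0)) = (s k - 0) * (surface_grad u (?y \<xi>) \<bullet> cross3 e m)"
        using MVT2[of 0 "s k" "\<lambda>t. u (sgn (?y t))" "\<lambda>t. surface_grad u (?y t) \<bullet> cross3 e m"]
          sphere_path_derivative[OF u y0] s by blast
      then have "d k m = surface_grad u (?y \<xi>) \<bullet> cross3 e m" using m s[of k] by (simp add: d_def M_def)
      also have "\<bar>\<dots>\<bar> \<le> norm (surface_grad u (?y \<xi>)) * norm (cross3 e m)" by (rule Cauchy_Schwarz_ineq2)
      also have "\<dots> \<le> K * 1"
      proof (intro mult_mono)
        have "norm (surface_grad u (?y \<xi>)) = norm (rgrad u (sgn (?y \<xi>))) / norm (?y \<xi>)"
          by (rule norm_surface_grad[OF u y0])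
        also have "\<dots> \<le> K / 1" using y1[of \<xi>] K y0[of \<xi>] by (intro frac_le) (auto simp: norm_sgn)
        finally show "norm (surface_grad u (?y \<xi>)) \<le> K" by simp
      qed (use cr[of m] m K in auto)
      finally show "norm (d k m) \<le> K" by simp
    qed
  qed
  moreover have "(\<lambda>k. LINT m|surf. d k m) \<longlonglongrightarrow> 0"
  proof (rule Lim_null_comparison)
    show "\<forall>\<^sub>F k in sequentially. norm (LINT m|surf. d k m) \<le> s k * (3 * A)"
    proof (rule always_eventually, rule allI)
      fix k
      have "(LINT m|surf. d k m) = ((LINT m|surf. u (sgn (M (s k) m))) - (LINT m|surf. u m)) / s k"
        unfolding d_def using Mi[of k] iu by simp
      also have "\<bar>\<dots>\<bar> \<le> 3 * (s k)\<^sup>2 * A / s k"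
        unfolding abs_divide using diff[of "s k"] s[of k] A by (intro frac_le) auto
      also have "\<dots> = s k * (3 * A)" using s[of k] by (simp add: power2_eq_square)
      finally show "norm (LINT m|surf. d k m) \<le> s k * (3 * A)" by simp
    qed
    show "(\<lambda>k. s k * (3 * A)) \<longlonglongrightarrow> 0" using tendsto_mult_left_zero[OF s0] .
  qed
  ultimately show ?thesis by (rule LIMSEQ_unique)
qed

lemma L2_smooth: "sphere_smooth f \<Longrightarrow> L2 f"
  by (intro L2_continuous sphere_smooth_continuous)

lemma L2_rgrad: "sphere_smooth f \<Longrightarrow> L2 (rgrad f)"
  by (intro L2_continuous rgrad_continuous)

lemma L2_rgrad_component: "sphere_smooth f \<Longrightarrow> L2 (\<lambda>m. rgrad f m $ i)"
  by (intro L2_smooth sphere_smooth_rgrad)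

lemma LINT_by_parts:
  assumes "sphere_smooth u" "sphere_smooth v"
  shows "(LINT m|surf. u m * rgrad v m $ i) = - (LINT m|surf. rgrad u m $ i * v m)"
proof -
  have "0 = (LINT m|surf. rgrad (\<lambda>m. u m * v m) m $ i)"
    using LINT_rgrad_zero[OF sphere_smooth_mult[OF assms]] by simp
  also have "\<dots> = (LINT m|surf. u m * rgrad v m $ i + rgrad u m $ i * v m)"
    by (intro LINT_cong_S2) (simp add: rgrad_mult[OF assms] mult.commute)
  also have "\<dots> = (LINT m|surf. u m * rgrad v m $ i) + (LINT m|surf. rgrad u m $ i * v m)"
    using assms by (intro Bochner_Integration.integral_add L2_mult_integrable L2_smooth sphere_smooth_rgrad)
  finally show ?thesis by simp
qed

lemma has_weak_rgrad_smooth: "sphere_smooth u \<Longrightarrow> has_weak_rgrad u (rgrad u)"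
  unfolding has_weak_rgrad_def sphere_L2_iff by (auto intro: LINT_by_parts L2_rgrad_component)

lemma LINT_rdiv_by_parts:
  assumes V: "\<And>i. sphere_smooth (\<lambda>m. V m $ i)" and \<phi>: "sphere_smooth \<phi>"
  shows "(LINT m|surf. rdiv V m * \<phi> m) = - (LINT m|surf. V m \<bullet> rgrad \<phi> m)"
proof -
  have i1: "integrable surf (\<lambda>m. rgrad (\<lambda>x. V x $ i) m $ i * \<phi> m)" for i
    by (intro L2_mult_integrable L2_rgrad_component V L2_smooth \<phi>)
  have i2: "integrable surf (\<lambda>m. V m $ i * rgrad \<phi> m $ i)" for i
    by (intro L2_mult_integrable L2_rgrad_component \<phi> L2_smooth V)
  have "(LINT m|surf. rdiv V m * \<phi> m) = (\<Sum>i\<in>UNIV. LINT m|surf. rgrad (\<lambda>x. V x $ i) m $ i * \<phi> m)"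
    unfolding rdiv_def sum_distrib_right using i1 by simp
  also have "\<dots> = (\<Sum>i\<in>UNIV. - (LINT m|surf. V m $ i * rgrad \<phi> m $ i))"
    by (intro sum.cong refl) (simp add: LINT_by_parts[OF V \<phi>])
  also have "\<dots> = - (LINT m|surf. V m \<bullet> rgrad \<phi> m)"
    unfolding inner_vec_def using i2 by (simp add: sum_negf)
  finally show ?thesis .
qed

section \<open>A polynomial approximate identity\<close>

text \<open>A zonal kernel that is a polynomial in \<open>m \<cdot> m'\<close>, concentrates at \<open>m = m'\<close> as \<open>n\<close> grows and has integral 1.  Being a polynomial
  makes convolutions smooth with little effort; being zonal makes them commute with \<open>\<R>\<close>.\<close>

definition bump :: "nat \<Rightarrow> real^3 \<Rightarrow> real^3 \<Rightarrow> real" where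
  "bump n m m' = real (Suc n) / area * ((1 + m \<bullet> m') / 2) ^ n"

definition smoothing :: "nat \<Rightarrow> (real^3 \<Rightarrow> real) \<Rightarrow> real^3 \<Rightarrow> real" where
  "smoothing n u m = (LINT m'|surf. bump n m m' * u m')"

lemma bump_commute: "bump n m m' = bump n m' m"
  by (simp add: bump_def inner_commute)

lemma inner_unit_bounds:
  fixes m m' :: "real^3" assumes "norm m = 1" "norm m' = 1" shows "- 1 \<le> m \<bullet> m'" "m \<bullet> m' \<le> 1"
  using Cauchy_Schwarz_ineq2[of m m'] assms by auto

lemma bump_bounds:
  assumes "norm m = 1" "norm m' = 1" shows "0 \<le> bump n m m'" "bump n m m' \<le> real (Suc n) / area"
proof -
  have "((1 + m \<bullet> m') / 2) ^ n \<le> 1" using inner_unit_bounds[OF assms] by (intro power_le_one) auto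
  then show "bump n m m' \<le> real (Suc n) / area" unfolding bump_def using area_pos
    by (metis area_pos divide_nonneg_pos mult.right_neutral mult_left_mono of_nat_0_le_iff)
  show "0 \<le> bump n m m'" unfolding bump_def using area_pos inner_unit_bounds[OF assms] by simp
qed

lemma integrable_mult_continuous:
  fixes c u :: "real^3 \<Rightarrow> real"
  assumes c: "continuous_on S2 c" and u: "integrable surf u"
  shows "integrable surf (\<lambda>m. c m * u m)"
proof -
  obtain K where K: "\<And>m. norm m = 1 \<Longrightarrow> norm (c m) \<le> K" "K > 0" using continuous_S2_bounded[OF c] by blast
  show ?thesis
  proof (rule Bochner_Integration.integrable_bound)
    show "integrable surf (\<lambda>m. K * u m)" using u by simp
    show "(\<lambda>m. c m * u m) \<in> borel_measurable surf" using measurable_surf_continuous[OF c] u by auto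
    show "AE m in surf. norm (c m * u m) \<le> norm (K * u m)"
      using K by (intro AE_I2) (auto simp: abs_mult intro!: mult_right_mono)
  qed
qed

subsection \<open>Moments\<close>

text \<open>The smoothing of \<open>u\<close>, up to a factor, as a polynomial on the ambient space.\<close>

definition moment :: "nat \<Rightarrow> (real^3 \<Rightarrow> real) \<Rightarrow> real^3 \<Rightarrow> real" where
  "moment j u x = (LINT m|surf. (1 + x \<bullet> m) ^ j * u m)"

lemma moment_integrable: "integrable surf u \<Longrightarrow> integrable surf (\<lambda>m. (1 + x \<bullet> m) ^ j * u m)"
  by (intro integrable_mult_continuous continuous_intros)

lemma component_integrable: "integrable surf u \<Longrightarrow> integrable surf (\<lambda>m. m $ i * u m)" for u :: "real^3 \<Rightarrow> real"
  by (intro integrable_mult_continuous continuous_intros)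

lemma inner_integrable: "integrable surf u \<Longrightarrow> integrable surf (\<lambda>m. (v \<bullet> m) * u m)" for u :: "real^3 \<Rightarrow> real"
  by (intro integrable_mult_continuous continuous_intros)

lemma moment_linear:
  assumes u: "integrable surf u" shows "moment j (\<lambda>m. (v \<bullet> m) * u m) x = (\<Sum>i\<in>UNIV. v $ i * moment j (\<lambda>m. m $ i * u m) x)"
proof -
  have "moment j (\<lambda>m. (v \<bullet> m) * u m) x = (LINT m|surf. (\<Sum>i\<in>UNIV. v $ i * ((1 + x \<bullet> m) ^ j * (m $ i * u m))))"
    unfolding moment_def inner_vec_def[of v] sum_distrib_left sum_distrib_right by (simp add: mult_ac)
  also have "\<dots> = (\<Sum>i\<in>UNIV. LINT m|surf. v $ i * ((1 + x \<bullet> m) ^ j * (m $ i * u m)))"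
    using moment_integrable[OF component_integrable[OF u]] by (intro Bochner_Integration.integral_sum) simp
  finally show ?thesis by (simp add: moment_def)
qed

lemma moment_Suc:
  assumes u: "integrable surf u"
  shows "moment (Suc j) u x = moment j u x + (\<Sum>i\<in>UNIV. x $ i * moment j (\<lambda>m. m $ i * u m) x)"
proof -
  have "moment (Suc j) u x = (LINT m|surf. (1 + x \<bullet> m) ^ j * u m + (1 + x \<bullet> m) ^ j * ((x \<bullet> m) * u m))"
    unfolding moment_def by (simp add: algebra_simps)
  also have "\<dots> = moment j u x + moment j (\<lambda>m. (x \<bullet> m) * u m) x"
    unfolding moment_def using u by (intro Bochner_Integration.integral_add moment_integrable inner_integrable)
  finally show ?thesis by (simp add: moment_linear[OF u])
qed

lemma moment_polynomial: "integrable surf u \<Longrightarrow> real_polynomial_function (moment j u)"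
proof (induction j arbitrary: u)
  case 0
  then show ?case by (simp add: moment_def real_polynomial_function.intros(2))
next
  case (Suc j)
  have eq: "moment (Suc j) u = (\<lambda>x. moment j u x + (\<Sum>i\<in>UNIV. x $ i * moment j (\<lambda>m. m $ i * u m) x))"
    using moment_Suc[OF Suc.prems] by blast
  show ?case unfolding eq
    by (intro real_polynomial_function.intros(3,4,1) real_polynomial_function_sum
        bounded_linear_vec_nth Suc.IH Suc.prems component_integrable) auto
qed

lemma moment_has_derivative:
  "integrable surf u \<Longrightarrow> (moment j u has_derivative (\<lambda>v. real j * moment (j - 1) (\<lambda>m. (v \<bullet> m) * u m) x)) (at x)"
proof (induction j arbitrary: u)
  case 0
  then show ?case by (simp add: moment_def)
next
  case (Suc j)
  let ?w = "\<lambda>v m. (v \<bullet> m) * u m"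
  have eq: "moment (Suc j) u = (\<lambda>x. moment j u x + (\<Sum>i\<in>UNIV. x $ i * moment j (\<lambda>m. m $ i * u m) x))"
    using moment_Suc[OF Suc.prems] by blast
  have nth: "((\<lambda>x. x $ i) has_derivative (\<lambda>v. v $ i)) (at x)" for i
    by (rule bounded_linear_imp_has_derivative[OF bounded_linear_vec_nth])
  have "(moment (Suc j) u has_derivative (\<lambda>v. real j * moment (j - 1) (?w v) x +
      (\<Sum>i\<in>UNIV. x $ i * (real j * moment (j - 1) (\<lambda>m. (v \<bullet> m) * (m $ i * u m)) x) + v $ i * moment j (\<lambda>m. m $ i * u m) x))) (at x)"
    unfolding eq
    by (intro has_derivative_add has_derivative_sum has_derivative_mult nth Suc.IH Suc.prems component_integrable)
  moreover have "real j * moment (j - 1) (?w v) x +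
      (\<Sum>i\<in>UNIV. x $ i * (real j * moment (j - 1) (\<lambda>m. (v \<bullet> m) * (m $ i * u m)) x) + v $ i * moment j (\<lambda>m. m $ i * u m) x)
      = real (Suc j) * moment j (?w v) x" for v
  proof -
    have "(\<Sum>i\<in>UNIV. v $ i * moment j (\<lambda>m. m $ i * u m) x) = moment j (?w v) x"
      by (rule moment_linear[OF Suc.prems, symmetric])
    moreover have "real j * moment (j - 1) (?w v) x +
        (\<Sum>i\<in>UNIV. x $ i * (real j * moment (j - 1) (\<lambda>m. (v \<bullet> m) * (m $ i * u m)) x)) = real j * moment j (?w v) x"
    proof (cases j)
      case (Suc l)
      have "moment (Suc l) (?w v) x = moment l (?w v) x + (\<Sum>i\<in>UNIV. x $ i * moment l (\<lambda>m. m $ i * ?w v m) x)"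
        by (rule moment_Suc[OF inner_integrable[OF Suc.prems]])
      moreover have "(\<lambda>m. m $ i * ?w v m) = (\<lambda>m. (v \<bullet> m) * (m $ i * u m))" for i by (auto simp: mult_ac)
      ultimately show ?thesis by (simp add: Suc sum_distrib_left algebra_simps)
    qed simp
    ultimately show ?thesis by (simp add: sum.distrib algebra_simps)
  qed
  ultimately show ?case by simp
qed

lemma smoothing_eq_moment: "smoothing n u m = real (Suc n) / area / 2 ^ n * moment n u m"
proof -
  have "bump n m m' * u m' = real (Suc n) / area / 2 ^ n * ((1 + m \<bullet> m') ^ n * u m')" for m'
    by (simp add: bump_def power_divide)
  then show ?thesis unfolding smoothing_def moment_def by simp
qed

lemma sphere_smooth_smoothing: "integrable surf u \<Longrightarrow> sphere_smooth (smoothing n u)"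
  unfolding smoothing_eq_moment[abs_def]
  by (intro sphere_smooth_cmult sphere_smooth_polynomial moment_polynomial)

lemma bump_continuous: "continuous_on S (bump n m)"
  unfolding bump_def[abs_def] using area_pos by (intro continuous_intros) auto

lemma bump_mult_integrable: "integrable surf u \<Longrightarrow> integrable surf (\<lambda>m'. bump n m m' * u m')"
  by (intro integrable_mult_continuous bump_continuous)

subsection \<open>Rotational gradients\<close>

definition dbump :: "nat \<Rightarrow> real^3 \<Rightarrow> real^3 \<Rightarrow> real" where
  "dbump n m m' = real (Suc n) / area * (real n / 2) * ((1 + m \<bullet> m') / 2) ^ (n - 1)"

lemma bump_has_derivative:
  "((\<lambda>x. bump n x a) has_derivative (\<lambda>v. (dbump n m a *\<^sub>R a) \<bullet> v)) (at m)"
proof -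
  have "((\<lambda>x. c * ((1 + x \<bullet> a) / 2) ^ n) has_derivative
      (\<lambda>v. ((c * (real n / 2) * ((1 + m \<bullet> a) / 2) ^ (n - 1)) *\<^sub>R a) \<bullet> v)) (at m)" for c
    by (auto intro!: derivative_eq_intros simp: inner_commute algebra_simps)
  then show ?thesis unfolding bump_def dbump_def .
qed

lemma rgrad_bump: "norm m = 1 \<Longrightarrow> rgrad (\<lambda>x. bump n x a) m = dbump n m a *\<^sub>R cross3 m a"
  using rgrad_ambient(2)[OF bump_has_derivative] by (simp add: cross_mult_right)

lemma sphere_smooth_bump: "sphere_smooth (\<lambda>x. bump n x a)"
proof -
  have "bump n x a = real (Suc n) / area * (1 / 2 + 1 / 2 * (x \<bullet> a)) ^ n" for x
    by (simp add: bump_def add_divide_distrib)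
  then show ?thesis
    by (simp only:) (intro sphere_smooth_cmult sphere_smooth_power sphere_smooth_add sphere_smooth_const sphere_smooth_inner)
qed

lemma bump_flip: "(\<lambda>x. bump n x m) = bump n m"
  by (auto simp: fun_eq_iff bump_commute)

text \<open>Invariance of the kernel under simultaneous rotation of both arguments.\<close>

lemma rgrad_bump_swap:
  assumes "norm m = 1" "norm m' = 1" shows "rgrad (bump n m) m' = - rgrad (\<lambda>x. bump n x m') m"
proof -
  have "rgrad (bump n m) m' = rgrad (\<lambda>x. bump n x m) m'" by (simp add: bump_flip)
  also have "\<dots> = - rgrad (\<lambda>x. bump n x m') m"
    using assms by (simp add: rgrad_bump dbump_def inner_commute[of m m'] cross_skew[of m' m])
  finally show ?thesis .
qed

lemma rgrad_smoothing_kernel: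
  assumes u: "integrable surf u" and m: "norm m = 1"
  shows "rgrad (smoothing n u) m $ i = (LINT m'|surf. rgrad (\<lambda>x. bump n x m') m $ i * u m')"
proof -
  define D where "D v = (LINT m'|surf. dbump n m m' * (v \<bullet> m') * u m')" for v
  have "(smoothing n u has_derivative D) (at m)"
  proof -
    have "(smoothing n u has_derivative (\<lambda>v. real (Suc n) / area / 2 ^ n * (real n * moment (n - 1) (\<lambda>m. (v \<bullet> m) * u m) m))) (at m)"
      unfolding smoothing_eq_moment[abs_def] by (intro has_derivative_mult_right moment_has_derivative u)
    also have "(\<lambda>v. real (Suc n) / area / 2 ^ n * (real n * moment (n - 1) (\<lambda>m. (v \<bullet> m) * u m) m)) = D"
    proof
      fix v
      have c: "real (Suc n) / area / 2 ^ n * real n * X ^ (n - 1) = real (Suc n) / area * (real n / 2) * (X / 2) ^ (n - 1)" for X :: real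
        by (cases n) (auto simp: power_divide)
      have "real (Suc n) / area / 2 ^ n * (real n * moment (n - 1) (\<lambda>m. (v \<bullet> m) * u m) m)
         = (LINT m'|surf. real (Suc n) / area / 2 ^ n * real n * (1 + m \<bullet> m') ^ (n - 1) * ((v \<bullet> m') * u m'))"
        unfolding moment_def mult.assoc by (simp add: mult.assoc)
      then show "real (Suc n) / area / 2 ^ n * (real n * moment (n - 1) (\<lambda>m. (v \<bullet> m) * u m) m) = D v"
        unfolding D_def c dbump_def by (simp only: mult.assoc)
    qed
    finally show ?thesis .
  qed
  note dD = this
  define p where "p = (\<chi> i. D (axis i 1))"
  have Dp: "D = (\<lambda>v. p \<bullet> v)"
    unfolding p_def using has_derivative_linear[OF dD] by (intro ext linear_eq_inner_vec)
  have "rgrad (smoothing n u) m $ i = cross3 m p $ i"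
    using rgrad_ambient(2)[of "smoothing n u" p m] dD m Dp by simp
  also have "\<dots> = p \<bullet> cross3 (axis i 1) m"
  proof -
    have "p \<bullet> cross3 e m = e \<bullet> cross3 m p" for e by (simp add: cross3_simps)
    then show ?thesis by (simp add: inner_axis')
  qed
  also have "\<dots> = D (cross3 (axis i 1) m)" by (simp add: Dp)
  also have "\<dots> = (LINT m'|surf. rgrad (\<lambda>x. bump n x m') m $ i * u m')"
  proof -
    have "cross3 e m \<bullet> m' = e \<bullet> cross3 m m'" for e m' by (simp add: cross3_simps)
    then show ?thesis unfolding D_def using m by (simp add: rgrad_bump inner_axis')
  qed
  finally show ?thesis .
qed

text \<open>The gradient falls on the kernel, moves to its other argument by rotation invariance, and from there to \<open>u\<close> by the definition
  of the weak gradient.\<close>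

lemma rgrad_smoothing:
  assumes w: "has_weak_rgrad u G" and u: "L2 u" and m: "norm m = 1"
  shows "rgrad (smoothing n u) m $ i = smoothing n (\<lambda>m'. G m' $ i) m"
proof -
  have "sphere_smooth (bump n m)"
    using sphere_smooth_bump[of n m] by (simp add: bump_flip)
  then have w: "(LINT m'|surf. u m' * rgrad (bump n m) m' $ i) = - (LINT m'|surf. G m' $ i * bump n m m')"
    using w by (simp add: has_weak_rgrad_def)
  have "rgrad (smoothing n u) m $ i = (LINT m'|surf. rgrad (\<lambda>x. bump n x m') m $ i * u m')"
    by (rule rgrad_smoothing_kernel[OF L2_integrable[OF u] m])
  also have "\<dots> = (LINT m'|surf. - (u m' * rgrad (bump n m) m' $ i))"
    by (intro LINT_cong_S2) (simp add: rgrad_bump_swap m mult.commute)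
  also have "\<dots> = smoothing n (\<lambda>m'. G m' $ i) m"
    by (simp add: w smoothing_def mult.commute)
  finally show ?thesis .
qed

text \<open>The kernels are linked by the Laplacian \<open>\<R> \<cdot> \<R>\<close>, which makes their normalization and the
  spectral gap below telescope.\<close>

lemma laplacian_bump:
  assumes m: "norm m = 1" and a: "norm a = 1"
  shows "rdiv (rgrad (\<lambda>x. bump (Suc n) x a)) m = real (Suc n) * real (Suc (Suc n)) * (bump n m a - bump (Suc n) m a)"
proof -
  define c where "c = real (Suc (Suc n)) / area * (real (Suc n) / 2)"
  define y where "y = (1 + m \<bullet> a) / 2"
  have deriv: "((\<lambda>x. c * ((1 + x \<bullet> a) / 2) ^ n * (x \<bullet> cross3 a (axis i 1))) has_derivative
      (\<lambda>v. ((c * (real n / 2) * y ^ (n - 1) * (m \<bullet> cross3 a (axis i 1))) *\<^sub>R a + (c * y ^ n) *\<^sub>R cross3 a (axis i 1)) \<bullet> v)) (at m)" for i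
    unfolding y_def by (auto intro!: derivative_eq_intros simp: inner_commute algebra_simps)
  have comp: "cross3 x a $ i = x \<bullet> cross3 a (axis i 1)" for x i
  proof -
    have "x \<bullet> cross3 a e = e \<bullet> cross3 x a" for e by (simp add: cross3_simps)
    then show ?thesis by (simp add: inner_axis')
  qed
  have "rgrad (\<lambda>x. rgrad (\<lambda>x. bump (Suc n) x a) x $ i) m
     = rgrad (\<lambda>x. c * ((1 + x \<bullet> a) / 2) ^ n * (x \<bullet> cross3 a (axis i 1))) m" for i
    by (rule rgrad_cong_S2[OF _ m]) (simp add: rgrad_bump dbump_def c_def comp)
  also have "\<dots> i = cross3 m ((c * (real n / 2) * y ^ (n - 1) * (m \<bullet> cross3 a (axis i 1))) *\<^sub>R a + (c * y ^ n) *\<^sub>R cross3 a (axis i 1))" for i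
    by (rule rgrad_ambient(2)[OF deriv m])
  finally have "rdiv (rgrad (\<lambda>x. bump (Suc n) x a)) m = (\<Sum>i\<in>UNIV.
      cross3 m ((c * (real n / 2) * y ^ (n - 1) * (m \<bullet> cross3 a (axis i 1))) *\<^sub>R a + (c * y ^ n) *\<^sub>R cross3 a (axis i 1)) $ i)"
    by (simp add: rdiv_def)
  also have "\<dots> = (\<Sum>i\<in>UNIV. (c * (real n / 2) * y ^ (n - 1)) * ((m \<bullet> cross3 a (axis i 1)) * cross3 m a $ i)
      + (c * y ^ n) * cross3 m (cross3 a (axis i 1)) $ i)"
    by (simp add: cross_add_right cross_mult_right algebra_simps)
  also have "\<dots> = (c * (real n / 2) * y ^ (n - 1)) * (norm (cross3 m a))\<^sup>2 + (c * y ^ n) * (- 2 * (m \<bullet> a))"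
  proof -
    have 1: "(\<Sum>i\<in>UNIV. (m \<bullet> cross3 a (axis i 1)) * cross3 m a $ i) = (norm (cross3 m a))\<^sup>2"
      unfolding comp[symmetric] power2_norm_eq_inner by (simp add: inner_vec_def)
    have 2: "(\<Sum>i\<in>UNIV. cross3 m (cross3 a (axis i 1)) $ i) = - 2 * (m \<bullet> a)"
      by (simp add: sum_3 cross3_simps axis_def)
    show ?thesis unfolding sum.distrib sum_distrib_left[symmetric] 1 2 by simp
  qed
  also have "(norm (cross3 m a))\<^sup>2 = 4 * y * (1 - y)"
    using norm_cross_dot[of m a] m a by (simp add: y_def power2_eq_square field_simps)
  also have "m \<bullet> a = 2 * y - 1" by (simp add: y_def field_simps)
  also have "c * (real n / 2) * y ^ (n - 1) * (4 * y * (1 - y)) = c * (2 * real n) * y ^ n * (1 - y)"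
    by (cases n) auto
  also have "c * (2 * real n) * y ^ n * (1 - y) + c * y ^ n * (- 2 * (2 * y - 1))
     = real (Suc n) * real (Suc (Suc n)) * (bump n m a - bump (Suc n) m a)"
    unfolding bump_def y_def[symmetric] c_def using area_pos by (simp add: field_simps)
  finally show ?thesis .
qed

subsection \<open>Symmetry and contractivity\<close>

lemma measure_surf_S2 [simp]: "measure surf S2 = area"
  by (simp add: area_def)

lemma LINT_rdiv_zero:
  assumes "\<And>i. sphere_smooth (\<lambda>m. V m $ i)" shows "(LINT m|surf. rdiv V m) = 0"
proof -
  have "(LINT m|surf. rdiv V m) = (\<Sum>i\<in>UNIV. LINT m|surf. rgrad (\<lambda>x. V x $ i) m $ i)"
    unfolding rdiv_def using L2_integrable[OF L2_rgrad_component[OF assms]] by simp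
  then show ?thesis by (simp add: LINT_rgrad_zero assms)
qed

text \<open>The integral of a Laplacian vanishes, so by the recursion for the Laplacian the integrals of consecutive kernels agree; the first
  kernel is constant.\<close>

lemma bump_integral:
  assumes m: "norm m = 1" shows "(LINT m'|surf. bump n m m') = 1"
proof (induction n)
  case 0
  then show ?case using area_pos by (simp add: bump_def)
next
  case (Suc n)
  have i: "integrable surf (bump k m)" for k by (intro integrable_surf_continuous bump_continuous)
  have "0 = (LINT m'|surf. rdiv (rgrad (\<lambda>x. bump (Suc n) x m)) m')"
    by (rule LINT_rdiv_zero[symmetric]) (intro sphere_smooth_rgrad sphere_smooth_bump)
  also have "\<dots> = (LINT m'|surf. real (Suc n) * real (Suc (Suc n)) * (bump n m m' - bump (Suc n) m m'))"
    using m by (intro LINT_cong_S2) (simp only: laplacian_bump bump_commute[of _ m])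
  also have "\<dots> = real (Suc n) * real (Suc (Suc n)) * ((LINT m'|surf. bump n m m') - (LINT m'|surf. bump (Suc n) m m'))"
    using i by simp
  finally show ?case using Suc.IH by simp
qed

interpretation surf2: pair_sigma_finite surf surf ..

lemma smoothing_symmetric:
  assumes u: "integrable surf u" and v: "integrable surf v"
  shows "(LINT m|surf. v m * smoothing n u m) = (LINT m|surf. smoothing n v m * u m)"
proof -
  let ?F = "\<lambda>(m, m'). v m * (bump n m m' * u m')"
  have fs: "fst \<in> borel_measurable (surf \<Otimes>\<^sub>M surf)" "snd \<in> borel_measurable (surf \<Otimes>\<^sub>M surf)"
    using measurable_compose[OF measurable_fst measurable_surf_borel[of id]]
      measurable_compose[OF measurable_snd measurable_surf_borel[of id]] by (simp_all add: o_def)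
  have [measurable]: "(\<lambda>p. bump n (fst p) (snd p)) \<in> borel_measurable (surf \<Otimes>\<^sub>M surf)"
    unfolding bump_def using fs by measurable
  have [measurable]: "u \<in> borel_measurable surf" "v \<in> borel_measurable surf" using u v by auto
  have mF: "?F \<in> borel_measurable (surf \<Otimes>\<^sub>M surf)"
    unfolding split_beta by measurable
  have dom: "integrable (surf \<Otimes>\<^sub>M surf) (\<lambda>p. v (fst p) * u (snd p))"
  proof (rule surf2.Fubini_integrable)
    have "(\<lambda>x. LINT y|surf. norm (v (fst (x, y)) * u (snd (x, y)))) = (\<lambda>x. \<bar>v x\<bar> * (LINT y|surf. \<bar>u y\<bar>))"
      by (simp add: abs_mult)
    then show "integrable surf (\<lambda>x. LINT y|surf. norm (v (fst (x, y)) * u (snd (x, y))))" using v by simp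
  qed (use u in auto)
  have iF: "integrable (surf \<Otimes>\<^sub>M surf) ?F"
  proof (rule Bochner_Integration.integrable_bound[OF _ mF])
    show "integrable (surf \<Otimes>\<^sub>M surf) (\<lambda>p. real (Suc n) / area * (v (fst p) * u (snd p)))" using dom by simp
    show "AE p in surf \<Otimes>\<^sub>M surf. norm (?F p) \<le> norm (real (Suc n) / area * (v (fst p) * u (snd p)))"
    proof (rule AE_I2)
      fix p assume "p \<in> space (surf \<Otimes>\<^sub>M surf)"
      then have p: "norm (fst p) = 1" "norm (snd p) = 1" by (auto simp: space_pair_measure)
      have "\<bar>bump n (fst p) (snd p)\<bar> * (\<bar>v (fst p)\<bar> * \<bar>u (snd p)\<bar>)
          \<le> real (Suc n) / area * (\<bar>v (fst p)\<bar> * \<bar>u (snd p)\<bar>)"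
        using bump_bounds[OF p, of n] by (intro mult_right_mono) auto
      then show "norm (?F p) \<le> norm (real (Suc n) / area * (v (fst p) * u (snd p)))"
        using area_pos by (simp add: split_beta abs_mult mult_ac)
    qed
  qed
  have "(LINT m|surf. v m * smoothing n u m) = (LINT m|surf. LINT m'|surf. v m * (bump n m m' * u m'))"
    unfolding smoothing_def using bump_mult_integrable[OF u] by simp
  also have "\<dots> = (LINT m'|surf. LINT m|surf. v m * (bump n m m' * u m'))"
    using surf2.Fubini_integral[of "\<lambda>m m'. v m * (bump n m m' * u m')"] iF by simp
  also have "\<dots> = (LINT m'|surf. LINT m|surf. bump n m' m * v m * u m')"
    by (simp add: mult_ac bump_commute)
  also have "\<dots> = (LINT m'|surf. smoothing n v m' * u m')"
    unfolding smoothing_def using bump_mult_integrable[OF v] by simp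
  finally show ?thesis .
qed

lemma smoothing_diff:
  assumes "integrable surf u" "integrable surf v"
  shows "smoothing n (\<lambda>m. u m - v m) x = smoothing n u x - smoothing n v x"
  unfolding smoothing_def using bump_mult_integrable[OF assms(1)] bump_mult_integrable[OF assms(2)]
  by (simp add: right_diff_distrib)

text \<open>By \<open>2 a b \<le> a\<^sup>2 + b\<^sup>2\<close> under the double integral, whose weight is a positive kernel with both marginals constant.\<close>

lemma smoothing_young:
  assumes u: "L2 u" and v: "L2 v"
  shows "(LINT m|surf. v m * smoothing n u m) \<le> ((l2norm v)\<^sup>2 + (l2norm u)\<^sup>2) / 2"
proof -
  note iu = L2_integrable[OF u] and iv = L2_integrable[OF v]
  have iu2: "integrable surf (\<lambda>m. (u m)\<^sup>2)" and iv2: "integrable surf (\<lambda>m. (v m)\<^sup>2)" using u v by (auto simp: L2_def)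
  have Lk: "L2 (smoothing n w)" if "integrable surf w" for w by (intro L2_smooth sphere_smooth_smoothing that)
  have pt: "v m * smoothing n u m \<le> (v m)\<^sup>2 / 2 + smoothing n (\<lambda>m. (u m)\<^sup>2) m / 2" if m: "norm m = 1" for m
  proof -
    have i1: "integrable surf (\<lambda>m'. bump n m m' * ((v m)\<^sup>2 / 2))" by (intro bump_mult_integrable) simp
    note i = i1 bump_mult_integrable[OF iu2, of n m] bump_mult_integrable[OF iu, of n m]
    have "0 \<le> (LINT m'|surf. bump n m m' * ((v m - u m')\<^sup>2 / 2))"
      using bump_bounds(1)[OF m] by (intro integral_nonneg_AE AE_I2) auto
    also have "\<dots> = (LINT m'|surf. bump n m m' * ((v m)\<^sup>2 / 2) + (bump n m m' * (u m')\<^sup>2) / 2 - v m * (bump n m m' * u m'))"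
      by (intro LINT_cong_S2) (simp add: power2_diff algebra_simps add_divide_distrib diff_divide_distrib)
    also have "\<dots> = (LINT m'|surf. bump n m m') * ((v m)\<^sup>2 / 2) + smoothing n (\<lambda>m. (u m)\<^sup>2) m / 2 - v m * smoothing n u m"
      unfolding smoothing_def using i integrable_surf_continuous[OF bump_continuous, of n m] by simp
    finally show ?thesis by (simp add: bump_integral[OF m])
  qed
  have "(LINT m|surf. v m * smoothing n u m) \<le> (LINT m|surf. (v m)\<^sup>2 / 2 + 1 * smoothing n (\<lambda>m. (u m)\<^sup>2) m / 2)"
    using pt iv2 L2_integrable[OF Lk[OF iu2]] by (intro integral_mono L2_mult_integrable v Lk iu) auto
  also have "\<dots> = (LINT m|surf. (v m)\<^sup>2) / 2 + (LINT m|surf. 1 * smoothing n (\<lambda>m. (u m)\<^sup>2) m) / 2"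
    using iv2 L2_integrable[OF Lk[OF iu2]] by simp
  also have "(LINT m|surf. 1 * smoothing n (\<lambda>m. (u m)\<^sup>2) m) = (LINT m|surf. smoothing n (\<lambda>m. 1) m * (u m)\<^sup>2)"
    by (rule smoothing_symmetric[OF iu2]) simp
  also have "\<dots> = (LINT m|surf. (u m)\<^sup>2)"
    by (intro LINT_cong_S2) (simp add: smoothing_def bump_integral)
  finally show ?thesis by (simp add: l2norm_power2 add_divide_distrib)
qed

text \<open>The preceding inequality with \<open>v\<close> the smoothing of \<open>u\<close>.\<close>

lemma smoothing_contraction:
  assumes u: "L2 u" shows "l2norm (smoothing n u) \<le> l2norm u"
proof -
  have eq: "(LINT m|surf. smoothing n u m * smoothing n u m) = (l2norm (smoothing n u))\<^sup>2"
    unfolding l2norm_power2 by (simp add: power2_eq_square)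
  have "(l2norm (smoothing n u))\<^sup>2 \<le> ((l2norm (smoothing n u))\<^sup>2 + (l2norm u)\<^sup>2) / 2"
    using smoothing_young[OF u, of "smoothing n u" n] L2_smooth[OF sphere_smooth_smoothing[OF L2_integrable[OF u]]]
    unfolding eq by blast
  then have "(l2norm (smoothing n u))\<^sup>2 \<le> (l2norm u)\<^sup>2" by simp
  then show ?thesis by (rule power2_le_imp_le) simp
qed

subsection \<open>Convergence\<close>

text \<open>Away from the diagonal the kernel is at most \<open>(n + 1) q\<^sup>n\<close> up to a constant, with \<open>q < 1\<close>; near the diagonal uniform continuity applies.\<close>

lemma smoothing_uniform:
  assumes c: "continuous_on S2 u" and e: "e > 0"
  shows "\<forall>\<^sub>F n in sequentially. \<forall>m. norm m = 1 \<longrightarrow> \<bar>smoothing n u m - u m\<bar> \<le> e"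
proof -
  obtain K where K: "K > 0" "\<And>m. norm m = 1 \<Longrightarrow> \<bar>u m\<bar> \<le> K" using continuous_S2_bounded[OF c] by (metis real_norm_def)
  have "uniformly_continuous_on S2 u" by (intro compact_uniformly_continuous c compact_sphere)
  then obtain d where d: "d > 0" "\<And>m m'. norm m = 1 \<Longrightarrow> norm m' = 1 \<Longrightarrow> dist m' m < d \<Longrightarrow> \<bar>u m' - u m\<bar> < e / 2"
    using e unfolding uniformly_continuous_on_def dist_real_def by (metis half_gt_zero mem_sphere_0)
  define q where "q = max 0 (1 - d\<^sup>2 / 4)"
  have q: "0 \<le> q" "q < 1" using d by (auto simp: q_def)
  have "(\<lambda>n. real n * q ^ n + q ^ n) \<longlonglongrightarrow> 0 + 0"
    using q by (intro tendsto_add powser_times_n_limit_0 LIMSEQ_realpow_zero) auto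
  then have "(\<lambda>n. real (Suc n) * q ^ n * (2 * K)) \<longlonglongrightarrow> 0 * (2 * K)"
    by (intro tendsto_mult tendsto_const) (simp add: algebra_simps)
  then have "\<forall>\<^sub>F n in sequentially. real (Suc n) * q ^ n * (2 * K) < e / 2"
    using e by (intro order_tendstoD) auto
  then show ?thesis
  proof (eventually_elim, intro allI impI)
    fix n and m :: "real^3" assume n: "real (Suc n) * q ^ n * (2 * K) < e / 2" and m: "norm m = 1"
    have far: "bump n m m' \<le> real (Suc n) / area * q ^ n" if "norm m' = 1" "\<not> dist m' m < d" for m'
    proof -
      have "(dist m' m)\<^sup>2 = 2 - 2 * (m \<bullet> m')"
        using m that unfolding dist_norm power2_norm_eq_inner inner_diff_left inner_diff_right
        by (simp add: inner_commute dot_square_norm)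
      moreover have "d\<^sup>2 \<le> (dist m' m)\<^sup>2" using that d by (intro power_mono) auto
      ultimately have "(1 + m \<bullet> m') / 2 \<le> 1 - d\<^sup>2 / 4" by (simp add: field_simps)
      then have "(1 + m \<bullet> m') / 2 \<le> q" unfolding q_def by (rule max.coboundedI2)
      then have "((1 + m \<bullet> m') / 2) ^ n \<le> q ^ n" using inner_unit_bounds[OF m that(1)] by (intro power_mono) auto
      then show ?thesis unfolding bump_def using area_pos by (intro mult_left_mono) auto
    qed
    have pt: "bump n m m' * \<bar>u m' - u m\<bar> \<le> bump n m m' * (e / 2) + real (Suc n) / area * q ^ n * (2 * K)" if m': "norm m' = 1" for m'
    proof (cases "dist m' m < d")
      case True
      have "bump n m m' * \<bar>u m' - u m\<bar> \<le> bump n m m' * (e / 2)"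
        using d(2)[OF m m' True] bump_bounds(1)[OF m m', of n] by (intro mult_left_mono) auto
      moreover have "0 \<le> real (Suc n) / area * q ^ n * (2 * K)" using q K area_pos by simp
      ultimately show ?thesis by linarith
    next
      case False
      have "bump n m m' * \<bar>u m' - u m\<bar> \<le> real (Suc n) / area * q ^ n * (2 * K)"
        using far[OF m' False] K(2)[OF m] K(2)[OF m'] bump_bounds(1)[OF m m', of n] area_pos q
        by (intro mult_mono) auto
      moreover have "0 \<le> bump n m m' * (e / 2)" using bump_bounds(1)[OF m m', of n] e by simp
      ultimately show ?thesis by linarith
    qed
    have ic: "integrable surf (bump n m)" by (intro integrable_surf_continuous bump_continuous)
    have iu: "integrable surf u" by (rule integrable_surf_continuous[OF c])
    have "smoothing n u m - u m = (LINT m'|surf. bump n m m' * (u m' - u m))"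
      unfolding right_diff_distrib using bump_mult_integrable[OF iu, of n m] ic bump_integral[OF m]
      by (simp add: smoothing_def)
    also have "\<bar>\<dots>\<bar> \<le> (LINT m'|surf. \<bar>bump n m m' * (u m' - u m)\<bar>)"
      using integral_abs_bound[of surf "\<lambda>m'. bump n m m' * (u m' - u m)"] by simp
    also have "\<dots> \<le> (LINT m'|surf. bump n m m' * (e / 2) + real (Suc n) / area * q ^ n * (2 * K))"
    proof (rule integral_mono)
      show "integrable surf (\<lambda>m'. \<bar>bump n m m' * (u m' - u m)\<bar>)"
        using iu by (intro integrable_abs bump_mult_integrable) simp
      show "\<bar>bump n m m' * (u m' - u m)\<bar> \<le> bump n m m' * (e / 2) + real (Suc n) / area * q ^ n * (2 * K)"
        if "m' \<in> space surf" for m'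
        using pt[of m'] bump_bounds(1)[OF m, of m' n] that unfolding abs_mult by simp
    qed (use ic in auto)
    also have "\<dots> = e / 2 + real (Suc n) * q ^ n * (2 * K)"
      using ic bump_integral[OF m] area_pos by (simp add: field_simps)
    finally show "\<bar>smoothing n u m - u m\<bar> \<le> e" using n by simp
  qed
qed

lemma indicator_approx:
  assumes A: "A \<in> sets surf" and e: "e > 0"
  shows "\<exists>c :: real^3 \<Rightarrow> real. continuous_on UNIV c \<and> (LINT m|surf. \<bar>indicator A m - c m\<bar>) < e"
proof -
  define N where "N = distr surf borel (\<lambda>x. x)"
  have id[measurable]: "(\<lambda>x. x) \<in> borel_measurable surf" by (rule measurable_surf_borel) simp
  have "A \<in> sets (restrict_space borel S2)" using A by (simp add: sets_surf)
  then obtain B where B: "B \<in> sets borel" "A = B \<inter> S2" by (auto simp: sets_restrict_space)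
  interpret N: finite_measure N unfolding N_def by (rule surf.finite_measure_distr) simp
  have sN: "sets N = sets borel" by (simp add: N_def)
  have "emeasure N B = (INF U\<in>{U. B \<subseteq> U \<and> open U}. emeasure N U)"
    by (rule outer_regular[OF sN]) (auto simp: B)
  then have "(INF U\<in>{U. B \<subseteq> U \<and> open U}. emeasure N U) < emeasure N B + ennreal (e / 2)"
    using e by (metis N.emeasure_finite ennreal_add_left_cancel_less ennreal_eq_0_iff add.right_neutral half_gt_zero linorder_not_le infinity_ennreal_def zero_less_iff_neq_zero)
  then obtain U where U: "B \<subseteq> U" "open U" "emeasure N U < emeasure N B + ennreal (e / 2)"
    by (auto simp: INF_less_iff)
  have U1: "measure N U < measure N B + e / 2"
    using U(3) e by (simp add: N.emeasure_eq_measure ennreal_plus[symmetric] ennreal_less_iff del: ennreal_plus)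
  have m: "measure N X = (LINT m|surf. indicator X m)" if "X \<in> sets borel" for X
    using that by (simp add: N_def measure_distr B(1) sets_restrict_space sets_surf)
  have ind: "integrable surf (\<lambda>m. indicator X m :: real)" if "X \<in> sets borel" for X
    using that by (intro integrable_surf_bounded[where K=1] measurable_surf_borel) (auto simp: indicator_def)
  define c where "c k x = (if U = UNIV then 1 else min 1 (real k * infdist x (- U)))" for k x
  have c: "continuous_on UNIV (c k)" for k
    unfolding c_def by (cases "U = UNIV") (auto intro!: continuous_intros)
  have ic: "integrable surf (c k)" for k
    by (rule integrable_surf_continuous[OF continuous_on_subset[OF c]]) simp
  have cb: "0 \<le> c k x" "c k x \<le> indicator U x" for k x
    using U(2) by (auto simp: c_def indicator_def infdist_nonneg)
  have "(\<lambda>k. LINT m|surf. indicator U m - c k m) \<longlonglongrightarrow> (LINT m|surf. 0)"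
  proof (rule integral_dominated_convergence)
    show "AE m in surf. (\<lambda>k. indicator U m - c k m) \<longlonglongrightarrow> 0"
    proof (rule AE_I2)
      fix m :: "real^3"
      show "(\<lambda>k. indicator U m - c k m) \<longlonglongrightarrow> 0"
      proof (cases "m \<in> U \<and> U \<noteq> UNIV")
        case True
        then have "infdist m (- U) > 0"
          using in_closed_iff_infdist_zero[of "- U" m] U(2) infdist_nonneg[of m "- U"]
          by (auto simp: closed_Compl order_less_le)
        then obtain K where "1 < real K * infdist m (- U)" using reals_Archimedean3 by blast
        then have "1 \<le> real k * infdist m (- U)" if "k \<ge> K" for k
          using that infdist_nonneg[of m "- U"] by (smt (verit) mult_right_mono of_nat_mono)
        then have "\<forall>\<^sub>F k in sequentially. indicator U m - c k m = 0"
          using True by (intro eventually_sequentiallyI[of K]) (auto simp: c_def)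
        then show ?thesis by (rule tendsto_eventually)
      next
        case False
        then have "indicator U m - c k m = 0" for k
          using cb[of k m] by (auto simp: c_def indicator_def)
        then show ?thesis by simp
      qed
    qed
    show "AE m in surf. norm (indicator U m - c k m) \<le> 1" for k
      using cb by (auto simp: indicator_def intro!: AE_I2) (smt (verit))+
  qed (use U(2) ic ind[of U] in auto)
  then have "\<forall>\<^sub>F k in sequentially. (LINT m|surf. indicator U m - c k m) < e / 2"
    using e by (intro order_tendstoD) auto
  then obtain k where k: "(LINT m|surf. indicator U m - c k m) < e / 2" using eventually_happens' by fastforce
  have "(LINT m|surf. \<bar>indicator A m - c k m\<bar>) = (LINT m|surf. \<bar>indicator B m - c k m\<bar>)"
    using B by (intro LINT_cong_S2) (auto simp: indicator_def)
  also have "\<dots> \<le> (LINT m|surf. (indicator U m - indicator B m) + (indicator U m - c k m))"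
  proof (rule integral_mono)
    show "\<bar>indicator B m - c k m\<bar> \<le> (indicator U m - indicator B m) + (indicator U m - c k m)" for m
      using cb[of k m] U(1) by (auto simp: indicator_def split: if_splits)
  qed (use ic ind B U(2) in auto)
  also have "\<dots> = (measure N U - measure N B) + (LINT m|surf. indicator U m - c k m)"
    using ic ind[of U] ind[of B] B U(2) by (simp add: m)
  also have "\<dots> < e" using U1 k by simp
  finally show ?thesis using c by blast
qed

lemma L1_continuous_approx:
  fixes f :: "real^3 \<Rightarrow> real"
  assumes "integrable surf f"
  shows "\<forall>e>0. \<exists>c :: real^3 \<Rightarrow> real. continuous_on UNIV c \<and> (LINT m|surf. \<bar>f m - c m\<bar>) < e"
  using assms
proof (induction f rule: integrable_induct)
  case (base A a)
  show ?case
  proof (intro allI impI)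
    fix e :: real assume e: "e > 0"
    obtain c :: "real^3 \<Rightarrow> real" where c: "continuous_on UNIV c" "(LINT m|surf. \<bar>indicator A m - c m\<bar>) < e / (\<bar>a\<bar> + 1)"
      using indicator_approx[OF base(1), of "e / (\<bar>a\<bar> + 1)"] e by (auto simp: divide_pos_pos add_nonneg_pos)
    have eq: "\<bar>indicator A m *\<^sub>R a - c m * a\<bar> = \<bar>a\<bar> * \<bar>indicator A m - c m\<bar>" for m
      by (simp add: abs_mult[symmetric] algebra_simps)
    have "(LINT m|surf. \<bar>indicator A m *\<^sub>R a - c m * a\<bar>) = \<bar>a\<bar> * (LINT m|surf. \<bar>indicator A m - c m\<bar>)"
      unfolding eq by simp
    also have "\<dots> \<le> \<bar>a\<bar> * (e / (\<bar>a\<bar> + 1))" using c(2) by (intro mult_left_mono) auto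
    also have "\<dots> < e" using e by (simp add: field_simps)
    finally show "\<exists>c :: real^3 \<Rightarrow> real. continuous_on UNIV c \<and> (LINT m|surf. \<bar>indicator A m *\<^sub>R a - c m\<bar>) < e"
      using c(1) by (intro exI[of _ "\<lambda>m. c m * a"] conjI) (auto intro: continuous_intros)
  qed
next
  case (add f g)
  show ?case
  proof (intro allI impI)
    fix e :: real assume e: "e > 0"
    obtain c where c: "continuous_on UNIV c" "(LINT m|surf. \<bar>f m - c m\<bar>) < e / 2" using add(3) e half_gt_zero by blast
    obtain d where d: "continuous_on UNIV d" "(LINT m|surf. \<bar>g m - d m\<bar>) < e / 2" using add(4) e half_gt_zero by blast
    have i: "integrable surf c" "integrable surf d"
      using c(1) d(1) by (auto intro!: integrable_surf_continuous intro: continuous_on_subset)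
    have "(LINT m|surf. \<bar>f m + g m - (c m + d m)\<bar>) \<le> (LINT m|surf. \<bar>f m - c m\<bar> + \<bar>g m - d m\<bar>)"
      using add i by (intro integral_mono) auto
    also have "\<dots> = (LINT m|surf. \<bar>f m - c m\<bar>) + (LINT m|surf. \<bar>g m - d m\<bar>)" using add i by simp
    also have "\<dots> < e" using c d by simp
    finally show "\<exists>c. continuous_on UNIV c \<and> (LINT m|surf. \<bar>f m + g m - c m\<bar>) < e"
      using c(1) d(1) by (intro exI[of _ "\<lambda>m. c m + d m"] conjI) (auto intro: continuous_intros)
  qed
next
  case (lim f s)
  show ?case
  proof (intro allI impI)
    fix e :: real assume e: "e > 0"
    have "(\<lambda>i. LINT m|surf. \<bar>f m - s i m\<bar>) \<longlonglongrightarrow> (LINT m|surf. 0)"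
    proof (rule integral_dominated_convergence[where w="\<lambda>m. 3 * \<bar>f m\<bar>"])
      show "AE m in surf. (\<lambda>i. \<bar>f m - s i m\<bar>) \<longlonglongrightarrow> 0"
      proof (rule AE_I2)
        fix m assume "m \<in> space surf"
        then have "(\<lambda>i. \<bar>f m - s i m\<bar>) \<longlonglongrightarrow> \<bar>f m - f m\<bar>" by (intro tendsto_intros lim.hyps(2))
        then show "(\<lambda>i. \<bar>f m - s i m\<bar>) \<longlonglongrightarrow> 0" by simp
      qed
      show "AE m in surf. norm \<bar>f m - s i m\<bar> \<le> 3 * \<bar>f m\<bar>" for i
      proof (rule AE_I2)
        fix m assume "m \<in> space surf"
        then show "norm \<bar>f m - s i m\<bar> \<le> 3 * \<bar>f m\<bar>" using lim.hyps(3)[of m i] by auto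
      qed
    qed (use lim in auto)
    then have "\<forall>\<^sub>F i in sequentially. (LINT m|surf. \<bar>f m - s i m\<bar>) < e / 2"
      using e by (intro order_tendstoD) auto
    then obtain i where i: "(LINT m|surf. \<bar>f m - s i m\<bar>) < e / 2" using eventually_happens' by fastforce
    obtain c where c: "continuous_on UNIV c" "(LINT m|surf. \<bar>s i m - c m\<bar>) < e / 2" using lim.IH e half_gt_zero by blast
    have ic: "integrable surf c" using c(1) by (auto intro!: integrable_surf_continuous intro: continuous_on_subset)
    have "(LINT m|surf. \<bar>f m - c m\<bar>) \<le> (LINT m|surf. \<bar>f m - s i m\<bar> + \<bar>s i m - c m\<bar>)"
      using lim ic by (intro integral_mono) auto
    also have "\<dots> = (LINT m|surf. \<bar>f m - s i m\<bar>) + (LINT m|surf. \<bar>s i m - c m\<bar>)" using lim ic by simp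
    also have "\<dots> < e" using i c by simp
    finally show "\<exists>c. continuous_on UNIV c \<and> (LINT m|surf. \<bar>f m - c m\<bar>) < e" using c(1) by blast
  qed
qed

lemma l2norm_le_bounded:
  assumes "L2 f" "\<And>m. norm m = 1 \<Longrightarrow> norm (f m) \<le> K" "K \<ge> 0" shows "l2norm f \<le> K * sqrt area"
  using L2_bound(2)[OF L2_measurable[OF assms(1)] L2_const[of "1::real"], of K] assms by (simp add: l2norm_const)

lemma L2_truncate_approx:
  fixes f :: "real^3 \<Rightarrow> real"
  assumes f: "L2 f" and e: "e > 0"
  shows "\<exists>K>0. l2norm (\<lambda>m. f m - max (-K) (min K (f m))) < e"
proof -
  have [measurable]: "f \<in> borel_measurable surf" using f by (rule L2_measurable)
  define d where "d k m = (norm (f m - max (- real (Suc k)) (min (real (Suc k)) (f m))))\<^sup>2" for k m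
  have bd: "d k m \<le> (norm (f m))\<^sup>2" for k m unfolding d_def by (intro power_mono) auto
  have "(\<lambda>k. LINT m|surf. d k m) \<longlonglongrightarrow> (LINT m|surf. 0)"
  proof (rule integral_dominated_convergence[where w="\<lambda>m. (norm (f m))\<^sup>2"])
    show "AE m in surf. (\<lambda>k. d k m) \<longlonglongrightarrow> 0"
    proof (rule AE_I2)
      fix m :: "real^3"
      obtain N :: nat where N: "\<bar>f m\<bar> \<le> real N" using real_arch_simple by blast
      have "\<forall>\<^sub>F k in sequentially. d k m = 0"
        using N by (intro eventually_sequentiallyI[of N]) (auto simp: d_def)
      then show "(\<lambda>k. d k m) \<longlonglongrightarrow> 0" by (rule tendsto_eventually)
    qed
    show "AE m in surf. norm (d k m) \<le> (norm (f m))\<^sup>2" for k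
      using bd by (intro AE_I2) (simp add: d_def)
    show "d k \<in> borel_measurable surf" for k unfolding d_def by measurable
  qed (use f in \<open>auto simp: L2_def\<close>)
  then have "(\<lambda>k. sqrt (LINT m|surf. d k m)) \<longlonglongrightarrow> sqrt 0" by (intro tendsto_intros) simp
  then have "\<forall>\<^sub>F k in sequentially. sqrt (LINT m|surf. d k m) < e"
    using e by (intro order_tendstoD) auto
  then obtain k where "sqrt (LINT m|surf. d k m) < e" using eventually_happens' by fastforce
  then show ?thesis by (intro exI[of _ "real (Suc k)"]) (simp add: l2norm_def d_def)
qed

lemma L2_continuous_approx:
  fixes f :: "real^3 \<Rightarrow> real"
  assumes f: "L2 f" and e: "e > 0"
  shows "\<exists>c :: real^3 \<Rightarrow> real. continuous_on UNIV c \<and> l2norm (\<lambda>m. f m - c m) < e"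
proof -
  obtain K where K: "K > 0" "l2norm (\<lambda>m. f m - max (-K) (min K (f m))) < e / 2"
    using L2_truncate_approx[OF f, of "e / 2"] e by auto
  define t where "t y = max (-K) (min K y)" for y
  have [measurable]: "f \<in> borel_measurable surf" using f by (rule L2_measurable)
  obtain c :: "real^3 \<Rightarrow> real" where c: "continuous_on UNIV c" "(LINT m|surf. \<bar>f m - c m\<bar>) < e\<^sup>2 / (8 * K)"
    using L1_continuous_approx[OF L2_integrable[OF f]] e K by (meson divide_pos_pos mult_pos_pos zero_less_numeral zero_less_power)
  have ct: "continuous_on UNIV (\<lambda>m. t (c m))" unfolding t_def using c(1) by (intro continuous_intros)
  have ic: "integrable surf c" using c(1) by (auto intro!: integrable_surf_continuous intro: continuous_on_subset)
  have Lc: "L2 (\<lambda>m. t (c m))" using ct by (auto intro!: L2_continuous intro: continuous_on_subset)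
  have Lf: "L2 (\<lambda>m. t (f m))"
  proof (rule L2_bound(1)[OF _ f, where c=1])
    show "(\<lambda>m. t (f m)) \<in> borel_measurable surf" unfolding t_def by measurable
    show "norm (t (f m)) \<le> 1 * norm (f m)" for m using K by (simp add: t_def max_def min_def)
  qed
  have "(l2norm (\<lambda>m. t (f m) - t (c m)))\<^sup>2 \<le> (LINT m|surf. 2 * K * \<bar>f m - c m\<bar>)"
    unfolding l2norm_power2
  proof (rule integral_mono)
    show "integrable surf (\<lambda>m. (norm (t (f m) - t (c m)))\<^sup>2)" using L2_diff[OF Lf Lc] by (simp add: L2_def)
    fix m
    have "\<bar>t (f m) - t (c m)\<bar> \<le> \<bar>f m - c m\<bar>" "\<bar>t (f m) - t (c m)\<bar> \<le> 2 * K" using K by (auto simp: t_def)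
    then have "\<bar>t (f m) - t (c m)\<bar> * \<bar>t (f m) - t (c m)\<bar> \<le> 2 * K * \<bar>f m - c m\<bar>" by (intro mult_mono) auto
    then show "(norm (t (f m) - t (c m)))\<^sup>2 \<le> 2 * K * \<bar>f m - c m\<bar>" by (simp add: power2_eq_square)
  qed (use L2_integrable[OF f] ic in auto)
  also have "\<dots> = 2 * K * (LINT m|surf. \<bar>f m - c m\<bar>)" by simp
  also have "\<dots> < 2 * K * (e\<^sup>2 / (8 * K))" using c(2) K by (intro mult_strict_left_mono) auto
  also have "\<dots> = (e / 2)\<^sup>2" using K by (simp add: power2_eq_square)
  finally have "l2norm (\<lambda>m. t (f m) - t (c m)) < e / 2" using e power_less_imp_less_base[of _ 2 "e / 2"] by simp
  then have "l2norm (\<lambda>m. f m - t (c m)) < e"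
    using l2norm_diff_triangle[OF f Lf Lc] K(2) unfolding t_def by linarith
  then show ?thesis using ct by blast
qed

text \<open>Convergence for continuous functions extends to all of \<open>L\<^sup>2\<close> by density and contractivity.\<close>

lemma smoothing_tendsto:
  assumes u: "L2 u" shows "(\<lambda>n. l2norm (\<lambda>m. smoothing n u m - u m)) \<longlonglongrightarrow> 0"
proof (rule tendstoI)
  fix e :: real assume e: "e > 0"
  obtain c :: "real^3 \<Rightarrow> real" where c: "continuous_on UNIV c" "l2norm (\<lambda>m. u m - c m) < e / 4"
    using L2_continuous_approx[OF u, of "e / 4"] e by auto
  have cS: "continuous_on S2 c" using c(1) continuous_on_subset by blast
  have Lc: "L2 c" using cS by (rule L2_continuous)
  have Lk: "L2 (smoothing n w)" if "L2 w" for w n using L2_smooth[OF sphere_smooth_smoothing[OF L2_integrable[OF that]]] .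
  define d where "d = e / 4 / (sqrt area + 1)"
  have d: "d > 0" "d * sqrt area \<le> e / 4" using e area_pos by (auto simp: d_def field_simps add_pos_pos)
  have "\<forall>\<^sub>F n in sequentially. \<forall>m. norm m = 1 \<longrightarrow> \<bar>smoothing n c m - c m\<bar> \<le> d"
    by (rule smoothing_uniform[OF cS d(1)])
  then show "\<forall>\<^sub>F n in sequentially. dist (l2norm (\<lambda>m. smoothing n u m - u m)) 0 < e"
  proof eventually_elim
    fix n assume n: "\<forall>m. norm m = 1 \<longrightarrow> \<bar>smoothing n c m - c m\<bar> \<le> d"
    have 1: "l2norm (\<lambda>m. smoothing n c m - c m) \<le> d * sqrt area"
      using n d by (intro l2norm_le_bounded L2_diff Lk Lc) auto
    have "l2norm (\<lambda>m. smoothing n u m - smoothing n c m) = l2norm (smoothing n (\<lambda>m. u m - c m))"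
      using smoothing_diff[OF L2_integrable[OF u] L2_integrable[OF Lc]] by presburger
    also have "\<dots> \<le> l2norm (\<lambda>m. u m - c m)" by (rule smoothing_contraction[OF L2_diff[OF u Lc]])
    finally have 2: "l2norm (\<lambda>m. smoothing n u m - smoothing n c m) \<le> l2norm (\<lambda>m. u m - c m)" .
    have "l2norm (\<lambda>m. smoothing n u m - u m) \<le> l2norm (\<lambda>m. smoothing n u m - smoothing n c m) + l2norm (\<lambda>m. smoothing n c m - u m)"
      by (intro l2norm_diff_triangle Lk u Lc)
    also have "l2norm (\<lambda>m. smoothing n c m - u m) \<le> l2norm (\<lambda>m. smoothing n c m - c m) + l2norm (\<lambda>m. c m - u m)"
      by (intro l2norm_diff_triangle Lk u Lc)
    finally show "dist (l2norm (\<lambda>m. smoothing n u m - u m)) 0 < e"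
      using 1 2 c(2) d(2) e l2norm_diff_commute[of c u] by simp
  qed
qed

lemma smoothing_pairing_tendsto:
  assumes u: "L2 u" and v: "L2 v" shows "(\<lambda>n. LINT m|surf. v m * smoothing n u m) \<longlonglongrightarrow> (LINT m|surf. v m * u m)"
proof -
  have Lk: "L2 (smoothing n u)" for n by (intro L2_smooth sphere_smooth_smoothing L2_integrable u)
  have "(\<lambda>n. (LINT m|surf. v m * smoothing n u m) - (LINT m|surf. v m * u m)) \<longlonglongrightarrow> 0"
  proof (rule Lim_null_comparison)
    show "\<forall>\<^sub>F n in sequentially. norm ((LINT m|surf. v m * smoothing n u m) - (LINT m|surf. v m * u m))
        \<le> l2norm v * l2norm (\<lambda>m. smoothing n u m - u m)"
    proof (rule always_eventually, rule allI)
      fix n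
      have "(LINT m|surf. v m * smoothing n u m) - (LINT m|surf. v m * u m) = (LINT m|surf. v m * (smoothing n u m - u m))"
        using L2_mult_integrable[OF v Lk] L2_mult_integrable[OF v u] by (simp add: right_diff_distrib)
      then show "norm ((LINT m|surf. v m * smoothing n u m) - (LINT m|surf. v m * u m)) \<le> l2norm v * l2norm (\<lambda>m. smoothing n u m - u m)"
        using L2_Cauchy_Schwarz_real[OF v L2_diff[OF Lk u]] by simp
    qed
    show "(\<lambda>n. l2norm v * l2norm (\<lambda>m. smoothing n u m - u m)) \<longlonglongrightarrow> 0"
      using tendsto_mult_right_zero[OF smoothing_tendsto[OF u]] .
  qed
  then show ?thesis by (simp add: LIM_zero_iff)
qed

subsection \<open>The Poincare inequality\<close>

lemma smoothing_0: "norm m = 1 \<Longrightarrow> smoothing 0 u m = (LINT m|surf. u m) / area"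
  by (simp add: smoothing_def bump_def)

text \<open>The recursion for the Laplacian turns the difference of consecutive smoothings into a smoothing of the gradient, which is a
  contraction.\<close>

lemma smoothing_step:
  assumes \<psi>: "sphere_smooth \<psi>"
  shows "(LINT m|surf. \<psi> m * smoothing (Suc n) \<psi> m) - (LINT m|surf. \<psi> m * smoothing n \<psi> m)
    \<le> (l2norm (rgrad \<psi>))\<^sup>2 / (real (Suc n) * real (Suc (Suc n)))"
proof -
  let ?N = "real (Suc n) * real (Suc (Suc n))"
  let ?D = "\<lambda>i m. rgrad \<psi> m $ i"
  note L\<psi> = L2_smooth[OF \<psi>] and LD = L2_rgrad_component[OF \<psi>]
  note i\<psi> = L2_integrable[OF L\<psi>] and iD = L2_integrable[OF LD]
  have sm: "sphere_smooth (smoothing k w)" if "L2 w" for k w by (intro sphere_smooth_smoothing L2_integrable that)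
  have pt: "?N * (smoothing (Suc n) \<psi> m - smoothing n \<psi> m) = (\<Sum>i\<in>UNIV. - rgrad (smoothing (Suc n) (?D i)) m $ i)"
    if m: "norm m = 1" for m
  proof -
    have "?N * (smoothing n \<psi> m - smoothing (Suc n) \<psi> m) = (LINT m'|surf. ?N * (bump n m' m - bump (Suc n) m' m) * \<psi> m')"
      unfolding smoothing_def using bump_mult_integrable[OF i\<psi>, of _ m]
      by (simp add: bump_commute[of _ _ m] left_diff_distrib right_diff_distrib mult.assoc)
    also have "\<dots> = (LINT m'|surf. rdiv (rgrad (\<lambda>x. bump (Suc n) x m)) m' * \<psi> m')"
      using m by (intro LINT_cong_S2) (simp only: laplacian_bump)
    also have "\<dots> = - (LINT m'|surf. rgrad (\<lambda>x. bump (Suc n) x m) m' \<bullet> rgrad \<psi> m')"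
      by (intro LINT_rdiv_by_parts sphere_smooth_rgrad sphere_smooth_bump \<psi>)
    also have "\<dots> = (LINT m'|surf. rgrad (\<lambda>x. bump (Suc n) x m') m \<bullet> rgrad \<psi> m')"
      unfolding integral_minus[symmetric]
      by (intro LINT_cong_S2) (simp only: bump_flip rgrad_bump_swap[OF m] inner_minus_left minus_minus)
    also have "\<dots> = (\<Sum>i\<in>UNIV. LINT m'|surf. rgrad (\<lambda>x. bump (Suc n) x m') m $ i * ?D i m')"
    proof -
      have "integrable surf (\<lambda>m'. rgrad (\<lambda>x. bump (Suc n) x m') m $ i * ?D i m')" for i
      proof -
        have "integrable surf (\<lambda>m'. rgrad (bump (Suc n) m) m' $ i * ?D i m')"
          using sphere_smooth_bump[of "Suc n" m] by (intro L2_mult_integrable LD L2_rgrad_component) (simp add: bump_flip)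
        then have "integrable surf (\<lambda>m'. - (rgrad (bump (Suc n) m) m' $ i * ?D i m'))" by simp
        also have "?this \<longleftrightarrow> ?thesis" by (intro integrable_cong_S2) (simp only: bump_flip rgrad_bump_swap[OF m] vector_uminus_component mult_minus_left minus_minus)
        finally show ?thesis .
      qed
      then show ?thesis unfolding inner_vec_def by simp
    qed
    also have "\<dots> = (\<Sum>i\<in>UNIV. rgrad (smoothing (Suc n) (?D i)) m $ i)"
      by (intro sum.cong refl rgrad_smoothing_kernel[symmetric] iD m)
    finally show ?thesis by (simp add: sum_negf algebra_simps)
  qed
  have "?N * ((LINT m|surf. \<psi> m * smoothing (Suc n) \<psi> m) - (LINT m|surf. \<psi> m * smoothing n \<psi> m))
     = (LINT m|surf. \<psi> m * (?N * (smoothing (Suc n) \<psi> m - smoothing n \<psi> m)))"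
  proof -
    have "\<psi> m * (c * (smoothing (Suc n) \<psi> m - smoothing n \<psi> m))
        = c * (\<psi> m * smoothing (Suc n) \<psi> m - \<psi> m * smoothing n \<psi> m)" for c m by (simp add: algebra_simps)
    then show ?thesis using L2_mult_integrable[OF L\<psi> L2_smooth[OF sm[OF L\<psi>]]] by (simp only:) simp
  qed
  also have "\<dots> = (LINT m|surf. (\<Sum>i\<in>UNIV. - (\<psi> m * rgrad (smoothing (Suc n) (?D i)) m $ i)))"
    by (intro LINT_cong_S2) (simp only: pt sum_distrib_left mult_minus_right)
  also have "\<dots> = (\<Sum>i\<in>UNIV. - (LINT m|surf. \<psi> m * rgrad (smoothing (Suc n) (?D i)) m $ i))"
    using L2_mult_integrable[OF L\<psi> L2_rgrad_component[OF sm[OF LD]]] by simp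
  also have "\<dots> = (\<Sum>i\<in>UNIV. LINT m|surf. ?D i m * smoothing (Suc n) (?D i) m)"
    by (simp add: LINT_by_parts[OF \<psi> sm[OF LD]])
  also have "\<dots> \<le> (\<Sum>i\<in>UNIV. ((l2norm (?D i))\<^sup>2 + (l2norm (?D i))\<^sup>2) / 2)"
    by (intro sum_mono smoothing_young LD)
  also have "\<dots> = (LINT m|surf. (\<Sum>i\<in>UNIV. (?D i m)\<^sup>2))"
  proof -
    have "integrable surf (\<lambda>m. (?D i m)\<^sup>2)" for i using LD[of i] by (simp add: L2_def)
    then show ?thesis by (simp add: l2norm_power2)
  qed
  also have "\<dots> = (l2norm (rgrad \<psi>))\<^sup>2"
    unfolding l2norm_power2 power2_norm_eq_inner inner_vec_def by (simp add: power2_eq_square)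
  finally have le: "?N * ((LINT m|surf. \<psi> m * smoothing (Suc n) \<psi> m) - (LINT m|surf. \<psi> m * smoothing n \<psi> m))
     \<le> (l2norm (rgrad \<psi>))\<^sup>2" .
  have N: "?N > 0" by (intro mult_pos_pos) auto
  show ?thesis using le unfolding pos_le_divide_eq[OF N] by (simp only: mult.commute)
qed

text \<open>The smoothings interpolate between the mean (\<open>n = 0\<close>) and the function itself (\<open>n \<rightarrow> \<infinity>\<close>).  The increments of the quadratic form
  are at most \<open>1/((n+1)(n+2))\<close> times the squared norm of the gradient, and these factors sum to 1.\<close>

lemma poincare:
  assumes \<psi>: "sphere_smooth \<psi>"
  shows "l2norm (\<lambda>m. \<psi> m - (LINT m|surf. \<psi> m) / area) \<le> l2norm (rgrad \<psi>)"
proof -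
  let ?D = "(l2norm (rgrad \<psi>))\<^sup>2" and ?I = "LINT m|surf. \<psi> m"
  define b where "b n = (LINT m|surf. \<psi> m * smoothing n \<psi> m)" for n
  note L = L2_smooth[OF \<psi>]
  have step: "b n \<le> b 0 + (1 - 1 / real (Suc n)) * ?D" for n
  proof (induction n)
    case (Suc n)
    have "b (Suc n) \<le> b n + ?D / (real (Suc n) * real (Suc (Suc n)))" using smoothing_step[OF \<psi>, of n] by (simp add: b_def)
    also have "\<dots> \<le> b 0 + ((1 - 1 / real (Suc n)) + 1 / (real (Suc n) * real (Suc (Suc n)))) * ?D"
      using Suc.IH by (simp add: algebra_simps)
    also have "(1 - 1 / real (Suc n)) + 1 / (real (Suc n) * real (Suc (Suc n))) = 1 - 1 / real (Suc (Suc n))"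
    proof -
      have "(1 - 1 / x) + 1 / (x * (x + 1)) = 1 - 1 / (x + 1)" if "x > 0" for x :: real
      proof -
        have "1 / x - 1 / (x + 1) = 1 / (x * (x + 1))" using that by (subst diff_frac_eq) auto
        then show ?thesis by linarith
      qed
      from this[of "real (Suc n)"] show ?thesis by (simp add: add.commute)
    qed
    finally show ?case .
  qed simp
  have "(1 - 1 / real (Suc n)) * ?D \<le> 1 * ?D" for n by (intro mult_right_mono) auto
  then have bb: "b n \<le> b 0 + ?D" for n using step[of n] by (smt (verit))
  have "b \<longlonglongrightarrow> (LINT m|surf. \<psi> m * \<psi> m)" unfolding b_def by (rule smoothing_pairing_tendsto[OF L L])
  then have 1: "(LINT m|surf. \<psi> m * \<psi> m) \<le> b 0 + ?D" using bb by (intro LIMSEQ_le_const2) auto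
  have "b 0 = (LINT m|surf. \<psi> m * (?I / area))"
    unfolding b_def by (intro LINT_cong_S2) (simp add: smoothing_0)
  then have 2: "b 0 = ?I\<^sup>2 / area" by (simp add: power2_eq_square)
  have "(l2norm (\<lambda>m. \<psi> m - ?I / area))\<^sup>2 = (LINT m|surf. \<psi> m * \<psi> m - 2 * (?I / area) * \<psi> m + (?I / area)\<^sup>2)"
  proof -
    have "(norm (\<psi> m - a))\<^sup>2 = \<psi> m * \<psi> m - 2 * a * \<psi> m + a\<^sup>2" for a m
      by (simp add: power2_eq_square algebra_simps)
    then show ?thesis unfolding l2norm_power2 by (simp only:)
  qed
  also have "\<dots> = (LINT m|surf. \<psi> m * \<psi> m) - 2 * (?I / area) * ?I + area * (?I / area)\<^sup>2"
    using L2_mult_integrable[OF L L] L2_integrable[OF L] by simp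
  also have "\<dots> = (LINT m|surf. \<psi> m * \<psi> m) - ?I\<^sup>2 / area"
    using area_pos by (simp add: power2_eq_square)
  finally have "(l2norm (\<lambda>m. \<psi> m - ?I / area))\<^sup>2 \<le> (l2norm (rgrad \<psi>))\<^sup>2" using 1 2 by simp
  then show ?thesis by (rule power2_le_imp_le) simp
qed

section \<open>Sobolev spaces\<close>

lemma l2norm_cong_AE:
  assumes "AE m in surf. f m = g m" "f \<in> borel_measurable surf" "g \<in> borel_measurable surf"
  shows "l2norm f = l2norm g"
proof -
  have "(LINT m|surf. (norm (f m))\<^sup>2) = (LINT m|surf. (norm (g m))\<^sup>2)"
    using assms by (intro integral_cong_AE) auto
  then show ?thesis by (simp add: l2norm_def)
qed

lemma l2norm_vec_power2:
  fixes F :: "real^3 \<Rightarrow> real^3"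
  assumes "L2 F" shows "(l2norm F)\<^sup>2 = (\<Sum>i\<in>UNIV. (l2norm (\<lambda>m. F m $ i))\<^sup>2)"
proof -
  have i: "integrable surf (\<lambda>m. (F m $ i)\<^sup>2)" for i
    using assms[unfolded L2_vec_iff] by (simp add: L2_def)
  have "(l2norm F)\<^sup>2 = (LINT m|surf. (\<Sum>i\<in>UNIV. (F m $ i)\<^sup>2))"
    unfolding l2norm_power2 power2_norm_eq_inner inner_vec_def by (simp add: power2_eq_square)
  then show ?thesis using i by (simp add: l2norm_power2)
qed

lemma has_weak_rgrad_L2: "has_weak_rgrad u G \<Longrightarrow> L2 G"
  by (simp add: has_weak_rgrad_def sphere_L2_iff L2_vec_iff)

text \<open>By the commutation of smoothing and \<open>\<R>\<close>, two weak gradients have the same smoothings, and these converge to both.\<close>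

lemma has_weak_rgrad_unique:
  assumes u: "L2 u" and G: "has_weak_rgrad u G" and G': "has_weak_rgrad u G'"
  shows "AE m in surf. G m = G' m"
proof -
  have L: "L2 (\<lambda>m. G m $ i)" "L2 (\<lambda>m. G' m $ i)" for i
    using has_weak_rgrad_L2[OF G] has_weak_rgrad_L2[OF G'] by (simp_all add: L2_vec_iff)
  have "AE m in surf. G m $ i = G' m $ i" for i
  proof -
    have Ls: "L2 (smoothing n (\<lambda>m. G m $ i))" for n
      by (intro L2_smooth sphere_smooth_smoothing L2_integrable L)
    have "l2norm (\<lambda>m. G m $ i - G' m $ i) \<le> l2norm (\<lambda>m. smoothing n (\<lambda>m. G m $ i) m - G m $ i) + l2norm (\<lambda>m. smoothing n (\<lambda>m. G' m $ i) m - G' m $ i)" for n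
    proof -
      have eq: "l2norm (\<lambda>m. smoothing n (\<lambda>m. G m $ i) m - G' m $ i) = l2norm (\<lambda>m. smoothing n (\<lambda>m. G' m $ i) m - G' m $ i)"
        by (rule l2norm_cong_S2) (simp add: rgrad_smoothing[OF G u, symmetric] rgrad_smoothing[OF G' u, symmetric])
      show ?thesis
        using l2norm_diff_triangle[OF L(1)[of i] Ls L(2)[of i], of n]
        by (simp add: eq l2norm_diff_commute[of "\<lambda>m. G m $ i"])
    qed
    moreover have "(\<lambda>n. l2norm (\<lambda>m. smoothing n (\<lambda>m. G m $ i) m - G m $ i) + l2norm (\<lambda>m. smoothing n (\<lambda>m. G' m $ i) m - G' m $ i)) \<longlonglongrightarrow> 0 + 0"
      by (intro tendsto_add smoothing_tendsto L)
    ultimately have "l2norm (\<lambda>m. G m $ i - G' m $ i) \<le> 0 + 0"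
      by (intro LIMSEQ_le_const) auto
    then have "l2norm (\<lambda>m. G m $ i - G' m $ i) = 0" using l2norm_nonneg[of "\<lambda>m. G m $ i - G' m $ i"] by simp
    from l2norm_eq_0[OF L2_diff[OF L] this] show ?thesis by simp
  qed
  then have "AE m in surf. \<forall>i. G m $ i = G' m $ i" by (subst AE_all_countable) auto
  then show ?thesis by (simp add: vec_eq_iff)
qed

lemma has_weak_rgrad_l2norm_unique:
  assumes "L2 u" "has_weak_rgrad u G" "has_weak_rgrad u G'" shows "l2norm G = l2norm G'"
  using assms has_weak_rgrad_unique[OF assms] by (intro l2norm_cong_AE) (auto dest!: has_weak_rgrad_L2 L2_measurable)

lemma sphere_H1_L2: "sphere_H1 u \<Longrightarrow> L2 u"
  by (simp add: sphere_H1_def sphere_L2_iff)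

lemma sphere_H1_weak: "sphere_H1 u \<Longrightarrow> has_weak_rgrad u (weak_rgrad u)"
  unfolding sphere_H1_def weak_rgrad_def by (metis someI_ex)

lemma sphere_H1I: "L2 u \<Longrightarrow> has_weak_rgrad u G \<Longrightarrow> sphere_H1 u"
  by (auto simp: sphere_H1_def sphere_L2_iff)

lemma L2_weak_rgrad: "sphere_H1 u \<Longrightarrow> L2 (weak_rgrad u)"
  using sphere_H1_weak has_weak_rgrad_L2 by blast

lemma sphere_H1_norm_power2:
  assumes "L2 u" "has_weak_rgrad u G" shows "(sphere_H1_norm u)\<^sup>2 = (l2norm u)\<^sup>2 + (l2norm G)\<^sup>2"
proof -
  have H: "sphere_H1 u" using assms by (rule sphere_H1I)
  have "l2norm (weak_rgrad u) = l2norm G"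
    by (rule has_weak_rgrad_l2norm_unique[OF assms(1) sphere_H1_weak[OF H] assms(2)])
  then have "(LINT m|surf. (norm (weak_rgrad u m))\<^sup>2) = (l2norm G)\<^sup>2" by (simp add: l2norm_power2[symmetric])
  moreover have "(LINT m|surf. (u m)\<^sup>2) = (l2norm u)\<^sup>2" by (simp add: l2norm_power2)
  ultimately show ?thesis by (simp add: sphere_H1_norm_def)
qed

lemma sphere_H1_norm_nonneg: "L2 u \<Longrightarrow> has_weak_rgrad u G \<Longrightarrow> sphere_H1_norm u \<ge> 0"
  unfolding sphere_H1_norm_def by (intro real_sqrt_ge_zero add_nonneg_nonneg integral_nonneg_AE) auto

lemma l2norm_le_H1:
  assumes "L2 u" "has_weak_rgrad u G" shows "l2norm u \<le> sphere_H1_norm u" "l2norm G \<le> sphere_H1_norm u"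
  using sphere_H1_norm_power2[OF assms] sphere_H1_norm_nonneg[OF assms]
  by (auto intro!: power2_le_imp_le[of "l2norm _" "sphere_H1_norm u"])

lemma has_weak_rgrad_add:
  assumes "L2 u" "has_weak_rgrad u G" "L2 v" "has_weak_rgrad v H"
  shows "has_weak_rgrad (\<lambda>m. u m + v m) (\<lambda>m. G m + H m)"
  unfolding has_weak_rgrad_def sphere_L2_iff
proof (intro conjI allI impI)
  have L: "L2 (\<lambda>m. G m $ i)" "L2 (\<lambda>m. H m $ i)" for i
    using has_weak_rgrad_L2[OF assms(2)] has_weak_rgrad_L2[OF assms(4)] by (simp_all add: L2_vec_iff)
  show "L2 (\<lambda>m. (G m + H m) $ i)" for i using L2_add[OF L] by simp
  fix \<phi> i assume \<phi>: "sphere_smooth \<phi>"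
  note i = L2_mult_integrable[OF assms(1) L2_rgrad_component[OF \<phi>]] L2_mult_integrable[OF assms(3) L2_rgrad_component[OF \<phi>]]
    L2_mult_integrable[OF L(1) L2_smooth[OF \<phi>]] L2_mult_integrable[OF L(2) L2_smooth[OF \<phi>]]
  show "(LINT m|surf. (u m + v m) * rgrad \<phi> m $ i) = - (LINT m|surf. (G m + H m) $ i * \<phi> m)"
    using i assms(2,4) \<phi> by (simp add: distrib_right has_weak_rgrad_def)
qed

lemma L2_scaleR_continuous:
  fixes b :: "real^3 \<Rightarrow> real" and w :: "real^3 \<Rightarrow> 'b::euclidean_space"
  assumes w: "L2 w" and b: "continuous_on S2 b" shows "L2 (\<lambda>m. b m *\<^sub>R w m)"
proof -
  obtain K where K0: "K > 0" and K: "\<And>m. norm m = 1 \<Longrightarrow> norm (b m) \<le> K"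
    by (rule continuous_S2_bounded[OF b]) (rule that)
  show ?thesis
  proof (rule L2_bound(1)[OF _ w, where c=K])
    show "(\<lambda>m. b m *\<^sub>R w m) \<in> borel_measurable surf"
      using measurable_surf_continuous[OF b] L2_measurable[OF w] by simp
    show "norm (b m *\<^sub>R w m) \<le> K * norm (w m)" if "norm m = 1" for m
      using K[OF that] by (simp add: mult_right_mono)
  qed
qed

lemma L2_mult_continuous:
  fixes b w :: "real^3 \<Rightarrow> real"
  assumes "L2 w" and "continuous_on S2 b" shows "L2 (\<lambda>m. b m * w m)"
  using L2_scaleR_continuous[OF assms] by simp

lemma L2_scaleR_vec_continuous:
  fixes b :: "real^3 \<Rightarrow> real" and w :: "real^3 \<Rightarrow> 'b::euclidean_space"
  assumes b: "L2 b" and w: "continuous_on S2 w" shows "L2 (\<lambda>m. b m *\<^sub>R w m)"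
proof -
  obtain K where K0: "K > 0" and K: "\<And>m. norm m = 1 \<Longrightarrow> norm (w m) \<le> K"
    by (rule continuous_S2_bounded[OF w]) (rule that)
  show ?thesis
  proof (rule L2_bound(1)[OF _ b, where c=K])
    show "(\<lambda>m. b m *\<^sub>R w m) \<in> borel_measurable surf"
      using measurable_surf_continuous[OF w] L2_measurable[OF b] by simp
    show "norm (b m *\<^sub>R w m) \<le> K * norm (b m)" if "norm m = 1" for m
      using mult_left_mono[OF K[OF that], of "\<bar>b m\<bar>"] by (simp add: mult.commute)
  qed
qed

lemma has_weak_rgrad_mult:
  assumes u: "L2 u" and G: "has_weak_rgrad u G" and a: "sphere_smooth a"
  shows "has_weak_rgrad (\<lambda>m. a m * u m) (\<lambda>m. a m *\<^sub>R G m + u m *\<^sub>R rgrad a m)"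
  unfolding has_weak_rgrad_def sphere_L2_iff
proof (intro conjI allI impI)
  have L: "L2 (\<lambda>m. G m $ i)" for i using has_weak_rgrad_L2[OF G] by (simp add: L2_vec_iff)
  have Lm: "L2 (\<lambda>m. b m * w m)" if w: "L2 w" and b: "sphere_smooth b" for b w :: "real^3 \<Rightarrow> real"
    using w sphere_smooth_continuous[OF b] by (rule L2_mult_continuous)
  show "L2 (\<lambda>m. (a m *\<^sub>R G m + u m *\<^sub>R rgrad a m) $ i)" for i
    using L2_add[OF Lm[OF L[of i] a] Lm[OF u sphere_smooth_rgrad[OF a, of i]]] by (simp add: mult.commute)
  fix \<phi> i assume \<phi>: "sphere_smooth \<phi>"
  have "(LINT m|surf. a m * u m * rgrad \<phi> m $ i) = (LINT m|surf. u m * rgrad (\<lambda>x. a x * \<phi> x) m $ i - u m * (rgrad a m $ i * \<phi> m))"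
  proof (rule LINT_cong_S2)
    fix m :: "real^3" assume m: "norm m = 1"
    show "a m * u m * rgrad \<phi> m $ i = u m * rgrad (\<lambda>x. a x * \<phi> x) m $ i - u m * (rgrad a m $ i * \<phi> m)"
      unfolding rgrad_mult[OF a \<phi> m] by (simp add: algebra_simps)
  qed
  also have "\<dots> = (LINT m|surf. u m * rgrad (\<lambda>x. a x * \<phi> x) m $ i) - (LINT m|surf. u m * (rgrad a m $ i * \<phi> m))"
    by (intro Bochner_Integration.integral_diff L2_mult_integrable u L2_smooth sphere_smooth_mult sphere_smooth_rgrad a \<phi>)
  also have "(LINT m|surf. u m * rgrad (\<lambda>x. a x * \<phi> x) m $ i) = - (LINT m|surf. G m $ i * (a m * \<phi> m))"
    using G sphere_smooth_mult[OF a \<phi>] by (simp add: has_weak_rgrad_def)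
  also have "- (LINT m|surf. G m $ i * (a m * \<phi> m)) - (LINT m|surf. u m * (rgrad a m $ i * \<phi> m))
      = - ((LINT m|surf. G m $ i * (a m * \<phi> m)) + (LINT m|surf. u m * (rgrad a m $ i * \<phi> m)))" by simp
  also have "\<dots> = - (LINT m|surf. G m $ i * (a m * \<phi> m) + u m * (rgrad a m $ i * \<phi> m))"
    by (subst Bochner_Integration.integral_add) (auto intro!: L2_mult_integrable u L L2_smooth sphere_smooth_mult sphere_smooth_rgrad a \<phi>)
  also have "\<dots> = - (LINT m|surf. (a m *\<^sub>R G m + u m *\<^sub>R rgrad a m) $ i * \<phi> m)"
    by (simp add: algebra_simps)
  finally show "(LINT m|surf. a m * u m * rgrad \<phi> m $ i) = - (LINT m|surf. (a m *\<^sub>R G m + u m *\<^sub>R rgrad a m) $ i * \<phi> m)" .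
qed

lemma has_weak_rgrad_cong:
  assumes "has_weak_rgrad u G" "\<And>m. norm m = 1 \<Longrightarrow> u m = v m" "\<And>m. norm m = 1 \<Longrightarrow> G m = H m"
  shows "has_weak_rgrad v H"
proof -
  have "L2 G" using assms(1) by (rule has_weak_rgrad_L2)
  then have "L2 H" using L2_cong_S2[of G H] assms(3) by simp
  moreover have "(LINT m|surf. v m * rgrad \<phi> m $ i) = (LINT m|surf. u m * rgrad \<phi> m $ i)" for \<phi> i
    by (intro LINT_cong_S2) (simp add: assms)
  moreover have "(LINT m|surf. H m $ i * \<phi> m) = (LINT m|surf. G m $ i * \<phi> m)" for \<phi> i
    by (intro LINT_cong_S2) (simp add: assms)
  ultimately show ?thesis using assms(1) by (simp add: has_weak_rgrad_def sphere_L2_iff L2_vec_iff)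
qed

lemma has_weak_rgrad_cmult:
  assumes "L2 u" "has_weak_rgrad u G" shows "has_weak_rgrad (\<lambda>m. c * u m) (\<lambda>m. c *\<^sub>R G m)"
  by (rule has_weak_rgrad_cong[OF has_weak_rgrad_mult[OF assms sphere_smooth_const[of c]]]) (auto simp: rgrad_const)

lemma has_weak_rgrad_diff:
  assumes "L2 u" "has_weak_rgrad u G" "L2 v" "has_weak_rgrad v H"
  shows "has_weak_rgrad (\<lambda>m. u m - v m) (\<lambda>m. G m - H m)"
  using has_weak_rgrad_add[OF assms(1,2) L2_cmult[OF assms(3), of "-1"] has_weak_rgrad_cmult[OF assms(3,4), of "-1"]] by simp

subsection \<open>Smoothing of Sobolev functions\<close>

lemma sphere_smooth_smoothing_L2: "L2 u \<Longrightarrow> sphere_smooth (smoothing n u)"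
  by (intro sphere_smooth_smoothing L2_integrable)

lemma rgrad_smoothing_l2norm:
  assumes u: "L2 u" and G: "has_weak_rgrad u G" shows "l2norm (rgrad (smoothing n u)) \<le> l2norm G"
proof (rule power2_le_imp_le)
  have LG: "L2 (\<lambda>m. G m $ i)" for i using has_weak_rgrad_L2[OF G] by (simp add: L2_vec_iff)
  have "l2norm (\<lambda>m. rgrad (smoothing n u) m $ i) = l2norm (smoothing n (\<lambda>m. G m $ i))" for i
    by (intro l2norm_cong_S2 rgrad_smoothing[OF G u])
  then have "(l2norm (\<lambda>m. rgrad (smoothing n u) m $ i))\<^sup>2 \<le> (l2norm (\<lambda>m. G m $ i))\<^sup>2" for i
    using smoothing_contraction[OF LG] by (intro power_mono) auto
  then show "(l2norm (rgrad (smoothing n u)))\<^sup>2 \<le> (l2norm G)\<^sup>2"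
    unfolding l2norm_vec_power2[OF L2_rgrad[OF sphere_smooth_smoothing_L2[OF u]]] l2norm_vec_power2[OF has_weak_rgrad_L2[OF G]]
    by (intro sum_mono)
qed simp

lemma rgrad_smoothing_pairing_tendsto:
  assumes u: "L2 u" and G: "has_weak_rgrad u G" and V: "L2 V"
  shows "(\<lambda>n. LINT m|surf. V m \<bullet> rgrad (smoothing n u) m) \<longlonglongrightarrow> (LINT m|surf. V m \<bullet> G m)"
proof -
  have LG: "L2 (\<lambda>m. G m $ i)" for i using has_weak_rgrad_L2[OF G] by (simp add: L2_vec_iff)
  have LV: "L2 (\<lambda>m. V m $ i)" for i using V by (simp add: L2_vec_iff)
  have 1: "(LINT m|surf. V m \<bullet> rgrad (smoothing n u) m) = (\<Sum>i\<in>UNIV. LINT m|surf. V m $ i * smoothing n (\<lambda>m. G m $ i) m)" for n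
  proof -
    have "(LINT m|surf. V m \<bullet> rgrad (smoothing n u) m) = (LINT m|surf. (\<Sum>i\<in>UNIV. V m $ i * smoothing n (\<lambda>m. G m $ i) m))"
      by (intro LINT_cong_S2) (simp add: inner_vec_def rgrad_smoothing[OF G u])
    then show ?thesis using L2_mult_integrable[OF LV L2_smooth[OF sphere_smooth_smoothing_L2[OF LG]]] by simp
  qed
  have 2: "(LINT m|surf. V m \<bullet> G m) = (\<Sum>i\<in>UNIV. LINT m|surf. V m $ i * G m $ i)"
    unfolding inner_vec_def using L2_mult_integrable[OF LV LG] by simp
  show ?thesis unfolding 1 2 by (intro tendsto_sum smoothing_pairing_tendsto LG LV)
qed

subsection \<open>The negative norm\<close>

text \<open>Smooth test functions suffice: a test function in \<open>H\<^sup>1\<close> is the limit of its smoothings, whose gradients are bounded by its own.\<close>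

lemma sphere_Hm1_normI:
  assumes r: "L2 r" and c: "c \<ge> 0" and le: "\<And>\<phi>. sphere_smooth \<phi> \<Longrightarrow> \<bar>LINT m|surf. r m * \<phi> m\<bar> \<le> c * l2norm (rgrad \<phi>)"
  shows "sphere_Hm1_norm r \<le> ereal c"
proof -
  have "\<bar>LINT m|surf. r m * \<psi> m\<bar> \<le> c" if H: "sphere_H1 \<psi>" and n: "sphere_H1_norm \<psi> \<le> 1" for \<psi>
  proof -
    note L = sphere_H1_L2[OF H] and W = sphere_H1_weak[OF H]
    have "\<bar>LINT m|surf. r m * smoothing n \<psi> m\<bar> \<le> c" for n
    proof -
      have "\<bar>LINT m|surf. r m * smoothing n \<psi> m\<bar> \<le> c * l2norm (rgrad (smoothing n \<psi>))"
        by (intro le sphere_smooth_smoothing_L2 L)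
      also have "\<dots> \<le> c * 1"
        using rgrad_smoothing_l2norm[OF L W] l2norm_le_H1(2)[OF L W] n c by (intro mult_left_mono) (meson order_trans)+
      finally show ?thesis by simp
    qed
    moreover have "(\<lambda>n. \<bar>LINT m|surf. r m * smoothing n \<psi> m\<bar>) \<longlonglongrightarrow> \<bar>LINT m|surf. r m * \<psi> m\<bar>"
      by (intro tendsto_rabs smoothing_pairing_tendsto L r)
    ultimately show ?thesis by (intro LIMSEQ_le_const2) auto
  qed
  then show ?thesis unfolding sphere_Hm1_norm_def sphere_L2_iff using r by (auto intro!: SUP_least)
qed

text \<open>Since \<open>r\<close> has mean zero, the mean of the test function may be removed; then its \<open>H\<^sup>1\<close> norm is at most twice the norm of its gradient by the
  Poincare inequality.\<close>

lemma sphere_Hm1_normD: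
  assumes r: "sphere_Hm1_norm r \<le> ereal C" and mean: "(LINT m|surf. r m) = 0" and \<phi>: "sphere_smooth \<phi>"
  shows "\<bar>LINT m|surf. r m * \<phi> m\<bar> \<le> 2 * \<bar>C\<bar> * l2norm (rgrad \<phi>)"
proof -
  have L: "L2 r" using r unfolding sphere_Hm1_norm_def sphere_L2_iff by (auto split: if_splits)
  have sup: "\<bar>LINT m|surf. r m * \<psi> m\<bar> \<le> \<bar>C\<bar>" if "sphere_H1 \<psi>" "sphere_H1_norm \<psi> \<le> 1" for \<psi>
  proof -
    have "ereal \<bar>LINT m|surf. r m * \<psi> m\<bar> \<le> sphere_Hm1_norm r"
      unfolding sphere_Hm1_norm_def sphere_L2_iff using L that by (auto intro!: SUP_upper2[of \<psi>])
    then have "ereal \<bar>LINT m|surf. r m * \<psi> m\<bar> \<le> ereal C" using r by (rule order_trans)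
    then show ?thesis by simp
  qed
  define a where "a = (LINT m|surf. \<phi> m) / area"
  define \<psi> where "\<psi> m = \<phi> m - a" for m
  have s: "sphere_smooth \<psi>" unfolding \<psi>_def by (intro sphere_smooth_diff \<phi> sphere_smooth_const)
  note L\<psi> = L2_smooth[OF s] and W\<psi> = has_weak_rgrad_smooth[OF s]
  have R: "l2norm (rgrad \<psi>) = l2norm (rgrad \<phi>)"
    unfolding \<psi>_def by (intro l2norm_cong_S2) (simp add: rgrad_diff[OF \<phi> sphere_smooth_const] rgrad_const)
  have p: "l2norm \<psi> \<le> l2norm (rgrad \<phi>)" using poincare[OF \<phi>] by (simp add: \<psi>_def[abs_def] a_def)
  have eq: "(LINT m|surf. r m * \<phi> m) = (LINT m|surf. r m * \<psi> m)"
    unfolding \<psi>_def right_diff_distrib using L2_mult_integrable[OF L L2_smooth[OF \<phi>]] L2_integrable[OF L] mean by simp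
  show ?thesis
  proof (cases "l2norm (rgrad \<phi>) = 0")
    case True
    then have "l2norm \<psi> = 0" using p l2norm_nonneg[of \<psi>] by simp
    then show ?thesis using L2_Cauchy_Schwarz_real[OF L L\<psi>] True by (simp add: eq)
  next
    case False
    define k where "k = 2 * l2norm (rgrad \<phi>)"
    have k: "k > 0" using False l2norm_nonneg[of "rgrad \<phi>"] by (auto simp: k_def order_less_le)
    have "(sphere_H1_norm (\<lambda>m. (1/k) * \<psi> m))\<^sup>2 = ((1/k) * l2norm \<psi>)\<^sup>2 + ((1/k) * l2norm (rgrad \<psi>))\<^sup>2"
      using sphere_H1_norm_power2[OF L2_cmult[OF L\<psi>] has_weak_rgrad_cmult[OF L\<psi> W\<psi>], of "1/k"] k
      unfolding l2norm_cmult l2norm_scaleR by simp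
    also have "\<dots> \<le> (1/2)\<^sup>2 + (1/2)\<^sup>2"
      using p R k by (intro add_mono power_mono) (auto simp: k_def field_simps)
    also have "\<dots> \<le> 1\<^sup>2" by (simp add: power2_eq_square)
    finally have "sphere_H1_norm (\<lambda>m. (1/k) * \<psi> m) \<le> 1" by (rule power2_le_imp_le) simp
    then have "\<bar>LINT m|surf. r m * ((1/k) * \<psi> m)\<bar> \<le> \<bar>C\<bar>"
      by (intro sup sphere_H1I[OF L2_cmult[OF L\<psi>] has_weak_rgrad_cmult[OF L\<psi> W\<psi>]])
    moreover have "(LINT m|surf. r m * ((1/k) * \<psi> m)) = (1/k) * (LINT m|surf. r m * \<psi> m)"
      by (simp only: mult.left_commute[of _ "1/k"] integral_mult_right_zero)
    ultimately have "\<bar>LINT m|surf. r m * \<psi> m\<bar> / k \<le> \<bar>C\<bar>" using k by (simp add: abs_mult)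
    then show ?thesis unfolding eq using k by (simp add: k_def field_simps)
  qed
qed

section \<open>Inner variations\<close>

lemma DERIV_LINT:
  fixes F F' :: "real \<Rightarrow> real^3 \<Rightarrow> real"
  assumes d: "d > 0"
    and int: "\<And>t. \<bar>t - t0\<bar> < d \<Longrightarrow> integrable surf (F t)"
    and der: "\<And>t m. \<bar>t - t0\<bar> < d \<Longrightarrow> norm m = 1 \<Longrightarrow> ((\<lambda>t. F t m) has_real_derivative F' t m) (at t)"
    and bound: "\<And>t m. \<bar>t - t0\<bar> < d \<Longrightarrow> norm m = 1 \<Longrightarrow> \<bar>F' t m\<bar> \<le> g m"
    and g: "integrable surf g" and meas: "F' t0 \<in> borel_measurable surf"
  shows "((\<lambda>t. LINT m|surf. F t m) has_real_derivative (LINT m|surf. F' t0 m)) (at t0)"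
  unfolding has_field_derivative_iff tendsto_at_iff_sequentially comp_def
proof (intro allI impI)
  fix X assume X: "\<forall>i. X i \<in> UNIV - {t0}" "X \<longlonglongrightarrow> t0"
  then have "\<forall>\<^sub>F i in sequentially. dist (X i) t0 < d" using d by (intro tendstoD)
  then obtain N where N: "\<And>i. i \<ge> N \<Longrightarrow> \<bar>X i - t0\<bar> < d" by (auto simp: eventually_sequentially dist_real_def)
  define Y where "Y i = X (i + N)" for i
  have Y: "Y i \<noteq> t0" "\<bar>Y i - t0\<bar> < d" for i using X(1) N by (auto simp: Y_def)
  have Yl: "Y \<longlonglongrightarrow> t0" unfolding Y_def by (rule LIMSEQ_ignore_initial_segment[OF X(2)])
  have t0: "\<bar>t0 - t0\<bar> < d" using d by simp
  have "(\<lambda>i. LINT m|surf. (F (Y i) m - F t0 m) / (Y i - t0)) \<longlonglongrightarrow> (LINT m|surf. F' t0 m)"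
  proof (rule integral_dominated_convergence[OF meas _ g])
    show "(\<lambda>m. (F (Y i) m - F t0 m) / (Y i - t0)) \<in> borel_measurable surf" for i
      using int[OF Y(2)[of i]] int[OF t0] by auto
    show "AE m in surf. (\<lambda>i. (F (Y i) m - F t0 m) / (Y i - t0)) \<longlonglongrightarrow> F' t0 m"
    proof (rule AE_I2)
      fix m assume "m \<in> space surf"
      then have "((\<lambda>t. (F t m - F t0 m) / (t - t0)) \<longlongrightarrow> F' t0 m) (at t0)"
        using der[OF t0, of m] by (simp add: has_field_derivative_iff)
      then show "(\<lambda>i. (F (Y i) m - F t0 m) / (Y i - t0)) \<longlonglongrightarrow> F' t0 m"
        unfolding tendsto_at_iff_sequentially comp_def using Y Yl by simp
    qed
    show "AE m in surf. norm ((F (Y i) m - F t0 m) / (Y i - t0)) \<le> g m" for i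
    proof (rule AE_I2)
      fix m assume "m \<in> space surf" then have m: "norm m = 1" by simp
      have "norm (F (Y i) m - F t0 m) \<le> g m * norm (Y i - t0)"
      proof (rule field_differentiable_bound[where S="ball t0 d" and f'="\<lambda>t. F' t m"])
        show "((\<lambda>t. F t m) has_field_derivative F' t m) (at t within ball t0 d)" if "t \<in> ball t0 d" for t
          using der[of t m] that m by (intro DERIV_subset[OF der]) (auto simp: dist_real_def abs_minus_commute)
        show "norm (F' t m) \<le> g m" if "t \<in> ball t0 d" for t
          using bound[of t m] that m by (auto simp: dist_real_def abs_minus_commute)
      qed (use Y(2)[of i] d in \<open>auto simp: dist_real_def abs_minus_commute\<close>)
      then show "norm ((F (Y i) m - F t0 m) / (Y i - t0)) \<le> g m"
        using Y(1)[of i] by (simp add: norm_divide divide_le_eq)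
    qed
  qed
  then have "(\<lambda>i. ((LINT m|surf. F (Y i) m) - (LINT m|surf. F t0 m)) / (Y i - t0)) \<longlonglongrightarrow> (LINT m|surf. F' t0 m)"
    using int[OF Y(2)] int[OF t0] by simp
  then show "(\<lambda>i. ((LINT m|surf. F (X i) m) - (LINT m|surf. F t0 m)) / (X i - t0)) \<longlonglongrightarrow> (LINT m|surf. F' t0 m)"
    unfolding Y_def by (rule LIMSEQ_offset)
qed

lemma surface_grad_continuous:
  assumes "sphere_smooth f" shows "continuous_on (- {0}) (surface_grad f)"
  unfolding continuous_on_vec_iff
proof
  fix i
  have "smooth_on (- {0}) (\<lambda>x. frechet_derivative (\<lambda>y. f (sgn y)) (at x) (axis i 1))"
    using assms by (intro smooth_on_frechet) (simp add: sphere_smooth_def)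
  then show "continuous_on (- {0}) (\<lambda>x. surface_grad f x $ i)"
    by (simp add: surface_grad_def smooth_on_continuous)
qed

text \<open>The weighted Dirichlet integral.\<close>

definition energy :: "(real^3 \<Rightarrow> real) \<Rightarrow> (real^3 \<Rightarrow> real) \<Rightarrow> real" where
  "energy h \<phi> = (LINT m|surf. h m * (norm (rgrad \<phi> m))\<^sup>2)"

lemma stretch_ratio:
  fixes x :: real
  assumes "0 \<le> x" "x \<le> 1/2" shows "(1 + x) / (1 - x) \<le> exp (3 * x)"
proof -
  have "1 \<le> (1 - x) * (1 + 2 * x)" using mult_nonneg_nonneg[of x "1 - 2 * x"] assms by (simp add: algebra_simps)
  also have "\<dots> \<le> (1 - x) * exp (2 * x)" using assms exp_ge_add_one_self[of "2 * x"] by (intro mult_left_mono) auto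
  finally have "1 / (1 - x) \<le> exp (2 * x)" using assms by (simp add: field_simps)
  then have "(1 + x) * (1 / (1 - x)) \<le> exp x * exp (2 * x)" using assms exp_ge_add_one_self[of x] by (intro mult_mono) auto
  then show ?thesis by (simp add: exp_add[symmetric])
qed

text \<open>The family of maps \<open>1 + \<sigma> L\<close> and the maps \<open>X \<sigma>\<close> of the sphere that they induce.  The latter agree to first order in \<open>\<sigma>\<close> with the flow of
  the tangential part of \<open>L m\<close>, and linearity makes all distortions explicit.\<close>

locale perturbation =
  fixes L :: "real^3 \<Rightarrow> real^3" and \<beta> :: real
  assumes linL: "linear L" and \<beta>0: "\<beta> \<ge> 0" and boundL: "\<And>x. norm (L x) \<le> \<beta> * norm x"
begin

definition "M \<sigma> x = x + \<sigma> *\<^sub>R L x"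

abbreviation "X \<sigma> x \<equiv> sgn (M \<sigma> x)"

lemma linM: "linear (M \<sigma>)"
  unfolding M_def using linL by (auto intro!: linearI simp: linear_add linear_scale algebra_simps)

lemma M_dist: "norm (M \<sigma> x - x) \<le> \<bar>\<sigma>\<bar> * \<beta> * norm x"
  using mult_left_mono[OF boundL[of x], of "\<bar>\<sigma>\<bar>"] by (simp add: M_def mult.assoc)

lemma M_lower: "(1 - \<bar>\<sigma>\<bar> * \<beta>) * norm x \<le> norm (M \<sigma> x)"
  using M_dist[of \<sigma> x] norm_triangle_ineq2[of x "x - M \<sigma> x"] by (simp add: norm_minus_commute algebra_simps)

lemma M_upper: "norm (M \<sigma> x) \<le> (1 + \<bar>\<sigma>\<bar> * \<beta>) * norm x"
  using M_dist[of \<sigma> x] norm_triangle_ineq[of x "M \<sigma> x - x"] by (simp add: algebra_simps)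

lemma near: "\<bar>\<sigma>\<bar> * \<beta> \<le> 1/2 \<Longrightarrow> near_isometry (M \<sigma>) (1 - \<bar>\<sigma>\<bar> * \<beta>) (1 + \<bar>\<sigma>\<bar> * \<beta>)"
  by (simp add: near_isometry_def linM M_lower M_upper)

lemma q_le: "\<bar>\<sigma>\<bar> * \<beta> \<le> 1/2 \<Longrightarrow> near_isometry.q (1 - \<bar>\<sigma>\<bar> * \<beta>) (1 + \<bar>\<sigma>\<bar> * \<beta>) \<le> exp (9 * (\<bar>\<sigma>\<bar> * \<beta>))"
proof -
  assume s: "\<bar>\<sigma>\<bar> * \<beta> \<le> 1/2"
  have "((1 + \<bar>\<sigma>\<bar> * \<beta>) / (1 - \<bar>\<sigma>\<bar> * \<beta>)) ^ 3 \<le> exp (3 * (\<bar>\<sigma>\<bar> * \<beta>)) ^ 3"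
    using s \<beta>0 by (intro power_mono stretch_ratio) auto
  also have "\<dots> = exp (9 * (\<bar>\<sigma>\<bar> * \<beta>))" by (simp add: exp_of_nat_mult[symmetric])
  finally show ?thesis by (simp add: near_isometry.q_def[OF near[OF s]])
qed

lemma M_nonzero: "\<bar>\<sigma>\<bar> * \<beta> \<le> 1/2 \<Longrightarrow> x \<noteq> 0 \<Longrightarrow> M \<sigma> x \<noteq> 0"
  using near_isometry.M0[OF near] by blast

lemma M_norm_ge: "\<bar>\<sigma>\<bar> * \<beta> \<le> 1/2 \<Longrightarrow> norm m = 1 \<Longrightarrow> norm (M \<sigma> m) \<ge> 1/2"
  using M_lower[of \<sigma> m] by simp

lemma X_dist:
  assumes "norm m = 1" "M \<sigma> m \<noteq> 0" shows "norm (X \<sigma> m - m) \<le> 2 * (\<bar>\<sigma>\<bar> * \<beta>)"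
proof -
  have y: "norm (M \<sigma> m - m) \<le> \<bar>\<sigma>\<bar> * \<beta>" using M_dist[of \<sigma> m] assms by simp
  have "X \<sigma> m - M \<sigma> m = (1 - norm (M \<sigma> m)) *\<^sub>R X \<sigma> m" using assms(2) by (simp add: sgn_div_norm left_diff_distrib scaleR_diff_left)
  then have "norm (X \<sigma> m - M \<sigma> m) = \<bar>1 - norm (M \<sigma> m)\<bar>" using assms(2) by (simp add: norm_sgn)
  also have "\<dots> \<le> norm (M \<sigma> m - m)" using norm_triangle_ineq3[of "M \<sigma> m" m] assms(1) by (simp add: abs_minus_commute)
  finally show ?thesis using y norm_triangle_ineq[of "X \<sigma> m - M \<sigma> m" "M \<sigma> m - m"] by simp
qed

lemma comp_smooth:
  assumes "sphere_smooth \<phi>" "\<bar>\<sigma>\<bar> * \<beta> \<le> 1/2" shows "sphere_smooth (\<lambda>x. \<phi> (X \<sigma> x))"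
  using M_nonzero[OF assms(2)] by (intro sphere_smooth_comp_linear assms linM) auto

text \<open>By homogeneity \<open>\<phi> \<circ> X \<sigma>\<close> is the composition of the extension of \<open>\<phi>\<close> with the linear map \<open>1 + \<sigma> L\<close>, so the chain rule costs one
  factor \<open>1 + |\<sigma>| \<beta>\<close>, and the homogeneity of the gradient another \<open>1 / (1 - |\<sigma>| \<beta>)\<close>.\<close>

lemma norm_rgrad_comp:
  assumes \<phi>: "sphere_smooth \<phi>" and s: "\<bar>\<sigma>\<bar> * \<beta> \<le> 1/2" and m: "norm m = 1"
  shows "norm (rgrad (\<lambda>x. \<phi> (X \<sigma> x)) m) \<le> exp (3 * (\<bar>\<sigma>\<bar> * \<beta>)) * norm (rgrad \<phi> (X \<sigma> m))"
proof -
  let ?\<phi>' = "\<lambda>x. \<phi> (X \<sigma> x)" and ?x = "\<bar>\<sigma>\<bar> * \<beta>"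
  have m0: "m \<noteq> 0" using m by auto
  have y0: "M \<sigma> m \<noteq> 0" by (rule M_nonzero[OF s m0])
  have D: "Dhat ?\<phi>' m" by (rule Dhat_S2[OF comp_smooth[OF \<phi> s] m])
  have "(M \<sigma> has_derivative M \<sigma>) (at m)"
    by (intro bounded_linear_imp_has_derivative) (simp add: linM linear_linear)
  from diff_chain_at[OF this Dhat_has_derivative[OF sphere_smooth_Dhat[OF \<phi> y0]]]
  have "((\<lambda>x. \<phi> (X \<sigma> x)) has_derivative (\<lambda>v. surface_grad \<phi> (M \<sigma> m) \<bullet> M \<sigma> v)) (at m)" by (simp add: o_def)
  then have "((\<lambda>x. \<phi> (X \<sigma> (sgn x))) has_derivative (\<lambda>v. surface_grad \<phi> (M \<sigma> m) \<bullet> M \<sigma> v)) (at m)"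
  proof (rule has_derivative_transform_within_open[where s="- {0}"])
    fix x :: "real^3" assume x: "x \<in> - {0}"
    then show "\<phi> (X \<sigma> x) = \<phi> (X \<sigma> (sgn x))"
      using linM[of \<sigma>] by (simp add: sgn_div_norm linear_scale field_simps)
  qed (use m0 in auto)
  then have eq: "surface_grad ?\<phi>' m \<bullet> v = surface_grad \<phi> (M \<sigma> m) \<bullet> M \<sigma> v" for v
    using has_derivative_unique[OF _ Dhat_has_derivative[OF D]] by (metis (no_types, lifting))
  have le: "norm (surface_grad ?\<phi>' m) \<le> norm (surface_grad \<phi> (M \<sigma> m)) * (1 + ?x)"
  proof (cases "surface_grad ?\<phi>' m = 0")
    case False
    let ?v = "surface_grad ?\<phi>' m"
    have "norm ?v * norm ?v = ?v \<bullet> ?v" by (simp add: dot_square_norm power2_eq_square)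
    also have "\<dots> \<le> norm (surface_grad \<phi> (M \<sigma> m)) * norm (M \<sigma> ?v)" unfolding eq by (rule norm_cauchy_schwarz)
    also have "\<dots> \<le> norm (surface_grad \<phi> (M \<sigma> m)) * ((1 + ?x) * norm ?v)" by (intro mult_left_mono M_upper) auto
    finally show ?thesis using False by (simp add: mult.assoc[symmetric])
  qed (use \<beta>0 in auto)
  have x: "0 \<le> ?x" using \<beta>0 by simp
  have "norm (rgrad ?\<phi>' m) = norm (surface_grad ?\<phi>' m)" by (rule norm_rgrad[OF D m])
  also have "\<dots> \<le> norm (rgrad \<phi> (X \<sigma> m)) / norm (M \<sigma> m) * (1 + ?x)"
    using le by (simp add: norm_surface_grad[OF \<phi> y0])
  also have "\<dots> \<le> norm (rgrad \<phi> (X \<sigma> m)) / (1 - ?x) * (1 + ?x)"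
    using M_lower[of \<sigma> m] m s x by (intro mult_right_mono frac_le) auto
  also have "\<dots> = ((1 + ?x) / (1 - ?x)) * norm (rgrad \<phi> (X \<sigma> m))" by simp
  also have "\<dots> \<le> exp (3 * ?x) * norm (rgrad \<phi> (X \<sigma> m))"
    using s x by (intro mult_right_mono stretch_ratio) auto
  finally show ?thesis .
qed

text \<open>The exponent collects \<open>2 H\<close> from the change of the weight, \<open>6\<close> from the square of the gradient and \<open>9\<close> from the area distortion.\<close>

lemma energy_comp:
  assumes \<phi>: "sphere_smooth \<phi>" and s: "\<bar>\<sigma>\<bar> * \<beta> \<le> 1/2" and h: "continuous_on S2 h"
    and h0: "\<And>m. norm m = 1 \<Longrightarrow> h m \<ge> 0" and H: "H \<ge> 0"
    and hL: "\<And>m m'. norm m = 1 \<Longrightarrow> norm m' = 1 \<Longrightarrow> h m \<le> exp (H * norm (m - m')) * h m'"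
  shows "energy h (\<lambda>x. \<phi> (X \<sigma> x)) \<le> exp ((2 * H + 15) * (\<bar>\<sigma>\<bar> * \<beta>)) * energy h \<phi>"
proof -
  let ?x = "\<bar>\<sigma>\<bar> * \<beta>"
  interpret N: near_isometry "M \<sigma>" "1 - ?x" "1 + ?x" by (rule near[OF s])
  let ?g = "\<lambda>m. h m * (norm (rgrad \<phi> m))\<^sup>2"
  have ig: "integrable surf ?g"
    by (intro integrable_surf_continuous continuous_intros h rgrad_continuous \<phi>)
  have ig': "integrable surf (\<lambda>m. h m * (norm (rgrad (\<lambda>x. \<phi> (X \<sigma> x)) m))\<^sup>2)"
    by (intro integrable_surf_continuous continuous_intros h rgrad_continuous comp_smooth \<phi> s)
  have e0: "energy h \<phi> \<ge> 0" unfolding energy_def using h0 by (intro integral_nonneg_AE AE_I2) auto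
  have pt: "h m * (norm (rgrad (\<lambda>x. \<phi> (X \<sigma> x)) m))\<^sup>2 \<le> exp ((2 * H + 6) * ?x) * ?g (X \<sigma> m)" if m: "norm m = 1" for m
  proof -
    have m0: "m \<noteq> 0" using m by auto
    have X1: "norm (X \<sigma> m) = 1" using M_nonzero[OF s m0] by (simp add: norm_sgn)
    have "h m \<le> exp (H * norm (m - X \<sigma> m)) * h (X \<sigma> m)" by (rule hL[OF m X1])
    also have "\<dots> \<le> exp (H * (2 * ?x)) * h (X \<sigma> m)"
      using X_dist[OF m M_nonzero[OF s m0]] H h0[OF X1]
      by (intro mult_right_mono) (auto simp: norm_minus_commute intro!: mult_left_mono)
    finally have 1: "h m \<le> exp (H * (2 * ?x)) * h (X \<sigma> m)" .
    have 2: "(norm (rgrad (\<lambda>x. \<phi> (X \<sigma> x)) m))\<^sup>2 \<le> (exp (3 * ?x) * norm (rgrad \<phi> (X \<sigma> m)))\<^sup>2"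
      by (intro power_mono norm_rgrad_comp \<phi> s m) auto
    have "h m * (norm (rgrad (\<lambda>x. \<phi> (X \<sigma> x)) m))\<^sup>2
        \<le> (exp (H * (2 * ?x)) * h (X \<sigma> m)) * (exp (3 * ?x) * norm (rgrad \<phi> (X \<sigma> m)))\<^sup>2"
      using h0[OF X1] by (intro mult_mono 1 2) auto
    also have "\<dots> = (exp (H * (2 * ?x)) * (exp (3 * ?x))\<^sup>2) * ?g (X \<sigma> m)" by (simp add: power_mult_distrib)
    also have "exp (H * (2 * ?x)) * (exp (3 * ?x))\<^sup>2 = exp ((2 * H + 6) * ?x)"
      by (simp add: power2_eq_square exp_add[symmetric] algebra_simps)
    finally show ?thesis .
  qed
  have "energy h (\<lambda>x. \<phi> (X \<sigma> x)) \<le> (LINT m|surf. exp ((2 * H + 6) * ?x) * ?g (X \<sigma> m))"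
    unfolding energy_def using pt N.comp_integrable[OF ig] by (intro integral_mono ig') auto
  also have "\<dots> = exp ((2 * H + 6) * ?x) * (LINT m|surf. ?g (X \<sigma> m))" by simp
  also have "\<dots> \<le> exp ((2 * H + 6) * ?x) * (N.q * energy h \<phi>)"
    unfolding energy_def using h0 by (intro mult_left_mono N.LINT_comp_le(1) ig) auto
  also have "\<dots> \<le> exp ((2 * H + 6) * ?x) * (exp (9 * ?x) * energy h \<phi>)"
    using q_le[OF s] e0 by (intro mult_left_mono mult_right_mono) auto
  also have "\<dots> = exp ((2 * H + 15) * ?x) * energy h \<phi>"
    by (simp add: exp_add[symmetric] algebra_simps)
  finally show ?thesis .
qed

text \<open>Clear for continuous \<open>r\<close>; the general case follows by density, as compositions are bounded in \<open>L\<^sup>2\<close> uniformly in \<open>\<sigma>\<close>.\<close>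

lemma comp_tendsto:
  fixes r :: "real^3 \<Rightarrow> real"
  assumes r: "L2 r" and e: "e > 0"
  shows "\<exists>s0>0. s0 * \<beta> \<le> 1/2 \<and> (\<forall>\<sigma>. \<bar>\<sigma>\<bar> < s0 \<longrightarrow> l2norm (\<lambda>m. r m - r (X \<sigma> m)) < e)"
proof -
  define k :: real where "k = 1 + exp 5"
  have k: "k > 0" by (simp add: k_def add_pos_pos)
  obtain c :: "real^3 \<Rightarrow> real" where c: "continuous_on UNIV c" "l2norm (\<lambda>m. r m - c m) < e / (2 * k)"
    using L2_continuous_approx[OF r, of "e / (2 * k)"] e k by auto
  have cS: "continuous_on S2 c" using c(1) continuous_on_subset by blast
  have Lc: "L2 c" by (rule L2_continuous[OF cS])
  have "uniformly_continuous_on S2 c" by (intro compact_uniformly_continuous cS compact_sphere)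
  moreover define e' where "e' = e / 2 / (1 + sqrt area)"
  have e': "e' > 0" "e' * sqrt area < e / 2" using e area_pos by (auto simp: e'_def field_simps add_pos_pos)
  ultimately obtain d where d: "d > 0" "\<And>m m'. norm m = 1 \<Longrightarrow> norm m' = 1 \<Longrightarrow> dist m' m < d \<Longrightarrow> \<bar>c m' - c m\<bar> < e'"
    using e'(1) unfolding uniformly_continuous_on_def dist_real_def by (metis mem_sphere_0)
  define s0 where "s0 = min (1/2) (d / 2) / (\<beta> + 1)"
  have s0: "s0 > 0" using d \<beta>0 by (auto simp: s0_def)
  have "s0 * \<beta> < s0 * (\<beta> + 1)" using s0 by (intro mult_strict_left_mono) auto
  also have "\<dots> = min (1/2) (d / 2)" using \<beta>0 by (simp add: s0_def)
  finally have s0b: "s0 * \<beta> < min (1/2) (d / 2)" .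
  show ?thesis
  proof (intro exI[of _ s0] conjI allI impI)
    show "s0 > 0" "s0 * \<beta> \<le> 1/2" using s0 s0b by auto
    fix \<sigma> assume \<sigma>: "\<bar>\<sigma>\<bar> < s0"
    have le: "\<bar>\<sigma>\<bar> * \<beta> \<le> s0 * \<beta>" using \<sigma> \<beta>0 by (intro mult_right_mono) auto
    then have s: "\<bar>\<sigma>\<bar> * \<beta> \<le> 1/2" using s0b by simp
    interpret N: near_isometry "M \<sigma>" "1 - \<bar>\<sigma>\<bar> * \<beta>" "1 + \<bar>\<sigma>\<bar> * \<beta>" by (rule near[OF s])
    have "N.q \<le> exp (9 * (1/2))" using q_le[OF s] s by (meson exp_le_cancel_iff mult_left_mono order_trans zero_le_numeral)
    also have "\<dots> \<le> exp 5 * exp 5" by (simp add: exp_add[symmetric])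
    finally have "sqrt N.q \<le> sqrt (exp 5 * exp 5)" by (rule real_sqrt_le_mono)
    then have qs: "sqrt N.q \<le> exp 5" by simp
    note Lr' = N.L2_comp[OF r] and Lc' = N.L2_comp[OF Lc]
    have dist: "dist (X \<sigma> m) m < d" if "norm m = 1" for m
    proof -
      have "m \<noteq> 0" using that by auto
      then show ?thesis using X_dist[OF that M_nonzero[OF s]] le s0b by (simp add: dist_norm)
    qed
    have "l2norm (\<lambda>m. c m - c (X \<sigma> m)) \<le> e' * sqrt area"
    proof (rule l2norm_le_bounded[OF L2_diff[OF Lc Lc'(1)]])
      fix m :: "real^3" assume m: "norm m = 1"
      then have "m \<noteq> 0" by auto
      then have "norm (X \<sigma> m) = 1" using M_nonzero[OF s] by (simp add: norm_sgn)
      then show "norm (c m - c (X \<sigma> m)) \<le> e'" using d(2)[OF m, of "X \<sigma> m"] dist[OF m] by (force simp: abs_minus_commute)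
    qed (use e' in simp)
    moreover have "l2norm (\<lambda>m. c (X \<sigma> m) - r (X \<sigma> m)) \<le> exp 5 * l2norm (\<lambda>m. r m - c m)"
    proof -
      have "l2norm (\<lambda>m. c (X \<sigma> m) - r (X \<sigma> m)) \<le> sqrt N.q * l2norm (\<lambda>m. c m - r m)"
        by (rule N.L2_comp(2)[OF L2_diff[OF Lc r]])
      also have "\<dots> \<le> exp 5 * l2norm (\<lambda>m. c m - r m)" using qs by (intro mult_right_mono) auto
      finally show ?thesis by (simp add: l2norm_diff_commute[of c r])
    qed
    moreover have "l2norm (\<lambda>m. r m - r (X \<sigma> m)) \<le> l2norm (\<lambda>m. r m - c m) + l2norm (\<lambda>m. c m - r (X \<sigma> m))"
      by (rule l2norm_diff_triangle[OF r Lc Lr'(1)])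
    moreover have "l2norm (\<lambda>m. c m - r (X \<sigma> m)) \<le> l2norm (\<lambda>m. c m - c (X \<sigma> m)) + l2norm (\<lambda>m. c (X \<sigma> m) - r (X \<sigma> m))"
      by (rule l2norm_diff_triangle[OF Lc Lc'(1) Lr'(1)])
    moreover have "k * l2norm (\<lambda>m. r m - c m) \<le> e / 2" using c(2) k by (simp add: field_simps)
    ultimately show "l2norm (\<lambda>m. r m - r (X \<sigma> m)) < e" using e'(2) by (simp add: k_def algebra_simps)
  qed
qed

lemma transport_bound: "sphere_smooth \<phi> \<Longrightarrow> norm m = 1 \<Longrightarrow> \<bar>surface_grad \<phi> m \<bullet> L m\<bar> \<le> \<beta> * norm (rgrad \<phi> m)"
  using Cauchy_Schwarz_ineq2[of "surface_grad \<phi> m" "L m"] mult_left_mono[OF boundL[of m] norm_ge_zero[of "surface_grad \<phi> m"]]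
  by (simp add: norm_rgrad Dhat_S2 mult.commute)

lemma transport_continuous:
  assumes "sphere_smooth \<phi>" shows "continuous_on S2 (\<lambda>m. surface_grad \<phi> m \<bullet> L m)"
proof -
  have "continuous_on S2 (\<lambda>m. cross3 m (L m) \<bullet> rgrad \<phi> m)"
    using linL by (intro continuous_intros continuous_on_cross rgrad_continuous assms linear_continuous_on) (simp add: linear_linear)
  also have "?this \<longleftrightarrow> ?thesis"
    by (intro continuous_on_cong) (auto simp: cross3_transport_inner Dhat_S2 assms)
  finally show ?thesis .
qed

lemma transport_L2:
  assumes "sphere_smooth \<phi>"
  shows "L2 (\<lambda>m. surface_grad \<phi> m \<bullet> L m)" "l2norm (\<lambda>m. surface_grad \<phi> m \<bullet> L m) \<le> \<beta> * l2norm (rgrad \<phi>)"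
  using L2_bound[of "\<lambda>m. surface_grad \<phi> m \<bullet> L m" "rgrad \<phi>" \<beta>] transport_bound[OF assms] \<beta>0
    measurable_surf_continuous[OF transport_continuous[OF assms]] L2_rgrad[OF assms] by auto

text \<open>The derivative of \<open>\<integral> r (\<phi> \<circ> X \<sigma>)\<close> in \<open>\<sigma>\<close>, compared with its value at 0.\<close>

lemma first_order_aux:
  fixes r :: "real^3 \<Rightarrow> real"
  assumes r: "L2 r" and \<phi>: "sphere_smooth \<phi>" and s: "\<bar>\<sigma>\<bar> * \<beta> \<le> 1/2"
  shows "\<bar>(LINT m|surf. r m * (surface_grad \<phi> (M \<sigma> m) \<bullet> L m)) - (LINT m|surf. r m * (surface_grad \<phi> m \<bullet> L m))\<bar>
    \<le> (l2norm (\<lambda>m. r m - r (X \<sigma> m)) * exp 5 * \<beta> + (exp (9 * (\<bar>\<sigma>\<bar> * \<beta>)) - 1) * l2norm r * \<beta>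
        + \<bar>\<sigma>\<bar> * l2norm r * (2 * \<beta>\<^sup>2 * exp 5)) * l2norm (rgrad \<phi>)"
proof -
  let ?x = "\<bar>\<sigma>\<bar> * \<beta>"
  interpret N: near_isometry "M \<sigma>" "1 - ?x" "1 + ?x" by (rule near[OF s])
  have "N.q \<le> exp (9 * (1/2))" using q_le[OF s] s by (meson exp_le_cancel_iff mult_left_mono order_trans zero_le_numeral)
  also have "\<dots> \<le> exp 5 * exp 5" by (simp add: exp_add[symmetric])
  finally have "sqrt N.q \<le> sqrt (exp 5 * exp 5)" by (rule real_sqrt_le_mono)
  then have qs: "sqrt N.q \<le> exp 5" by simp
  define W where "W m = surface_grad \<phi> m \<bullet> L m" for m
  define Z where "Z m = surface_grad \<phi> (M \<sigma> m) \<bullet> L (L m)" for m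
  let ?G = "l2norm (rgrad \<phi>)"
  have LW: "L2 W" "l2norm W \<le> \<beta> * ?G" using transport_L2[OF \<phi>] unfolding W_def[abs_def] by auto
  note LWX = N.L2_comp[OF LW(1)]
  have LrX: "L2 (\<lambda>m. r (X \<sigma> m))" by (rule N.L2_comp(1)[OF r])
  have split: "surface_grad \<phi> (M \<sigma> m) \<bullet> L m = W (X \<sigma> m) - \<sigma> * Z m" if m: "norm m = 1" for m
  proof -
    have m0: "m \<noteq> 0" using m by auto
    let ?y = "M \<sigma> m"
    have y0: "?y \<noteq> 0" by (rule M_nonzero[OF s m0])
    have D: "Dhat \<phi> (sgn ?y)" using y0 by (intro sphere_smooth_Dhat \<phi>) (auto simp: sgn_zero_iff)
    have "W (X \<sigma> m) = surface_grad \<phi> ?y \<bullet> L ?y"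
      unfolding W_def surface_grad_sgn(2)[OF D y0] using linL y0 by (simp add: sgn_div_norm linear_scale)
    also have "L ?y = L m + \<sigma> *\<^sub>R L (L m)" using linL by (simp add: M_def linear_add linear_scale)
    finally show ?thesis by (simp add: Z_def inner_add_right)
  qed
  have Zb: "norm (Z m) \<le> (2 * \<beta>\<^sup>2) * norm (rgrad \<phi> (X \<sigma> m))" if m: "norm m = 1" for m
  proof -
    have m0: "m \<noteq> 0" using m by auto
    have y0: "M \<sigma> m \<noteq> 0" by (rule M_nonzero[OF s m0])
    have "norm (L (L m)) \<le> \<beta> * (\<beta> * 1)"
      using boundL[of "L m"] mult_left_mono[OF boundL[of m] \<beta>0] m by simp
    moreover have "norm (surface_grad \<phi> (M \<sigma> m)) \<le> 2 * norm (rgrad \<phi> (X \<sigma> m))"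
    proof -
      have "norm (rgrad \<phi> (X \<sigma> m)) / norm (M \<sigma> m) \<le> norm (rgrad \<phi> (X \<sigma> m)) / (1/2)"
        using M_norm_ge[OF s m] by (intro frac_le) auto
      then show ?thesis by (simp add: norm_surface_grad[OF \<phi> y0])
    qed
    ultimately have "norm (surface_grad \<phi> (M \<sigma> m)) * norm (L (L m)) \<le> (2 * norm (rgrad \<phi> (X \<sigma> m))) * (\<beta> * (\<beta> * 1))"
      by (intro mult_mono) auto
    then show ?thesis using Cauchy_Schwarz_ineq2[of "surface_grad \<phi> (M \<sigma> m)" "L (L m)"]
      by (simp add: Z_def power2_eq_square algebra_simps)
  qed
  have Zm: "Z \<in> borel_measurable surf"
  proof (rule measurable_surf_continuous)
    have cl: "continuous_on S2 K" if "linear K" for K :: "real^3 \<Rightarrow> real^3"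
      using that by (simp add: linear_continuous_on linear_linear)
    have "continuous_on S2 (\<lambda>m. surface_grad \<phi> (M \<sigma> m))"
    proof (rule continuous_on_compose2[OF surface_grad_continuous[OF \<phi>] cl[OF linM]])
      have "M \<sigma> m \<noteq> 0" if "m \<in> S2" for m
        using that by (intro M_nonzero[OF s]) auto
      then show "M \<sigma> ` S2 \<subseteq> - {0}" by auto
    qed
    then show "continuous_on S2 Z" unfolding Z_def[abs_def]
      using cl[OF linear_compose[OF linL linL]] by (intro continuous_intros) (simp_all add: o_def)
  qed
  note LR = N.L2_comp[OF L2_rgrad[OF \<phi>]]
  have LZ: "L2 Z" "l2norm Z \<le> (2 * \<beta>\<^sup>2) * l2norm (\<lambda>m. rgrad \<phi> (X \<sigma> m))"
    using L2_bound[OF Zm LR(1) Zb] by auto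
  have "l2norm (\<lambda>m. rgrad \<phi> (X \<sigma> m)) \<le> exp 5 * ?G" using LR(2) mult_right_mono[OF qs l2norm_nonneg[of "rgrad \<phi>"]] by linarith
  then have LZ2: "l2norm Z \<le> (2 * \<beta>\<^sup>2) * (exp 5 * ?G)" using LZ(2) mult_left_mono[of _ _ "2 * \<beta>\<^sup>2"] by (meson order_trans zero_le_mult_iff zero_le_numeral zero_le_power2)
  have LWX2: "l2norm (\<lambda>m. W (X \<sigma> m)) \<le> exp 5 * (\<beta> * ?G)"
  proof -
    have "sqrt N.q * l2norm W \<le> exp 5 * (\<beta> * ?G)" using qs LW(2) by (intro mult_mono) auto
    then show ?thesis using LWX(2) by linarith
  qed
  have irW: "integrable surf (\<lambda>m. r m * W m)" by (rule L2_mult_integrable[OF r LW(1)])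
  have t1: "\<bar>LINT m|surf. (r m - r (X \<sigma> m)) * W (X \<sigma> m)\<bar> \<le> l2norm (\<lambda>m. r m - r (X \<sigma> m)) * (exp 5 * (\<beta> * ?G))"
    using L2_Cauchy_Schwarz_real[OF L2_diff[OF r LrX] LWX(1)] 
      mult_left_mono[OF LWX2 l2norm_nonneg[of "\<lambda>m. r m - r (X \<sigma> m)"]] by linarith
  have t2: "\<bar>(LINT m|surf. r (X \<sigma> m) * W (X \<sigma> m)) - (LINT m|surf. r m * W m)\<bar> \<le> (exp (9 * ?x) - 1) * (l2norm r * (\<beta> * ?G))"
  proof -
    have L: "L2 (\<lambda>m. \<bar>r m\<bar>)" "L2 (\<lambda>m. \<bar>W m\<bar>)" using r LW(1) by (auto simp: L2_def)
    have "(LINT m|surf. \<bar>r m * W m\<bar>) \<le> l2norm (\<lambda>m. \<bar>r m\<bar>) * l2norm (\<lambda>m. \<bar>W m\<bar>)"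
      using L2_Cauchy_Schwarz_real[OF L] by (simp add: abs_mult)
    also have "\<dots> = l2norm r * l2norm W" by (simp add: l2norm_def)
    also have "\<dots> \<le> l2norm r * (\<beta> * ?G)" using LW(2) by (intro mult_left_mono) auto
    finally have le: "(LINT m|surf. \<bar>r m * W m\<bar>) \<le> l2norm r * (\<beta> * ?G)" .
    have "\<bar>(LINT m|surf. r (X \<sigma> m) * W (X \<sigma> m)) - (LINT m|surf. r m * W m)\<bar> \<le> (N.q - 1) * (LINT m|surf. \<bar>r m * W m\<bar>)"
      by (rule N.LINT_comp_diff[OF irW])
    also have "\<dots> \<le> (exp (9 * ?x) - 1) * (l2norm r * (\<beta> * ?G))"
      using q_le[OF s] N.q1 \<beta>0 by (intro mult_mono le) auto
    finally show ?thesis .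
  qed
  have t3: "\<bar>\<sigma> * (LINT m|surf. r m * Z m)\<bar> \<le> \<bar>\<sigma>\<bar> * (l2norm r * ((2 * \<beta>\<^sup>2) * (exp 5 * ?G)))"
    unfolding abs_mult using L2_Cauchy_Schwarz_real[OF r LZ(1)] mult_left_mono[OF LZ2 l2norm_nonneg[of r]]
    by (intro mult_left_mono) (auto intro: order_trans)
  have "(LINT m|surf. r m * (surface_grad \<phi> (M \<sigma> m) \<bullet> L m)) = (LINT m|surf. r m * W (X \<sigma> m) - \<sigma> * (r m * Z m))"
    by (intro LINT_cong_S2) (simp add: split algebra_simps)
  also have "\<dots> = (LINT m|surf. r m * W (X \<sigma> m)) - \<sigma> * (LINT m|surf. r m * Z m)"
    using L2_mult_integrable[OF r LWX(1)] L2_mult_integrable[OF r LZ(1)] by simp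
  also have "(LINT m|surf. r m * W (X \<sigma> m)) = (LINT m|surf. (r m - r (X \<sigma> m)) * W (X \<sigma> m)) + (LINT m|surf. r (X \<sigma> m) * W (X \<sigma> m))"
    using L2_mult_integrable[OF r LWX(1)] L2_mult_integrable[OF LrX LWX(1)] by (simp add: left_diff_distrib)
  finally have "\<bar>(LINT m|surf. r m * (surface_grad \<phi> (M \<sigma> m) \<bullet> L m)) - (LINT m|surf. r m * W m)\<bar>
     \<le> l2norm (\<lambda>m. r m - r (X \<sigma> m)) * (exp 5 * (\<beta> * ?G)) + (exp (9 * ?x) - 1) * (l2norm r * (\<beta> * ?G)) + \<bar>\<sigma>\<bar> * (l2norm r * ((2 * \<beta>\<^sup>2) * (exp 5 * ?G)))"
    using t1 t2 t3 by linarith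
  then show ?thesis unfolding W_def by (simp add: algebra_simps)
qed

text \<open>A first order Taylor expansion whose error is controlled by the gradient of \<open>\<phi>\<close> in \<open>L\<^sup>2\<close>, uniformly in \<open>\<phi>\<close>.  No second derivative of \<open>\<phi>\<close> may
  enter, because \<open>\<phi>\<close> will vary with \<open>\<sigma>\<close>.  A change of variables therefore moves the displacement from the derivative of \<open>\<phi>\<close> to \<open>r\<close>,
  where continuity of translations in \<open>L\<^sup>2\<close> applies.\<close>

lemma first_order:
  fixes r :: "real^3 \<Rightarrow> real"
  assumes r: "L2 r" and e: "e > 0"
  shows "\<exists>s0>0. s0 * \<beta> \<le> 1/2 \<and> (\<forall>\<sigma> \<phi>. 0 < \<sigma> \<and> \<sigma> < s0 \<and> sphere_smooth \<phi> \<longrightarrow>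
    \<bar>(LINT m|surf. r m * \<phi> (X \<sigma> m)) - (LINT m|surf. r m * \<phi> m) - \<sigma> * (LINT m|surf. r m * (surface_grad \<phi> m \<bullet> L m))\<bar>
      \<le> \<sigma> * e * l2norm (rgrad \<phi>))"
proof -
  define e1 where "e1 = e / 3 / (exp 5 * \<beta> + 1)"
  have K: "exp 5 * \<beta> + 1 > 0" using \<beta>0 by (simp add: add_nonneg_pos)
  have e1: "e1 > 0" "e1 * exp 5 * \<beta> \<le> e / 3"
  proof -
    show p: "e1 > 0" using e K by (simp add: e1_def)
    have "e / 3 / d * d = e / 3" if "d > 0" for d :: real using that by simp
    from this[OF K] have "e1 * (exp 5 * \<beta> + 1) = e / 3" by (simp only: e1_def)
    then show "e1 * exp 5 * \<beta> \<le> e / 3" using p by (simp add: algebra_simps)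
  qed
  obtain s1 where s1: "s1 > 0" "s1 * \<beta> \<le> 1/2" "\<And>\<sigma>. \<bar>\<sigma>\<bar> < s1 \<Longrightarrow> l2norm (\<lambda>m. r m - r (X \<sigma> m)) < e1"
    using comp_tendsto[OF r e1(1)] by blast
  have lim: "((\<lambda>\<sigma>. (exp (9 * (\<sigma> * \<beta>)) - 1) * l2norm r * \<beta> + \<sigma> * l2norm r * (2 * \<beta>\<^sup>2 * exp 5)) \<longlongrightarrow>
      (exp (9 * (0 * \<beta>)) - 1) * l2norm r * \<beta> + 0 * l2norm r * (2 * \<beta>\<^sup>2 * exp 5)) (at_right 0)"
    by (intro tendsto_intros)
  then have "\<forall>\<^sub>F \<sigma> in at_right 0. (exp (9 * (\<sigma> * \<beta>)) - 1) * l2norm r * \<beta> + \<sigma> * l2norm r * (2 * \<beta>\<^sup>2 * exp 5) < e / 3"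
    using e by (intro order_tendstoD(2)[OF lim]) auto
  then obtain s2 where s2: "s2 > 0" "\<And>\<sigma>. 0 < \<sigma> \<Longrightarrow> \<sigma> < s2 \<Longrightarrow>
      (exp (9 * (\<sigma> * \<beta>)) - 1) * l2norm r * \<beta> + \<sigma> * l2norm r * (2 * \<beta>\<^sup>2 * exp 5) < e / 3"
    by (auto simp: eventually_at_right_field)
  show ?thesis
  proof (intro exI[of _ "min s1 s2"] conjI allI impI)
    show "min s1 s2 > 0" using s1 s2 by simp
    have "min s1 s2 * \<beta> \<le> s1 * \<beta>" using \<beta>0 by (intro mult_right_mono) auto
    then show "min s1 s2 * \<beta> \<le> 1/2" using s1(2) by simp
  next
    fix \<sigma> \<phi> assume "0 < \<sigma> \<and> \<sigma> < min s1 s2 \<and> sphere_smooth \<phi>"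
    then have \<sigma>: "0 < \<sigma>" "\<sigma> < s1" "\<sigma> < s2" and \<phi>: "sphere_smooth \<phi>" by auto
    have small: "\<bar>t\<bar> * \<beta> \<le> 1/2" if "\<bar>t\<bar> < s1" for t
      using that s1(2) mult_right_mono[of "\<bar>t\<bar>" s1 \<beta>] \<beta>0 by linarith
    define Q where "Q t = (LINT m|surf. r m * \<phi> (X t m))" for t
    define Q' where "Q' t = (LINT m|surf. r m * (surface_grad \<phi> (M t m) \<bullet> L m))" for t
    obtain K where K: "K > 0" "\<And>m. norm m = 1 \<Longrightarrow> norm (rgrad \<phi> m) \<le> K" using bounded_rgrad[OF \<phi>] by metis
    have der: "(Q has_real_derivative Q' t) (at t)" if t: "\<bar>t\<bar> < s1" for t
      unfolding Q_def Q'_def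
    proof (rule DERIV_LINT[where d="s1 - \<bar>t\<bar>" and g="\<lambda>m. \<bar>r m\<bar> * (2 * K * \<beta>)"])
      show "s1 - \<bar>t\<bar> > 0" using t by simp
      show "integrable surf (\<lambda>m. \<bar>r m\<bar> * (2 * K * \<beta>))" using L2_integrable[OF r] by auto
      have sm: "\<bar>u\<bar> < s1" if "\<bar>u - t\<bar> < s1 - \<bar>t\<bar>" for u using that by linarith
      show "integrable surf (\<lambda>m. r m * \<phi> (X u m))" if "\<bar>u - t\<bar> < s1 - \<bar>t\<bar>" for u
        by (intro L2_mult_integrable r L2_smooth comp_smooth \<phi> small sm that)
      show "((\<lambda>u. r m * \<phi> (X u m)) has_real_derivative r m * (surface_grad \<phi> (M u m) \<bullet> L m)) (at u)"
        if u: "\<bar>u - t\<bar> < s1 - \<bar>t\<bar>" and m: "norm m = 1" for u m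
      proof -
        have m0: "m \<noteq> 0" using m by auto
        have "M u m \<noteq> 0" by (rule M_nonzero[OF small[OF sm[OF u]] m0])
        then show ?thesis unfolding M_def by (intro DERIV_cmult sphere_path_derivative \<phi>)
      qed
      show "\<bar>r m * (surface_grad \<phi> (M u m) \<bullet> L m)\<bar> \<le> \<bar>r m\<bar> * (2 * K * \<beta>)"
        if u: "\<bar>u - t\<bar> < s1 - \<bar>t\<bar>" and m: "norm m = 1" for u m
      proof -
        have m0: "m \<noteq> 0" using m by auto
        note sb = small[OF sm[OF u]]
        have y0: "M u m \<noteq> 0" by (rule M_nonzero[OF sb m0])
        have "norm (surface_grad \<phi> (M u m)) \<le> K / (1/2)"
          unfolding norm_surface_grad[OF \<phi> y0] using M_norm_ge[OF sb m] K y0 by (intro frac_le) (auto simp: norm_sgn)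
        moreover have "norm (L m) \<le> \<beta>" using boundL[of m] m by simp
        ultimately have "norm (surface_grad \<phi> (M u m)) * norm (L m) \<le> 2 * K * \<beta>" using K by (intro mult_mono) auto
        then have "\<bar>surface_grad \<phi> (M u m) \<bullet> L m\<bar> \<le> 2 * K * \<beta>"
          using Cauchy_Schwarz_ineq2[of "surface_grad \<phi> (M u m)" "L m"] by linarith
        then show ?thesis unfolding abs_mult by (intro mult_left_mono) auto
      qed
      show "(\<lambda>m. r m * (surface_grad \<phi> (M t m) \<bullet> L m)) \<in> borel_measurable surf"
      proof -
        have cl: "continuous_on S2 k" if "linear k" for k :: "real^3 \<Rightarrow> real^3"
          using that by (simp add: linear_continuous_on linear_linear)
        have "M t m \<noteq> 0" if "m \<in> S2" for m
          using that by (intro M_nonzero[OF small[OF t]]) auto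
        then have "continuous_on S2 (\<lambda>m. surface_grad \<phi> (M t m))"
          by (intro continuous_on_compose2[OF surface_grad_continuous[OF \<phi>] cl[OF linM]]) auto
        then have "continuous_on S2 (\<lambda>m. surface_grad \<phi> (M t m) \<bullet> L m)" by (intro continuous_intros cl[OF linL])
        then show ?thesis using measurable_surf_continuous L2_measurable[OF r] by (intro borel_measurable_times) auto
      qed
    qed
    obtain \<xi> where \<xi>: "0 < \<xi>" "\<xi> < \<sigma>" "Q \<sigma> - Q 0 = (\<sigma> - 0) * Q' \<xi>"
      using MVT2[of 0 \<sigma> Q Q'] der \<sigma> by force
    have Q0: "Q 0 = (LINT m|surf. r m * \<phi> m)" unfolding Q_def by (intro LINT_cong_S2) (simp add: M_def)
    have \<xi>s: "\<bar>\<xi>\<bar> < s1" using \<xi> \<sigma> by simp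
    let ?G = "l2norm (rgrad \<phi>)"
    have "\<bar>Q' \<xi> - (LINT m|surf. r m * (surface_grad \<phi> m \<bullet> L m))\<bar>
      \<le> (l2norm (\<lambda>m. r m - r (X \<xi> m)) * exp 5 * \<beta> + (exp (9 * (\<bar>\<xi>\<bar> * \<beta>)) - 1) * l2norm r * \<beta>
        + \<bar>\<xi>\<bar> * l2norm r * (2 * \<beta>\<^sup>2 * exp 5)) * ?G"
      unfolding Q'_def by (rule first_order_aux[OF r \<phi> small[OF \<xi>s]])
    also have "\<dots> \<le> e * ?G"
    proof (intro mult_right_mono)
      have "l2norm (\<lambda>m. r m - r (X \<xi> m)) * (exp 5 * \<beta>) \<le> e1 * (exp 5 * \<beta>)"
        using s1(3)[OF \<xi>s] \<beta>0 by (intro mult_right_mono) auto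
      then have A: "l2norm (\<lambda>m. r m - r (X \<xi> m)) * exp 5 * \<beta> \<le> e / 3" using e1(2) by (simp only: mult.assoc)
      have B: "(exp (9 * (\<bar>\<xi>\<bar> * \<beta>)) - 1) * l2norm r * \<beta> + \<bar>\<xi>\<bar> * l2norm r * (2 * \<beta>\<^sup>2 * exp 5) < e / 3"
        using s2(2)[of \<xi>] \<xi> \<sigma> by (simp only: abs_of_pos)
      show "l2norm (\<lambda>m. r m - r (X \<xi> m)) * exp 5 * \<beta> + (exp (9 * (\<bar>\<xi>\<bar> * \<beta>)) - 1) * l2norm r * \<beta>
        + \<bar>\<xi>\<bar> * l2norm r * (2 * \<beta>\<^sup>2 * exp 5) \<le> e"
        using A B e by (simp only: add.assoc) 
    qed simp
    finally have "\<sigma> * \<bar>Q' \<xi> - (LINT m|surf. r m * (surface_grad \<phi> m \<bullet> L m))\<bar> \<le> \<sigma> * (e * ?G)"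
      using \<sigma> by (intro mult_left_mono) auto
    moreover have "Q \<sigma> - Q 0 - \<sigma> * (LINT m|surf. r m * (surface_grad \<phi> m \<bullet> L m)) = \<sigma> * (Q' \<xi> - (LINT m|surf. r m * (surface_grad \<phi> m \<bullet> L m)))"
      using \<xi>(3) by (simp add: algebra_simps)
    ultimately show "\<bar>(LINT m|surf. r m * \<phi> (X \<sigma> m)) - (LINT m|surf. r m * \<phi> m) - \<sigma> * (LINT m|surf. r m * (surface_grad \<phi> m \<bullet> L m))\<bar>
      \<le> \<sigma> * e * l2norm (rgrad \<phi>)"
      using \<sigma> unfolding Q0[symmetric] Q_def[of \<sigma>, symmetric] by (simp add: abs_mult mult.assoc)
  qed
qed

text \<open>The left hand side contains \<open>r\<close> times the gradient of \<open>\<phi>\<close>, but the bound is free of norms of \<open>r\<close>.  If \<open>\<phi>\<close> nearly attains the supremum \<open>E\<close>, then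
  its composition with \<open>X \<sigma>\<close> is no better, so that the change of \<open>2 \<integral> r \<phi>\<close> is at most the change of the Dirichlet integral plus
  \<open>\<sigma>\<^sup>2\<close>.  Division by \<open>\<sigma>\<close> gives the claim.\<close>

lemma inner_variation:
  fixes r h :: "real^3 \<Rightarrow> real"
  assumes r: "L2 r" and h: "continuous_on S2 h"
    and h0: "\<And>m. norm m = 1 \<Longrightarrow> h m \<ge> 0" and H: "H \<ge> 0"
    and hL: "\<And>m m'. norm m = 1 \<Longrightarrow> norm m' = 1 \<Longrightarrow> h m \<le> exp (H * norm (m - m')) * h m'"
    and sup: "\<And>\<phi>. sphere_smooth \<phi> \<Longrightarrow> 2 * (LINT m|surf. r m * \<phi> m) - energy h \<phi> \<le> E"
    and e: "e > 0"
  shows "\<exists>s0>0. \<forall>\<sigma> \<phi>. 0 < \<sigma> \<and> \<sigma> < s0 \<and> sphere_smooth \<phi> \<and> E - \<sigma>\<^sup>2 \<le> 2 * (LINT m|surf. r m * \<phi> m) - energy h \<phi> \<longrightarrow>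
    (LINT m|surf. r m * (surface_grad \<phi> m \<bullet> L m)) \<le> (2 * H + 15) * \<beta> * energy h \<phi> + e * (1 + l2norm (rgrad \<phi>))"
proof -
  obtain s1 where s1: "s1 > 0" "s1 * \<beta> \<le> 1/2" "\<And>\<sigma> \<phi>. 0 < \<sigma> \<Longrightarrow> \<sigma> < s1 \<Longrightarrow> sphere_smooth \<phi> \<Longrightarrow>
    \<bar>(LINT m|surf. r m * \<phi> (X \<sigma> m)) - (LINT m|surf. r m * \<phi> m) - \<sigma> * (LINT m|surf. r m * (surface_grad \<phi> m \<bullet> L m))\<bar>
      \<le> \<sigma> * e * l2norm (rgrad \<phi>)"
    using first_order[OF r e] by blast
  define k where "k = (2 * H + 15) * \<beta>"
  have k: "k \<ge> 0" using H \<beta>0 by (simp add: k_def)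
  define s0 where "s0 = min s1 (min e (1 / (k + 1)))"
  have s0: "s0 > 0" using s1 e k by (auto simp: s0_def)
  show ?thesis
  proof (intro exI[of _ s0] conjI allI impI)
    fix \<sigma> \<phi> assume "0 < \<sigma> \<and> \<sigma> < s0 \<and> sphere_smooth \<phi> \<and> E - \<sigma>\<^sup>2 \<le> 2 * (LINT m|surf. r m * \<phi> m) - energy h \<phi>"
    then have \<sigma>: "0 < \<sigma>" "\<sigma> < s1" "\<sigma> < e" "\<sigma> < 1 / (k + 1)" and \<phi>: "sphere_smooth \<phi>"
      and nm: "E - \<sigma>\<^sup>2 \<le> 2 * (LINT m|surf. r m * \<phi> m) - energy h \<phi>" by (auto simp: s0_def)
    let ?I = "LINT m|surf. r m * (surface_grad \<phi> m \<bullet> L m)" and ?G = "l2norm (rgrad \<phi>)"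
    have s: "\<bar>\<sigma>\<bar> * \<beta> \<le> 1/2" using \<sigma> s1(2) mult_right_mono[of "\<sigma>" s1 \<beta>] \<beta>0 by linarith
    have e0: "energy h \<phi> \<ge> 0" unfolding energy_def using h0 by (intro integral_nonneg_AE AE_I2) auto
    have "k * \<sigma> \<le> k * (1 / (k + 1))" using \<sigma> k by (intro mult_left_mono) auto
    also have "\<dots> \<le> 1" using k by simp
    finally have k1: "k * \<sigma> \<le> 1" .
    have k0: "0 \<le> k * \<sigma>" using k \<sigma> by simp
    have "exp (k * \<sigma>) \<le> 1 + k * \<sigma> + (k * \<sigma>)\<^sup>2" by (rule exp_bound[OF k0 k1])
    also have "(k * \<sigma>)\<^sup>2 \<le> k * \<sigma>" using mult_left_mono[OF k1 k0] by (simp add: power2_eq_square)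
    finally have ex: "exp (k * \<sigma>) \<le> 1 + 2 * (k * \<sigma>)" by linarith
    have "energy h (\<lambda>x. \<phi> (X \<sigma> x)) \<le> exp ((2 * H + 15) * (\<bar>\<sigma>\<bar> * \<beta>)) * energy h \<phi>"
      by (rule energy_comp[OF \<phi> s h h0 H hL])
    also have "(2 * H + 15) * (\<bar>\<sigma>\<bar> * \<beta>) = k * \<sigma>" using \<sigma> by (simp add: k_def)
    also have "exp (k * \<sigma>) * energy h \<phi> \<le> (1 + 2 * (k * \<sigma>)) * energy h \<phi>" using ex e0 by (rule mult_right_mono)
    finally have en: "energy h (\<lambda>x. \<phi> (X \<sigma> x)) \<le> energy h \<phi> + 2 * \<sigma> * (k * energy h \<phi>)" by (simp add: algebra_simps)
    have su: "2 * (LINT m|surf. r m * \<phi> (X \<sigma> m)) - energy h (\<lambda>x. \<phi> (X \<sigma> x)) \<le> E" by (rule sup[OF comp_smooth[OF \<phi> s]])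
    have "2 * (\<sigma> * ?I) \<le> 2 * ((LINT m|surf. r m * \<phi> (X \<sigma> m)) - (LINT m|surf. r m * \<phi> m)) + 2 * (\<sigma> * e * ?G)"
    proof -
      have "2 * (\<sigma> * I) \<le> 2 * (A - B) + 2 * c" if "\<bar>A - B - \<sigma> * I\<bar> \<le> c" for A B I c :: real
        using abs_le_D2[OF that] by simp
      then show ?thesis using s1(3)[OF \<sigma>(1,2) \<phi>] by blast
    qed
    also have "\<dots> \<le> 2 * \<sigma> * (k * energy h \<phi>) + \<sigma>\<^sup>2 + 2 * (\<sigma> * e * ?G)"
    proof -
      have "2 * (A - B) + c \<le> F + S + c" if "e1 \<le> e0 + F" "2 * A - e1 \<le> E" "E - S \<le> 2 * B - e0" for A B F S c e0 e1 :: real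
        using that by (simp add: algebra_simps)
      from this[OF en su nm] show ?thesis .
    qed
    also have "\<dots> = 2 * (\<sigma> * (k * energy h \<phi> + \<sigma> / 2 + e * ?G))" by (simp add: power2_eq_square algebra_simps)
    finally have "?I \<le> k * energy h \<phi> + \<sigma> / 2 + e * ?G" using \<sigma>(1) by simp
    then show "?I \<le> (2 * H + 15) * \<beta> * energy h \<phi> + e * (1 + ?G)"
      using \<sigma> by (simp add: k_def algebra_simps)
  qed (rule s0)
qed

end

section \<open>The weighted dual energy\<close>

lemma quadratic_bound:
  fixes P N E :: real
  assumes *: "\<And>s. 2 * s * P - s\<^sup>2 * N \<le> E" and N: "N \<ge> 0"
  shows "P\<^sup>2 \<le> E * N"
proof (cases "N = 0")
  case True
  have "P = 0"
  proof (rule ccontr)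
    assume "P \<noteq> 0"
    then show False using *[of "(E + 1) / (2 * P)"] True by simp
  qed
  then show ?thesis using True by simp
next
  case False
  then have N: "N > 0" using N by simp
  have "2 * (P / N) * P - (P / N)\<^sup>2 * N \<le> E" by (rule *)
  also have "2 * (P / N) * P - (P / N)\<^sup>2 * N = P\<^sup>2 / N" using N by (simp add: power2_eq_square)
  finally show ?thesis using N by (simp add: field_simps)
qed

text \<open>The supremum of the action is the square of the norm of \<open>r\<close> in the dual of the space of mean zero functions with the weighted
  Dirichlet norm.  The quadratic form of the definition lets the weight and \<open>r\<close> vary independently of the test function.\<close>

definition action :: "(real^3 \<Rightarrow> real) \<Rightarrow> (real^3 \<Rightarrow> real) \<Rightarrow> (real^3 \<Rightarrow> real) \<Rightarrow> real" where
  "action h r \<phi> = 2 * (LINT m|surf. r m * \<phi> m) - energy h \<phi>"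

definition dual_energy :: "(real^3 \<Rightarrow> real) \<Rightarrow> (real^3 \<Rightarrow> real) \<Rightarrow> real" where
  "dual_energy h r = (SUP \<phi>\<in>{\<phi>. sphere_smooth \<phi>}. action h r \<phi>)"

locale weight =
  fixes h :: "real^3 \<Rightarrow> real" and c0 c1 :: real
  assumes cont: "continuous_on S2 h" and c0: "c0 > 0"
    and lower: "\<And>m. norm m = 1 \<Longrightarrow> c0 \<le> h m" and upper: "\<And>m. norm m = 1 \<Longrightarrow> h m \<le> c1"
begin

lemma c1: "c1 > 0"
  using lower[of "axis 1 1"] upper[of "axis 1 1"] c0 by simp

lemma h_pos: "norm m = 1 \<Longrightarrow> h m > 0"
  using lower[of m] c0 by linarith

lemma energy_integrable: "sphere_smooth \<phi> \<Longrightarrow> integrable surf (\<lambda>m. h m * (norm (rgrad \<phi> m))\<^sup>2)"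
  by (intro integrable_surf_continuous continuous_intros cont rgrad_continuous)

lemma cross_integrable:
  "sphere_smooth \<phi> \<Longrightarrow> sphere_smooth \<psi> \<Longrightarrow> integrable surf (\<lambda>m. h m * (rgrad \<phi> m \<bullet> rgrad \<psi> m))"
  by (intro integrable_surf_continuous continuous_intros cont rgrad_continuous)

lemma energy_nonneg: "energy h \<phi> \<ge> 0"
  unfolding energy_def by (intro integral_nonneg_AE AE_I2) (simp add: h_pos less_imp_le)

lemma energy_lower: "sphere_smooth \<phi> \<Longrightarrow> c0 * (l2norm (rgrad \<phi>))\<^sup>2 \<le> energy h \<phi>"
proof -
  assume \<phi>: "sphere_smooth \<phi>"
  have "c0 * (l2norm (rgrad \<phi>))\<^sup>2 = (LINT m|surf. c0 * (norm (rgrad \<phi> m))\<^sup>2)" by (simp add: l2norm_power2)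
  also have "\<dots> \<le> energy h \<phi>" unfolding energy_def
    using L2_rgrad[OF \<phi>] lower by (intro integral_mono energy_integrable \<phi>) (auto simp: L2_def intro!: mult_right_mono)
  finally show ?thesis .
qed

lemma energy_upper: "sphere_smooth \<phi> \<Longrightarrow> energy h \<phi> \<le> c1 * (l2norm (rgrad \<phi>))\<^sup>2"
proof -
  assume \<phi>: "sphere_smooth \<phi>"
  have "energy h \<phi> \<le> (LINT m|surf. c1 * (norm (rgrad \<phi> m))\<^sup>2)" unfolding energy_def
    using L2_rgrad[OF \<phi>] upper by (intro integral_mono energy_integrable \<phi>) (auto simp: L2_def intro!: mult_right_mono)
  also have "\<dots> = c1 * (l2norm (rgrad \<phi>))\<^sup>2" by (simp add: l2norm_power2)
  finally show ?thesis .
qed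

lemma l2norm_rgrad_le: assumes "sphere_smooth \<phi>" shows "l2norm (rgrad \<phi>) \<le> sqrt (energy h \<phi>) / sqrt c0"
proof -
  have "(l2norm (rgrad \<phi>))\<^sup>2 \<le> energy h \<phi> / c0" using energy_lower[OF assms] c0 by (simp add: field_simps)
  then show ?thesis by (metis real_le_rsqrt real_sqrt_divide)
qed

lemma sqrt_energy_le: assumes "sphere_smooth \<phi>" shows "sqrt (energy h \<phi>) \<le> sqrt c1 * l2norm (rgrad \<phi>)"
proof -
  have "sqrt (energy h \<phi>) \<le> sqrt (c1 * (l2norm (rgrad \<phi>))\<^sup>2)" by (rule real_sqrt_le_mono[OF energy_upper[OF assms]])
  then show ?thesis by (simp add: real_sqrt_mult)
qed

lemma energy_add:
  assumes \<phi>: "sphere_smooth \<phi>" and \<psi>: "sphere_smooth \<psi>"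
  shows "energy h (\<lambda>m. \<phi> m + s * \<psi> m)
    = energy h \<phi> + 2 * s * (LINT m|surf. h m * (rgrad \<phi> m \<bullet> rgrad \<psi> m)) + s\<^sup>2 * energy h \<psi>"
proof -
  have eq: "(norm (rgrad (\<lambda>m. \<phi> m + s * \<psi> m) m))\<^sup>2 = (norm (rgrad \<phi> m))\<^sup>2 + 2 * s * (rgrad \<phi> m \<bullet> rgrad \<psi> m) + s\<^sup>2 * (norm (rgrad \<psi> m))\<^sup>2"
    if m: "norm m = 1" for m
    unfolding rgrad_add[OF \<phi> sphere_smooth_cmult[OF \<psi>] m] rgrad_cmult[OF \<psi> m] power2_norm_eq_inner
    by (simp add: inner_add_left inner_add_right inner_commute power2_eq_square algebra_simps)
  have "energy h (\<lambda>m. \<phi> m + s * \<psi> m) = (LINT m|surf. h m * (norm (rgrad \<phi> m))\<^sup>2 + 2 * s * (h m * (rgrad \<phi> m \<bullet> rgrad \<psi> m)) + s\<^sup>2 * (h m * (norm (rgrad \<psi> m))\<^sup>2))"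
    unfolding energy_def by (intro LINT_cong_S2) (simp add: eq algebra_simps)
  then show ?thesis unfolding energy_def using energy_integrable[OF \<phi>] energy_integrable[OF \<psi>] cross_integrable[OF \<phi> \<psi>] by simp
qed

lemma energy_cmult: "sphere_smooth \<psi> \<Longrightarrow> energy h (\<lambda>m. s * \<psi> m) = s\<^sup>2 * energy h \<psi>"
proof -
  assume \<psi>: "sphere_smooth \<psi>"
  have "energy h (\<lambda>m. s * \<psi> m) = (LINT m|surf. s\<^sup>2 * (h m * (norm (rgrad \<psi> m))\<^sup>2))"
    unfolding energy_def by (intro LINT_cong_S2) (simp add: rgrad_cmult[OF \<psi>] power_mult_distrib)
  then show ?thesis by (simp add: energy_def)
qed

end

text \<open>The mean of \<open>r\<close> must vanish: otherwise constant test functions make the supremum infinite, and the supremum of an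
  unbounded set of reals is a default value.\<close>

locale dual = weight +
  fixes r :: "real^3 \<Rightarrow> real"
  assumes r: "L2 r" and mean: "(LINT m|surf. r m) = 0"
begin

lemma pairing_poincare:
  assumes \<phi>: "sphere_smooth \<phi>" shows "\<bar>LINT m|surf. r m * \<phi> m\<bar> \<le> l2norm r * l2norm (rgrad \<phi>)"
proof -
  define a where "a = (LINT m|surf. \<phi> m) / area"
  have "(LINT m|surf. r m * (\<phi> m - a)) = (LINT m|surf. r m * \<phi> m)"
    unfolding right_diff_distrib using L2_mult_integrable[OF r L2_smooth[OF \<phi>]] L2_integrable[OF r] mean by simp
  moreover have "\<bar>LINT m|surf. r m * (\<phi> m - a)\<bar> \<le> l2norm r * l2norm (\<lambda>m. \<phi> m - a)"
    by (intro L2_Cauchy_Schwarz_real r L2_smooth sphere_smooth_diff \<phi> sphere_smooth_const)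
  moreover have "l2norm r * l2norm (\<lambda>m. \<phi> m - a) \<le> l2norm r * l2norm (rgrad \<phi>)"
    using poincare[OF \<phi>] by (intro mult_left_mono) (auto simp: a_def)
  ultimately show ?thesis by simp
qed

lemma action_le:
  assumes K: "\<And>\<phi>. sphere_smooth \<phi> \<Longrightarrow> \<bar>LINT m|surf. r m * \<phi> m\<bar> \<le> K * l2norm (rgrad \<phi>)" and \<phi>: "sphere_smooth \<phi>"
  shows "action h r \<phi> \<le> K\<^sup>2 / c0"
proof -
  let ?G = "l2norm (rgrad \<phi>)"
  have "action h r \<phi> \<le> 2 * (K * ?G) - c0 * ?G\<^sup>2"
    unfolding action_def using K[OF \<phi>] energy_lower[OF \<phi>] by linarith
  also have "\<dots> = K\<^sup>2 / c0 - c0 * (?G - K / c0)\<^sup>2" using c0 by (simp add: power2_eq_square field_simps)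
  also have "\<dots> \<le> K\<^sup>2 / c0" using c0 by simp
  finally show ?thesis .
qed

lemma action_bdd: "bdd_above (action h r ` {\<phi>. sphere_smooth \<phi>})"
  using action_le[OF pairing_poincare] by (intro bdd_aboveI2) auto

lemma action_le_dual: "sphere_smooth \<phi> \<Longrightarrow> action h r \<phi> \<le> dual_energy h r"
  unfolding dual_energy_def by (intro cSUP_upper action_bdd) simp

lemma dual_energy_le: "(\<And>\<phi>. sphere_smooth \<phi> \<Longrightarrow> action h r \<phi> \<le> B) \<Longrightarrow> dual_energy h r \<le> B"
  unfolding dual_energy_def by (rule cSUP_least) (use sphere_smooth_const in auto)

lemma dual_energy_nonneg: "dual_energy h r \<ge> 0"
proof -
  have "action h r (\<lambda>m. 0) = 0"
  proof -
    have "energy h (\<lambda>m. 0) = (LINT m|surf. 0)" unfolding energy_def by (intro LINT_cong_S2) (simp add: rgrad_const)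
    then show ?thesis by (simp add: action_def)
  qed
  then show ?thesis using action_le_dual[OF sphere_smooth_const[of 0]] by simp
qed

lemma pairing_le: assumes \<phi>: "sphere_smooth \<phi>"
  shows "\<bar>LINT m|surf. r m * \<phi> m\<bar> \<le> sqrt (dual_energy h r) * sqrt (energy h \<phi>)"
proof -
  let ?P = "LINT m|surf. r m * \<phi> m" and ?E = "dual_energy h r" and ?N = "energy h \<phi>"
  have *: "2 * s * ?P - s\<^sup>2 * ?N \<le> ?E" for s
    using action_le_dual[OF sphere_smooth_cmult[OF \<phi>, of s]]
    by (simp add: action_def energy_cmult[OF \<phi>] mult.left_commute)
  have "?P\<^sup>2 \<le> ?E * ?N" by (rule quadratic_bound[OF * energy_nonneg])
  then have "sqrt (?P\<^sup>2) \<le> sqrt (?E * ?N)" by (rule real_sqrt_le_mono)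
  then show ?thesis by (simp add: real_sqrt_mult)
qed

lemma Hm1_norm_le: "sphere_Hm1_norm r \<le> ereal (sqrt (dual_energy h r) * sqrt c1)"
proof (rule sphere_Hm1_normI[OF r])
  show "0 \<le> sqrt (dual_energy h r) * sqrt c1" using dual_energy_nonneg c1 by simp
  fix \<phi> assume \<phi>: "sphere_smooth \<phi>"
  have "\<bar>LINT m|surf. r m * \<phi> m\<bar> \<le> sqrt (dual_energy h r) * sqrt (energy h \<phi>)" by (rule pairing_le[OF \<phi>])
  also have "\<dots> \<le> sqrt (dual_energy h r) * (sqrt c1 * l2norm (rgrad \<phi>))"
    using dual_energy_nonneg by (intro mult_left_mono sqrt_energy_le \<phi>) auto
  finally show "\<bar>LINT m|surf. r m * \<phi> m\<bar> \<le> sqrt (dual_energy h r) * sqrt c1 * l2norm (rgrad \<phi>)" by simp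
qed

lemma near_maximizer:
  assumes "\<delta> > 0" obtains \<phi> where "sphere_smooth \<phi>" "dual_energy h r - \<delta> \<le> action h r \<phi>"
proof -
  have "dual_energy h r - \<delta> < dual_energy h r" using assms by simp
  then obtain x where "x \<in> action h r ` {\<phi>. sphere_smooth \<phi>}" "dual_energy h r - \<delta> < x"
    unfolding dual_energy_def by (rule less_cSupE) (use sphere_smooth_const in auto)
  then show thesis by (auto intro!: that)
qed

text \<open>Completing the square: the deviation of the Dirichlet norm of \<open>\<phi>\<close> from the dual norm of \<open>r\<close> is paid for by the deficit \<open>\<delta>\<close>.\<close>

lemma near_maximizer_energy:
  assumes \<phi>: "sphere_smooth \<phi>" and nm: "dual_energy h r - \<delta> \<le> action h r \<phi>" and \<delta>: "\<delta> \<ge> 0"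
  shows "sqrt (energy h \<phi>) \<le> sqrt (dual_energy h r) + sqrt \<delta>"
proof -
  let ?E = "dual_energy h r" and ?N = "energy h \<phi>"
  have "?E - \<delta> + ?N \<le> 2 * (sqrt ?E * sqrt ?N)"
    using nm pairing_le[OF \<phi>] unfolding action_def by linarith
  moreover have "(sqrt ?N - sqrt ?E)\<^sup>2 = ?N + ?E - 2 * (sqrt ?E * sqrt ?N)"
    using energy_nonneg[of \<phi>] dual_energy_nonneg by (simp add: power2_diff)
  ultimately have "(sqrt ?N - sqrt ?E)\<^sup>2 \<le> \<delta>" by simp
  then have "sqrt ((sqrt ?N - sqrt ?E)\<^sup>2) \<le> sqrt \<delta>" by (rule real_sqrt_le_mono)
  then show ?thesis by simp
qed

text \<open>An exact maximizer satisfies the Euler-Lagrange equation \<open>- \<R> \<cdot> (h \<R> \<phi>) = r\<close> weakly.  A near-maximizer satisfies it up to \<open>\<surd>\<delta>\<close>, because the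
  action along \<open>\<phi> + s \<psi>\<close> is a parabola in \<open>s\<close> that stays below the supremum.\<close>

lemma first_variation_smooth:
  assumes \<phi>: "sphere_smooth \<phi>" and nm: "dual_energy h r - \<delta> \<le> action h r \<phi>" and \<psi>: "sphere_smooth \<psi>" and \<delta>: "\<delta> \<ge> 0"
  shows "\<bar>(LINT m|surf. r m * \<psi> m) - (LINT m|surf. h m * (rgrad \<phi> m \<bullet> rgrad \<psi> m))\<bar> \<le> sqrt \<delta> * (sqrt c1 * l2norm (rgrad \<psi>))"
proof -
  let ?D = "(LINT m|surf. r m * \<psi> m) - (LINT m|surf. h m * (rgrad \<phi> m \<bullet> rgrad \<psi> m))" and ?N = "energy h \<psi>"
  have *: "2 * s * ?D - s\<^sup>2 * ?N \<le> \<delta>" for s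
  proof -
    have "action h r (\<lambda>m. \<phi> m + s * \<psi> m) \<le> dual_energy h r"
      by (intro action_le_dual sphere_smooth_add \<phi> sphere_smooth_cmult \<psi>)
    moreover have "(LINT m|surf. r m * (\<phi> m + s * \<psi> m)) = (LINT m|surf. r m * \<phi> m) + s * (LINT m|surf. r m * \<psi> m)"
      using L2_mult_integrable[OF r L2_smooth[OF \<phi>]] L2_mult_integrable[OF r L2_smooth[OF \<psi>]]
      by (simp add: distrib_left mult.left_commute)
    ultimately show ?thesis using nm by (simp add: action_def energy_add[OF \<phi> \<psi>] algebra_simps)
  qed
  have "?D\<^sup>2 \<le> \<delta> * ?N" by (rule quadratic_bound[OF * energy_nonneg])
  then have "sqrt (?D\<^sup>2) \<le> sqrt (\<delta> * ?N)" by (rule real_sqrt_le_mono)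
  then have "\<bar>?D\<bar> \<le> sqrt \<delta> * sqrt ?N" by (simp add: real_sqrt_mult)
  also have "\<dots> \<le> sqrt \<delta> * (sqrt c1 * l2norm (rgrad \<psi>))" using \<delta> by (intro mult_left_mono sqrt_energy_le \<psi>) auto
  finally show ?thesis .
qed

lemma first_variation:
  assumes \<phi>: "sphere_smooth \<phi>" and nm: "dual_energy h r - \<delta> \<le> action h r \<phi>" and \<psi>: "L2 \<psi>" "has_weak_rgrad \<psi> G" and \<delta>: "\<delta> \<ge> 0"
  shows "\<bar>(LINT m|surf. r m * \<psi> m) - (LINT m|surf. h m * (rgrad \<phi> m \<bullet> G m))\<bar> \<le> sqrt \<delta> * (sqrt c1 * l2norm G)"
proof (rule LIMSEQ_le_const2)
  have V: "L2 (\<lambda>m. h m *\<^sub>R rgrad \<phi> m)" by (intro L2_scaleR_continuous L2_rgrad \<phi> cont)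
  show "(\<lambda>n. \<bar>(LINT m|surf. r m * smoothing n \<psi> m) - (LINT m|surf. h m * (rgrad \<phi> m \<bullet> rgrad (smoothing n \<psi>) m))\<bar>)
      \<longlonglongrightarrow> \<bar>(LINT m|surf. r m * \<psi> m) - (LINT m|surf. h m * (rgrad \<phi> m \<bullet> G m))\<bar>"
    using rgrad_smoothing_pairing_tendsto[OF \<psi> V]
    by (intro tendsto_rabs tendsto_diff smoothing_pairing_tendsto r \<psi>) simp
  have "\<bar>(LINT m|surf. r m * smoothing n \<psi> m) - (LINT m|surf. h m * (rgrad \<phi> m \<bullet> rgrad (smoothing n \<psi>) m))\<bar> \<le> sqrt \<delta> * (sqrt c1 * l2norm G)" for n
  proof -
    have "\<bar>(LINT m|surf. r m * smoothing n \<psi> m) - (LINT m|surf. h m * (rgrad \<phi> m \<bullet> rgrad (smoothing n \<psi>) m))\<bar>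
        \<le> sqrt \<delta> * (sqrt c1 * l2norm (rgrad (smoothing n \<psi>)))"
      by (intro first_variation_smooth \<phi> nm sphere_smooth_smoothing_L2 \<psi> \<delta>)
    also have "\<dots> \<le> sqrt \<delta> * (sqrt c1 * l2norm G)"
      using \<delta> c1 by (intro mult_left_mono rgrad_smoothing_l2norm \<psi>) auto
    finally show ?thesis .
  qed
  then show "\<exists>N. \<forall>n\<ge>N. \<bar>(LINT m|surf. r m * smoothing n \<psi> m) - (LINT m|surf. h m * (rgrad \<phi> m \<bullet> rgrad (smoothing n \<psi>) m))\<bar> \<le> sqrt \<delta> * (sqrt c1 * l2norm G)"
    by blast
qed

end

section \<open>The mean field potential\<close>

text \<open>The matrix of second moments of \<open>f\<close>, as a linear map.  Since \<open>|m \<times> m'|\<^sup>2 = 1 - (m \<cdot> m')\<^sup>2\<close>, it determines the mean field of \<open>f\<close> up to a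
  constant.\<close>

definition qop :: "(real^3 \<Rightarrow> real) \<Rightarrow> real^3 \<Rightarrow> real^3" where
  "qop f v = (LINT m|surf. (f m * (m \<bullet> v)) *\<^sub>R m)"

lemma integrable_scaleR_continuous:
  fixes w :: "real^3 \<Rightarrow> 'b::euclidean_space"
  assumes f: "integrable surf f" and w: "continuous_on S2 w" shows "integrable surf (\<lambda>m. f m *\<^sub>R w m)"
proof -
  obtain K where K0: "K > 0" and K: "\<And>m. norm m = 1 \<Longrightarrow> norm (w m) \<le> K"
    by (rule continuous_S2_bounded[OF w]) (rule that)
  show ?thesis
  proof (rule Bochner_Integration.integrable_bound)
    show "integrable surf (\<lambda>m. K * f m)" using f by simp
    show "(\<lambda>m. f m *\<^sub>R w m) \<in> borel_measurable surf" using measurable_surf_continuous[OF w] f by auto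
    show "AE m in surf. norm (f m *\<^sub>R w m) \<le> norm (K * f m)"
    proof (rule AE_I2)
      fix m assume "m \<in> space surf"
      then show "norm (f m *\<^sub>R w m) \<le> norm (K * f m)"
        using mult_left_mono[OF K[of m], of "\<bar>f m\<bar>"] K0 by (simp add: abs_mult mult.commute)
    qed
  qed
qed

lemma qop_integrable: "integrable surf f \<Longrightarrow> integrable surf (\<lambda>m. (f m * (m \<bullet> v)) *\<^sub>R m)"
  using integrable_scaleR_continuous[of f "\<lambda>m. (m \<bullet> v) *\<^sub>R m"] by (simp add: continuous_intros)

lemma qop_inner:
  assumes f: "integrable surf f" shows "u \<bullet> qop f v = (LINT m|surf. f m * ((m \<bullet> v) * (m \<bullet> u)))"
proof -
  have "u \<bullet> qop f v = (LINT m|surf. u \<bullet> ((f m * (m \<bullet> v)) *\<^sub>R m))"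
    unfolding qop_def by (rule integral_inner_right[symmetric]) (rule qop_integrable[OF f])
  then show ?thesis by (simp add: inner_commute mult_ac)
qed

lemma qop_symmetric: "integrable surf f \<Longrightarrow> u \<bullet> qop f v = qop f u \<bullet> v"
  unfolding inner_commute[of "qop f u" v] by (simp add: qop_inner mult_ac)

lemma qop_linear: assumes f: "integrable surf f" shows "linear (qop f)"
proof
  show "qop f (x + y) = qop f x + qop f y" for x y
    unfolding qop_def using qop_integrable[OF f]
    by (simp add: inner_add_right distrib_left scaleR_add_left)
  show "qop f (c *\<^sub>R x) = c *\<^sub>R qop f x" for c x
    unfolding qop_def integral_scaleR_right[symmetric] by (simp add: mult_ac)
qed

lemma qop_add: "integrable surf f \<Longrightarrow> integrable surf g \<Longrightarrow> qop (\<lambda>m. f m + g m) v = qop f v + qop g v"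
  unfolding qop_def using qop_integrable[of f v] qop_integrable[of g v]
  by (simp add: distrib_right scaleR_add_left)

lemma qop_cmult: "qop (\<lambda>m. c * f m) v = c *\<^sub>R qop f v"
  unfolding qop_def integral_scaleR_right[symmetric] by (simp add: mult_ac)

lemma qop_diff: "integrable surf f \<Longrightarrow> integrable surf g \<Longrightarrow> qop (\<lambda>m. f m - g m) v = qop f v - qop g v"
  unfolding qop_def using qop_integrable[of f v] qop_integrable[of g v]
  by (simp add: left_diff_distrib scaleR_diff_left)

lemma norm_qop_le:
  assumes f: "L2 f" shows "norm (qop f v) \<le> sqrt area * l2norm f * norm v"
proof -
  have "norm (qop f v) \<le> (LINT m|surf. norm ((f m * (m \<bullet> v)) *\<^sub>R m))"
    unfolding qop_def by (rule integral_norm_bound)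
  also have "\<dots> \<le> (LINT m|surf. \<bar>f m\<bar> * norm v)"
  proof (rule integral_mono)
    show "integrable surf (\<lambda>m. norm ((f m * (m \<bullet> v)) *\<^sub>R m))" using qop_integrable[OF L2_integrable[OF f]] by (rule integrable_norm)
    show "integrable surf (\<lambda>m. \<bar>f m\<bar> * norm v)" using L2_integrable[OF f] by auto
    fix m assume "m \<in> space surf"
    then show "norm ((f m * (m \<bullet> v)) *\<^sub>R m) \<le> \<bar>f m\<bar> * norm v"
      using Cauchy_Schwarz_ineq2[of m v] by (auto simp: abs_mult intro!: mult_left_mono)
  qed
  also have "\<dots> = (LINT m|surf. 1 * \<bar>f m\<bar>) * norm v" by simp
  also have "(LINT m|surf. 1 * \<bar>f m\<bar>) \<le> l2norm (\<lambda>m. 1 :: real) * l2norm (\<lambda>m. \<bar>f m\<bar>)"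
  proof -
    have "L2 (\<lambda>m. \<bar>f m\<bar>)" using f by (auto simp: L2_def)
    from L2_Cauchy_Schwarz_real[OF L2_const this, of 1] show ?thesis by linarith
  qed
  also have "l2norm (\<lambda>m. 1 :: real) * l2norm (\<lambda>m. \<bar>f m\<bar>) = sqrt area * l2norm f"
    by (simp only: l2norm_const) (simp add: l2norm_def)
  finally show ?thesis by (simp add: mult_right_mono)
qed

lemma norm_cross3_unit: "norm m = 1 \<Longrightarrow> norm m' = 1 \<Longrightarrow> (norm (cross3 m m'))\<^sup>2 = 1 - (m \<bullet> m')\<^sup>2"
  using norm_cross_dot[of m m'] by simp

lemma mean_field_eq:
  assumes f: "integrable surf f" and m: "norm m = 1"
  shows "mean_field \<alpha> f m = \<alpha> * ((LINT m|surf. f m) - m \<bullet> qop f m)"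
proof -
  have i: "integrable surf (\<lambda>m'. f m' * ((m' \<bullet> m) * (m' \<bullet> m)))"
    using integrable_mult_continuous[of "\<lambda>m'. (m' \<bullet> m) * (m' \<bullet> m)", OF _ f] by (simp add: continuous_intros mult.commute)
  have "(LINT m'|surf. (norm (cross3 m m'))\<^sup>2 * f m') = (LINT m'|surf. f m' - f m' * ((m' \<bullet> m) * (m' \<bullet> m)))"
  proof (rule LINT_cong_S2)
    fix m' :: "real^3" assume m': "norm m' = 1"
    show "(norm (cross3 m m'))\<^sup>2 * f m' = f m' - f m' * ((m' \<bullet> m) * (m' \<bullet> m))"
      unfolding norm_cross3_unit[OF m m'] by (simp add: power2_eq_square inner_commute algebra_simps)
  qed
  also have "\<dots> = (LINT m|surf. f m) - m \<bullet> qop f m" using f i by (simp add: qop_inner[OF f])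
  finally show ?thesis by (simp add: mean_field_def)
qed

lemma sphere_smooth_quadratic:
  assumes "linear K" shows "sphere_smooth (\<lambda>x. x \<bullet> K x)"
proof -
  have "bounded_linear (\<lambda>x. K x $ i)" for i
    using bounded_linear_compose[OF bounded_linear_vec_nth, of K i] assms by (simp add: linear_linear)
  then show ?thesis unfolding inner_vec_def
    by (simp, intro sphere_smooth_sum sphere_smooth_mult sphere_smooth_component sphere_smooth_linear) auto
qed

lemma sphere_smooth_mean_field:
  assumes f: "integrable surf f" shows "sphere_smooth (mean_field \<alpha> f)"
  by (rule sphere_smooth_cong[OF mean_field_eq[OF f, symmetric]])
    (auto intro!: sphere_smooth_cmult sphere_smooth_diff sphere_smooth_const sphere_smooth_quadratic qop_linear f)

lemma rgrad_mean_field: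
  assumes f: "integrable surf f" and m: "norm m = 1"
  shows "rgrad (mean_field \<alpha> f) m = (- 2 * \<alpha>) *\<^sub>R cross3 m (qop f m)"
proof -
  have q: "(qop f has_derivative qop f) (at m)"
    using qop_linear[OF f] by (intro bounded_linear_imp_has_derivative) (simp add: linear_linear)
  have "((\<lambda>x. \<alpha> * ((LINT m|surf. f m) - x \<bullet> qop f x)) has_derivative (\<lambda>v. \<alpha> * (0 - (m \<bullet> qop f v + v \<bullet> qop f m)))) (at m)"
    by (intro has_derivative_mult_right has_derivative_diff has_derivative_const has_derivative_inner q has_derivative_ident)
  also have "(\<lambda>v. \<alpha> * (0 - (m \<bullet> qop f v + v \<bullet> qop f m))) = (\<lambda>v. ((- 2 * \<alpha>) *\<^sub>R qop f m) \<bullet> v)"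
    by (rule ext) (simp add: qop_symmetric[OF f, of m] inner_commute[of _ "qop f m"] algebra_simps)
  finally have "rgrad (\<lambda>x. \<alpha> * ((LINT m|surf. f m) - x \<bullet> qop f x)) m = cross3 m ((- 2 * \<alpha>) *\<^sub>R qop f m)"
    using m by (rule rgrad_ambient(2))
  moreover have "rgrad (mean_field \<alpha> f) m = rgrad (\<lambda>x. \<alpha> * ((LINT m|surf. f m) - x \<bullet> qop f x)) m"
    using m by (intro rgrad_cong_S2 mean_field_eq f)
  ultimately show ?thesis by (simp add: cross_mult_right)
qed

lemma norm_cross3_le: "norm (cross3 x y) \<le> norm x * norm y"
proof (rule power2_le_imp_le)
  have "a \<le> c" if "a + b\<^sup>2 = c" for a b c :: real using that zero_le_power2[of b] by linarith
  then show "(norm (cross3 x y))\<^sup>2 \<le> (norm x * norm y)\<^sup>2" using norm_cross_dot[of x y] .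
qed simp

section \<open>Equilibria\<close>

definition partition_function :: "real \<Rightarrow> real" where
  "partition_function \<eta> = (LINT m|surf. exp (\<eta> * (m \<bullet> axis 1 1)\<^sup>2))"

lemma exp_quadratic_continuous: "continuous_on S (\<lambda>m. exp (\<eta> * (m \<bullet> n)\<^sup>2))"
  by (intro continuous_intros)

lemma orthogonal_exists_unit:
  fixes a b :: "real^3"
  assumes "norm a = 1" "norm b = 1" shows "\<exists>Q. orthogonal_transformation Q \<and> Q a = b"
proof -
  have "norm a = norm b" using assms by simp
  then show ?thesis by (rule orthogonal_transformation_exists) blast
qed

text \<open>Rotation invariance of the surface measure makes the choice of the axis immaterial.\<close>

lemma partition_function_eq:
  assumes n: "norm n = 1" shows "(LINT m|surf. exp (\<eta> * (m \<bullet> n)\<^sup>2)) = partition_function \<eta>"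
proof -
  obtain Q :: "real^3 \<Rightarrow> real^3" where Q: "orthogonal_transformation Q" "Q n = axis 1 1"
    using orthogonal_exists_unit[OF n norm_axis_1[of "1 :: 3"]] by blast
  have "partition_function \<eta> = (LINT m|surf. exp (\<eta> * (Q m \<bullet> axis 1 1)\<^sup>2))"
    unfolding partition_function_def
    by (rule LINT_orthogonal[OF Q(1), symmetric]) (intro integrable_surf_continuous exp_quadratic_continuous)
  also have "\<dots> = (LINT m|surf. exp (\<eta> * (m \<bullet> n)\<^sup>2))"
    using Q by (simp add: Q(2)[symmetric] orthogonal_transformation_def)
  finally show ?thesis by simp
qed

lemma partition_function_pos: "partition_function \<eta> > 0"
proof -
  have "(LINT m|surf. exp (- \<bar>\<eta>\<bar>)) \<le> partition_function \<eta>"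
    unfolding partition_function_def
  proof (rule integral_mono)
    fix m :: "real^3" assume "m \<in> space surf"
    then have "\<bar>m \<bullet> axis 1 1\<bar> \<le> 1" using Cauchy_Schwarz_ineq2[of m "axis 1 1"] by simp
    then have "(m \<bullet> axis 1 1)\<^sup>2 \<le> 1" by (simp add: abs_square_le_1)
    then have "\<bar>\<eta>\<bar> * (m \<bullet> axis 1 1)\<^sup>2 \<le> \<bar>\<eta>\<bar> * 1" by (intro mult_left_mono) auto
    moreover have "- (\<bar>\<eta>\<bar> * (m \<bullet> axis 1 1)\<^sup>2) \<le> \<eta> * (m \<bullet> axis 1 1)\<^sup>2"
      using mult_right_mono[of "- \<bar>\<eta>\<bar>" \<eta> "(m \<bullet> axis 1 1)\<^sup>2"] by simp
    ultimately show "exp (- \<bar>\<eta>\<bar>) \<le> exp (\<eta> * (m \<bullet> axis 1 1)\<^sup>2)" by simp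
  qed (auto intro: integrable_surf_continuous exp_quadratic_continuous)
  moreover have "(LINT m|surf. exp (- \<bar>\<eta>\<bar>)) > 0" using area_pos by simp
  ultimately show ?thesis by linarith
qed

lemma equilibrium_eq: "norm n = 1 \<Longrightarrow> equilibrium \<eta> n m = exp (\<eta> * (m \<bullet> n)\<^sup>2) / partition_function \<eta>"
  by (simp add: equilibrium_def partition_function_eq)

lemma equilibrium_fun_eq: "norm n = 1 \<Longrightarrow> equilibrium \<eta> n = (\<lambda>m. exp (\<eta> * (m \<bullet> n)\<^sup>2) / partition_function \<eta>)"
  by (rule ext) (rule equilibrium_eq)

lemma equilibrium_continuous: "norm n = 1 \<Longrightarrow> continuous_on S (equilibrium \<eta> n)"
  using partition_function_pos[of \<eta>] by (auto simp: equilibrium_fun_eq intro!: continuous_intros)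

lemma equilibrium_integral: "norm n = 1 \<Longrightarrow> (LINT m|surf. equilibrium \<eta> n m) = 1"
  using partition_function_pos[of \<eta>] by (simp add: equilibrium_eq partition_function_eq)

lemma equilibrium_pos: "norm n = 1 \<Longrightarrow> equilibrium \<eta> n m > 0"
  using partition_function_pos[of \<eta>] by (simp add: equilibrium_eq)

lemma sphere_smooth_exp_quadratic: "sphere_smooth (\<lambda>m. exp (\<eta> * (m \<bullet> n)\<^sup>2))"
  by (intro sphere_smooth_exp sphere_smooth_cmult sphere_smooth_power sphere_smooth_inner)

lemma equilibrium_smooth: "norm n = 1 \<Longrightarrow> sphere_smooth (equilibrium \<eta> n)"
  using sphere_smooth_cmult[OF sphere_smooth_exp_quadratic, of "inverse (partition_function \<eta>)" \<eta> n]
  by (simp add: equilibrium_fun_eq divide_inverse mult.commute)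

lemma equilibrium_inverse_smooth: "norm n = 1 \<Longrightarrow> sphere_smooth (\<lambda>m. 1 / equilibrium \<eta> n m)"
  using sphere_smooth_cmult[OF sphere_smooth_exp_quadratic, of "partition_function \<eta>" "- \<eta>" n]
  by (simp add: equilibrium_fun_eq exp_minus divide_inverse mult.commute)

lemma square_inner_diff:
  fixes m m' n n' :: "real^3"
  assumes "norm m = 1" "norm m' = 1" "norm n = 1" "norm n' = 1"
  shows "\<bar>(m \<bullet> n)\<^sup>2 - (m' \<bullet> n')\<^sup>2\<bar> \<le> 2 * (norm (m - m') + norm (n - n'))"
proof -
  have "\<bar>m \<bullet> n - m' \<bullet> n'\<bar> = \<bar>(m - m') \<bullet> n + m' \<bullet> (n - n')\<bar>" by (simp add: inner_diff_left inner_diff_right)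
  also have "\<dots> \<le> norm (m - m') * norm n + norm m' * norm (n - n')"
    using Cauchy_Schwarz_ineq2[of "m - m'" n] Cauchy_Schwarz_ineq2[of m' "n - n'"] by linarith
  finally have 1: "\<bar>m \<bullet> n - m' \<bullet> n'\<bar> \<le> norm (m - m') + norm (n - n')" using assms by simp
  have 2: "\<bar>m \<bullet> n + m' \<bullet> n'\<bar> \<le> 2"
    using inner_unit_bounds[OF assms(1,3)] inner_unit_bounds[OF assms(2,4)] by linarith
  have "\<bar>(m \<bullet> n)\<^sup>2 - (m' \<bullet> n')\<^sup>2\<bar> = \<bar>m \<bullet> n + m' \<bullet> n'\<bar> * \<bar>m \<bullet> n - m' \<bullet> n'\<bar>"
    by (simp add: abs_mult[symmetric] power2_eq_square algebra_simps)
  also have "\<dots> \<le> 2 * (norm (m - m') + norm (n - n'))" using 1 2 by (intro mult_mono) auto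
  finally show ?thesis .
qed

lemma equilibrium_log_lipschitz:
  assumes "norm m = 1" "norm m' = 1" "norm n = 1" "norm n' = 1"
  shows "equilibrium \<eta> n m \<le> exp (2 * \<bar>\<eta>\<bar> * (norm (m - m') + norm (n - n'))) * equilibrium \<eta> n' m'"
proof -
  have "\<eta> * (m \<bullet> n)\<^sup>2 - \<eta> * (m' \<bullet> n')\<^sup>2 \<le> \<bar>\<eta>\<bar> * \<bar>(m \<bullet> n)\<^sup>2 - (m' \<bullet> n')\<^sup>2\<bar>"
    unfolding right_diff_distrib[symmetric] abs_mult[symmetric] by simp
  also have "\<dots> \<le> \<bar>\<eta>\<bar> * (2 * (norm (m - m') + norm (n - n')))"
    by (intro mult_left_mono square_inner_diff assms) auto
  finally have "\<eta> * (m \<bullet> n)\<^sup>2 \<le> 2 * \<bar>\<eta>\<bar> * (norm (m - m') + norm (n - n')) + \<eta> * (m' \<bullet> n')\<^sup>2" by (simp add: algebra_simps)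
  then have "exp (\<eta> * (m \<bullet> n)\<^sup>2) \<le> exp (2 * \<bar>\<eta>\<bar> * (norm (m - m') + norm (n - n'))) * exp (\<eta> * (m' \<bullet> n')\<^sup>2)"
    by (simp add: exp_add[symmetric])
  then show ?thesis using partition_function_pos[of \<eta>] assms by (simp add: equilibrium_eq divide_right_mono)
qed

lemma weight_equilibrium:
  assumes n: "norm n = 1" shows "weight (equilibrium \<eta> n) (exp (- \<bar>\<eta>\<bar>) / partition_function \<eta>) (exp \<bar>\<eta>\<bar> / partition_function \<eta>)"
proof
  show "continuous_on S2 (equilibrium \<eta> n)" by (rule equilibrium_continuous[OF n])
  show "0 < exp (- \<bar>\<eta>\<bar>) / partition_function \<eta>" using partition_function_pos by simp
  fix m :: "real^3" assume m: "norm m = 1"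
  have "\<bar>m \<bullet> n\<bar> \<le> 1" using inner_unit_bounds[OF m n] by (simp add: abs_le_iff)
  then have "(m \<bullet> n)\<^sup>2 \<le> 1" by (simp add: abs_square_le_1)
  then have "\<bar>\<eta> * (m \<bullet> n)\<^sup>2\<bar> \<le> \<bar>\<eta>\<bar>" by (simp add: abs_mult mult_left_le)
  then show "exp (- \<bar>\<eta>\<bar>) / partition_function \<eta> \<le> equilibrium \<eta> n m" "equilibrium \<eta> n m \<le> exp \<bar>\<eta>\<bar> / partition_function \<eta>"
    using partition_function_pos[of \<eta>] by (auto simp: equilibrium_eq[OF n] intro!: divide_right_mono)
qed

text \<open>The gradient of the Euler-Lagrange equation \<open>ln h + U h = const\<close>.\<close>

lemma critical_point_rgrad:
  assumes c: "critical_point \<alpha> (equilibrium \<eta> n)" and n: "norm n = 1" and m: "norm m = 1"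
  shows "rgrad (equilibrium \<eta> n) m = - equilibrium \<eta> n m *\<^sub>R rgrad (mean_field \<alpha> (equilibrium \<eta> n)) m"
proof -
  let ?h = "equilibrium \<eta> n" and ?U = "mean_field \<alpha> (equilibrium \<eta> n)"
  have ih: "integrable surf ?h" by (intro integrable_surf_continuous equilibrium_continuous n)
  have sU: "sphere_smooth ?U" by (rule sphere_smooth_mean_field[OF ih])
  obtain k where k: "\<And>m. norm m = 1 \<Longrightarrow> ln (?h m) + ?U m = k" using c by (auto simp: critical_point_def)
  have h: "?h m = exp (k - ?U m)" if "norm m = 1" for m
    using k[OF that] equilibrium_pos[OF n, of \<eta> m] by (metis add_diff_cancel_right' exp_ln)
  have "rgrad ?h m = rgrad (\<lambda>m. exp (k - ?U m)) m" by (rule rgrad_cong_S2[OF h m])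
  also have "\<dots> = exp (k - ?U m) *\<^sub>R rgrad (\<lambda>m. k - ?U m) m"
    by (intro rgrad_exp sphere_smooth_diff sphere_smooth_const sU m)
  also have "rgrad (\<lambda>m. k - ?U m) m = - rgrad ?U m"
    by (simp add: rgrad_diff[OF sphere_smooth_const sU m] rgrad_const[OF m])
  finally show ?thesis by (simp add: h[OF m])
qed

subsection \<open>Rotation invariance\<close>

lemma norm_cross3_orthogonal:
  assumes "orthogonal_transformation Q" shows "norm (cross3 (Q x) (Q y)) = norm (cross3 x y)"
proof -
  have i: "Q x \<bullet> Q y = x \<bullet> y" "norm (Q x) = norm x" "norm (Q y) = norm y"
    using assms by (simp_all add: orthogonal_transformation_norm) (simp add: orthogonal_transformation_def)
  have "(norm (cross3 (Q x) (Q y)))\<^sup>2 = (norm (cross3 x y))\<^sup>2"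
    using norm_cross_dot[of "Q x" "Q y"] norm_cross_dot[of x y] unfolding i by linarith
  then show ?thesis by (rule power2_eq_imp_eq) auto
qed

lemma L2_orthogonal:
  fixes f :: "real^3 \<Rightarrow> real"
  assumes Q: "orthogonal_transformation Q" and f: "L2 f" shows "L2 (\<lambda>m. f (Q m))"
proof -
  interpret near_isometry Q 1 1
    using Q by unfold_locales (auto simp: orthogonal_transformation intro: linear_add linear_scale)
  have "L2 (\<lambda>m. f (sgn (Q m)))" by (rule L2_comp[OF f])
  also have "?this \<longleftrightarrow> ?thesis"
    using Q by (intro L2_cong_S2) (auto simp: orthogonal_transformation sgn_div_norm)
  finally show ?thesis .
qed

lemma mean_field_orthogonal:
  assumes Q: "orthogonal_transformation Q" and f: "integrable surf f"
  shows "mean_field \<alpha> (\<lambda>m. f (Q m)) m = mean_field \<alpha> f (Q m)"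
proof -
  have "(LINT m'|surf. (norm (cross3 (Q m) (Q m')))\<^sup>2 * f (Q m')) = (LINT m'|surf. (norm (cross3 (Q m) m'))\<^sup>2 * f m')"
    by (rule LINT_orthogonal[OF Q]) (intro integrable_mult_continuous f continuous_intros continuous_on_cross)
  then show ?thesis by (simp add: mean_field_def norm_cross3_orthogonal[OF Q])
qed

lemma equilibrium_orthogonal:
  assumes Q: "orthogonal_transformation Q" and n: "norm n = 1"
  shows "equilibrium \<eta> (Q n) (Q m) = equilibrium \<eta> n m"
  using Q n by (simp add: equilibrium_eq orthogonal_transformation_norm[OF Q]) (simp add: orthogonal_transformation_def)

lemma critical_point_rotate:
  assumes c: "critical_point \<alpha> (equilibrium \<eta> n0)" and n0: "norm n0 = 1" and n: "norm n = 1"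
  shows "critical_point \<alpha> (equilibrium \<eta> n)"
proof -
  obtain Q :: "real^3 \<Rightarrow> real^3" where Q: "orthogonal_transformation Q" "Q n = n0"
    using orthogonal_exists_unit[OF n n0] by blast
  have ih: "integrable surf (equilibrium \<eta> n0)" by (intro integrable_surf_continuous equilibrium_continuous n0)
  have h: "equilibrium \<eta> n = (\<lambda>m. equilibrium \<eta> n0 (Q m))"
    using equilibrium_orthogonal[OF Q(1) n] by (auto simp: Q(2))
  have "mean_field \<alpha> (equilibrium \<eta> n) m = mean_field \<alpha> (equilibrium \<eta> n0) (Q m)" for m
    unfolding h by (rule mean_field_orthogonal[OF Q(1) ih])
  moreover obtain k where "\<And>m. norm m = 1 \<Longrightarrow> ln (equilibrium \<eta> n0 m) + mean_field \<alpha> (equilibrium \<eta> n0) m = k"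
    using c by (auto simp: critical_point_def)
  ultimately show ?thesis unfolding critical_point_def
    by (intro exI[of _ k]) (auto simp: h orthogonal_transformation_norm[OF Q(1)])
qed

lemma stable_point_rotate:
  assumes s: "stable_point \<alpha> (equilibrium \<eta> n0)" and n0: "norm n0 = 1" and n: "norm n = 1"
  shows "stable_point \<alpha> (equilibrium \<eta> n)"
  unfolding stable_point_def sphere_L2_iff
proof (intro allI impI)
  fix \<phi> :: "real^3 \<Rightarrow> real" assume "L2 \<phi> \<and> (LINT m|surf. \<phi> m) = 0"
  then have \<phi>: "L2 \<phi>" "(LINT m|surf. \<phi> m) = 0" by auto
  obtain P :: "real^3 \<Rightarrow> real^3" where P: "orthogonal_transformation P" "P n0 = n"
    using orthogonal_exists_unit[OF n0 n] by blast
  define \<psi> where "\<psi> m = \<phi> (P m)" for m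
  have L\<psi>: "L2 \<psi>" unfolding \<psi>_def[abs_def] by (rule L2_orthogonal[OF P(1) \<phi>(1)])
  have "(LINT m|surf. \<psi> m) = 0" unfolding \<psi>_def using LINT_orthogonal[OF P(1) L2_integrable[OF \<phi>(1)]] \<phi>(2) by simp
  with s L\<psi> have "0 \<le> (LINT m|surf. (\<psi> m / equilibrium \<eta> n0 m + mean_field \<alpha> \<psi> m) * \<psi> m)"
    by (simp add: stable_point_def sphere_L2_iff)
  also have "\<dots> = (LINT m|surf. (\<phi> (P m) / equilibrium \<eta> n (P m) + mean_field \<alpha> \<phi> (P m)) * \<phi> (P m))"
    using equilibrium_orthogonal[OF P(1) n0] mean_field_orthogonal[OF P(1) L2_integrable[OF \<phi>(1)]]
    by (simp add: \<psi>_def[abs_def] P(2))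
  also have "\<dots> = (LINT m|surf. (\<phi> m / equilibrium \<eta> n m + mean_field \<alpha> \<phi> m) * \<phi> m)"
  proof (rule LINT_orthogonal[OF P(1)])
    have "L2 (\<lambda>m. (1 / equilibrium \<eta> n m) * \<phi> m + mean_field \<alpha> \<phi> m)"
      by (intro L2_add L2_mult_continuous \<phi> sphere_smooth_continuous equilibrium_inverse_smooth n L2_smooth sphere_smooth_mean_field L2_integrable)
    then show "integrable surf (\<lambda>m. (\<phi> m / equilibrium \<eta> n m + mean_field \<alpha> \<phi> m) * \<phi> m)"
      using L2_mult_integrable[OF _ \<phi>(1)] by simp
  qed
  finally show "0 \<le> (LINT m|surf. (\<phi> m / equilibrium \<eta> n m + mean_field \<alpha> \<phi> m) * \<phi> m)" .
qed

section \<open>The linearized operator\<close>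

text \<open>The flux of the linearized operator, \<open>\<G> r = \<R> \<cdot> (lin_flux)\<close>, with the gradient \<open>G\<close> of \<open>r\<close> as a separate argument so that it can be a weak
  gradient.\<close>

definition lin_flux :: "real \<Rightarrow> (real^3 \<Rightarrow> real) \<Rightarrow> (real^3 \<Rightarrow> real) \<Rightarrow> (real^3 \<Rightarrow> real^3) \<Rightarrow> real^3 \<Rightarrow> real^3" where
  "lin_flux \<alpha> h r G m = G m + h m *\<^sub>R rgrad (mean_field \<alpha> r) m + r m *\<^sub>R rgrad (mean_field \<alpha> h) m"

text \<open>At a critical point \<open>\<R> h = - h \<R> U h\<close>, hence the flux divided by \<open>h\<close> is the gradient of \<open>r/h + U r\<close>, the first variation of the free
  energy.\<close>

lemma lin_flux_weak_gradient:
  assumes c: "critical_point \<alpha> (equilibrium \<eta> n)" and n: "norm n = 1" and r: "L2 r" and G: "has_weak_rgrad r G"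
  shows "has_weak_rgrad (\<lambda>m. (1 / equilibrium \<eta> n m) * r m + mean_field \<alpha> r m)
    (\<lambda>m. (1 / equilibrium \<eta> n m) *\<^sub>R lin_flux \<alpha> (equilibrium \<eta> n) r G m)"
proof -
  let ?h = "equilibrium \<eta> n" and ?U = "mean_field \<alpha> r"
  note si = equilibrium_inverse_smooth[OF n, of \<eta>] and sh = equilibrium_smooth[OF n, of \<eta>]
  have sU: "sphere_smooth ?U" by (intro sphere_smooth_mean_field L2_integrable r)
  have w: "has_weak_rgrad (\<lambda>m. (1 / ?h m) * r m + ?U m) (\<lambda>m. ((1 / ?h m) *\<^sub>R G m + r m *\<^sub>R rgrad (\<lambda>m. 1 / ?h m) m) + rgrad ?U m)"
    by (intro has_weak_rgrad_add has_weak_rgrad_mult r G si has_weak_rgrad_smooth sU L2_smooth L2_mult_continuous sphere_smooth_continuous)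
  show ?thesis
  proof (rule has_weak_rgrad_cong[OF w refl])
    fix m :: "real^3" assume m: "norm m = 1"
    have hp: "?h m > 0" by (rule equilibrium_pos[OF n])
    have "0 = rgrad (\<lambda>m. (1 / ?h m) * ?h m) m"
    proof -
      have "(\<lambda>m. (1 / ?h m) * ?h m) = (\<lambda>m. 1)" using equilibrium_pos[OF n, of \<eta>] by (auto simp: less_imp_neq[symmetric])
      then show ?thesis by (simp only: rgrad_const[OF m])
    qed
    also have "\<dots> = (1 / ?h m) *\<^sub>R rgrad ?h m + ?h m *\<^sub>R rgrad (\<lambda>m. 1 / ?h m) m"
      by (rule rgrad_mult[OF si sh m])
    finally have "?h m *\<^sub>R rgrad (\<lambda>m. 1 / ?h m) m = rgrad (mean_field \<alpha> ?h) m"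
      using hp by (simp add: critical_point_rgrad[OF c n m])
    then have "(1 / ?h m) *\<^sub>R (?h m *\<^sub>R rgrad (\<lambda>m. 1 / ?h m) m) = (1 / ?h m) *\<^sub>R rgrad (mean_field \<alpha> ?h) m" by simp
    then have "rgrad (\<lambda>m. 1 / ?h m) m = (1 / ?h m) *\<^sub>R rgrad (mean_field \<alpha> ?h) m" using hp by simp
    then show "((1 / ?h m) *\<^sub>R G m + r m *\<^sub>R rgrad (\<lambda>m. 1 / ?h m) m) + rgrad ?U m = (1 / ?h m) *\<^sub>R lin_flux \<alpha> ?h r G m"
      using hp by (simp add: lin_flux_def scaleR_add_right)
  qed
qed

text \<open>For an exact maximizer the right hand side equals \<open>\<integral> r (r/h + U r)\<close>, which is the second variation of the free energy at \<open>h\<close> in the direction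
  \<open>r\<close> and nonnegative by stability.  The constant \<open>K\<close> depends on the gradient of \<open>r\<close>, but it comes with \<open>\<surd>\<delta>\<close> and
  disappears as \<open>\<delta>\<close> tends to 0.\<close>

lemma lin_flux_dissipation:
  assumes c: "critical_point \<alpha> (equilibrium \<eta> n)" and st: "stable_point \<alpha> (equilibrium \<eta> n)" and n: "norm n = 1"
    and r: "L2 r" and mean: "(LINT m|surf. r m) = 0" and G: "has_weak_rgrad r G"
  shows "\<exists>K\<ge>0. \<forall>\<delta> \<phi>. 0 \<le> \<delta> \<longrightarrow> sphere_smooth \<phi> \<longrightarrow>
      dual_energy (equilibrium \<eta> n) r - \<delta> \<le> action (equilibrium \<eta> n) r \<phi> \<longrightarrow>
      - (sqrt \<delta> * K) \<le> (LINT m|surf. lin_flux \<alpha> (equilibrium \<eta> n) r G m \<bullet> rgrad \<phi> m)"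
proof -
  let ?h = "equilibrium \<eta> n"
  let ?F = "\<lambda>m. (1 / ?h m) *\<^sub>R lin_flux \<alpha> ?h r G m" and ?H = "\<lambda>m. (1 / ?h m) * r m + mean_field \<alpha> r m"
  define c1 where "c1 = exp \<bar>\<eta>\<bar> / partition_function \<eta>"
  interpret weight ?h "exp (- \<bar>\<eta>\<bar>) / partition_function \<eta>" c1 unfolding c1_def by (rule weight_equilibrium[OF n])
  interpret dual ?h "exp (- \<bar>\<eta>\<bar>) / partition_function \<eta>" c1 r by unfold_locales (rule r, rule mean)
  have LH: "L2 ?H"
    by (intro L2_add L2_mult_continuous r sphere_smooth_continuous equilibrium_inverse_smooth n L2_smooth sphere_smooth_mean_field L2_integrable)
  have w: "has_weak_rgrad ?H ?F" by (rule lin_flux_weak_gradient[OF c n r G])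
  have st': "0 \<le> (LINT m|surf. r m * ?H m)"
    using st r mean by (simp add: stable_point_def sphere_L2_iff mult.commute)
  show ?thesis
  proof (intro exI[of _ "sqrt c1 * l2norm ?F"] conjI allI impI)
    show "0 \<le> sqrt c1 * l2norm ?F" using c1 by simp
    fix \<delta> \<phi> assume \<delta>: "0 \<le> \<delta>" and \<phi>: "sphere_smooth \<phi>" and nm: "dual_energy ?h r - \<delta> \<le> action ?h r \<phi>"
    have "(LINT m|surf. ?h m * (rgrad \<phi> m \<bullet> ?F m)) = (LINT m|surf. lin_flux \<alpha> ?h r G m \<bullet> rgrad \<phi> m)"
    proof (rule LINT_cong_S2)
      fix m :: "real^3"
      show "?h m * (rgrad \<phi> m \<bullet> ?F m) = lin_flux \<alpha> ?h r G m \<bullet> rgrad \<phi> m"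
        using equilibrium_pos[OF n, of \<eta> m] by (simp add: inner_commute)
    qed
    then show "- (sqrt \<delta> * (sqrt c1 * l2norm ?F)) \<le> (LINT m|surf. lin_flux \<alpha> ?h r G m \<bullet> rgrad \<phi> m)"
      using first_variation[OF \<phi> nm LH w \<delta>] st' by linarith
  qed
qed

section \<open>The growth rate of the dual energy\<close>

text \<open>Adding constants to the test function does not change the action, so the Poincare inequality may be enforced.\<close>

lemma (in dual) near_maximizer_mean_zero:
  assumes "\<delta> > 0"
  shows "\<exists>\<phi>. sphere_smooth \<phi> \<and> dual_energy h r - \<delta> \<le> action h r \<phi> \<and> l2norm \<phi> \<le> l2norm (rgrad \<phi>)"
proof -
  obtain \<phi> where \<phi>: "sphere_smooth \<phi>" "dual_energy h r - \<delta> \<le> action h r \<phi>"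
    using near_maximizer[OF assms] by blast
  define a where "a = (LINT m|surf. \<phi> m) / area"
  define \<psi> where "\<psi> m = \<phi> m - a" for m
  have s: "sphere_smooth \<psi>" unfolding \<psi>_def by (intro sphere_smooth_diff \<phi> sphere_smooth_const)
  have R: "rgrad \<psi> m = rgrad \<phi> m" if "norm m = 1" for m
    unfolding \<psi>_def using that by (simp add: rgrad_diff[OF \<phi>(1) sphere_smooth_const] rgrad_const)
  have "(LINT m|surf. r m * \<psi> m) = (LINT m|surf. r m * \<phi> m)"
    unfolding \<psi>_def right_diff_distrib using L2_mult_integrable[OF r L2_smooth[OF \<phi>(1)]] L2_integrable[OF r] mean by simp
  moreover have "energy h \<psi> = energy h \<phi>" unfolding energy_def by (intro LINT_cong_S2) (simp add: R)
  ultimately have "action h r \<psi> = action h r \<phi>" by (simp add: action_def)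
  moreover have "l2norm \<psi> \<le> l2norm (rgrad \<psi>)"
    using poincare[OF \<phi>(1)] l2norm_cong_S2[of "rgrad \<psi>" "rgrad \<phi>"] R by (simp add: \<psi>_def[abs_def] a_def)
  ultimately show ?thesis using s \<phi>(2) by (intro exI[of _ \<psi>]) simp
qed

lemma rgrad_inner: "norm m = 1 \<Longrightarrow> rgrad (\<lambda>x. x \<bullet> p) m = cross3 m p"
proof (rule rgrad_ambient(2))
  show "((\<lambda>x. x \<bullet> p) has_derivative (\<lambda>v. p \<bullet> v)) (at m)"
    by (auto intro!: derivative_eq_intros simp: inner_commute)
qed

text \<open>Second moments of \<open>r\<close> are pairings of \<open>r\<close> with quadratic polynomials.\<close>

lemma (in dual) qop_dual_bound:
  "norm (qop r v) \<le> 2 * sqrt c1 * sqrt area * sqrt (dual_energy h r) * norm v"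
proof (cases "qop r v = 0")
  case True
  then show ?thesis using c1 dual_energy_nonneg area_pos by simp
next
  case False
  define p where "p = qop r v"
  let ?\<psi> = "\<lambda>m. (m \<bullet> v) * (m \<bullet> p)"
  have s: "sphere_smooth ?\<psi>" by (intro sphere_smooth_mult sphere_smooth_inner)
  have "l2norm (rgrad ?\<psi>) \<le> (2 * norm v * norm p) * sqrt area"
  proof (rule l2norm_le_bounded[OF L2_rgrad[OF s]])
    fix m :: "real^3" assume m: "norm m = 1"
    have "norm (rgrad ?\<psi> m) \<le> \<bar>m \<bullet> v\<bar> * norm (cross3 m p) + \<bar>m \<bullet> p\<bar> * norm (cross3 m v)"
      unfolding rgrad_mult[OF sphere_smooth_inner sphere_smooth_inner m] rgrad_inner[OF m]
      by (rule norm_triangle_le) simp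
    also have "\<dots> \<le> norm v * norm p + norm p * norm v"
      using Cauchy_Schwarz_ineq2[of m v] Cauchy_Schwarz_ineq2[of m p] norm_cross3_le[of m p] norm_cross3_le[of m v] m
      by (intro add_mono mult_mono) auto
    finally show "norm (rgrad ?\<psi> m) \<le> 2 * norm v * norm p" by (simp add: mult_ac)
  qed simp
  then have "sqrt (energy h ?\<psi>) \<le> sqrt c1 * ((2 * norm v * norm p) * sqrt area)"
    using sqrt_energy_le[OF s] mult_left_mono[of "l2norm (rgrad ?\<psi>)" _ "sqrt c1"] c1 by (meson less_imp_le order_trans real_sqrt_ge_zero)
  then have 1: "sqrt (dual_energy h r) * sqrt (energy h ?\<psi>) \<le> sqrt (dual_energy h r) * (sqrt c1 * ((2 * norm v * norm p) * sqrt area))"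
    using dual_energy_nonneg by (intro mult_left_mono) auto
  have "norm p * norm p = p \<bullet> qop r v" by (simp add: p_def dot_square_norm power2_eq_square)
  also have "\<dots> = (LINT m|surf. r m * ?\<psi> m)" by (rule qop_inner[OF L2_integrable[OF r]])
  also have "\<dots> \<le> sqrt (dual_energy h r) * (sqrt c1 * ((2 * norm v * norm p) * sqrt area))"
    using pairing_le[OF s] 1 by linarith
  also have "\<dots> = (2 * sqrt c1 * sqrt area * sqrt (dual_energy h r) * norm v) * norm p" by simp
  finally show ?thesis using False unfolding p_def[symmetric] by simp
qed

text \<open>The rotational gradient of a mean field is \<open>m\<close> times a linear map of \<open>m\<close>, like the flow field itself.  All fluxes that are
  proportional to \<open>r\<close> therefore combine into \<open>r m \<times> L m\<close> with this linear map \<open>L\<close>; the last summand is the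
  quadratic term of the equation.\<close>

definition transport_map :: "real \<Rightarrow> real^3^3 \<Rightarrow> real \<Rightarrow> (real^3 \<Rightarrow> real) \<Rightarrow> (real^3 \<Rightarrow> real) \<Rightarrow> real^3 \<Rightarrow> real^3" where
  "transport_map \<alpha> \<kappa> \<epsilon> F r v = \<kappa> *v v + (2 * \<alpha>) *\<^sub>R qop F v + (2 * \<alpha> * \<epsilon>) *\<^sub>R qop r v"

text \<open>The pairing of the time derivative of the remainder with \<open>\<phi>\<close>.  Here \<open>F\<close> is the sum of the correctors, while \<open>Y\<close> and \<open>B\<close> are the terms of the
  flux and of the time derivative that the expansion leaves uncancelled.\<close>

definition rate ::
  "real \<Rightarrow> real^3^3 \<Rightarrow> real \<Rightarrow> (real^3 \<Rightarrow> real) \<Rightarrow> (real^3 \<Rightarrow> real) \<Rightarrow> (real^3 \<Rightarrow> real^3) \<Rightarrow> (real^3 \<Rightarrow> real) \<Rightarrow>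
    (real^3 \<Rightarrow> real^3) \<Rightarrow> (real^3 \<Rightarrow> real) \<Rightarrow> (real^3 \<Rightarrow> real) \<Rightarrow> real" where
  "rate \<alpha> \<kappa> \<epsilon> h r G F Y B \<phi> =
     - (1 / \<epsilon>) * (LINT m|surf. lin_flux \<alpha> h r G m \<bullet> rgrad \<phi> m)
     - (LINT m|surf. (F m *\<^sub>R rgrad (mean_field \<alpha> r) m) \<bullet> rgrad \<phi> m)
     + (LINT m|surf. r m * (surface_grad \<phi> m \<bullet> transport_map \<alpha> \<kappa> \<epsilon> F r m))
     - \<epsilon> * (LINT m|surf. Y m \<bullet> rgrad \<phi> m) - \<epsilon> * (LINT m|surf. B m * \<phi> m)"

text \<open>The first term of the rate is harmless by dissipation, the mean field of \<open>r\<close> is bounded through its second moments, and the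
  transport term is an inner variation.  Only powers of \<open>S\<close>, the square root of the dual energy, appear; \<open>cq S\<close> bounds the second moments of
  \<open>r\<close>, and \<open>S / \<surd>c0\<close> the gradient of a near-maximizer.\<close>

lemma rate_bound:
  fixes n :: "real^3" and F r B :: "real^3 \<Rightarrow> real" and Y G :: "real^3 \<Rightarrow> real^3"
  assumes c: "critical_point \<alpha> (equilibrium \<eta> n)" and st: "stable_point \<alpha> (equilibrium \<eta> n)" and n: "norm n = 1"
    and r: "L2 r" and mean: "(LINT m|surf. r m) = 0" and G: "has_weak_rgrad r G"
    and \<alpha>: "\<alpha> \<ge> 0" and \<epsilon>: "\<epsilon> > 0"
    and F: "F \<in> borel_measurable surf" "\<And>m. norm m = 1 \<Longrightarrow> \<bar>F m\<bar> \<le> K" and K: "K \<ge> 0"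
    and Y: "Y \<in> borel_measurable surf" "\<And>m. norm m = 1 \<Longrightarrow> norm (Y m) \<le> KY" and KY: "KY \<ge> 0"
    and B: "B \<in> borel_measurable surf" "\<And>m. norm m = 1 \<Longrightarrow> \<bar>B m\<bar> \<le> KB" and KB: "KB \<ge> 0"
    and \<kappa>: "\<And>v. norm (\<kappa> *v v) \<le> K\<kappa> * norm v" and K\<kappa>: "K\<kappa> \<ge> 0" and e: "e > 0"
    and c0_def: "c0 = exp (- \<bar>\<eta>\<bar>) / partition_function \<eta>" and cq_def: "cq = 2 * sqrt (exp \<bar>\<eta>\<bar> / partition_function \<eta>) * sqrt area"
    and S_def: "S = sqrt (dual_energy (equilibrium \<eta> n) r)"
  shows "\<forall>\<^sub>F s in at_right 0. \<forall>\<phi>. sphere_smooth \<phi> \<longrightarrow>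
      dual_energy (equilibrium \<eta> n) r - s\<^sup>2 \<le> action (equilibrium \<eta> n) r \<phi> \<longrightarrow> l2norm \<phi> \<le> l2norm (rgrad \<phi>) \<longrightarrow>
      rate \<alpha> \<kappa> \<epsilon> (equilibrium \<eta> n) r G F Y B \<phi>
      \<le> K * (2 * \<alpha> * cq * S) * sqrt area * (S / sqrt c0)
        + (4 * \<bar>\<eta>\<bar> + 15) * (K\<kappa> + 2 * \<alpha> * K * area + 2 * \<alpha> * \<epsilon> * cq * S) * S\<^sup>2
        + \<epsilon> * (KY + KB) * sqrt area * (S / sqrt c0) + e"
proof -
  let ?h = "equilibrium \<eta> n"
  define c1 where "c1 = exp \<bar>\<eta>\<bar> / partition_function \<eta>"
  interpret weight ?h c0 c1 unfolding c1_def c0_def by (rule weight_equilibrium[OF n])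
  interpret dual ?h c0 c1 r by unfold_locales (rule r, rule mean)
  let ?E = "dual_energy ?h r"
  have S: "S \<ge> 0" "?E = S\<^sup>2" using dual_energy_nonneg by (auto simp: S_def)
  have cq: "cq \<ge> 0" using c1 area_pos unfolding cq_def c1_def[symmetric] by simp
  have LF: "L2 F" using L2_bound(1)[OF F(1) L2_const[of "1::real"], of K] F(2) by simp
  have LY: "L2 Y" using L2_bound(1)[OF Y(1) L2_const[of "1::real"], of KY] Y(2) by simp
  have LB: "L2 B" using L2_bound(1)[OF B(1) L2_const[of "1::real"], of KB] B(2) by simp
  have qr: "norm (qop r v) \<le> cq * S * norm v" for v
    using qop_dual_bound[of v] by (simp add: cq_def c1_def S_def)
  define \<beta> where "\<beta> = K\<kappa> + 2 * \<alpha> * K * area + 2 * \<alpha> * \<epsilon> * cq * S"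
  let ?L = "transport_map \<alpha> \<kappa> \<epsilon> F r"
  have pert: "perturbation ?L \<beta>"
  proof
    have q: "linear (qop F)" "linear (qop r)" using qop_linear L2_integrable LF r by auto
    show "?L (x + y) = ?L x + ?L y" for x y
      using q by (simp add: transport_map_def matrix_vector_right_distrib linear_add scaleR_add_right)
    show "?L (k *\<^sub>R x) = k *\<^sub>R ?L x" for k x
      using q by (simp add: transport_map_def matrix_vector_mult_scaleR linear_scale scaleR_add_right mult.commute)
    show "\<beta> \<ge> 0" unfolding \<beta>_def using K\<kappa> \<alpha> K area_pos \<epsilon> cq S by simp
    fix x
    have qF: "norm (qop F x) \<le> K * area * norm x"
    proof -
      have "l2norm F \<le> K * sqrt area" using F K by (intro l2norm_le_bounded LF) auto
      then have "sqrt area * l2norm F * norm x \<le> sqrt area * (K * sqrt area) * norm x"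
        using area_pos by (intro mult_right_mono mult_left_mono) auto
      also have "\<dots> = K * area * norm x" using area_pos by simp
      finally show ?thesis using norm_qop_le[OF LF, of x] by linarith
    qed
    have "norm (?L x) \<le> norm (\<kappa> *v x) + (2 * \<alpha>) * norm (qop F x) + (2 * \<alpha> * \<epsilon>) * norm (qop r x)"
      unfolding transport_map_def using \<alpha> \<epsilon>
      by (intro norm_triangle_le add_mono) (auto simp: abs_mult)
    also have "\<dots> \<le> K\<kappa> * norm x + (2 * \<alpha>) * (K * area * norm x) + (2 * \<alpha> * \<epsilon>) * (cq * S * norm x)"
      using \<alpha> \<epsilon> by (intro add_mono mult_left_mono \<kappa> qF qr) auto
    finally show "norm (?L x) \<le> \<beta> * norm x" by (simp add: \<beta>_def algebra_simps)
  qed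
  then interpret P: perturbation ?L \<beta> .
  define k0 where "k0 = 4 * \<bar>\<eta>\<bar> + 15"
  have k0: "k0 \<ge> 0" by (simp add: k0_def)
  define e' where "e' = e / (2 * (1 + S / sqrt c0))"
  have pos: "1 + S / sqrt c0 > 0" using S c0 by (simp add: add_pos_nonneg)
  have half: "e / (2 * d) * d = e / 2" if "d > 0" for d :: real using that by simp
  have e': "e' > 0" "e' * (1 + S / sqrt c0) = e / 2" unfolding e'_def using e pos half[OF pos] by simp_all
  have hL: "?h m \<le> exp (2 * \<bar>\<eta>\<bar> * norm (m - m')) * ?h m'" if "norm m = 1" "norm m' = 1" for m m'
    using equilibrium_log_lipschitz[OF that n n, of \<eta>] by simp
  obtain s0 where s0: "s0 > 0" "\<And>\<sigma> \<phi>. 0 < \<sigma> \<Longrightarrow> \<sigma> < s0 \<Longrightarrow> sphere_smooth \<phi> \<Longrightarrow> ?E - \<sigma>\<^sup>2 \<le> action ?h r \<phi> \<Longrightarrow>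
    (LINT m|surf. r m * (surface_grad \<phi> m \<bullet> ?L m)) \<le> k0 * \<beta> * energy ?h \<phi> + e' * (1 + l2norm (rgrad \<phi>))"
  proof -
    have "\<exists>s0>0. \<forall>\<sigma> \<phi>. 0 < \<sigma> \<and> \<sigma> < s0 \<and> sphere_smooth \<phi> \<and> ?E - \<sigma>\<^sup>2 \<le> 2 * (LINT m|surf. r m * \<phi> m) - energy ?h \<phi> \<longrightarrow>
      (LINT m|surf. r m * (surface_grad \<phi> m \<bullet> ?L m)) \<le> (2 * (2 * \<bar>\<eta>\<bar>) + 15) * \<beta> * energy ?h \<phi> + e' * (1 + l2norm (rgrad \<phi>))"
      using action_le_dual by (intro P.inner_variation r cont less_imp_le[OF h_pos] hL e') (auto simp: action_def)
    then show thesis using that unfolding action_def k0_def by auto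
  qed
  obtain K1 where K1: "K1 \<ge> 0" "\<And>\<delta> \<phi>. 0 \<le> \<delta> \<Longrightarrow> sphere_smooth \<phi> \<Longrightarrow> ?E - \<delta> \<le> action ?h r \<phi> \<Longrightarrow>
      - (sqrt \<delta> * K1) \<le> (LINT m|surf. lin_flux \<alpha> ?h r G m \<bullet> rgrad \<phi> m)"
    using lin_flux_dissipation[OF c st n r mean G] by blast
  define a where "a = K * (2 * \<alpha> * cq * S) * sqrt area + \<epsilon> * (KY + KB) * sqrt area"
  have a: "a \<ge> 0" unfolding a_def using K \<alpha> cq S area_pos \<epsilon> KY KB by simp
  define W where "W s = s * K1 / \<epsilon> + a * ((S + s) / sqrt c0) + k0 * \<beta> * (S + s)\<^sup>2 + e' * (1 + (S + s) / sqrt c0)" for s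
  have "(W \<longlongrightarrow> W 0) (at_right 0)"
    unfolding W_def using \<epsilon> c0 by (intro tendsto_intros) auto
  moreover have "W 0 < a * (S / sqrt c0) + k0 * \<beta> * S\<^sup>2 + e"
  proof -
    have "W 0 = a * (S / sqrt c0) + k0 * \<beta> * S\<^sup>2 + e' * (1 + S / sqrt c0)" by (simp add: W_def)
    moreover have "x + e / 2 < x + e" for x using e by simp
    ultimately show ?thesis unfolding e'(2) by (simp only:)
  qed
  ultimately have "\<forall>\<^sub>F s in at_right 0. W s < a * (S / sqrt c0) + k0 * \<beta> * S\<^sup>2 + e"
    by (rule order_tendstoD(2))
  moreover have "\<forall>\<^sub>F s in at_right 0. s \<in> {0<..<s0}" by (rule eventually_at_rightI[OF _ s0(1)])
  ultimately show ?thesis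
  proof (eventually_elim, intro allI impI)
    fix s \<phi>
    assume Ws: "W s < a * (S / sqrt c0) + k0 * \<beta> * S\<^sup>2 + e" and s: "s \<in> {0<..<s0}" and \<phi>: "sphere_smooth \<phi>"
      and nm: "?E - s\<^sup>2 \<le> action ?h r \<phi>" and mz: "l2norm \<phi> \<le> l2norm (rgrad \<phi>)"
    let ?G = "l2norm (rgrad \<phi>)"
    have s0': "0 \<le> s\<^sup>2" "0 < s" "s < s0" using s by auto
    have N: "sqrt (energy ?h \<phi>) \<le> S + s"
      using near_maximizer_energy[OF \<phi> nm s0'(1)] s0' by (simp add: S_def)
    have N2: "energy ?h \<phi> \<le> (S + s)\<^sup>2"
      using power_mono[OF N, of 2] energy_nonneg[of \<phi>] by simp
    have G: "?G \<le> (S + s) / sqrt c0"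
      using l2norm_rgrad_le[OF \<phi>] divide_right_mono[OF N, of "sqrt c0"] c0 by simp
    have LR: "L2 (rgrad \<phi>)" by (rule L2_rgrad[OF \<phi>])
    have bnd: "\<bar>LINT m|surf. V m \<bullet> rgrad \<phi> m\<bar> \<le> k * sqrt area * ?G"
      if V: "L2 V" "\<And>m. norm m = 1 \<Longrightarrow> norm (V m) \<le> k" and k: "k \<ge> 0" for V :: "real^3 \<Rightarrow> real^3" and k
    proof -
      have "l2norm V * ?G \<le> (k * sqrt area) * ?G" using l2norm_le_bounded[OF V k] by (intro mult_right_mono) auto
      then show ?thesis using L2_Cauchy_Schwarz[OF V(1) LR] by linarith
    qed
    have t1: "- (1 / \<epsilon>) * (LINT m|surf. lin_flux \<alpha> ?h r G m \<bullet> rgrad \<phi> m) \<le> s * K1 / \<epsilon>"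
      using K1(2)[OF s0'(1) \<phi> nm] s0' \<epsilon> by (simp add: field_simps)
    have t2: "\<bar>LINT m|surf. (F m *\<^sub>R rgrad (mean_field \<alpha> r) m) \<bullet> rgrad \<phi> m\<bar> \<le> K * (2 * \<alpha> * cq * S) * sqrt area * ?G"
    proof (rule bnd)
      show "L2 (\<lambda>m. F m *\<^sub>R rgrad (mean_field \<alpha> r) m)"
        by (intro L2_scaleR_vec_continuous LF rgrad_continuous sphere_smooth_mean_field L2_integrable r)
      fix m :: "real^3" assume m: "norm m = 1"
      have "norm (rgrad (mean_field \<alpha> r) m) = 2 * \<alpha> * norm (cross3 m (qop r m))"
        using \<alpha> by (simp add: rgrad_mean_field[OF L2_integrable[OF r] m])
      also have "\<dots> \<le> 2 * \<alpha> * (cq * S)"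
        using norm_cross3_le[of m "qop r m"] qr[of m] m \<alpha> by (intro mult_left_mono) auto
      finally have "\<bar>F m\<bar> * norm (rgrad (mean_field \<alpha> r) m) \<le> K * (2 * \<alpha> * (cq * S))"
        using F(2)[OF m] K by (intro mult_mono) auto
      then show "norm (F m *\<^sub>R rgrad (mean_field \<alpha> r) m) \<le> K * (2 * \<alpha> * cq * S)" by (simp add: mult.assoc)
    qed (use K \<alpha> cq S in simp)
    have t3: "(LINT m|surf. r m * (surface_grad \<phi> m \<bullet> ?L m)) \<le> k0 * \<beta> * (S + s)\<^sup>2 + e' * (1 + (S + s) / sqrt c0)"
    proof -
      have "k0 * \<beta> * energy ?h \<phi> \<le> k0 * \<beta> * (S + s)\<^sup>2" using N2 k0 P.\<beta>0 by (intro mult_left_mono) auto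
      moreover have "e' * (1 + ?G) \<le> e' * (1 + (S + s) / sqrt c0)" using G e' by (intro mult_left_mono) auto
      ultimately show ?thesis using s0(2)[OF s0'(2,3) \<phi> nm] by linarith
    qed
    have t4: "\<bar>LINT m|surf. Y m \<bullet> rgrad \<phi> m\<bar> \<le> KY * sqrt area * ?G" by (rule bnd[OF LY Y(2) KY])
    have t5: "\<bar>LINT m|surf. B m * \<phi> m\<bar> \<le> KB * sqrt area * ?G"
    proof -
      have "l2norm B * l2norm \<phi> \<le> (KB * sqrt area) * ?G"
        using l2norm_le_bounded[OF LB _ KB] B(2) mz KB area_pos by (intro mult_mono) auto
      then show ?thesis using L2_Cauchy_Schwarz_real[OF LB L2_smooth[OF \<phi>]] by linarith
    qed
    have t45: "- \<epsilon> * (LINT m|surf. Y m \<bullet> rgrad \<phi> m) - \<epsilon> * (LINT m|surf. B m * \<phi> m) \<le> \<epsilon> * (KY + KB) * sqrt area * ?G"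
    proof -
      have "\<epsilon> * (- (LINT m|surf. Y m \<bullet> rgrad \<phi> m) - (LINT m|surf. B m * \<phi> m)) \<le> \<epsilon> * (KY * sqrt area * ?G + KB * sqrt area * ?G)"
        using t4 t5 \<epsilon> by (intro mult_left_mono) auto
      then show ?thesis by (simp add: algebra_simps)
    qed
    have "rate \<alpha> \<kappa> \<epsilon> ?h r G F Y B \<phi> \<le> s * K1 / \<epsilon> + K * (2 * \<alpha> * cq * S) * sqrt area * ?G
        + (k0 * \<beta> * (S + s)\<^sup>2 + e' * (1 + (S + s) / sqrt c0)) + \<epsilon> * (KY + KB) * sqrt area * ?G"
      unfolding rate_def using t1 t2 t3 t45 by linarith
    also have "\<dots> = s * K1 / \<epsilon> + a * ?G + k0 * \<beta> * (S + s)\<^sup>2 + e' * (1 + (S + s) / sqrt c0)"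
      by (simp add: a_def algebra_simps)
    also have "\<dots> \<le> W s" unfolding W_def using mult_left_mono[OF G a] by linarith
    finally have "rate \<alpha> \<kappa> \<epsilon> ?h r G F Y B \<phi> \<le> a * (S / sqrt c0) + k0 * \<beta> * S\<^sup>2 + e" using Ws by linarith
    also have "\<dots> = K * (2 * \<alpha> * cq * S) * sqrt area * (S / sqrt c0)
        + (4 * \<bar>\<eta>\<bar> + 15) * (K\<kappa> + 2 * \<alpha> * K * area + 2 * \<alpha> * \<epsilon> * cq * S) * S\<^sup>2
        + \<epsilon> * (KY + KB) * sqrt area * (S / sqrt c0) + e"
      unfolding a_def k0_def \<beta>_def distrib_right[of _ _ "S / sqrt c0"] by linarith
    finally show "rate \<alpha> \<kappa> \<epsilon> ?h r G F Y B \<phi> \<le> K * (2 * \<alpha> * cq * S) * sqrt area * (S / sqrt c0)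
        + (4 * \<bar>\<eta>\<bar> + 15) * (K\<kappa> + 2 * \<alpha> * K * area + 2 * \<alpha> * \<epsilon> * cq * S) * S\<^sup>2
        + \<epsilon> * (KY + KB) * sqrt area * (S / sqrt c0) + e" .
  qed
qed

section \<open>Evolution in time\<close>

subsection \<open>A comparison principle\<close>

text \<open>At the first time at which \<open>E\<close> reaches \<open>y\<close>, both functions agree, and \<open>E\<close> was below \<open>y\<close> before; so the backward difference
  quotients of \<open>E\<close> are at least those of \<open>y\<close>, which contradicts the strict differential inequality.  Semicontinuity from the right
  excludes that \<open>E\<close> exceeds \<open>y\<close> without such a time, and the bound on the backward quotients excludes upward jumps.\<close>

lemma comparison:
  fixes E y y' \<Phi> :: "real \<Rightarrow> real"
  assumes start: "E 0 < y 0"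
    and right: "\<And>t e. 0 \<le> t \<Longrightarrow> t < T \<Longrightarrow> e > 0 \<Longrightarrow> \<forall>\<^sub>F s in at_right 0. E (t + s) \<le> E t + e"
    and left: "\<And>t e. 0 < t \<Longrightarrow> t \<le> T \<Longrightarrow> e > 0 \<Longrightarrow> \<forall>\<^sub>F s in at_right 0. E t - E (t - s) \<le> s * (\<Phi> (E t) + e)"
    and y: "\<And>t. 0 \<le> t \<Longrightarrow> t \<le> T \<Longrightarrow> (y has_real_derivative y' t) (at t)"
    and super: "\<And>t. 0 \<le> t \<Longrightarrow> t \<le> T \<Longrightarrow> \<Phi> (y t) < y' t"
    and t: "0 \<le> t" "t \<le> T"
  shows "E t < y t"
proof (rule ccontr)
  assume neg: "\<not> E t < y t"
  define S where "S = {t. 0 \<le> t \<and> t \<le> T \<and> y t \<le> E t}"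
  have tS: "t \<in> S" using neg t by (simp add: S_def)
  have bdd: "bdd_below S" by (auto simp: S_def intro!: bdd_belowI[of _ 0])
  define a where "a = Inf S"
  have a: "0 \<le> a" "a \<le> t" "\<And>s. s \<in> S \<Longrightarrow> a \<le> s"
    using tS bdd by (auto simp: a_def S_def intro!: cInf_greatest cInf_lower)
  have contR: "((\<lambda>s. y (a + s)) \<longlongrightarrow> y a) (at_right 0)" and contL: "((\<lambda>s. y (a - s)) \<longlongrightarrow> y a) (at_right 0)"
  proof -
    have "isCont y a" using y[of a] a t by (intro DERIV_isCont) auto
    then have *: "(y \<longlongrightarrow> y a) (nhds a)" by (simp add: continuous_within tendsto_at_iff_tendsto_nhds)
    have "((\<lambda>s. a + s) \<longlongrightarrow> a + 0) (at_right 0)" "((\<lambda>s. a - s) \<longlongrightarrow> a - 0) (at_right 0)" by (intro tendsto_intros)+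
    then show "((\<lambda>s. y (a + s)) \<longlongrightarrow> y a) (at_right 0)" "((\<lambda>s. y (a - s)) \<longlongrightarrow> y a) (at_right 0)"
      using filterlim_compose[OF *] by auto
  qed
  have aS: "a \<in> S"
  proof (rule ccontr)
    assume aS: "a \<notin> S"
    have at: "a < t" using a(2) aS tS by (cases "a = t") auto
    have less: "E a < y a" using aS a t by (auto simp: S_def)
    define e where "e = (y a - E a) / 2"
    have e: "e > 0" using less by (simp add: e_def)
    have "\<forall>\<^sub>F s in at_right 0. E (a + s) \<le> E a + e" using a at t e by (intro right) auto
    moreover have "\<forall>\<^sub>F s in at_right 0. y a - e < y (a + s)" using e by (intro order_tendstoD(1)[OF contR]) auto
    ultimately have "\<forall>\<^sub>F s in at_right 0. E (a + s) < y (a + s)"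
      by eventually_elim (simp add: e_def field_simps)
    then obtain d where d: "d > 0" "\<And>s. 0 < s \<Longrightarrow> s < d \<Longrightarrow> E (a + s) < y (a + s)"
      by (auto simp: eventually_at_right_field)
    have "a + d \<le> Inf S"
    proof (rule cInf_greatest)
      show "S \<noteq> {}" using tS by auto
      fix s assume s: "s \<in> S"
      show "a + d \<le> s"
      proof (rule ccontr)
        assume "\<not> a + d \<le> s"
        moreover have "a < s" using a(3)[OF s] aS s by (cases "a = s") auto
        ultimately have "E (a + (s - a)) < y (a + (s - a))" by (intro d) auto
        then show False using s by (simp add: S_def)
      qed
    qed
    then show False using d by (simp add: a_def)
  qed
  then have ya: "y a \<le> E a" and aT: "a \<le> T" by (auto simp: S_def)
  have a0: "a > 0" using a(1) start ya by (cases "a = 0") auto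
  have below: "E s < y s" if "0 \<le> s" "s < a" for s
    using a(3)[of s] that aT by (force simp: S_def)
  have ea: "\<forall>\<^sub>F s in at_right 0. s \<in> {0<..<a}" by (rule eventually_at_rightI[OF _ a0])
  have eq: "E a = y a"
  proof (rule antisym[OF _ ya])
    have lim: "((\<lambda>s. y (a - s) + s * (\<Phi> (E a) + 1)) \<longlongrightarrow> y a + 0 * (\<Phi> (E a) + 1)) (at_right 0)"
      by (intro tendsto_intros contL)
    have "\<forall>\<^sub>F s in at_right 0. E a \<le> y (a - s) + s * (\<Phi> (E a) + 1)"
      using left[OF a0 aT zero_less_one] ea
    proof eventually_elim
      case (elim s)
      then show ?case using below[of "a - s"] by auto
    qed
    then have "E a \<le> y a + 0 * (\<Phi> (E a) + 1)" by (rule tendsto_lowerbound[OF lim]) simp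
    then show "E a \<le> y a" by simp
  qed
  define e where "e = (y' a - \<Phi> (y a)) / 2"
  have e: "e > 0" using super[of a] a aT by (simp add: e_def)
  have der: "((\<lambda>s. (y a - y (a - s)) / s) \<longlongrightarrow> y' a) (at_right 0)"
  proof -
    have "((\<lambda>h. (y (a + h) - y a) / h) \<longlongrightarrow> y' a) (at 0)" using y[of a] a aT by (simp add: DERIV_def)
    moreover have "filterlim (\<lambda>s::real. - s) (at 0) (at_right 0)"
      unfolding filterlim_at by (auto intro!: tendsto_eq_intros simp: eventually_at_filter)
    ultimately have "((\<lambda>s. (y (a + - s) - y a) / - s) \<longlongrightarrow> y' a) (at_right 0)" by (rule filterlim_compose)
    then show ?thesis by (simp add: field_simps minus_divide_left[symmetric] diff_divide_distrib)
  qed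
  have "\<forall>\<^sub>F s in at_right 0. (y a - y (a - s)) / s \<le> \<Phi> (y a) + e"
    using left[OF a0 aT e] ea
  proof eventually_elim
    case (elim s)
    then have "y a - y (a - s) \<le> s * (\<Phi> (y a) + e)" using below[of "a - s"] eq by auto
    then show ?case using elim by (simp add: divide_le_eq mult.commute)
  qed
  then have "y' a \<le> \<Phi> (y a) + e" by (rule tendsto_upperbound[OF der]) simp
  moreover have "\<Phi> (y a) + e < y' a" using e by (simp add: e_def field_simps)
  ultimately show False by simp
qed

text \<open>Both the weight and the function vary in time.  Pairings change by at most the \<open>L\<^sup>2\<close> distance times the gradient, and the supremum over the
  Dirichlet norm \<open>x\<close> of \<open>2 k x - \<theta> x\<^sup>2\<close> is \<open>k\<^sup>2 / \<theta>\<close>.\<close>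

lemma dual_energy_perturb:
  assumes 1: "dual h c0 c1 r" and 2: "dual h' c0' c1' r'" and \<theta>: "\<theta> > 0"
    and h: "\<And>m. norm m = 1 \<Longrightarrow> \<theta> * h m \<le> h' m"
  shows "dual_energy h' r' \<le> (sqrt (dual_energy h r) + l2norm (\<lambda>m. r' m - r m) / sqrt c0)\<^sup>2 / \<theta>"
proof -
  interpret A: dual h c0 c1 r by (rule 1)
  interpret B: dual h' c0' c1' r' by (rule 2)
  let ?d = "l2norm (\<lambda>m. r' m - r m)" and ?S = "sqrt (dual_energy h r)"
  have LD: "L2 (\<lambda>m. r' m - r m)" by (intro L2_diff A.r B.r)
  interpret D: dual h c0 c1 "\<lambda>m. r' m - r m"
    by unfold_locales (use LD L2_integrable[OF A.r] L2_integrable[OF B.r] A.mean B.mean in auto)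
  show ?thesis
  proof (rule B.dual_energy_le)
    fix \<phi> assume \<phi>: "sphere_smooth \<phi>"
    let ?x = "sqrt (energy h \<phi>)" and ?k = "?S + ?d / sqrt c0"
    have x: "?x\<^sup>2 = energy h \<phi>" using A.energy_nonneg by simp
    have "(LINT m|surf. r' m * \<phi> m) = (LINT m|surf. r m * \<phi> m) + (LINT m|surf. (r' m - r m) * \<phi> m)"
      using L2_mult_integrable[OF A.r L2_smooth[OF \<phi>]] L2_mult_integrable[OF B.r L2_smooth[OF \<phi>]]
      by (simp add: left_diff_distrib)
    also have "\<dots> \<le> ?S * ?x + ?d * (?x / sqrt c0)"
    proof -
      have "?d * l2norm (rgrad \<phi>) \<le> ?d * (?x / sqrt c0)" by (intro mult_left_mono A.l2norm_rgrad_le \<phi>) simp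
      then show ?thesis using A.pairing_le[OF \<phi>] D.pairing_poincare[OF \<phi>] by linarith
    qed
    also have "\<dots> = ?k * ?x" by (simp add: algebra_simps)
    finally have P: "(LINT m|surf. r' m * \<phi> m) \<le> ?k * ?x" .
    have N: "\<theta> * ?x\<^sup>2 \<le> energy h' \<phi>"
    proof -
      have "\<theta> * energy h \<phi> = (LINT m|surf. \<theta> * (h m * (norm (rgrad \<phi> m))\<^sup>2))" by (simp add: energy_def)
      also have "\<dots> \<le> energy h' \<phi>" unfolding energy_def
      proof (rule integral_mono[OF _ B.energy_integrable[OF \<phi>]])
        show "integrable surf (\<lambda>m. \<theta> * (h m * (norm (rgrad \<phi> m))\<^sup>2))" using A.energy_integrable[OF \<phi>] by simp
        fix m assume "m \<in> space surf"
        then have "\<theta> * h m * (norm (rgrad \<phi> m))\<^sup>2 \<le> h' m * (norm (rgrad \<phi> m))\<^sup>2" using h[of m] by (intro mult_right_mono) auto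
        then show "\<theta> * (h m * (norm (rgrad \<phi> m))\<^sup>2) \<le> h' m * (norm (rgrad \<phi> m))\<^sup>2" by (simp only: mult.assoc)
      qed
      finally show ?thesis by (simp add: x)
    qed
    have "action h' r' \<phi> \<le> 2 * (?k * ?x) - \<theta> * ?x\<^sup>2" unfolding action_def using P N by linarith
    also have "\<dots> = ?k\<^sup>2 / \<theta> - \<theta> * (?x - ?k / \<theta>)\<^sup>2" using \<theta> by (simp add: power2_diff power_divide) (simp add: power2_eq_square field_simps)
    also have "\<dots> \<le> ?k\<^sup>2 / \<theta>" using \<theta> by simp
    finally show "action h' r' \<phi> \<le> ?k\<^sup>2 / \<theta>" .
  qed
qed

subsection \<open>Functions that depend smoothly on time\<close>

text \<open>The joint extension gives the time derivative at \<open>t = 0\<close> as well, and compactness of the sphere times a time interval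
  gives the bounds.\<close>

lemma sphere_time_smoothD:
  assumes "sphere_time_smooth u"
  shows "\<And>t. t \<ge> 0 \<Longrightarrow> sphere_smooth (u t)"
    and "\<exists>u'. (\<forall>t\<ge>0. \<forall>m. norm m = 1 \<longrightarrow> ((\<lambda>s. u s m) has_real_derivative u' t m) (at t within {0..})) \<and>
      (\<forall>t\<ge>0. continuous_on S2 (u' t)) \<and>
      (\<forall>T. \<exists>B\<ge>0. \<forall>t\<in>{0..T}. \<forall>m. norm m = 1 \<longrightarrow> \<bar>u t m\<bar> \<le> B \<and> \<bar>u' t m\<bar> \<le> B)"
proof -
  let ?D = "(- {0 :: real^3}) \<times> (UNIV :: real set)"
  obtain E where E: "smooth_on ?D E" "\<And>x t. x \<noteq> 0 \<Longrightarrow> t \<ge> 0 \<Longrightarrow> E (x, t) = u t (sgn x)"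
    using assms unfolding sphere_time_smooth_def by blast
  have o: "open ?D" by (intro open_Times) auto
  show "sphere_smooth (u t)" if t: "t \<ge> 0" for t
    unfolding sphere_smooth_def smooth_on_def
  proof
    fix k
    have "Ck_on k (- {0}) (\<lambda>x. E ((x, 0) + (0, t)))"
      using E(1) by (intro Ck_on_affine[OF _ o]) (auto simp: smooth_on_def intro!: bounded_linear_Pair bounded_linear_ident bounded_linear_zero)
    then show "Ck_on k (- {0}) (\<lambda>x. u t (sgn x))"
      by (rule Ck_on_cong[rotated 2]) (auto simp: E(2) t)
  qed
  define d where "d p = frechet_derivative E (at p) (0, 1)" for p
  have dc: "continuous_on ?D d" unfolding d_def[abs_def]
    by (intro smooth_on_continuous smooth_on_frechet E o)
  have Ec: "continuous_on ?D E" by (intro smooth_on_continuous E o)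
  have der: "((\<lambda>s. u s m) has_real_derivative d (m, t)) (at t within {0..})" if t: "t \<ge> 0" and m: "norm m = 1" for t m
  proof -
    have m0: "m \<noteq> 0" using m by auto
    have "(E has_derivative frechet_derivative E (at (m, t))) (at (m, t))"
      using m0 by (intro smooth_on_has_derivative[OF E(1) o]) auto
    moreover have "((\<lambda>s. (m, s)) has_derivative (\<lambda>s. (0, s))) (at t)"
      by (auto intro!: derivative_eq_intros)
    ultimately have "((\<lambda>s. E (m, s)) has_derivative (\<lambda>s. frechet_derivative E (at (m, t)) (0, s))) (at t)"
      using diff_chain_at[of "\<lambda>s. (m, s)" "\<lambda>s. (0, s)" t E] by (simp add: o_def)
    moreover have "frechet_derivative E (at (m, t)) (0, s) = s * d (m, t)" for s
    proof -
      have l: "linear (frechet_derivative E (at (m, t)))"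
        using m0 by (intro has_derivative_linear[OF smooth_on_has_derivative[OF E(1) o]]) auto
      have "frechet_derivative E (at (m, t)) (s *\<^sub>R (0, 1)) = s *\<^sub>R frechet_derivative E (at (m, t)) (0, 1)"
        by (rule linear_scale[OF l])
      then show ?thesis by (simp add: d_def)
    qed
    ultimately have "((\<lambda>s. E (m, s)) has_real_derivative d (m, t)) (at t)"
      by (simp add: has_field_derivative_def mult_commute_abs)
    then have "((\<lambda>s. E (m, s)) has_real_derivative d (m, t)) (at t within {0..})" by (rule DERIV_subset) simp
    then show ?thesis
      by (rule has_field_derivative_transform_within[where d=1]) (use t m m0 E(2)[of m] in auto)
  qed
  have dS: "continuous_on S2 (\<lambda>m. d (m, t))" for t
    by (rule continuous_on_compose2[OF dc]) (auto intro!: continuous_intros)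
  have bnd: "\<exists>B\<ge>0. \<forall>t\<in>{0..T}. \<forall>m. norm m = 1 \<longrightarrow> \<bar>u t m\<bar> \<le> B \<and> \<bar>d (m, t)\<bar> \<le> B" for T
  proof -
    have comp: "compact (S2 \<times> {0..T})" by (intro compact_Times compact_sphere compact_Icc)
    have sub: "S2 \<times> {0..T} \<subseteq> ?D" by auto
    obtain B1 where B1: "\<And>p. p \<in> S2 \<times> {0..T} \<Longrightarrow> norm (E p) \<le> B1"
      using compact_imp_bounded[OF compact_continuous_image[OF continuous_on_subset[OF Ec sub] comp]] by (auto simp: bounded_iff)
    obtain B2 where B2: "\<And>p. p \<in> S2 \<times> {0..T} \<Longrightarrow> norm (d p) \<le> B2"
      using compact_imp_bounded[OF compact_continuous_image[OF continuous_on_subset[OF dc sub] comp]] by (auto simp: bounded_iff)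
    show ?thesis
    proof (intro exI[of _ "max 0 (max B1 B2)"] conjI ballI allI impI)
      fix t m assume t: "t \<in> {0..T}" and m: "norm (m :: real^3) = 1"
      have m0: "m \<noteq> 0" using m by auto
      have "E (m, t) = u t m" using E(2)[OF m0, of t] t m by simp
      then show "\<bar>u t m\<bar> \<le> max 0 (max B1 B2)" using B1[of "(m, t)"] t m by simp
      show "\<bar>d (m, t)\<bar> \<le> max 0 (max B1 B2)" using B2[of "(m, t)"] t m by simp
    qed simp
  qed
  show "\<exists>u'. (\<forall>t\<ge>0. \<forall>m. norm m = 1 \<longrightarrow> ((\<lambda>s. u s m) has_real_derivative u' t m) (at t within {0..})) \<and>
      (\<forall>t\<ge>0. continuous_on S2 (u' t)) \<and>
      (\<forall>T. \<exists>B\<ge>0. \<forall>t\<in>{0..T}. \<forall>m. norm m = 1 \<longrightarrow> \<bar>u t m\<bar> \<le> B \<and> \<bar>u' t m\<bar> \<le> B)"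
    using der dS bnd by (intro exI[of _ "\<lambda>t m. d (m, t)"]) blast
qed

lemma time_lipschitz:
  fixes u u' :: "real \<Rightarrow> real"
  assumes der: "\<And>t. t \<ge> 0 \<Longrightarrow> (u has_real_derivative u' t) (at t within {0..})"
    and bnd: "\<And>t. t \<in> {0..T} \<Longrightarrow> \<bar>u' t\<bar> \<le> B" and st: "s \<in> {0..T}" "t \<in> {0..T}"
  shows "\<bar>u t - u s\<bar> \<le> B * \<bar>t - s\<bar>"
proof -
  have "norm (u t - u s) \<le> B * norm (t - s)"
  proof (rule field_differentiable_bound[where S="{0..T}" and f'=u'])
    show "(u has_field_derivative u' z) (at z within {0..T})" if "z \<in> {0..T}" for z
      using der[of z] that by (intro DERIV_subset[OF der]) auto
  qed (use bnd st in auto)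
  then show ?thesis by simp
qed

text \<open>Pointwise convergence is dominated by the Lipschitz constant.\<close>

lemma difference_quotient_L2:
  fixes u :: "real \<Rightarrow> real^3 \<Rightarrow> real" and u' :: "real^3 \<Rightarrow> real"
  assumes t: "t > 0"
    and der: "\<And>m. norm m = 1 \<Longrightarrow> ((\<lambda>s. u s m) has_real_derivative u' m) (at t within {0..})"
    and lip: "\<And>s m. 0 \<le> s \<Longrightarrow> s \<le> t \<Longrightarrow> norm m = 1 \<Longrightarrow> \<bar>u t m - u s m\<bar> \<le> B * \<bar>t - s\<bar>"
    and meas: "\<And>s. 0 \<le> s \<Longrightarrow> s \<le> t \<Longrightarrow> u s \<in> borel_measurable surf" "u' \<in> borel_measurable surf"
    and B: "B \<ge> 0"
  shows "((\<lambda>s. l2norm (\<lambda>m. (u t m - u (t - s) m) / s - u' m)) \<longlongrightarrow> 0) (at_right 0)"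
  unfolding tendsto_at_iff_sequentially comp_def
proof (intro allI impI)
  fix X :: "nat \<Rightarrow> real" assume X: "\<forall>i. X i \<in> {0<..} - {0}" "X \<longlonglongrightarrow> 0"
  have "\<forall>\<^sub>F i in sequentially. X i < t" using t by (intro order_tendstoD(2)[OF X(2)])
  then obtain N where N: "\<And>i. i \<ge> N \<Longrightarrow> X i < t" by (auto simp: eventually_sequentially)
  define Y where "Y i = X (i + N)" for i
  have Y: "Y i > 0" "Y i < t" for i using X(1) N by (auto simp: Y_def)
  have Yl: "Y \<longlonglongrightarrow> 0" unfolding Y_def by (rule LIMSEQ_ignore_initial_segment[OF X(2)])
  let ?q = "\<lambda>i m. (u t m - u (t - Y i) m) / Y i"
  have qb: "\<bar>?q i m\<bar> \<le> B" if "norm m = 1" for i m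
  proof -
    have "\<bar>u t m - u (t - Y i) m\<bar> \<le> B * Y i" using lip[of "t - Y i" m] Y[of i] that by simp
    then show ?thesis unfolding abs_divide using Y(1)[of i] by (simp only: abs_of_pos pos_divide_le_eq)
  qed
  have qlim: "(\<lambda>i. ?q i m) \<longlonglongrightarrow> u' m" if m: "norm m = 1" for m
  proof -
    have lim: "((\<lambda>s. (u s m - u t m) / (s - t)) \<longlongrightarrow> u' m) (at t within {0..})"
      using der[OF m] by (simp add: has_field_derivative_iff)
    have conv: "(\<lambda>i. t - Y i) \<longlonglongrightarrow> t" using tendsto_diff[OF tendsto_const Yl, of t] by simp
    have mem: "t - Y i \<in> {0..} - {t}" for i using Y[of i] by auto
    have "(\<lambda>i. (u (t - Y i) m - u t m) / (t - Y i - t)) \<longlonglongrightarrow> u' m"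
      by (rule lim[unfolded tendsto_at_iff_sequentially comp_def, rule_format, OF mem conv])
    moreover have "(u (t - Y i) m - u t m) / (t - Y i - t) = ?q i m" for i
      using Y[of i] by (simp add: field_simps)
    ultimately show ?thesis by simp
  qed
  have u'b: "\<bar>u' m\<bar> \<le> B" if "norm m = 1" for m
    using qb[OF that] by (intro LIMSEQ_le_const2[OF tendsto_rabs[OF qlim[OF that]]]) auto
  have "(\<lambda>i. LINT m|surf. (norm (?q i m - u' m))\<^sup>2) \<longlonglongrightarrow> (LINT m|surf. 0)"
  proof (rule integral_dominated_convergence[where w="\<lambda>m. (2 * B)\<^sup>2"])
    show "(\<lambda>m. (norm (?q i m - u' m))\<^sup>2) \<in> borel_measurable surf" for i
      using meas(1)[of t] meas(1)[of "t - Y i"] meas(2) Y[of i] t by auto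
    show "AE m in surf. (\<lambda>i. (norm (?q i m - u' m))\<^sup>2) \<longlonglongrightarrow> 0"
    proof (rule AE_I2)
      fix m assume "m \<in> space surf"
      then have "(\<lambda>i. (norm (?q i m - u' m))\<^sup>2) \<longlonglongrightarrow> (norm (u' m - u' m))\<^sup>2" by (intro tendsto_intros qlim) simp
      then show "(\<lambda>i. (norm (?q i m - u' m))\<^sup>2) \<longlonglongrightarrow> 0" by simp
    qed
    show "AE m in surf. norm ((norm (?q i m - u' m))\<^sup>2) \<le> (2 * B)\<^sup>2" for i
    proof (rule AE_I2)
      fix m assume "m \<in> space surf"
      then have "\<bar>?q i m - u' m\<bar> \<le> 2 * B" 
        using abs_triangle_ineq4[of "?q i m" "u' m"] qb[of m i] u'b[of m] by (smt (verit) space_surf mem_sphere_0)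
      then have "\<bar>?q i m - u' m\<bar>\<^sup>2 \<le> (2 * B)\<^sup>2" by (intro power_mono) auto
      then show "norm ((norm (?q i m - u' m))\<^sup>2) \<le> (2 * B)\<^sup>2" by simp
    qed
  qed auto
  then have "(\<lambda>i. sqrt (LINT m|surf. (norm (?q i m - u' m))\<^sup>2)) \<longlonglongrightarrow> sqrt (LINT m|surf. 0)" by (intro tendsto_intros)
  then have "(\<lambda>i. l2norm (\<lambda>m. ?q i m - u' m)) \<longlonglongrightarrow> 0" by (simp add: l2norm_def)
  then show "(\<lambda>i. l2norm (\<lambda>m. (u t m - u (t - X i) m) / X i - u' m)) \<longlonglongrightarrow> 0"
    unfolding Y_def by (rule LIMSEQ_offset)
qed

subsection \<open>Smooth vector fields\<close>

definition smooth_field :: "(real^3 \<Rightarrow> real^3) \<Rightarrow> bool" where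
  "smooth_field V \<longleftrightarrow> (\<forall>i. sphere_smooth (\<lambda>m. V m $ i))"

lemma smooth_field_add: "smooth_field V \<Longrightarrow> smooth_field W \<Longrightarrow> smooth_field (\<lambda>m. V m + W m)"
  by (simp add: smooth_field_def sphere_smooth_add)

lemma smooth_field_diff: "smooth_field V \<Longrightarrow> smooth_field W \<Longrightarrow> smooth_field (\<lambda>m. V m - W m)"
  by (simp add: smooth_field_def sphere_smooth_diff)

lemma smooth_field_scaleR: "sphere_smooth a \<Longrightarrow> smooth_field V \<Longrightarrow> smooth_field (\<lambda>m. a m *\<^sub>R V m)"
  by (simp add: smooth_field_def sphere_smooth_mult)

lemma smooth_field_rgrad: "sphere_smooth a \<Longrightarrow> smooth_field (rgrad a)"
  by (simp add: smooth_field_def sphere_smooth_rgrad)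

lemma smooth_field_cross3:
  assumes K: "linear K" shows "smooth_field (\<lambda>m. cross3 m (K m))"
proof -
  have c: "sphere_smooth (\<lambda>m. m $ j * K m $ l)" for j l
    using bounded_linear_compose[OF bounded_linear_vec_nth, of K l] K
    by (intro sphere_smooth_mult sphere_smooth_component sphere_smooth_linear) (simp_all add: linear_linear)
  have "sphere_smooth (\<lambda>m. cross3 m (K m) $ i)" for i
  proof -
    consider "i = 1" | "i = 2" | "i = 3" using exhaust_3[of i] by blast
    then show ?thesis
    proof cases
      case 1 then show ?thesis using sphere_smooth_diff[OF c[of 2 3] c[of 3 2]] by (simp add: cross_components mult.commute)
    next
      case 2 then show ?thesis using sphere_smooth_diff[OF c[of 3 1] c[of 1 3]] by (simp add: cross_components mult.commute)
    next
      case 3 then show ?thesis using sphere_smooth_diff[OF c[of 1 2] c[of 2 1]] by (simp add: cross_components mult.commute)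
    qed
  qed
  then show ?thesis by (simp add: smooth_field_def)
qed

lemma smooth_field_continuous: "smooth_field V \<Longrightarrow> continuous_on S2 V"
  by (simp add: smooth_field_def continuous_on_vec_iff sphere_smooth_continuous)

lemma smooth_field_L2: "smooth_field V \<Longrightarrow> L2 V"
  by (intro L2_continuous smooth_field_continuous)

lemma sphere_smooth_rdiv: "smooth_field V \<Longrightarrow> sphere_smooth (rdiv V)"
  unfolding rdiv_def[abs_def] smooth_field_def by (intro sphere_smooth_sum sphere_smooth_rgrad) auto

lemma smooth_field_by_parts: "smooth_field V \<Longrightarrow> sphere_smooth \<phi> \<Longrightarrow> (LINT m|surf. rdiv V m * \<phi> m) = - (LINT m|surf. V m \<bullet> rgrad \<phi> m)"
  by (intro LINT_rdiv_by_parts) (auto simp: smooth_field_def)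

lemma rdiv_add: "smooth_field V \<Longrightarrow> smooth_field W \<Longrightarrow> norm m = 1 \<Longrightarrow> rdiv (\<lambda>m. V m + W m) m = rdiv V m + rdiv W m"
  by (simp add: rdiv_def smooth_field_def rgrad_add sum.distrib)

lemma rdiv_diff: "smooth_field V \<Longrightarrow> smooth_field W \<Longrightarrow> norm m = 1 \<Longrightarrow> rdiv (\<lambda>m. V m - W m) m = rdiv V m - rdiv W m"
  by (simp add: rdiv_def smooth_field_def rgrad_diff sum_subtractf)

subsection \<open>The flux of the expansion\<close>

lemma flux_identity_real:
  fixes \<epsilon> :: real
  assumes e: "\<epsilon> \<noteq> 0" and crit: "Rh = - (h * uh)" and g: "g = h + \<epsilon> * f1 + \<epsilon>\<^sup>2 * f2 + \<epsilon>^3 * f3"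
  shows "(1 / \<epsilon>) * ((Rh + \<epsilon> * R1 + \<epsilon>\<^sup>2 * R2 + \<epsilon>^3 * R3 + \<epsilon>\<^sup>2 * G) + (g + \<epsilon>\<^sup>2 * r) * (uh + \<epsilon> * u1 + \<epsilon>\<^sup>2 * u2 + \<epsilon>^3 * u3 + \<epsilon>\<^sup>2 * ur))
      - (g + \<epsilon>\<^sup>2 * r) * w
    = (R1 + h * u1 + f1 * uh - h * w) + \<epsilon> * (R2 + h * u2 + f2 * uh + f1 * u1 - f1 * w)
      + \<epsilon>\<^sup>2 * (R3 + h * u3 + f3 * uh + f1 * u2 + f2 * u1 - f2 * w)
      + \<epsilon>\<^sup>2 * ((1 / \<epsilon>) * (G + h * ur + r * uh) + (f1 + \<epsilon> * f2 + \<epsilon>\<^sup>2 * f3) * ur - r * (w - (u1 + \<epsilon> * u2 + \<epsilon>\<^sup>2 * u3) - \<epsilon> * ur))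
      + \<epsilon>^3 * (f1 * u3 + f2 * u2 + f3 * u1 + \<epsilon> * (f2 * u3 + f3 * u2) + \<epsilon>\<^sup>2 * (f3 * u3) - f3 * w)"
  unfolding crit g using e by (simp add: field_simps power2_eq_square power3_eq_cube)

text \<open>The flux of \<open>f\<^sub>\<epsilon>\<close> sorted by powers of \<open>\<epsilon>\<close>.  The lower case letters \<open>uh\<close>, \<open>u1\<close> and so on stand for the gradients of the mean fields,
  and the equilibrium equation removes the term of order \<open>1/\<epsilon>\<close>.\<close>

lemma flux_identity:
  fixes \<epsilon> h f1 f2 f3 r g :: real and G Rh R1 R2 R3 uh u1 u2 u3 ur w :: "real^3"
  assumes e: "\<epsilon> \<noteq> 0" and crit: "Rh = - h *\<^sub>R uh" and g: "g = h + \<epsilon> * f1 + \<epsilon>\<^sup>2 * f2 + \<epsilon>^3 * f3"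
  shows "(1 / \<epsilon>) *\<^sub>R ((Rh + \<epsilon> *\<^sub>R R1 + \<epsilon>\<^sup>2 *\<^sub>R R2 + \<epsilon>^3 *\<^sub>R R3 + \<epsilon>\<^sup>2 *\<^sub>R G)
        + (g + \<epsilon>\<^sup>2 * r) *\<^sub>R (uh + \<epsilon> *\<^sub>R u1 + \<epsilon>\<^sup>2 *\<^sub>R u2 + \<epsilon>^3 *\<^sub>R u3 + \<epsilon>\<^sup>2 *\<^sub>R ur))
      - (g + \<epsilon>\<^sup>2 * r) *\<^sub>R w
    = (R1 + h *\<^sub>R u1 + f1 *\<^sub>R uh - h *\<^sub>R w) + \<epsilon> *\<^sub>R (R2 + h *\<^sub>R u2 + f2 *\<^sub>R uh + f1 *\<^sub>R u1 - f1 *\<^sub>R w)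
      + \<epsilon>\<^sup>2 *\<^sub>R (R3 + h *\<^sub>R u3 + f3 *\<^sub>R uh + f1 *\<^sub>R u2 + f2 *\<^sub>R u1 - f2 *\<^sub>R w)
      + \<epsilon>\<^sup>2 *\<^sub>R ((1 / \<epsilon>) *\<^sub>R (G + h *\<^sub>R ur + r *\<^sub>R uh) + (f1 + \<epsilon> * f2 + \<epsilon>\<^sup>2 * f3) *\<^sub>R ur
          - r *\<^sub>R (w - (u1 + \<epsilon> *\<^sub>R u2 + \<epsilon>\<^sup>2 *\<^sub>R u3) - \<epsilon> *\<^sub>R ur))
      + \<epsilon>^3 *\<^sub>R (f1 *\<^sub>R u3 + f2 *\<^sub>R u2 + f3 *\<^sub>R u1 + \<epsilon> *\<^sub>R (f2 *\<^sub>R u3 + f3 *\<^sub>R u2) + \<epsilon>\<^sup>2 *\<^sub>R (f3 *\<^sub>R u3) - f3 *\<^sub>R w)"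
proof -
  have "Rh $ i = - (h * uh $ i)" for i unfolding crit by simp
  from flux_identity_real[OF e this g] show ?thesis
    by (simp only: vec_eq_iff vector_add_component vector_minus_component vector_scaleR_component real_scaleR_def) blast
qed

text \<open>The director enters only through its Lipschitz constant, and through the fact that the equilibrium is critical and stable at all times.\<close>

locale doi_expansion =
  fixes \<alpha> \<eta> Ln :: real and \<kappa> :: "real^3^3" and n :: "real \<Rightarrow> real^3" and f :: "nat \<Rightarrow> real \<Rightarrow> real^3 \<Rightarrow> real"
  assumes alpha: "\<alpha> \<ge> 0" and unit: "\<And>t. t \<ge> 0 \<Longrightarrow> norm (n t) = 1"
    and Ln: "Ln \<ge> 0" and n_lip: "\<And>s t. s \<ge> 0 \<Longrightarrow> t \<ge> 0 \<Longrightarrow> norm (n t - n s) \<le> Ln * \<bar>t - s\<bar>"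
    and expansion: "hilbert_expansion \<alpha> \<eta> \<kappa> n f"
    and crit: "\<And>t. t \<ge> 0 \<Longrightarrow> critical_point \<alpha> (equilibrium \<eta> (n t))"
    and stab: "\<And>t. t \<ge> 0 \<Longrightarrow> stable_point \<alpha> (equilibrium \<eta> (n t))"
begin

abbreviation "h t \<equiv> equilibrium \<eta> (n t)"

definition "approx \<epsilon> t m = h t m + (\<Sum>k=1..3. \<epsilon> ^ k * f k t m)"

lemma approx_eq: "approx \<epsilon> t m = h t m + \<epsilon> * f 1 t m + \<epsilon>\<^sup>2 * f 2 t m + \<epsilon>^3 * f 3 t m"
  by (simp add: approx_def eval_nat_numeral)

lemma f_time_smooth: "k \<in> {1..3} \<Longrightarrow> sphere_time_smooth (f k)"
  using expansion by (simp add: hilbert_expansion_def)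

lemma f_mean: "k \<in> {1..3} \<Longrightarrow> t \<ge> 0 \<Longrightarrow> (LINT m|surf. f k t m) = 0"
  using expansion by (simp add: hilbert_expansion_def)

lemma f_smooth: "k \<in> {1..3} \<Longrightarrow> t \<ge> 0 \<Longrightarrow> sphere_smooth (f k t)"
  by (rule sphere_time_smoothD(1)[OF f_time_smooth])

lemma f_smooth': "t \<ge> 0 \<Longrightarrow> sphere_smooth (f 1 t)" "t \<ge> 0 \<Longrightarrow> sphere_smooth (f 2 t)" "t \<ge> 0 \<Longrightarrow> sphere_smooth (f 3 t)"
  by (auto intro: f_smooth)

lemma h_smooth: "t \<ge> 0 \<Longrightarrow> sphere_smooth (h t)"
  by (intro equilibrium_smooth unit)

lemma smooth_integrable: "sphere_smooth u \<Longrightarrow> integrable surf u"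
  by (intro L2_integrable L2_smooth)

abbreviation "U g \<equiv> mean_field \<alpha> g"

abbreviation "w m \<equiv> cross3 m (\<kappa> *v m)"

text \<open>The fluxes on the right hand sides of the equations of the Hilbert expansion.\<close>

definition "flux0 t m = lin_flux \<alpha> (h t) (f 1 t) (rgrad (f 1 t)) m - h t m *\<^sub>R w m"

definition "flux1 t m = lin_flux \<alpha> (h t) (f 2 t) (rgrad (f 2 t)) m + f 1 t m *\<^sub>R rgrad (U (f 1 t)) m - f 1 t m *\<^sub>R w m"

definition "flux2 t m = lin_flux \<alpha> (h t) (f 3 t) (rgrad (f 3 t)) m + f 1 t m *\<^sub>R rgrad (U (f 2 t)) m
    + f 2 t m *\<^sub>R rgrad (U (f 1 t)) m - f 2 t m *\<^sub>R w m"

lemma smooth_field_lin_flux: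
  assumes "sphere_smooth a" "sphere_smooth b" shows "smooth_field (\<lambda>m. lin_flux \<alpha> a b (rgrad b) m)"
  unfolding lin_flux_def
  by (intro smooth_field_add smooth_field_scaleR smooth_field_rgrad sphere_smooth_mean_field smooth_integrable assms)

lemma smooth_field_w: "smooth_field w"
  by (rule smooth_field_cross3) (rule matrix_vector_mul_linear)

lemma smooth_field_drift: "sphere_smooth a \<Longrightarrow> smooth_field (\<lambda>m. a m *\<^sub>R w m)"
  by (intro smooth_field_scaleR smooth_field_w)

lemma smooth_field_interaction: "sphere_smooth a \<Longrightarrow> sphere_smooth b \<Longrightarrow> smooth_field (\<lambda>m. a m *\<^sub>R rgrad (U b) m)"
  by (intro smooth_field_scaleR smooth_field_rgrad sphere_smooth_mean_field smooth_integrable)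

lemma smooth_field_flux: assumes "t \<ge> 0" shows "smooth_field (flux0 t)" "smooth_field (flux1 t)" "smooth_field (flux2 t)"
  unfolding flux0_def[abs_def] flux1_def[abs_def] flux2_def[abs_def]
  by (intro smooth_field_add smooth_field_diff smooth_field_lin_flux smooth_field_drift smooth_field_interaction f_smooth' h_smooth assms)+

lemma linearized_eq: "linearized \<alpha> a b m = rdiv (\<lambda>m. lin_flux \<alpha> a b (rgrad b) m) m"
  by (simp add: linearized_def lin_flux_def)

lemma time_derivative:
  assumes t: "t \<ge> 0" and m: "norm m = 1"
  shows "((\<lambda>s. h s m) has_real_derivative rdiv (flux0 t) m) (at t within {0..})"
    and "((\<lambda>s. f 1 s m) has_real_derivative rdiv (flux1 t) m) (at t within {0..})"
    and "((\<lambda>s. f 2 s m) has_real_derivative rdiv (flux2 t) m) (at t within {0..})"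
proof -
  note s = f_smooth'[OF t] h_smooth[OF t]
  have eqs: "rdiv (flux0 t) m = linearized \<alpha> (h t) (f 1 t) m - transport \<kappa> (h t) m"
    "rdiv (flux1 t) m = linearized \<alpha> (h t) (f 2 t) m + interaction \<alpha> (f 1 t) (f 1 t) m - transport \<kappa> (f 1 t) m"
    "rdiv (flux2 t) m = linearized \<alpha> (h t) (f 3 t) m + interaction \<alpha> (f 1 t) (f 2 t) m + interaction \<alpha> (f 2 t) (f 1 t) m - transport \<kappa> (f 2 t) m"
    unfolding flux0_def[abs_def] flux1_def[abs_def] flux2_def[abs_def] linearized_eq interaction_def transport_def
    by (simp_all add: rdiv_diff rdiv_add smooth_field_add smooth_field_diff smooth_field_lin_flux smooth_field_drift smooth_field_interaction s m del: One_nat_def)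
  have "m \<in> S2" using m by simp
  then show "((\<lambda>s. h s m) has_real_derivative rdiv (flux0 t) m) (at t within {0..})"
    "((\<lambda>s. f 1 s m) has_real_derivative rdiv (flux1 t) m) (at t within {0..})"
    "((\<lambda>s. f 2 s m) has_real_derivative rdiv (flux2 t) m) (at t within {0..})"
    using expansion t unfolding hilbert_expansion_def eqs by blast+
qed

text \<open>No equation prescribes the time derivative of the last corrector; it is part of the error of order \<open>\<epsilon>\<^sup>3\<close>.\<close>

definition "df3 = (SOME u'. (\<forall>t\<ge>0. \<forall>m. norm m = 1 \<longrightarrow> ((\<lambda>s. f 3 s m) has_real_derivative u' t m) (at t within {0..})) \<and>
      (\<forall>t\<ge>0. continuous_on S2 (u' t)) \<and>
      (\<forall>T. \<exists>B\<ge>0. \<forall>t\<in>{0..T}. \<forall>m. norm m = 1 \<longrightarrow> \<bar>f 3 t m\<bar> \<le> B \<and> \<bar>u' t m\<bar> \<le> B))"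

lemma df3:
  "t \<ge> 0 \<Longrightarrow> norm m = 1 \<Longrightarrow> ((\<lambda>s. f 3 s m) has_real_derivative df3 t m) (at t within {0..})"
  "t \<ge> 0 \<Longrightarrow> continuous_on S2 (df3 t)"
  "\<exists>B\<ge>0. \<forall>t\<in>{0..T}. \<forall>m. norm m = 1 \<longrightarrow> \<bar>f 3 t m\<bar> \<le> B \<and> \<bar>df3 t m\<bar> \<le> B"
proof -
  have "(\<forall>t\<ge>0. \<forall>m. norm m = 1 \<longrightarrow> ((\<lambda>s. f 3 s m) has_real_derivative df3 t m) (at t within {0..})) \<and>
      (\<forall>t\<ge>0. continuous_on S2 (df3 t)) \<and>
      (\<forall>T. \<exists>B\<ge>0. \<forall>t\<in>{0..T}. \<forall>m. norm m = 1 \<longrightarrow> \<bar>f 3 t m\<bar> \<le> B \<and> \<bar>df3 t m\<bar> \<le> B)"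
    unfolding df3_def by (rule someI_ex[OF sphere_time_smoothD(2)[OF f_time_smooth[of 3]]]) simp
  then show "t \<ge> 0 \<Longrightarrow> norm m = 1 \<Longrightarrow> ((\<lambda>s. f 3 s m) has_real_derivative df3 t m) (at t within {0..})"
    "t \<ge> 0 \<Longrightarrow> continuous_on S2 (df3 t)"
    "\<exists>B\<ge>0. \<forall>t\<in>{0..T}. \<forall>m. norm m = 1 \<longrightarrow> \<bar>f 3 t m\<bar> \<le> B \<and> \<bar>df3 t m\<bar> \<le> B" by blast+
qed

lemma f_bounds_aux:
  assumes k: "k \<in> {1..3}"
  shows "\<exists>B\<ge>0. (\<forall>t\<in>{0..T}. \<forall>m. norm m = 1 \<longrightarrow> \<bar>f k t m\<bar> \<le> B) \<and>
    (\<forall>s\<in>{0..T}. \<forall>t\<in>{0..T}. \<forall>m. norm m = 1 \<longrightarrow> \<bar>f k t m - f k s m\<bar> \<le> B * \<bar>t - s\<bar>)"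
proof -
  obtain u' where u': "\<And>t m. t \<ge> 0 \<Longrightarrow> norm m = 1 \<Longrightarrow> ((\<lambda>s. f k s m) has_real_derivative u' t m) (at t within {0..})"
    and b: "\<And>T. \<exists>B\<ge>0. \<forall>t\<in>{0..T}. \<forall>m. norm m = 1 \<longrightarrow> \<bar>f k t m\<bar> \<le> B \<and> \<bar>u' t m\<bar> \<le> B"
    using sphere_time_smoothD(2)[OF f_time_smooth[OF k]] by blast
  obtain B where B: "B \<ge> 0" "\<And>t m. t \<in> {0..T} \<Longrightarrow> norm m = 1 \<Longrightarrow> \<bar>f k t m\<bar> \<le> B \<and> \<bar>u' t m\<bar> \<le> B" using b[of T] by blast
  show ?thesis
  proof (intro exI[of _ B] conjI ballI allI impI)
    fix s t m assume "s \<in> {0..T}" "t \<in> {0..T}" "norm (m :: real^3) = 1"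
    then show "\<bar>f k t m - f k s m\<bar> \<le> B * \<bar>t - s\<bar>"
      using B by (intro time_lipschitz[where u="\<lambda>s. f k s m" and u'="\<lambda>t. u' t m" and T=T] u') auto
  qed (use B in auto)
qed

lemma f_bounds:
  "\<exists>B\<ge>0. \<forall>k\<in>{1..3}. (\<forall>t\<in>{0..T}. \<forall>m. norm m = 1 \<longrightarrow> \<bar>f k t m\<bar> \<le> B) \<and>
    (\<forall>s\<in>{0..T}. \<forall>t\<in>{0..T}. \<forall>m. norm m = 1 \<longrightarrow> \<bar>f k t m - f k s m\<bar> \<le> B * \<bar>t - s\<bar>) \<and>
    (\<forall>t\<in>{0..T}. \<forall>m. norm m = 1 \<longrightarrow> \<bar>df3 t m\<bar> \<le> B)"
proof -
  obtain B1 where B1: "B1 \<ge> 0" "\<And>t m. t \<in> {0..T} \<Longrightarrow> norm m = 1 \<Longrightarrow> \<bar>f 1 t m\<bar> \<le> B1"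
    "\<And>s t m. s \<in> {0..T} \<Longrightarrow> t \<in> {0..T} \<Longrightarrow> norm m = 1 \<Longrightarrow> \<bar>f 1 t m - f 1 s m\<bar> \<le> B1 * \<bar>t - s\<bar>"
    using f_bounds_aux[of 1 T] by auto
  obtain B2 where B2: "B2 \<ge> 0" "\<And>t m. t \<in> {0..T} \<Longrightarrow> norm m = 1 \<Longrightarrow> \<bar>f 2 t m\<bar> \<le> B2"
    "\<And>s t m. s \<in> {0..T} \<Longrightarrow> t \<in> {0..T} \<Longrightarrow> norm m = 1 \<Longrightarrow> \<bar>f 2 t m - f 2 s m\<bar> \<le> B2 * \<bar>t - s\<bar>"
    using f_bounds_aux[of 2 T] by auto
  obtain B3 where B3: "B3 \<ge> 0" "\<And>t m. t \<in> {0..T} \<Longrightarrow> norm m = 1 \<Longrightarrow> \<bar>f 3 t m\<bar> \<le> B3"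
    "\<And>s t m. s \<in> {0..T} \<Longrightarrow> t \<in> {0..T} \<Longrightarrow> norm m = 1 \<Longrightarrow> \<bar>f 3 t m - f 3 s m\<bar> \<le> B3 * \<bar>t - s\<bar>"
    using f_bounds_aux[of 3 T] by auto
  obtain B4 where B4: "B4 \<ge> 0" "\<And>t m. t \<in> {0..T} \<Longrightarrow> norm m = 1 \<Longrightarrow> \<bar>df3 t m\<bar> \<le> B4"
    using df3(3)[of T] by blast
  define B where "B = B1 + B2 + B3 + B4"
  have B: "B \<ge> 0" "B1 \<le> B" "B2 \<le> B" "B3 \<le> B" "B4 \<le> B" using B1(1) B2(1) B3(1) B4(1) by (auto simp: B_def)
  have up: "x \<le> B * \<bar>t - s\<bar>" if "x \<le> C * \<bar>t - s\<bar>" "C \<le> B" for x C s t :: real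
    using that mult_right_mono[of C B "\<bar>t - s\<bar>"] by linarith
  have k: "k = 1 \<or> k = 2 \<or> k = 3" if "k \<in> {1..3}" for k :: nat using that by auto
  show ?thesis
  proof (intro exI[of _ B] conjI ballI allI impI)
    fix k :: nat and t m assume k': "k \<in> {1..3}" and t: "t \<in> {0..T}" and m: "norm (m :: real^3) = 1"
    show "\<bar>f k t m\<bar> \<le> B" using k[OF k'] B1(2)[OF t m] B2(2)[OF t m] B3(2)[OF t m] B by auto
    show "\<bar>df3 t m\<bar> \<le> B" using B4(2)[OF t m] B by simp
    fix s assume s: "s \<in> {0..T}"
    show "\<bar>f k t m - f k s m\<bar> \<le> B * \<bar>t - s\<bar>"
      using k[OF k'] up[OF B1(3)[OF s t m] B(2)] up[OF B2(3)[OF s t m] B(3)] up[OF B3(3)[OF s t m] B(4)] by auto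
  qed (rule B(1))
qed

text \<open>The weight of the dual energy varies by a factor close to 1 over a short time, which makes its contribution a multiple of the energy itself.\<close>

lemma h_ratio:
  assumes "s \<ge> 0" "t \<ge> 0" "norm m = 1" shows "h t m \<le> exp (2 * \<bar>\<eta>\<bar> * Ln * \<bar>t - s\<bar>) * h s m"
proof -
  have "h t m \<le> exp (2 * \<bar>\<eta>\<bar> * (norm (m - m) + norm (n t - n s))) * h s m"
    by (intro equilibrium_log_lipschitz unit assms)
  also have "\<dots> \<le> exp (2 * \<bar>\<eta>\<bar> * Ln * \<bar>t - s\<bar>) * h s m"
  proof (intro mult_right_mono)
    have "2 * \<bar>\<eta>\<bar> * norm (n t - n s) \<le> 2 * \<bar>\<eta>\<bar> * (Ln * \<bar>t - s\<bar>)" using n_lip[OF assms(1,2)] by (intro mult_left_mono) auto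
    then show "exp (2 * \<bar>\<eta>\<bar> * (norm (m - m) + norm (n t - n s))) \<le> exp (2 * \<bar>\<eta>\<bar> * Ln * \<bar>t - s\<bar>)" by (simp add: mult.assoc)
  qed (use equilibrium_pos[OF unit[OF assms(1)], of \<eta> m] in simp)
  finally show ?thesis .
qed

lemma h_lipschitz:
  "\<exists>B\<ge>0. \<forall>s\<in>{0..T}. \<forall>t\<in>{0..T}. \<forall>m. norm m = 1 \<longrightarrow> \<bar>h t m - h s m\<bar> \<le> B * \<bar>t - s\<bar>"
proof -
  define k where "k = 2 * \<bar>\<eta>\<bar> * Ln"
  have k: "k \<ge> 0" using Ln by (simp add: k_def)
  define c1 where "c1 = exp \<bar>\<eta>\<bar> / partition_function \<eta>"
  have c1: "c1 > 0" using partition_function_pos by (simp add: c1_def)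
  have one: "h t m - h s m \<le> (k * exp (k * T) * c1) * \<bar>t - s\<bar>" if "s \<in> {0..T}" "t \<in> {0..T}" and m: "norm m = 1" for s t m
  proof -
    have st: "s \<ge> 0" "t \<ge> 0" "\<bar>t - s\<bar> \<le> T" using that by auto
    interpret weight "h s" "exp (- \<bar>\<eta>\<bar>) / partition_function \<eta>" c1 unfolding c1_def by (rule weight_equilibrium[OF unit[OF st(1)]])
    let ?x = "k * \<bar>t - s\<bar>"
    have x: "0 \<le> ?x" "?x \<le> k * T" using k st by (auto intro!: mult_left_mono)
    have "1 - exp (- ?x) \<le> ?x" using exp_ge_add_one_self[of "- ?x"] by simp
    then have "exp ?x * (1 - exp (- ?x)) \<le> exp ?x * ?x" by (intro mult_left_mono) auto
    then have "exp ?x - 1 \<le> exp ?x * ?x" by (simp add: right_diff_distrib exp_add[symmetric])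
    also have "\<dots> \<le> exp (k * T) * ?x" using x by (intro mult_right_mono) auto
    finally have ex: "exp ?x - 1 \<le> exp (k * T) * ?x" .
    have "h t m - h s m \<le> (exp ?x - 1) * h s m" using h_ratio[OF st(1,2) m] by (simp add: k_def algebra_simps)
    also have "\<dots> \<le> (exp (k * T) * ?x) * c1" using ex upper[OF m] h_pos[OF m] x by (intro mult_mono) auto
    finally show ?thesis by (simp add: mult_ac)
  qed
  show ?thesis
  proof (intro exI[of _ "k * exp (k * T) * c1"] conjI ballI allI impI)
    show "0 \<le> k * exp (k * T) * c1" using k c1 by simp
    fix s t m assume st: "s \<in> {0..T}" "t \<in> {0..T}" and m: "norm (m :: real^3) = 1"
    show "\<bar>h t m - h s m\<bar> \<le> k * exp (k * T) * c1 * \<bar>t - s\<bar>"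
      using one[OF st m] one[OF st(2,1) m] by (simp add: abs_minus_commute abs_le_iff)
  qed
qed

definition "dapprox \<epsilon> t m = rdiv (flux0 t) m + \<epsilon> * rdiv (flux1 t) m + \<epsilon>\<^sup>2 * rdiv (flux2 t) m + \<epsilon>^3 * df3 t m"

lemma approx_derivative:
  assumes "t \<ge> 0" "norm m = 1" shows "((\<lambda>s. approx \<epsilon> s m) has_real_derivative dapprox \<epsilon> t m) (at t within {0..})"
  unfolding approx_eq dapprox_def
  by (intro DERIV_add DERIV_cmult time_derivative df3 assms)

lemma approx_smooth: "t \<ge> 0 \<Longrightarrow> sphere_smooth (approx \<epsilon> t)"
  unfolding approx_eq[abs_def] by (intro sphere_smooth_add sphere_smooth_cmult f_smooth' h_smooth)

lemma approx_integral: "t \<ge> 0 \<Longrightarrow> (LINT m|surf. approx \<epsilon> t m) = 1"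
proof -
  assume t: "t \<ge> 0"
  have "(LINT m|surf. approx \<epsilon> t m) = (LINT m|surf. h t m) + \<epsilon> * (LINT m|surf. f 1 t m) + \<epsilon>\<^sup>2 * (LINT m|surf. f 2 t m) + \<epsilon>^3 * (LINT m|surf. f 3 t m)"
    unfolding approx_eq using f_smooth'[OF t, THEN smooth_integrable] h_smooth[OF t, THEN smooth_integrable]
    by (simp del: One_nat_def)
  then show ?thesis using t by (simp add: f_mean equilibrium_integral unit del: One_nat_def)
qed

lemma dapprox_continuous: "t \<ge> 0 \<Longrightarrow> continuous_on S2 (dapprox \<epsilon> t)"
  unfolding dapprox_def[abs_def]
  by (intro continuous_intros sphere_smooth_continuous sphere_smooth_rdiv smooth_field_flux df3)

lemma approx_lipschitz:
  "\<exists>B\<ge>0. \<forall>s\<in>{0..T}. \<forall>t\<in>{0..T}. \<forall>m. norm m = 1 \<longrightarrow> \<bar>approx \<epsilon> t m - approx \<epsilon> s m\<bar> \<le> B * \<bar>t - s\<bar>"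
proof -
  obtain B1 where B1: "B1 \<ge> 0" "\<And>s t m. s \<in> {0..T} \<Longrightarrow> t \<in> {0..T} \<Longrightarrow> norm m = 1 \<Longrightarrow> \<bar>h t m - h s m\<bar> \<le> B1 * \<bar>t - s\<bar>"
    using h_lipschitz[of T] by blast
  obtain B2 where B2: "B2 \<ge> 0" "\<And>k s t m. k \<in> {1..3} \<Longrightarrow> s \<in> {0..T} \<Longrightarrow> t \<in> {0..T} \<Longrightarrow> norm m = 1 \<Longrightarrow> \<bar>f k t m - f k s m\<bar> \<le> B2 * \<bar>t - s\<bar>"
    using f_bounds[of T] by blast
  show ?thesis
  proof (intro exI[of _ "B1 + (\<Sum>k=1..3. \<bar>\<epsilon>\<bar> ^ k * B2)"] conjI ballI allI impI)
    show "0 \<le> B1 + (\<Sum>k=1..3. \<bar>\<epsilon>\<bar> ^ k * B2)" using B1 B2 by (intro add_nonneg_nonneg sum_nonneg mult_nonneg_nonneg) auto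
    fix s t m assume st: "s \<in> {0..T}" "t \<in> {0..T}" and m: "norm (m :: real^3) = 1"
    have "approx \<epsilon> t m - approx \<epsilon> s m = (h t m - h s m) + (\<Sum>k=1..3. \<epsilon> ^ k * (f k t m - f k s m))"
      by (simp add: approx_def sum_subtractf right_diff_distrib)
    also have "\<bar>\<dots>\<bar> \<le> \<bar>h t m - h s m\<bar> + (\<Sum>k=1..3. \<bar>\<epsilon> ^ k * (f k t m - f k s m)\<bar>)"
      by (intro order_trans[OF abs_triangle_ineq] add_left_mono sum_abs)
    also have "\<dots> \<le> B1 * \<bar>t - s\<bar> + (\<Sum>k=1..3. \<bar>\<epsilon>\<bar> ^ k * (B2 * \<bar>t - s\<bar>))"
      unfolding abs_mult power_abs by (intro add_mono sum_mono mult_left_mono B1 B2 st m) auto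
    finally show "\<bar>approx \<epsilon> t m - approx \<epsilon> s m\<bar> \<le> (B1 + (\<Sum>k=1..3. \<bar>\<epsilon>\<bar> ^ k * B2)) * \<bar>t - s\<bar>"
      by (simp add: distrib_right sum_distrib_right mult.assoc)
  qed
qed

text \<open>The equations of the expansion say that the time derivatives are divergences of the fluxes, and only the last corrector is left over.\<close>

lemma dapprox_weak:
  assumes t: "t \<ge> 0" and \<phi>: "sphere_smooth \<phi>"
  shows "(LINT m|surf. dapprox \<epsilon> t m * \<phi> m) =
    - (LINT m|surf. (flux0 t m + \<epsilon> *\<^sub>R flux1 t m + \<epsilon>\<^sup>2 *\<^sub>R flux2 t m) \<bullet> rgrad \<phi> m) + \<epsilon>^3 * (LINT m|surf. df3 t m * \<phi> m)"
proof -
  note sv = smooth_field_flux[OF t] and L\<phi> = L2_smooth[OF \<phi>]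
  have i: "integrable surf (\<lambda>m. rdiv V m * \<phi> m)" "integrable surf (\<lambda>m. V m \<bullet> rgrad \<phi> m)" if "smooth_field V" for V
    by (intro L2_mult_integrable L2_smooth sphere_smooth_rdiv that \<phi>) (intro L2_inner_integrable smooth_field_L2 L2_rgrad that \<phi>)
  have i3: "integrable surf (\<lambda>m. df3 t m * \<phi> m)" by (intro L2_mult_integrable L2_continuous df3 t L\<phi>)
  have "(LINT m|surf. dapprox \<epsilon> t m * \<phi> m) = (LINT m|surf. rdiv (flux0 t) m * \<phi> m + \<epsilon> * (rdiv (flux1 t) m * \<phi> m)
      + \<epsilon>\<^sup>2 * (rdiv (flux2 t) m * \<phi> m) + \<epsilon>^3 * (df3 t m * \<phi> m))"
    unfolding dapprox_def by (simp add: algebra_simps)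
  also have "\<dots> = (LINT m|surf. rdiv (flux0 t) m * \<phi> m) + \<epsilon> * (LINT m|surf. rdiv (flux1 t) m * \<phi> m)
      + \<epsilon>\<^sup>2 * (LINT m|surf. rdiv (flux2 t) m * \<phi> m) + \<epsilon>^3 * (LINT m|surf. df3 t m * \<phi> m)"
    using i(1)[OF sv(1)] i(1)[OF sv(2)] i(1)[OF sv(3)] i3 by simp
  also have "\<dots> = - ((LINT m|surf. flux0 t m \<bullet> rgrad \<phi> m) + \<epsilon> * (LINT m|surf. flux1 t m \<bullet> rgrad \<phi> m)
      + \<epsilon>\<^sup>2 * (LINT m|surf. flux2 t m \<bullet> rgrad \<phi> m)) + \<epsilon>^3 * (LINT m|surf. df3 t m * \<phi> m)"
    by (simp add: smooth_field_by_parts[OF _ \<phi>] sv)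
  also have "(LINT m|surf. flux0 t m \<bullet> rgrad \<phi> m) + \<epsilon> * (LINT m|surf. flux1 t m \<bullet> rgrad \<phi> m)
      + \<epsilon>\<^sup>2 * (LINT m|surf. flux2 t m \<bullet> rgrad \<phi> m)
      = (LINT m|surf. (flux0 t m + \<epsilon> *\<^sub>R flux1 t m + \<epsilon>\<^sup>2 *\<^sub>R flux2 t m) \<bullet> rgrad \<phi> m)"
    using i(2)[OF sv(1)] i(2)[OF sv(2)] i(2)[OF sv(3)] by (simp add: inner_add_left)
  finally show ?thesis .
qed

end

section \<open>The correctors\<close>

lemma matrix_bound: "\<exists>K\<ge>0. \<forall>v. norm (A *v v) \<le> K * norm v" for A :: "real^3^3"
  using bounded_linear.nonneg_bounded[OF matrix_vector_mul_bounded_linear[of A]] by (metis mult.commute)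

lemma l2norm_scaleR_le:
  fixes a :: "real^3 \<Rightarrow> real" and C :: "real^3 \<Rightarrow> real^3"
  assumes a: "L2 a" and C: "continuous_on S2 C" and k: "k \<ge> 0" and le: "\<And>m. norm m = 1 \<Longrightarrow> norm (C m) \<le> k"
  shows "l2norm (\<lambda>m. a m *\<^sub>R C m) \<le> k * l2norm a"
proof (rule L2_bound(2)[OF _ a _ k])
  show "(\<lambda>m. a m *\<^sub>R C m) \<in> borel_measurable surf" by (rule L2_measurable[OF L2_scaleR_vec_continuous[OF a C]])
  show "norm (a m *\<^sub>R C m) \<le> k * norm (a m)" if "norm m = 1" for m
    using mult_left_mono[OF le[OF that], of "\<bar>a m\<bar>"] by (simp add: mult.commute)
qed

lemma norm_rgrad_mean_field:
  assumes "L2 g" "norm m = 1" "\<alpha> \<ge> 0" shows "norm (rgrad (mean_field \<alpha> g) m) \<le> 2 * \<alpha> * (sqrt area * l2norm g)"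
proof -
  have "norm (cross3 m (qop g m)) \<le> sqrt area * l2norm g"
    using norm_cross3_le[of m "qop g m"] norm_qop_le[OF assms(1), of m] assms(2) by simp
  then show ?thesis using assms by (simp add: rgrad_mean_field L2_integrable mult_left_mono)
qed

context doi_expansion begin

definition "corr \<epsilon> t m = f 1 t m + \<epsilon> * f 2 t m + \<epsilon>\<^sup>2 * f 3 t m"

text \<open>The products of order \<open>\<epsilon>\<^sup>3\<close> and higher in the flux of the expansion.\<close>

definition "corr_flux \<epsilon> t m =
  f 1 t m *\<^sub>R rgrad (U (f 3 t)) m + f 2 t m *\<^sub>R rgrad (U (f 2 t)) m + f 3 t m *\<^sub>R rgrad (U (f 1 t)) m
    + \<epsilon> *\<^sub>R (f 2 t m *\<^sub>R rgrad (U (f 3 t)) m + f 3 t m *\<^sub>R rgrad (U (f 2 t)) m)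
    + \<epsilon>\<^sup>2 *\<^sub>R (f 3 t m *\<^sub>R rgrad (U (f 3 t)) m) - f 3 t m *\<^sub>R w m"

lemma corr_smooth: "t \<ge> 0 \<Longrightarrow> sphere_smooth (corr \<epsilon> t)"
  unfolding corr_def[abs_def] by (intro sphere_smooth_add sphere_smooth_cmult f_smooth')

lemma corr_flux_smooth_field: "t \<ge> 0 \<Longrightarrow> smooth_field (corr_flux \<epsilon> t)"
  unfolding corr_flux_def[abs_def]
  by (intro smooth_field_add smooth_field_diff smooth_field_interaction smooth_field_drift smooth_field_scaleR[OF sphere_smooth_const] f_smooth')

text \<open>The bound is uniform in \<open>\<epsilon>\<close>, as required of the final constant.\<close>

lemma coefficient_bounds:
  "\<exists>K\<ge>0. \<forall>\<epsilon> t m. 0 < \<epsilon> \<and> \<epsilon> \<le> 1 \<and> 0 \<le> t \<and> t \<le> T \<and> norm m = 1 \<longrightarrow> \<bar>corr \<epsilon> t m\<bar> \<le> K \<and> norm (corr_flux \<epsilon> t m) \<le> K \<and> \<bar>df3 t m\<bar> \<le> K"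
proof -
  obtain B where B: "B \<ge> 0" "\<And>k t m. k \<in> {1..3} \<Longrightarrow> t \<in> {0..T} \<Longrightarrow> norm m = 1 \<Longrightarrow> \<bar>f k t m\<bar> \<le> B"
    "\<And>t m. t \<in> {0..T} \<Longrightarrow> norm m = 1 \<Longrightarrow> \<bar>df3 t m\<bar> \<le> B"
  proof -
    have "1 \<in> {1..3::nat}" by simp
    then show thesis using f_bounds[of T] that by blast
  qed
  obtain K\<kappa> where K\<kappa>: "K\<kappa> \<ge> 0" "\<And>v. norm (\<kappa> *v v) \<le> K\<kappa> * norm v" using matrix_bound[of \<kappa>] by blast
  define A where "A = 2 * \<alpha> * (sqrt area * (B * sqrt area))"
  have A: "A \<ge> 0" using alpha B area_pos by (simp add: A_def)
  define K where "K = 3 * B + (6 * (B * A) + B * K\<kappa>)"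
  have K: "K \<ge> 0" "3 * B \<le> K" "B \<le> K" "6 * (B * A) + B * K\<kappa> \<le> K" using A B K\<kappa> by (auto simp: K_def)
  show ?thesis
  proof (intro exI[of _ K] conjI allI impI)
    fix \<epsilon> t :: real and m :: "real^3" assume "0 < \<epsilon> \<and> \<epsilon> \<le> 1 \<and> 0 \<le> t \<and> t \<le> T \<and> norm m = 1"
    then have e: "0 \<le> \<epsilon>" "\<epsilon> \<le> 1" and t: "t \<in> {0..T}" "t \<ge> 0" and m: "norm m = 1" by auto
    have e2: "0 \<le> \<epsilon>\<^sup>2" "\<epsilon>\<^sup>2 \<le> 1" using e by (auto simp: power_le_one)
    have fb: "\<bar>f 1 t m\<bar> \<le> B" "\<bar>f 2 t m\<bar> \<le> B" "\<bar>f 3 t m\<bar> \<le> B" by (auto intro!: B(2) t m)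
    have s1: "\<bar>c * x\<bar> \<le> b" if "\<bar>x\<bar> \<le> b" "0 \<le> c" "c \<le> 1" "b \<ge> 0" for c x b :: real
      using mult_mono[of c 1 "\<bar>x\<bar>" b] that by (simp add: abs_mult)
    have "\<bar>corr \<epsilon> t m\<bar> \<le> 3 * B" unfolding corr_def
      using fb(1) s1[OF fb(2) e B(1)] s1[OF fb(3) e2 B(1)] by linarith
    then show "\<bar>corr \<epsilon> t m\<bar> \<le> K" using K by linarith
    show "\<bar>df3 t m\<bar> \<le> K" using B(3)[OF t(1) m] K by linarith
    have ub: "norm (rgrad (U (f k t)) m) \<le> A" if k: "k \<in> {1..3}" for k
    proof -
      have L: "L2 (f k t)" by (intro L2_smooth f_smooth k t)
      have "l2norm (f k t) \<le> B * sqrt area" using B(2)[OF k t(1)] by (intro l2norm_le_bounded L B(1)) auto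
      then have "2 * \<alpha> * (sqrt area * l2norm (f k t)) \<le> A"
        unfolding A_def using alpha area_pos by (intro mult_left_mono) auto
      then show ?thesis using norm_rgrad_mean_field[OF L m alpha] by linarith
    qed
    have prod: "norm (a *\<^sub>R v) \<le> B * A" if "\<bar>a\<bar> \<le> B" "norm v \<le> A" for a and v :: "real^3"
      using mult_mono[OF that B(1)] by simp
    have u: "norm (rgrad (U (f 1 t)) m) \<le> A" "norm (rgrad (U (f 2 t)) m) \<le> A" "norm (rgrad (U (f 3 t)) m) \<le> A"
      by (auto intro!: ub)
    note p = prod[OF fb(1) u(3)] prod[OF fb(2) u(2)] prod[OF fb(3) u(1)] prod[OF fb(2) u(3)] prod[OF fb(3) u(2)] prod[OF fb(3) u(3)]
    have BA: "B * A \<ge> 0" using A B by simp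
    have s2: "norm (c *\<^sub>R v) \<le> b" if "norm v \<le> b" "0 \<le> c" "c \<le> 1" "b \<ge> 0" for c b and v :: "real^3"
      using mult_mono[of c 1 "norm v" b] that by simp
    have "norm (w m) \<le> K\<kappa>" using norm_cross3_le[of m "\<kappa> *v m"] K\<kappa>(2)[of m] m by simp
    then have pw: "norm (f 3 t m *\<^sub>R w m) \<le> B * K\<kappa>" using mult_mono[OF fb(3) _ B(1), of "norm (w m)" K\<kappa>] by simp
    have "norm (f 2 t m *\<^sub>R rgrad (U (f 3 t)) m + f 3 t m *\<^sub>R rgrad (U (f 2 t)) m) \<le> 2 * (B * A)"
      by (rule order_trans[OF norm_triangle_le[OF add_mono[OF p(4,5)]]]) simp
    from s2[OF this e] BA have q1: "norm (\<epsilon> *\<^sub>R (f 2 t m *\<^sub>R rgrad (U (f 3 t)) m + f 3 t m *\<^sub>R rgrad (U (f 2 t)) m)) \<le> 2 * (B * A)" by simp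
    have q2: "norm (\<epsilon>\<^sup>2 *\<^sub>R (f 3 t m *\<^sub>R rgrad (U (f 3 t)) m)) \<le> B * A" by (rule s2[OF p(6) e2 BA])
    have tri: "norm (a + b + c + d + g - k) \<le> norm a + norm b + norm c + norm d + norm g + norm k" for a b c d g k :: "real^3"
      by (intro order_trans[OF norm_triangle_ineq4] order_trans[OF norm_triangle_ineq] add_mono order_refl)
    have "norm (corr_flux \<epsilon> t m) \<le> B * A + B * A + B * A + 2 * (B * A) + B * A + B * K\<kappa>"
      unfolding corr_flux_def by (rule order_trans[OF tri]) (intro add_mono p q1 q2 pw)
    also have "\<dots> = 6 * (B * A) + B * K\<kappa>" by (simp add: algebra_simps)
    also have "\<dots> \<le> K" by (rule K)
    finally show "norm (corr_flux \<epsilon> t m) \<le> K" .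
  qed (rule K(1))
qed

lemma approx_increment:
  assumes t: "t > 0" and e: "e > 0"
  shows "\<forall>\<^sub>F s in at_right 0. \<forall>\<phi>. sphere_smooth \<phi> \<longrightarrow>
    \<bar>(LINT m|surf. approx \<epsilon> t m * \<phi> m) - (LINT m|surf. approx \<epsilon> (t - s) m * \<phi> m) - s * (LINT m|surf. dapprox \<epsilon> t m * \<phi> m)\<bar> \<le> s * e * l2norm \<phi>"
proof -
  obtain B where B: "B \<ge> 0" "\<And>s t' m. s \<in> {0..t} \<Longrightarrow> t' \<in> {0..t} \<Longrightarrow> norm m = 1 \<Longrightarrow> \<bar>approx \<epsilon> t' m - approx \<epsilon> s m\<bar> \<le> B * \<bar>t' - s\<bar>"
    using approx_lipschitz[of t \<epsilon>] by blast
  have La: "L2 (approx \<epsilon> s)" if "s \<ge> 0" for s by (intro L2_smooth approx_smooth that)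
  have Ld: "L2 (dapprox \<epsilon> t)" using t by (intro L2_continuous dapprox_continuous) simp
  have "((\<lambda>s. l2norm (\<lambda>m. (approx \<epsilon> t m - approx \<epsilon> (t - s) m) / s - dapprox \<epsilon> t m)) \<longlongrightarrow> 0) (at_right 0)"
  proof (rule difference_quotient_L2[OF t _ _ _ _ B(1)])
    show "((\<lambda>s. approx \<epsilon> s m) has_real_derivative dapprox \<epsilon> t m) (at t within {0..})" if "norm m = 1" for m
      using t that by (intro approx_derivative) auto
    show "\<bar>approx \<epsilon> t m - approx \<epsilon> s m\<bar> \<le> B * \<bar>t - s\<bar>" if "0 \<le> s" "s \<le> t" "norm m = 1" for s m
      using that by (intro B(2)) auto
    show "approx \<epsilon> s \<in> borel_measurable surf" if "0 \<le> s" for s by (rule L2_measurable[OF La[OF that]])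
    show "dapprox \<epsilon> t \<in> borel_measurable surf" by (rule L2_measurable[OF Ld])
  qed
  then have "\<forall>\<^sub>F s in at_right 0. l2norm (\<lambda>m. (approx \<epsilon> t m - approx \<epsilon> (t - s) m) / s - dapprox \<epsilon> t m) < e"
    using e by (intro order_tendstoD(2))
  moreover have "\<forall>\<^sub>F s in at_right 0. s \<in> {0<..<t}" by (rule eventually_at_rightI[OF _ t])
  ultimately show ?thesis
  proof (eventually_elim, intro allI impI)
    fix s \<phi> assume le: "l2norm (\<lambda>m. (approx \<epsilon> t m - approx \<epsilon> (t - s) m) / s - dapprox \<epsilon> t m) < e"
      and s: "s \<in> {0<..<t}" and \<phi>: "sphere_smooth \<phi>"
    note L\<phi> = L2_smooth[OF \<phi>]
    have L1: "L2 (approx \<epsilon> t)" "L2 (approx \<epsilon> (t - s))" using t s by (auto intro: La)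
    have Lq: "L2 (\<lambda>m. (approx \<epsilon> t m - approx \<epsilon> (t - s) m) / s - dapprox \<epsilon> t m)"
      using L2_diff[OF L2_cmult[OF L2_diff[OF L1], of "1/s"] Ld] by simp
    have "(LINT m|surf. ((approx \<epsilon> t m - approx \<epsilon> (t - s) m) / s - dapprox \<epsilon> t m) * \<phi> m)
        = (LINT m|surf. (1/s) * (approx \<epsilon> t m * \<phi> m) - (1/s) * (approx \<epsilon> (t - s) m * \<phi> m) - dapprox \<epsilon> t m * \<phi> m)"
      by (simp add: left_diff_distrib diff_divide_distrib)
    also have "\<dots> = (1/s) * (LINT m|surf. approx \<epsilon> t m * \<phi> m) - (1/s) * (LINT m|surf. approx \<epsilon> (t - s) m * \<phi> m) - (LINT m|surf. dapprox \<epsilon> t m * \<phi> m)"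
      using L2_mult_integrable[OF L1(1) L\<phi>] L2_mult_integrable[OF L1(2) L\<phi>] L2_mult_integrable[OF Ld L\<phi>] by simp
    finally have eq: "(LINT m|surf. approx \<epsilon> t m * \<phi> m) - (LINT m|surf. approx \<epsilon> (t - s) m * \<phi> m) - s * (LINT m|surf. dapprox \<epsilon> t m * \<phi> m)
        = s * (LINT m|surf. ((approx \<epsilon> t m - approx \<epsilon> (t - s) m) / s - dapprox \<epsilon> t m) * \<phi> m)"
      using s by (simp add: right_diff_distrib)
    have "\<bar>LINT m|surf. ((approx \<epsilon> t m - approx \<epsilon> (t - s) m) / s - dapprox \<epsilon> t m) * \<phi> m\<bar> \<le> e * l2norm \<phi>"
      using L2_Cauchy_Schwarz_real[OF Lq L\<phi>] mult_right_mono[OF less_imp_le[OF le] l2norm_nonneg[of \<phi>]] by linarith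
    then show "\<bar>(LINT m|surf. approx \<epsilon> t m * \<phi> m) - (LINT m|surf. approx \<epsilon> (t - s) m * \<phi> m) - s * (LINT m|surf. dapprox \<epsilon> t m * \<phi> m)\<bar> \<le> s * e * l2norm \<phi>"
      unfolding eq abs_mult using s by (simp add: mult.assoc mult_left_mono)
  qed
qed

end

section \<open>The kinetic solution\<close>

locale kinetic = doi_expansion +
  fixes \<epsilon> :: real and p0 :: "real^3 \<Rightarrow> real" and p :: "real \<Rightarrow> real^3 \<Rightarrow> real"
  assumes eps: "\<epsilon> > 0" and sol: "kinetic_solution \<alpha> \<kappa> \<epsilon> p0 p" and mass0: "(LINT m|surf. p0 m) = 1"
begin

lemma p_H1: "t \<ge> 0 \<Longrightarrow> sphere_H1 (p t)"
  using sol by (simp add: kinetic_solution_def)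

lemma p_L2: "t \<ge> 0 \<Longrightarrow> L2 (p t)"
  by (intro sphere_H1_L2 p_H1)

definition "W t = weak_rgrad (p t)"

lemma W: "t \<ge> 0 \<Longrightarrow> has_weak_rgrad (p t) (W t)" "t \<ge> 0 \<Longrightarrow> L2 (W t)"
  unfolding W_def by (auto intro: sphere_H1_weak L2_weak_rgrad p_H1)

definition "V t m = kinetic_flux \<alpha> \<kappa> \<epsilon> (p t) m"

lemma V_eq: "V t m = (1/\<epsilon>) *\<^sub>R (W t m + p t m *\<^sub>R rgrad (U (p t)) m) - p t m *\<^sub>R w m"
  by (simp add: V_def kinetic_flux_def W_def)

lemma w_continuous: "continuous_on S2 w"
  by (rule smooth_field_continuous[OF smooth_field_w])

lemma U_continuous: "L2 g \<Longrightarrow> continuous_on S2 (rgrad (U g))"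
  by (intro rgrad_continuous sphere_smooth_mean_field L2_integrable)

lemma V_L2: assumes t: "t \<ge> 0" shows "L2 (V t)"
  unfolding V_eq[abs_def]
  by (intro L2_diff L2_scaleR L2_add W t L2_scaleR_vec_continuous p_L2 U_continuous w_continuous)

lemma p_tendsto:
  assumes t: "t \<ge> 0"
  shows "((\<lambda>s. l2norm (\<lambda>m. p s m - p t m)) \<longlongrightarrow> 0) (at t within {0..})"
    and "((\<lambda>s. l2norm (\<lambda>m. W s m - W t m)) \<longlongrightarrow> 0) (at t within {0..})"
proof -
  have lim: "((\<lambda>s. sphere_H1_norm (\<lambda>m. p s m - p t m)) \<longlongrightarrow> 0) (at t within {0..})"
    using sol t by (simp add: kinetic_solution_def)
  have le: "l2norm (\<lambda>m. p s m - p t m) \<le> sphere_H1_norm (\<lambda>m. p s m - p t m)"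
    "l2norm (\<lambda>m. W s m - W t m) \<le> sphere_H1_norm (\<lambda>m. p s m - p t m)" if "s \<ge> 0" for s
    using l2norm_le_H1[OF L2_diff[OF p_L2[OF that] p_L2[OF t]] has_weak_rgrad_diff[OF p_L2[OF that] W(1)[OF that] p_L2[OF t] W(1)[OF t]]] .
  have ev: "\<forall>\<^sub>F s in at t within {0..}. s \<ge> 0" by (simp add: eventually_at_filter)
  show "((\<lambda>s. l2norm (\<lambda>m. p s m - p t m)) \<longlongrightarrow> 0) (at t within {0..})"
    by (rule Lim_null_comparison[OF _ lim]) (use ev in \<open>eventually_elim, simp add: le\<close>)
  show "((\<lambda>s. l2norm (\<lambda>m. W s m - W t m)) \<longlongrightarrow> 0) (at t within {0..})"
    by (rule Lim_null_comparison[OF _ lim]) (use ev in \<open>eventually_elim, simp add: le\<close>)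
qed

text \<open>The flux is continuous in time with values in \<open>L\<^sup>2\<close>.  In the quadratic term the potentials converge uniformly, since they depend on second
  moments only.\<close>

lemma V_tendsto:
  assumes t: "t \<ge> 0" shows "((\<lambda>s. l2norm (\<lambda>m. V s m - V t m)) \<longlongrightarrow> 0) (at t within {0..})"
proof -
  obtain K\<kappa> where K\<kappa>: "K\<kappa> \<ge> 0" "\<And>v. norm (\<kappa> *v v) \<le> K\<kappa> * norm v" using matrix_bound[of \<kappa>] by blast
  define c where "c = 2 * \<alpha> * sqrt area"
  have c: "c \<ge> 0" using alpha area_pos by (simp add: c_def)
  let ?x = "\<lambda>s. l2norm (\<lambda>m. W s m - W t m)" and ?y = "\<lambda>s. l2norm (\<lambda>m. p s m - p t m)" and ?P = "l2norm (p t)"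
  have le: "l2norm (\<lambda>m. V s m - V t m) \<le> (1/\<epsilon>) * (?x s + c * (?P + ?y s) * ?y s + c * ?y s * ?P) + K\<kappa> * ?y s" if s: "s \<ge> 0" for s
  proof -
    let ?d = "\<lambda>m. p s m - p t m"
    have Ld: "L2 ?d" by (intro L2_diff p_L2 s t)
    have LW: "L2 (\<lambda>m. W s m - W t m)" by (intro L2_diff W s t)
    let ?A = "\<lambda>m. ?d m *\<^sub>R rgrad (U (p s)) m" and ?B = "\<lambda>m. p t m *\<^sub>R rgrad (U ?d) m" and ?C = "\<lambda>m. ?d m *\<^sub>R w m"
    have LA: "L2 ?A" by (intro L2_scaleR_vec_continuous Ld U_continuous p_L2 s)
    have LB: "L2 ?B" by (intro L2_scaleR_vec_continuous Ld U_continuous p_L2 t)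
    have LC: "L2 ?C" by (intro L2_scaleR_vec_continuous Ld w_continuous)
    have eq: "V s m - V t m = (1/\<epsilon>) *\<^sub>R ((W s m - W t m) + ?A m + ?B m) - ?C m" if m: "norm m = 1" for m
    proof -
      have "rgrad (U ?d) m = rgrad (U (p s)) m - rgrad (U (p t)) m"
      proof -
        have "cross3 m (a - b) = cross3 m a - cross3 m b" for a b by (simp add: cross3_simps forall_3)
        then show ?thesis
          unfolding rgrad_mean_field[OF L2_integrable[OF Ld] m] rgrad_mean_field[OF L2_integrable[OF p_L2[OF s]] m]
            rgrad_mean_field[OF L2_integrable[OF p_L2[OF t]] m]
            qop_diff[OF L2_integrable[OF p_L2[OF s]] L2_integrable[OF p_L2[OF t]]]
          by (simp add: scaleR_diff_right)
      qed
      then have U_s: "rgrad (U (p s)) m = rgrad (U (p t)) m + rgrad (U ?d) m" by simp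
      show ?thesis unfolding V_eq U_s
        by (simp only: scaleR_add_right scaleR_diff_right scaleR_add_left scaleR_diff_left) (simp add: algebra_simps)
    qed
    have "l2norm (\<lambda>m. V s m - V t m) = l2norm (\<lambda>m. (1/\<epsilon>) *\<^sub>R ((W s m - W t m) + ?A m + ?B m) - ?C m)"
      by (rule l2norm_cong_S2) (rule eq)
    also have "\<dots> \<le> l2norm (\<lambda>m. (1/\<epsilon>) *\<^sub>R ((W s m - W t m) + ?A m + ?B m)) + l2norm ?C"
      by (intro l2norm_triangle_diff L2_scaleR L2_add LW LA LB LC)
    also have "l2norm (\<lambda>m. (1/\<epsilon>) *\<^sub>R ((W s m - W t m) + ?A m + ?B m)) = (1/\<epsilon>) * l2norm (\<lambda>m. (W s m - W t m) + ?A m + ?B m)"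
      using eps by (simp only: l2norm_scaleR) simp
    also have "l2norm (\<lambda>m. (W s m - W t m) + ?A m + ?B m) \<le> ?x s + l2norm ?A + l2norm ?B"
      using l2norm_triangle[OF L2_add[OF LW LA] LB] l2norm_triangle[OF LW LA] by linarith
    also have "l2norm ?A \<le> c * (?P + ?y s) * ?y s"
    proof (rule l2norm_scaleR_le[OF Ld])
      show "continuous_on S2 (rgrad (U (p s)))" by (intro U_continuous p_L2 s)
      show "0 \<le> c * (?P + ?y s)" using c by simp
      fix m :: "real^3" assume m: "norm m = 1"
      have "l2norm (p s) \<le> ?P + ?y s" using l2norm_triangle[OF p_L2[OF t] Ld] by simp
      then have "c * l2norm (p s) \<le> c * (?P + ?y s)" using c by (intro mult_left_mono)
      then show "norm (rgrad (U (p s)) m) \<le> c * (?P + ?y s)"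
        using norm_rgrad_mean_field[OF p_L2[OF s] m alpha] by (simp add: c_def mult.assoc)
    qed
    also have "l2norm ?B \<le> c * ?y s * ?P"
    proof (rule l2norm_scaleR_le[OF p_L2[OF t]])
      show "continuous_on S2 (rgrad (U ?d))" by (intro U_continuous Ld)
      show "0 \<le> c * ?y s" using c by simp
      show "norm (rgrad (U ?d) m) \<le> c * ?y s" if "norm m = 1" for m
        using norm_rgrad_mean_field[OF Ld that alpha] by (simp add: c_def mult.assoc)
    qed
    also have "l2norm ?C \<le> K\<kappa> * ?y s"
    proof (rule l2norm_scaleR_le[OF Ld w_continuous K\<kappa>(1)])
      show "norm (w m) \<le> K\<kappa>" if "norm m = 1" for m
        using norm_cross3_le[of m "\<kappa> *v m"] K\<kappa>(2)[of m] that by simp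
    qed
    finally show ?thesis using eps by (simp add: divide_right_mono)
  qed
  have "((\<lambda>s. (1/\<epsilon>) * (?x s + c * (?P + ?y s) * ?y s + c * ?y s * ?P) + K\<kappa> * ?y s) \<longlongrightarrow>
      (1/\<epsilon>) * (0 + c * (?P + 0) * 0 + c * 0 * ?P) + K\<kappa> * 0) (at t within {0..})"
    by (intro tendsto_intros p_tendsto t)
  then have lim: "((\<lambda>s. (1/\<epsilon>) * (?x s + c * (?P + ?y s) * ?y s + c * ?y s * ?P) + K\<kappa> * ?y s) \<longlongrightarrow> 0) (at t within {0..})" by simp
  have ev: "\<forall>\<^sub>F s in at t within {0..}. s \<ge> 0" by (simp add: eventually_at_filter)
  show ?thesis
  proof (rule Lim_null_comparison[OF _ lim])
    show "\<forall>\<^sub>F s in at t within {0..}. norm (l2norm (\<lambda>m. V s m - V t m)) \<le> (1/\<epsilon>) * (?x s + c * (?P + ?y s) * ?y s + c * ?y s * ?P) + K\<kappa> * ?y s"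
      using ev
    proof eventually_elim
      case (elim s)
      show ?case using le[OF elim] by simp
    qed
  qed
qed

lemma pairing_diff:
  assumes \<phi>: "sphere_smooth \<phi>" and st: "s \<ge> 0" "t \<ge> 0"
  shows "\<bar>(LINT m|surf. V s m \<bullet> rgrad \<phi> m) - (LINT m|surf. V t m \<bullet> rgrad \<phi> m)\<bar> \<le> l2norm (\<lambda>m. V s m - V t m) * l2norm (rgrad \<phi>)"
proof -
  have "(LINT m|surf. (V s m - V t m) \<bullet> rgrad \<phi> m) = (LINT m|surf. V s m \<bullet> rgrad \<phi> m) - (LINT m|surf. V t m \<bullet> rgrad \<phi> m)"
    using L2_inner_integrable[OF V_L2[OF st(1)] L2_rgrad[OF \<phi>]] L2_inner_integrable[OF V_L2[OF st(2)] L2_rgrad[OF \<phi>]]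
    by (simp add: inner_diff_left)
  then show ?thesis using L2_Cauchy_Schwarz[OF L2_diff[OF V_L2[OF st(1)] V_L2[OF st(2)]] L2_rgrad[OF \<phi>]] by simp
qed

lemma pairing_continuous:
  assumes \<phi>: "sphere_smooth \<phi>" shows "continuous_on {0..} (\<lambda>s. LINT m|surf. V s m \<bullet> rgrad \<phi> m)"
  unfolding continuous_on_def
proof
  fix t :: real assume "t \<in> {0..}" then have t: "t \<ge> 0" by simp
  have "((\<lambda>s. (LINT m|surf. V s m \<bullet> rgrad \<phi> m) - (LINT m|surf. V t m \<bullet> rgrad \<phi> m)) \<longlongrightarrow> 0) (at t within {0..})"
  proof (rule Lim_null_comparison)
    have ev: "\<forall>\<^sub>F s in at t within {0..}. s \<ge> 0" by (simp add: eventually_at_filter)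
    then show "\<forall>\<^sub>F s in at t within {0..}. norm ((LINT m|surf. V s m \<bullet> rgrad \<phi> m) - (LINT m|surf. V t m \<bullet> rgrad \<phi> m))
        \<le> l2norm (\<lambda>m. V s m - V t m) * l2norm (rgrad \<phi>)"
    proof eventually_elim
      case (elim s)
      then show ?case using pairing_diff[OF \<phi> _ t] by simp
    qed
    show "((\<lambda>s. l2norm (\<lambda>m. V s m - V t m) * l2norm (rgrad \<phi>)) \<longlongrightarrow> 0) (at t within {0..})"
      using tendsto_mult_left_zero[OF V_tendsto[OF t]] .
  qed
  then show "((\<lambda>s. LINT m|surf. V s m \<bullet> rgrad \<phi> m) \<longlongrightarrow> (LINT m|surf. V t m \<bullet> rgrad \<phi> m)) (at t within {0..})"
    by (simp add: LIM_zero_iff)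
qed

lemma weak_form:
  assumes "sphere_smooth \<phi>" "t \<ge> 0"
  shows "(LINT m|surf. p t m * \<phi> m) = (LINT m|surf. p0 m * \<phi> m) - integral {0..t} (\<lambda>s. LINT m|surf. V s m \<bullet> rgrad \<phi> m)"
  using sol assms by (simp add: kinetic_solution_def V_def)

text \<open>The weak formulation with the constant test function.\<close>

lemma mass: assumes t: "t \<ge> 0" shows "(LINT m|surf. p t m) = 1"
proof -
  have "(LINT m|surf. V s m \<bullet> rgrad (\<lambda>m. 1) m) = (LINT m|surf. 0)" for s
    by (intro LINT_cong_S2) (simp add: rgrad_const)
  then show ?thesis using weak_form[OF sphere_smooth_const[of 1] t] mass0 by simp
qed

lemma increment:
  assumes \<phi>: "sphere_smooth \<phi>" and st: "0 \<le> s" "s \<le> t"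
  shows "(LINT m|surf. p t m * \<phi> m) - (LINT m|surf. p s m * \<phi> m) = - integral {s..t} (\<lambda>s. LINT m|surf. V s m \<bullet> rgrad \<phi> m)"
proof -
  have "(\<lambda>s. LINT m|surf. V s m \<bullet> rgrad \<phi> m) integrable_on {0..t}"
    by (intro integrable_continuous_real continuous_on_subset[OF pairing_continuous[OF \<phi>]]) auto
  then have "integral {0..s} (\<lambda>s. LINT m|surf. V s m \<bullet> rgrad \<phi> m) + integral {s..t} (\<lambda>s. LINT m|surf. V s m \<bullet> rgrad \<phi> m)
      = integral {0..t} (\<lambda>s. LINT m|surf. V s m \<bullet> rgrad \<phi> m)"
    using st by (intro Henstock_Kurzweil_Integration.integral_combine) auto
  then show ?thesis using weak_form[OF \<phi>, of t] weak_form[OF \<phi>, of s] st by simp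
qed

text \<open>The weak formulation over a short time step, with an error \<open>o(s)\<close> that is uniform over test functions with bounded gradient.  Uniformity is
  needed because the near-maximizers depend on \<open>s\<close>.\<close>

lemma kinetic_increment:
  assumes t: "t > 0" and e: "e > 0"
  shows "\<forall>\<^sub>F s in at_right 0. \<forall>\<phi>. sphere_smooth \<phi> \<longrightarrow>
    \<bar>(LINT m|surf. p t m * \<phi> m) - (LINT m|surf. p (t - s) m * \<phi> m) + s * (LINT m|surf. V t m \<bullet> rgrad \<phi> m)\<bar> \<le> s * e * l2norm (rgrad \<phi>)"
proof -
  have t0: "t \<ge> 0" using t by simp
  have "\<forall>\<^sub>F s in at t within {0..}. l2norm (\<lambda>m. V s m - V t m) < e"
    using e by (intro order_tendstoD(2)[OF V_tendsto[OF t0]])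
  then obtain d where d: "d > 0" "\<And>s. s \<ge> 0 \<Longrightarrow> s \<noteq> t \<Longrightarrow> dist s t < d \<Longrightarrow> l2norm (\<lambda>m. V s m - V t m) < e"
    unfolding eventually_at by auto
  have close: "l2norm (\<lambda>m. V s m - V t m) \<le> e" if "s \<ge> 0" "\<bar>s - t\<bar> < d" for s
    using d(2)[of s] that e by (cases "s = t") (auto simp: l2norm_const dist_real_def)
  have "\<forall>\<^sub>F s in at_right 0. s \<in> {0<..<min d t}" by (rule eventually_at_rightI[of 0 "min d t"]) (use d t in auto)
  then show ?thesis
  proof (eventually_elim, intro allI impI)
    fix s \<phi> assume s: "s \<in> {0<..<min d t}" and \<phi>: "sphere_smooth \<phi>"
    let ?q = "\<lambda>\<tau>. LINT m|surf. V \<tau> m \<bullet> rgrad \<phi> m"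
    have cq: "continuous_on {t - s..t} ?q" using s by (intro continuous_on_subset[OF pairing_continuous[OF \<phi>]]) auto
    have "integral {t - s..t} (\<lambda>\<tau>. ?q \<tau> - ?q t) = integral {t - s..t} ?q - s * ?q t"
    proof -
      have "integral {t - s..t} (\<lambda>\<tau>. q \<tau> - c) = integral {t - s..t} q - s * c"
        if "q integrable_on {t - s..t}" for q :: "real \<Rightarrow> real" and c
        using Henstock_Kurzweil_Integration.integral_diff[OF that integrable_const_ivl[of c]] s by simp
      from this[OF integrable_continuous_real[OF cq]] show ?thesis .
    qed
    then have eq: "(LINT m|surf. p t m * \<phi> m) - (LINT m|surf. p (t - s) m * \<phi> m) + s * ?q t = - integral {t - s..t} (\<lambda>\<tau>. ?q \<tau> - ?q t)"
      using increment[OF \<phi>, of "t - s" t] s by simp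
    have "norm (integral {t - s..t} (\<lambda>\<tau>. ?q \<tau> - ?q t)) \<le> (e * l2norm (rgrad \<phi>)) * (t - (t - s))"
    proof (rule integral_bound)
      show "t - s \<le> t" using s by simp
      show "continuous_on {t - s..t} (\<lambda>\<tau>. ?q \<tau> - ?q t)" by (intro continuous_intros cq)
      fix \<tau> assume \<tau>: "\<tau> \<in> {t - s..t}"
      have "\<bar>?q \<tau> - ?q t\<bar> \<le> l2norm (\<lambda>m. V \<tau> m - V t m) * l2norm (rgrad \<phi>)" using \<tau> s t0 by (intro pairing_diff \<phi>) auto
      also have "\<dots> \<le> e * l2norm (rgrad \<phi>)" using \<tau> s by (intro mult_right_mono close) auto
      finally show "norm (?q \<tau> - ?q t) \<le> e * l2norm (rgrad \<phi>)" by simp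
    qed
    then show "\<bar>(LINT m|surf. p t m * \<phi> m) - (LINT m|surf. p (t - s) m * \<phi> m) + s * ?q t\<bar> \<le> s * e * l2norm (rgrad \<phi>)"
      unfolding eq by (simp add: mult_ac)
  qed
qed

end

context doi_expansion begin

definition "hmin = exp (- \<bar>\<eta>\<bar>) / partition_function \<eta>"
definition "hmax = exp \<bar>\<eta>\<bar> / partition_function \<eta>"

lemma hmin: "hmin > 0" using partition_function_pos by (simp add: hmin_def)

end

context kinetic begin

section \<open>The equation for the remainder\<close>

definition "rem t m = (p t m - approx \<epsilon> t m) / \<epsilon>\<^sup>2"

definition "rem_grad t m = (1/\<epsilon>\<^sup>2) *\<^sub>R (W t m - rgrad (approx \<epsilon> t) m)"

lemma p_eq: "p t m = approx \<epsilon> t m + \<epsilon>\<^sup>2 * rem t m"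
  using eps by (simp add: rem_def)

lemma approx_L2: "t \<ge> 0 \<Longrightarrow> L2 (approx \<epsilon> t)"
  by (intro L2_smooth approx_smooth)

lemma rem_L2: "t \<ge> 0 \<Longrightarrow> L2 (rem t)"
  using L2_cmult[OF L2_diff[OF p_L2[of t] approx_L2[of t]], of "1/\<epsilon>\<^sup>2"] by (simp add: rem_def[abs_def])

lemma rem_mean: "t \<ge> 0 \<Longrightarrow> (LINT m|surf. rem t m) = 0"
  unfolding rem_def using L2_integrable[OF p_L2[of t]] L2_integrable[OF approx_L2[of t]]
  by (simp add: mass approx_integral)

lemma rem_grad: assumes t: "t \<ge> 0" shows "has_weak_rgrad (rem t) (rem_grad t)"
  using has_weak_rgrad_cmult[OF L2_diff[OF p_L2[OF t] approx_L2[OF t]]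
      has_weak_rgrad_diff[OF p_L2[OF t] W(1)[OF t] approx_L2[OF t] has_weak_rgrad_smooth[OF approx_smooth[OF t]]], of "1/\<epsilon>\<^sup>2"]
  by (simp add: rem_def[abs_def] rem_grad_def[abs_def])

lemma rem_grad_L2: "t \<ge> 0 \<Longrightarrow> L2 (rem_grad t)"
  unfolding rem_grad_def[abs_def] by (intro L2_scaleR L2_diff W L2_rgrad approx_smooth)

lemma rgrad_U_add:
  "integrable surf a \<Longrightarrow> integrable surf b \<Longrightarrow> norm m = 1 \<Longrightarrow> rgrad (U (\<lambda>m. a m + b m)) m = rgrad (U a) m + rgrad (U b) m"
  by (simp add: rgrad_mean_field qop_add cross_add_right scaleR_add_right)

lemma rgrad_U_cmult:
  "integrable surf a \<Longrightarrow> norm m = 1 \<Longrightarrow> rgrad (U (\<lambda>m. c * a m)) m = c *\<^sub>R rgrad (U a) m"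
  by (simp add: rgrad_mean_field qop_cmult cross_mult_right)

text \<open>The part of the flux that depends on the remainder, divided by \<open>\<epsilon>\<^sup>2\<close>.\<close>

definition "rem_flux t m = (1/\<epsilon>) *\<^sub>R lin_flux \<alpha> (h t) (rem t) (rem_grad t) m + corr \<epsilon> t m *\<^sub>R rgrad (U (rem t)) m
    - rem t m *\<^sub>R cross3 m (transport_map \<alpha> \<kappa> \<epsilon> (corr \<epsilon> t) (rem t) m)"

lemma V_expansion:
  assumes t: "t \<ge> 0" and m: "norm m = 1"
  shows "V t m = flux0 t m + \<epsilon> *\<^sub>R flux1 t m + \<epsilon>\<^sup>2 *\<^sub>R flux2 t m + \<epsilon>\<^sup>2 *\<^sub>R rem_flux t m + \<epsilon>^3 *\<^sub>R corr_flux \<epsilon> t m"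
proof -
  note s = f_smooth'[OF t] h_smooth[OF t]
  note i = s[THEN smooth_integrable] L2_integrable[OF rem_L2[OF t]]
  have Wm: "W t m = rgrad (h t) m + \<epsilon> *\<^sub>R rgrad (f 1 t) m + \<epsilon>\<^sup>2 *\<^sub>R rgrad (f 2 t) m + \<epsilon>^3 *\<^sub>R rgrad (f 3 t) m + \<epsilon>\<^sup>2 *\<^sub>R rem_grad t m"
  proof -
    have "rgrad (approx \<epsilon> t) m = rgrad (h t) m + \<epsilon> *\<^sub>R rgrad (f 1 t) m + \<epsilon>\<^sup>2 *\<^sub>R rgrad (f 2 t) m + \<epsilon>^3 *\<^sub>R rgrad (f 3 t) m"
      unfolding approx_eq[abs_def] using s m by (simp add: rgrad_add rgrad_cmult sphere_smooth_add sphere_smooth_cmult del: One_nat_def)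
    then show ?thesis using eps by (simp add: rem_grad_def)
  qed
  have Um: "rgrad (U (p t)) m = rgrad (U (h t)) m + \<epsilon> *\<^sub>R rgrad (U (f 1 t)) m + \<epsilon>\<^sup>2 *\<^sub>R rgrad (U (f 2 t)) m
      + \<epsilon>^3 *\<^sub>R rgrad (U (f 3 t)) m + \<epsilon>\<^sup>2 *\<^sub>R rgrad (U (rem t)) m"
  proof -
    have e: "p t = (\<lambda>m. h t m + \<epsilon> * f 1 t m + \<epsilon>\<^sup>2 * f 2 t m + \<epsilon>^3 * f 3 t m + \<epsilon>\<^sup>2 * rem t m)"
      by (rule ext) (simp only: p_eq approx_eq)
    show ?thesis unfolding e using i m by (simp add: rgrad_U_add rgrad_U_cmult del: One_nat_def)
  qed
  have wm: "w m - (rgrad (U (f 1 t)) m + \<epsilon> *\<^sub>R rgrad (U (f 2 t)) m + \<epsilon>\<^sup>2 *\<^sub>R rgrad (U (f 3 t)) m) - \<epsilon> *\<^sub>R rgrad (U (rem t)) m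
      = cross3 m (transport_map \<alpha> \<kappa> \<epsilon> (corr \<epsilon> t) (rem t) m)"
  proof -
    have "rgrad (U (f 1 t)) m + \<epsilon> *\<^sub>R rgrad (U (f 2 t)) m + \<epsilon>\<^sup>2 *\<^sub>R rgrad (U (f 3 t)) m = rgrad (U (corr \<epsilon> t)) m"
      unfolding corr_def[abs_def] using i m by (simp add: rgrad_U_add rgrad_U_cmult del: One_nat_def)
    then show ?thesis
      using smooth_integrable[OF corr_smooth[OF t]] i m
      by (simp add: transport_map_def rgrad_mean_field cross_add_right cross_mult_right algebra_simps)
  qed
  have pm: "p t m = approx \<epsilon> t m + \<epsilon>\<^sup>2 * rem t m" by (rule p_eq)
  show ?thesis
    unfolding V_eq Wm Um pm
    by (subst flux_identity[OF less_imp_neq[OF eps, symmetric] critical_point_rgrad[OF crit[OF t] unit[OF t] m] approx_eq])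
      (simp only: wm flux0_def flux1_def flux2_def rem_flux_def corr_flux_def lin_flux_def corr_def)
qed

text \<open>The fluxes of the expansion cancel against its time derivative.\<close>

lemma rate_identity:
  assumes t: "t \<ge> 0" and \<phi>: "sphere_smooth \<phi>"
  shows "- (LINT m|surf. V t m \<bullet> rgrad \<phi> m) - (LINT m|surf. dapprox \<epsilon> t m * \<phi> m)
    = \<epsilon>\<^sup>2 * rate \<alpha> \<kappa> \<epsilon> (h t) (rem t) (rem_grad t) (corr \<epsilon> t) (corr_flux \<epsilon> t) (df3 t) \<phi>"
proof -
  let ?R = "rgrad \<phi>" and ?T = "\<lambda>m. cross3 m (transport_map \<alpha> \<kappa> \<epsilon> (corr \<epsilon> t) (rem t) m)"
  note ig = L2_inner_integrable[OF _ L2_rgrad[OF \<phi>]]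
  have ir: "integrable surf (rem t)" "integrable surf (corr \<epsilon> t)"
    by (intro L2_integrable rem_L2 t) (intro smooth_integrable corr_smooth t)
  have lin: "linear (transport_map \<alpha> \<kappa> \<epsilon> (corr \<epsilon> t) (rem t))"
    unfolding transport_map_def[abs_def]
    by (intro linear_compose_add linear_compose_scale_right qop_linear ir matrix_vector_mul_linear)
  have L1: "L2 (\<lambda>m. lin_flux \<alpha> (h t) (rem t) (rem_grad t) m)"
    unfolding lin_flux_def
    by (intro L2_add rem_grad_L2 t L2_scaleR_vec_continuous rem_L2 U_continuous L2_smooth h_smooth)
  have L2': "L2 (\<lambda>m. corr \<epsilon> t m *\<^sub>R rgrad (U (rem t)) m)"
    by (intro L2_scaleR_vec_continuous L2_smooth corr_smooth t U_continuous rem_L2)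
  have L3: "L2 (\<lambda>m. rem t m *\<^sub>R ?T m)"
    by (intro L2_scaleR_vec_continuous rem_L2 t smooth_field_continuous smooth_field_cross3 lin)
  have L4: "L2 (\<lambda>m. flux0 t m + \<epsilon> *\<^sub>R flux1 t m + \<epsilon>\<^sup>2 *\<^sub>R flux2 t m)"
    by (intro L2_add L2_scaleR smooth_field_L2 smooth_field_flux t)
  have L5: "L2 (corr_flux \<epsilon> t)" by (intro smooth_field_L2 corr_flux_smooth_field t)
  have "(LINT m|surf. V t m \<bullet> ?R m) = (LINT m|surf. (flux0 t m + \<epsilon> *\<^sub>R flux1 t m + \<epsilon>\<^sup>2 *\<^sub>R flux2 t m) \<bullet> ?R m
      + (\<epsilon>\<^sup>2 * (1/\<epsilon>)) * (lin_flux \<alpha> (h t) (rem t) (rem_grad t) m \<bullet> ?R m) + \<epsilon>\<^sup>2 * ((corr \<epsilon> t m *\<^sub>R rgrad (U (rem t)) m) \<bullet> ?R m)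
      - \<epsilon>\<^sup>2 * ((rem t m *\<^sub>R ?T m) \<bullet> ?R m) + \<epsilon>^3 * (corr_flux \<epsilon> t m \<bullet> ?R m))"
    by (rule LINT_cong_S2) (simp add: V_expansion[OF t] rem_flux_def inner_add_left inner_diff_left algebra_simps)
  also have "\<dots> = (LINT m|surf. (flux0 t m + \<epsilon> *\<^sub>R flux1 t m + \<epsilon>\<^sup>2 *\<^sub>R flux2 t m) \<bullet> ?R m)
      + (\<epsilon>\<^sup>2 * (1/\<epsilon>)) * (LINT m|surf. lin_flux \<alpha> (h t) (rem t) (rem_grad t) m \<bullet> ?R m) + \<epsilon>\<^sup>2 * (LINT m|surf. (corr \<epsilon> t m *\<^sub>R rgrad (U (rem t)) m) \<bullet> ?R m)
      - \<epsilon>\<^sup>2 * (LINT m|surf. (rem t m *\<^sub>R ?T m) \<bullet> ?R m) + \<epsilon>^3 * (LINT m|surf. corr_flux \<epsilon> t m \<bullet> ?R m)"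
    using ig[OF L1] ig[OF L2'] ig[OF L3] ig[OF L4] ig[OF L5] by (simp del: inner_scaleR_left)
  also have "(LINT m|surf. (rem t m *\<^sub>R ?T m) \<bullet> ?R m) = (LINT m|surf. rem t m * (surface_grad \<phi> m \<bullet> transport_map \<alpha> \<kappa> \<epsilon> (corr \<epsilon> t) (rem t) m))"
    by (rule LINT_cong_S2) (simp add: cross3_transport_inner[OF Dhat_S2[OF \<phi>]])
  finally show ?thesis
    unfolding dapprox_weak[OF t \<phi>] rate_def by (simp add: algebra_simps power2_eq_square power3_eq_cube)
qed

lemma rem_difference:
  assumes "s \<ge> 0" "t \<ge> 0"
  shows "l2norm (\<lambda>m. rem s m - rem t m) \<le> (1/\<epsilon>\<^sup>2) * (l2norm (\<lambda>m. p s m - p t m) + l2norm (\<lambda>m. approx \<epsilon> s m - approx \<epsilon> t m))"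
proof -
  have "(\<lambda>m. rem s m - rem t m) = (\<lambda>m. (1/\<epsilon>\<^sup>2) * ((p s m - p t m) - (approx \<epsilon> s m - approx \<epsilon> t m)))"
    by (rule ext) (simp add: rem_def diff_divide_distrib)
  then have "l2norm (\<lambda>m. rem s m - rem t m) = (1/\<epsilon>\<^sup>2) * l2norm (\<lambda>m. (p s m - p t m) - (approx \<epsilon> s m - approx \<epsilon> t m))"
    by (simp only: l2norm_cmult) simp
  also have "\<dots> \<le> (1/\<epsilon>\<^sup>2) * (l2norm (\<lambda>m. p s m - p t m) + l2norm (\<lambda>m. approx \<epsilon> s m - approx \<epsilon> t m))"
    using assms by (intro mult_left_mono l2norm_triangle_diff L2_diff p_L2 approx_L2) auto
  finally show ?thesis .
qed

lemma rem_right_continuous: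
  assumes t: "t \<ge> 0" shows "((\<lambda>s. l2norm (\<lambda>m. rem (t + s) m - rem t m)) \<longlongrightarrow> 0) (at_right 0)"
proof -
  obtain B where B: "B \<ge> 0" "\<And>s t' m. s \<in> {0..t+1} \<Longrightarrow> t' \<in> {0..t+1} \<Longrightarrow> norm m = 1 \<Longrightarrow> \<bar>approx \<epsilon> t' m - approx \<epsilon> s m\<bar> \<le> B * \<bar>t' - s\<bar>"
    using approx_lipschitz[of "t+1" \<epsilon>] by blast
  have f: "filterlim (\<lambda>s. t + s) (at t within {0..}) (at_right 0)"
  proof -
    have "((\<lambda>s. t + s) \<longlongrightarrow> t + 0) (at_right 0)" by (intro tendsto_intros)
    moreover have "\<forall>\<^sub>F s in at_right 0. t + s \<in> {0..} \<and> t + s \<noteq> t"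
      by (rule eventually_at_rightI[of 0 1]) (use t in auto)
    ultimately show ?thesis unfolding filterlim_at by simp
  qed
  have "((\<lambda>s. (1/\<epsilon>\<^sup>2) * (l2norm (\<lambda>m. p (t + s) m - p t m) + B * s * sqrt area)) \<longlongrightarrow> (1/\<epsilon>\<^sup>2) * (0 + B * 0 * sqrt area)) (at_right 0)"
    by (intro tendsto_intros filterlim_compose[OF p_tendsto(1)[OF t] f])
  then have lim: "((\<lambda>s. (1/\<epsilon>\<^sup>2) * (l2norm (\<lambda>m. p (t + s) m - p t m) + B * s * sqrt area)) \<longlongrightarrow> 0) (at_right 0)" by simp
  have "\<forall>\<^sub>F s in at_right 0. s \<in> {0<..<1::real}" by (rule eventually_at_rightI[of 0 1]) auto
  then have "\<forall>\<^sub>F s in at_right 0. norm (l2norm (\<lambda>m. rem (t + s) m - rem t m)) \<le> (1/\<epsilon>\<^sup>2) * (l2norm (\<lambda>m. p (t + s) m - p t m) + B * s * sqrt area)"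
  proof eventually_elim
    fix s :: real assume s: "s \<in> {0<..<1}"
    have "l2norm (\<lambda>m. approx \<epsilon> (t + s) m - approx \<epsilon> t m) \<le> (B * s) * sqrt area"
    proof (rule l2norm_le_bounded)
      show "L2 (\<lambda>m. approx \<epsilon> (t + s) m - approx \<epsilon> t m)" using t s by (intro L2_diff approx_L2) auto
      show "norm (approx \<epsilon> (t + s) m - approx \<epsilon> t m) \<le> B * s" if "norm m = 1" for m
        using B(2)[of t "t + s" m] t s that by simp
      show "0 \<le> B * s" using B s by simp
    qed
    then have "(1/\<epsilon>\<^sup>2) * (l2norm (\<lambda>m. p (t + s) m - p t m) + l2norm (\<lambda>m. approx \<epsilon> (t + s) m - approx \<epsilon> t m))
        \<le> (1/\<epsilon>\<^sup>2) * (l2norm (\<lambda>m. p (t + s) m - p t m) + B * s * sqrt area)" by (intro mult_left_mono add_left_mono) auto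
    moreover have "l2norm (\<lambda>m. rem (t + s) m - rem t m) \<le> (1/\<epsilon>\<^sup>2) * (l2norm (\<lambda>m. p (t + s) m - p t m) + l2norm (\<lambda>m. approx \<epsilon> (t + s) m - approx \<epsilon> t m))"
      using t s by (intro rem_difference) auto
    ultimately show "norm (l2norm (\<lambda>m. rem (t + s) m - rem t m)) \<le> (1/\<epsilon>\<^sup>2) * (l2norm (\<lambda>m. p (t + s) m - p t m) + B * s * sqrt area)" by simp
  qed
  then show ?thesis by (rule Lim_null_comparison[OF _ lim])
qed

lemma dual_rem: "t \<ge> 0 \<Longrightarrow> dual (h t) hmin hmax (rem t)"
  unfolding dual_def dual_axioms_def hmin_def hmax_def by (intro conjI weight_equilibrium unit rem_L2 rem_mean)

subsection \<open>Variation of the dual energy\<close>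

definition "E t = dual_energy (h t) (rem t)"

lemma E_nonneg: "t \<ge> 0 \<Longrightarrow> E t \<ge> 0"
  unfolding E_def by (rule dual.dual_energy_nonneg[OF dual_rem])

lemma E_right:
  assumes t: "t \<ge> 0" and e: "e > 0" shows "\<forall>\<^sub>F s in at_right 0. E (t + s) \<le> E t + e"
proof -
  let ?c = "2 * \<bar>\<eta>\<bar> * Ln"
  let ?b = "\<lambda>s. (sqrt (E t) + l2norm (\<lambda>m. rem (t + s) m - rem t m) / sqrt hmin)\<^sup>2 / exp (- (?c * s))"
  have "(?b \<longlongrightarrow> (sqrt (E t) + 0 / sqrt hmin)\<^sup>2 / exp (- (?c * 0))) (at_right 0)"
    using hmin by (intro tendsto_intros rem_right_continuous t) auto
  then have "(?b \<longlongrightarrow> E t) (at_right 0)" using E_nonneg[OF t] by simp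
  then have "\<forall>\<^sub>F s in at_right 0. ?b s < E t + e" using e by (intro order_tendstoD(2)) auto
  moreover have "\<forall>\<^sub>F s in at_right 0. s > (0::real)" by (simp add: eventually_at_filter)
  ultimately show ?thesis
  proof eventually_elim
    fix s :: real assume b: "?b s < E t + e" and s: "s > 0"
    have "E (t + s) \<le> ?b s" unfolding E_def
    proof (rule dual_energy_perturb[OF dual_rem[OF t] dual_rem])
      show "t + s \<ge> 0" using s t by simp
      fix m :: "real^3" assume m: "norm m = 1"
      have "h t m \<le> exp (?c * s) * h (t + s) m" using h_ratio[of "t + s" t m] s t m by simp
      then have "exp (- (?c * s)) * h t m \<le> exp (- (?c * s)) * (exp (?c * s) * h (t + s) m)" by (intro mult_left_mono) auto
      also have "\<dots> = h (t + s) m" by (simp add: exp_minus)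
      finally show "exp (- (?c * s)) * h t m \<le> h (t + s) m" .
    qed simp
    with b show "E (t + s) \<le> E t + e" by simp
  qed
qed

text \<open>The bound on the rate, twice, plus the contribution of the moving weight, as a function of the square root of the dual energy.\<close>

definition "growth K K\<kappa> S =
  2 * (K * (2 * \<alpha> * (2 * sqrt hmax * sqrt area) * S) * sqrt area * (S / sqrt hmin)
    + (4 * \<bar>\<eta>\<bar> + 15) * (K\<kappa> + 2 * \<alpha> * K * area + 2 * \<alpha> * \<epsilon> * (2 * sqrt hmax * sqrt area) * S) * S\<^sup>2
    + \<epsilon> * (K + K) * sqrt area * (S / sqrt hmin))
  + 2 * \<bar>\<eta>\<bar> * Ln * S\<^sup>2"

lemma exp_increment_limit: "((\<lambda>s. (exp (c * s) - 1) / s) \<longlongrightarrow> c) (at_right (0::real))"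
proof -
  have "((\<lambda>s. exp (c * s)) has_real_derivative exp (c * 0) * (c * 1)) (at 0)"
    by (auto intro!: derivative_eq_intros)
  then have "((\<lambda>s. exp (c * s)) has_real_derivative c) (at 0 within {0<..})" by (simp add: has_field_derivative_at_within)
  then show ?thesis by (simp add: has_field_derivative_iff)
qed

text \<open>The time derivative of the remainder against test functions that satisfy the Poincare inequality.  The error of the expansion is measured by the test function itself, which is why that inequality is assumed.\<close>

lemma rem_increment:
  assumes t: "t > 0" and e: "e > 0"
  shows "\<forall>\<^sub>F s in at_right 0. \<forall>\<phi>. sphere_smooth \<phi> \<longrightarrow> l2norm \<phi> \<le> l2norm (rgrad \<phi>) \<longrightarrow>
    (LINT m|surf. rem t m * \<phi> m) - (LINT m|surf. rem (t - s) m * \<phi> m)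
      \<le> s * rate \<alpha> \<kappa> \<epsilon> (h t) (rem t) (rem_grad t) (corr \<epsilon> t) (corr_flux \<epsilon> t) (df3 t) \<phi> + s * e * l2norm (rgrad \<phi>)"
proof -
  define e1 where "e1 = \<epsilon>\<^sup>2 * e / 2"
  have e1: "e1 > 0" using e eps by (simp add: e1_def)
  have "\<forall>\<^sub>F s in at_right 0. s \<in> {0<..<t}" by (rule eventually_at_rightI[OF _ t])
  then show ?thesis
    using kinetic_increment[OF t e1] approx_increment[OF t e1, of \<epsilon>]
  proof (eventually_elim, intro allI impI)
    fix s \<phi>
    assume s: "s \<in> {0<..<t}" and \<phi>: "sphere_smooth \<phi>" and le: "l2norm \<phi> \<le> l2norm (rgrad \<phi>)"
    assume k: "\<forall>\<phi>. sphere_smooth \<phi> \<longrightarrow>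
      \<bar>(LINT m|surf. p t m * \<phi> m) - (LINT m|surf. p (t - s) m * \<phi> m) + s * (LINT m|surf. V t m \<bullet> rgrad \<phi> m)\<bar> \<le> s * e1 * l2norm (rgrad \<phi>)"
      and a: "\<forall>\<phi>. sphere_smooth \<phi> \<longrightarrow>
      \<bar>(LINT m|surf. approx \<epsilon> t m * \<phi> m) - (LINT m|surf. approx \<epsilon> (t - s) m * \<phi> m) - s * (LINT m|surf. dapprox \<epsilon> t m * \<phi> m)\<bar> \<le> s * e1 * l2norm \<phi>"
    have split: "(LINT m|surf. rem \<tau> m * \<phi> m) = (1/\<epsilon>\<^sup>2) * ((LINT m|surf. p \<tau> m * \<phi> m) - (LINT m|surf. approx \<epsilon> \<tau> m * \<phi> m))" if "\<tau> \<ge> 0" for \<tau>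
    proof -
      have "(LINT m|surf. rem \<tau> m * \<phi> m) = (LINT m|surf. (1/\<epsilon>\<^sup>2) * (p \<tau> m * \<phi> m - approx \<epsilon> \<tau> m * \<phi> m))"
        by (simp add: rem_def left_diff_distrib)
      also have "\<dots> = (1/\<epsilon>\<^sup>2) * ((LINT m|surf. p \<tau> m * \<phi> m) - (LINT m|surf. approx \<epsilon> \<tau> m * \<phi> m))"
        using L2_mult_integrable[OF p_L2[OF that] L2_smooth[OF \<phi>]] L2_mult_integrable[OF approx_L2[OF that] L2_smooth[OF \<phi>]]
        by (simp only: Bochner_Integration.integral_diff integral_mult_right_zero)
      finally show ?thesis .
    qed
    let ?P = "\<lambda>\<tau>. LINT m|surf. p \<tau> m * \<phi> m" and ?A = "\<lambda>\<tau>. LINT m|surf. approx \<epsilon> \<tau> m * \<phi> m"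
    let ?r = "rate \<alpha> \<kappa> \<epsilon> (h t) (rem t) (rem_grad t) (corr \<epsilon> t) (corr_flux \<epsilon> t) (df3 t) \<phi>"
    let ?VR = "LINT m|surf. V t m \<bullet> rgrad \<phi> m" and ?D = "LINT m|surf. dapprox \<epsilon> t m * \<phi> m"
    have "s * e1 * l2norm \<phi> \<le> s * e1 * l2norm (rgrad \<phi>)" using s e1 le by (intro mult_left_mono) auto
    then have "(?P t - ?P (t - s)) - (?A t - ?A (t - s)) \<le> s * (- ?VR - ?D) + 2 * (s * e1 * l2norm (rgrad \<phi>))"
      using k[rule_format, OF \<phi>] a[rule_format, OF \<phi>] unfolding abs_le_iff right_diff_distrib by simp
    also have "- ?VR - ?D = \<epsilon>\<^sup>2 * ?r" using t by (intro rate_identity \<phi>) simp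
    finally have "(1/\<epsilon>\<^sup>2) * ((?P t - ?P (t - s)) - (?A t - ?A (t - s))) \<le> (1/\<epsilon>\<^sup>2) * (s * (\<epsilon>\<^sup>2 * ?r) + 2 * (s * e1 * l2norm (rgrad \<phi>)))"
      by (intro mult_left_mono) auto
    also have "\<dots> = s * ?r + s * e * l2norm (rgrad \<phi>)" using eps by (simp add: e1_def distrib_left)
    finally show "(LINT m|surf. rem t m * \<phi> m) - (LINT m|surf. rem (t - s) m * \<phi> m) \<le> s * ?r + s * e * l2norm (rgrad \<phi>)"
      using split[of t] split[of "t - s"] t s by (simp add: right_diff_distrib)
  qed
qed

text \<open>A near-maximizer at time \<open>t\<close> is a competitor at time \<open>t - s\<close>, so the backward increment of the supremum is at most the increment of
  its action, up to the deficit \<open>s\<^sup>2\<close>.  The action changes through the remainder (\<open>rate_bound\<close>) and through the weight.\<close>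

lemma E_left:
  assumes t: "t > 0" and e: "e > 0"
    and K: "K \<ge> 0" "\<And>m. norm m = 1 \<Longrightarrow> \<bar>corr \<epsilon> t m\<bar> \<le> K \<and> norm (corr_flux \<epsilon> t m) \<le> K \<and> \<bar>df3 t m\<bar> \<le> K"
    and K\<kappa>: "K\<kappa> \<ge> 0" "\<And>v. norm (\<kappa> *v v) \<le> K\<kappa> * norm v"
  shows "\<forall>\<^sub>F s in at_right 0. E t - E (t - s) \<le> s * (growth K K\<kappa> (sqrt (E t)) + e)"
proof -
  have t0: "t \<ge> 0" using t by simp
  interpret D: dual "h t" hmin hmax "rem t" by (rule dual_rem[OF t0])
  define S where "S = sqrt (E t)"
  have S: "S \<ge> 0" "S\<^sup>2 = E t" using E_nonneg[OF t0] by (auto simp: S_def)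
  define c where "c = 2 * \<bar>\<eta>\<bar> * Ln"
  have c: "c \<ge> 0" using Ln by (simp add: c_def)
  define R where "R = K * (2 * \<alpha> * (2 * sqrt hmax * sqrt area) * S) * sqrt area * (S / sqrt hmin)
    + (4 * \<bar>\<eta>\<bar> + 15) * (K\<kappa> + 2 * \<alpha> * K * area + 2 * \<alpha> * \<epsilon> * (2 * sqrt hmax * sqrt area) * S) * S\<^sup>2
    + \<epsilon> * (K + K) * sqrt area * (S / sqrt hmin)"
  define d where "d = (S + 1) / sqrt hmin"
  have d: "d > 0" using S hmin by (simp add: d_def)
  (* d bounds the gradient of a near-maximizer, so that e1 contributes e/8 *)
  define e1 where "e1 = e / (8 * d)"
  have e1: "e1 > 0" "e1 * d = e / 8" using d e by (auto simp: e1_def)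
  let ?r = "rate \<alpha> \<kappa> \<epsilon> (h t) (rem t) (rem_grad t) (corr \<epsilon> t) (corr_flux \<epsilon> t) (df3 t)"
  have rate: "\<forall>\<^sub>F s in at_right 0. \<forall>\<phi>. sphere_smooth \<phi> \<longrightarrow>
      dual_energy (h t) (rem t) - s\<^sup>2 \<le> action (h t) (rem t) \<phi> \<longrightarrow> l2norm \<phi> \<le> l2norm (rgrad \<phi>) \<longrightarrow> ?r \<phi> \<le> R + e/8"
    unfolding R_def
  proof (rule rate_bound[OF crit[OF t0] stab[OF t0] unit[OF t0] rem_L2[OF t0] rem_mean[OF t0] rem_grad[OF t0] alpha eps _ _ K(1) _ _ K(1) _ _ K(1) K\<kappa>(2) K\<kappa>(1)])
    show "corr \<epsilon> t \<in> borel_measurable surf" by (intro L2_measurable L2_smooth corr_smooth t0)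
    show "corr_flux \<epsilon> t \<in> borel_measurable surf" by (intro L2_measurable smooth_field_L2 corr_flux_smooth_field t0)
    show "df3 t \<in> borel_measurable surf" by (intro L2_measurable L2_continuous df3 t0)
  qed (use K(2) e in \<open>auto simp: hmin_def hmax_def S_def E_def\<close>)
  have "((\<lambda>s. (exp (c * s) - 1) / s * (S + s)\<^sup>2) \<longlongrightarrow> c * (S + 0)\<^sup>2) (at_right 0)"
    by (intro tendsto_intros exp_increment_limit)
  then have weight: "\<forall>\<^sub>F s in at_right 0. (exp (c * s) - 1) / s * (S + s)\<^sup>2 < c * S\<^sup>2 + e/4"
    using e by (intro order_tendstoD(2)) auto
  have "\<forall>\<^sub>F s in at_right 0. s \<in> {0<..<min t (min 1 (e/4))}"
    by (rule eventually_at_rightI[of 0 "min t (min 1 (e/4))"]) (use t e in auto)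
  then show ?thesis using rate weight rem_increment[OF t e1(1)]
  proof eventually_elim
    fix s
    assume s: "s \<in> {0<..<min t (min 1 (e/4))}" and w: "(exp (c * s) - 1) / s * (S + s)\<^sup>2 < c * S\<^sup>2 + e/4"
      and r: "\<forall>\<phi>. sphere_smooth \<phi> \<longrightarrow> dual_energy (h t) (rem t) - s\<^sup>2 \<le> action (h t) (rem t) \<phi> \<longrightarrow>
        l2norm \<phi> \<le> l2norm (rgrad \<phi>) \<longrightarrow> ?r \<phi> \<le> R + e/8"
      and inc: "\<forall>\<phi>. sphere_smooth \<phi> \<longrightarrow> l2norm \<phi> \<le> l2norm (rgrad \<phi>) \<longrightarrow>
        (LINT m|surf. rem t m * \<phi> m) - (LINT m|surf. rem (t - s) m * \<phi> m) \<le> s * ?r \<phi> + s * e1 * l2norm (rgrad \<phi>)"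
    have s0: "s > 0" "s < 1" "s \<le> e/4" and ts: "t - s \<ge> 0" using s by auto
    interpret D': dual "h (t - s)" hmin hmax "rem (t - s)" by (rule dual_rem[OF ts])
    obtain \<phi> where \<phi>: "sphere_smooth \<phi>" and max: "dual_energy (h t) (rem t) - s\<^sup>2 \<le> action (h t) (rem t) \<phi>"
      and P: "l2norm \<phi> \<le> l2norm (rgrad \<phi>)"
      using D.near_maximizer_mean_zero[of "s\<^sup>2"] s0 by auto
    define N where "N = energy (h t) \<phi>"
    have N0: "N \<ge> 0" unfolding N_def by (rule D.energy_nonneg)
    have sN: "sqrt N \<le> S + s"
      using D.near_maximizer_energy[OF \<phi> max] s0 by (simp add: N_def S_def E_def)
    then have N: "N \<le> (S + s)\<^sup>2" using power_mono[OF sN, of 2] N0 by simp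
    have "l2norm (rgrad \<phi>) \<le> sqrt N / sqrt hmin" unfolding N_def by (rule D.l2norm_rgrad_le[OF \<phi>])
    also have "\<dots> \<le> d" unfolding d_def using sN s0 hmin by (intro divide_right_mono) auto
    finally have "e1 * l2norm (rgrad \<phi>) \<le> e / 8" using mult_left_mono[of "l2norm (rgrad \<phi>)" d e1] e1 by simp
    then have "s * (?r \<phi> + e1 * l2norm (rgrad \<phi>)) \<le> s * ((R + e/8) + e/8)"
      using r[rule_format, OF \<phi> max P] s0 by (intro mult_left_mono add_mono) auto
    then have i: "(LINT m|surf. rem t m * \<phi> m) - (LINT m|surf. rem (t - s) m * \<phi> m) \<le> s * (R + e/4)"
      using inc[rule_format, OF \<phi> P] by (simp add: distrib_left mult.assoc)
    have "energy (h (t - s)) \<phi> \<le> exp (c * s) * N"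
    proof -
      have "energy (h (t - s)) \<phi> \<le> (LINT m|surf. exp (c * s) * (h t m * (norm (rgrad \<phi> m))\<^sup>2))"
        unfolding energy_def
      proof (rule integral_mono)
        show "integrable surf (\<lambda>m. h (t - s) m * (norm (rgrad \<phi> m))\<^sup>2)" by (rule D'.energy_integrable[OF \<phi>])
        show "integrable surf (\<lambda>m. exp (c * s) * (h t m * (norm (rgrad \<phi> m))\<^sup>2))" using D.energy_integrable[OF \<phi>] by simp
        fix m :: "real^3" assume "m \<in> space surf"
        then have "h (t - s) m \<le> exp (c * s) * h t m" using h_ratio[OF t0 ts, of m] s0 by (simp add: c_def)
        then show "h (t - s) m * (norm (rgrad \<phi> m))\<^sup>2 \<le> exp (c * s) * (h t m * (norm (rgrad \<phi> m))\<^sup>2)"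
          unfolding mult.assoc[symmetric] by (intro mult_right_mono) auto
      qed
      then show ?thesis by (simp add: N_def energy_def)
    qed
    then have "energy (h (t - s)) \<phi> - N \<le> (exp (c * s) - 1) * N" by (simp add: left_diff_distrib)
    also have "\<dots> \<le> (exp (c * s) - 1) * (S + s)\<^sup>2" using N c s0 by (intro mult_left_mono) auto
    also have "\<dots> = s * ((exp (c * s) - 1) / s * (S + s)\<^sup>2)" using s0 by simp
    also have "\<dots> \<le> s * (c * S\<^sup>2 + e/4)" using w s0 by (intro mult_left_mono) auto
    finally have ii: "energy (h (t - s)) \<phi> - N \<le> s * (c * S\<^sup>2 + e/4)" .
    have "s\<^sup>2 \<le> s * (e/4)" unfolding power2_eq_square using s0 by (intro mult_left_mono) auto
    moreover have "action (h (t - s)) (rem (t - s)) \<phi> \<le> E (t - s)" unfolding E_def by (rule D'.action_le_dual[OF \<phi>])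
    ultimately have "E t - E (t - s) \<le> s * (e/4) + 2 * (s * (R + e/4)) + s * (c * S\<^sup>2 + e/4)"
      using max i ii unfolding action_def N_def[symmetric] E_def[of t, symmetric] by linarith
    also have "\<dots> = s * (2 * R + c * S\<^sup>2 + e)" by (simp add: algebra_simps)
    also have "2 * R + c * S\<^sup>2 = growth K K\<kappa> S" by (simp add: R_def c_def growth_def)
    finally show "E t - E (t - s) \<le> s * (growth K K\<kappa> (sqrt (E t)) + e)" by (simp only: S_def)
  qed
qed

end

context doi_expansion begin

section \<open>The uniform bound\<close>

definition "growth_constant K K\<kappa> =
  2 * (K * (2 * \<alpha> * (2 * sqrt hmax * sqrt area)) * sqrt area / sqrt hmin
    + (4 * \<bar>\<eta>\<bar> + 15) * (K\<kappa> + 2 * \<alpha> * K * area)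
    + (4 * \<bar>\<eta>\<bar> + 15) * (2 * \<alpha> * (2 * sqrt hmax * sqrt area))
    + (K + K) * sqrt area / sqrt hmin)
  + 2 * \<bar>\<eta>\<bar> * Ln + 1"

lemma hmax: "hmax > 0" using partition_function_pos by (simp add: hmax_def)

lemma growth_constant_pos: "K \<ge> 0 \<Longrightarrow> K\<kappa> \<ge> 0 \<Longrightarrow> growth_constant K K\<kappa> > 0"
  unfolding growth_constant_def using alpha Ln hmin hmax area_pos
  by (intro add_nonneg_pos add_nonneg_nonneg mult_nonneg_nonneg divide_nonneg_nonneg) auto

end

context kinetic begin

text \<open>As long as \<open>\<epsilon> S \<le> 1\<close>, the cubic term is no larger than a quadratic one, and growth is at most exponential.\<close>

lemma growth_less:
  assumes S: "S \<ge> 1" "\<epsilon> * S \<le> 1" and \<epsilon>: "\<epsilon> \<le> 1" and K: "K \<ge> 0" and K\<kappa>: "K\<kappa> \<ge> 0"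
  shows "growth K K\<kappa> S < growth_constant K K\<kappa> * S\<^sup>2"
proof -
  define a1 where "a1 = K * (2 * \<alpha> * (2 * sqrt hmax * sqrt area)) * sqrt area / sqrt hmin"
  define a2 where "a2 = (4 * \<bar>\<eta>\<bar> + 15) * (K\<kappa> + 2 * \<alpha> * K * area)"
  define a3 where "a3 = (4 * \<bar>\<eta>\<bar> + 15) * (2 * \<alpha> * (2 * sqrt hmax * sqrt area))"
  define a4 where "a4 = (K + K) * sqrt area / sqrt hmin"
  have nn: "a3 \<ge> 0" "a4 \<ge> 0" unfolding a3_def a4_def using alpha K hmin hmax area_pos by auto
  have "S * 1 \<le> S * S" using S by (intro mult_left_mono) auto
  then have SS: "S \<le> S\<^sup>2" "1 \<le> S\<^sup>2" unfolding power2_eq_square using S(1) by linarith+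
  have "\<epsilon> * S \<le> 1 * S" using S \<epsilon> by (intro mult_right_mono) auto
  then have "a4 * (\<epsilon> * S) \<le> a4 * S\<^sup>2" using SS nn by (intro mult_left_mono) auto
  moreover have "a3 * ((\<epsilon> * S) * S\<^sup>2) \<le> a3 * S\<^sup>2" using mult_right_mono[OF S(2), of "S\<^sup>2"] nn by (intro mult_left_mono) auto
  moreover have "growth K K\<kappa> S = 2 * (a1 * S\<^sup>2 + a2 * S\<^sup>2 + a3 * ((\<epsilon> * S) * S\<^sup>2) + a4 * (\<epsilon> * S)) + 2 * \<bar>\<eta>\<bar> * Ln * S\<^sup>2"
  proof -
    have "K * (2 * \<alpha> * (2 * sqrt hmax * sqrt area) * S) * sqrt area * (S / sqrt hmin) = a1 * S\<^sup>2"
      by (simp add: a1_def power2_eq_square)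
    moreover have "\<epsilon> * (K + K) * sqrt area * (S / sqrt hmin) = a4 * (\<epsilon> * S)" by (simp add: a4_def)
    moreover have "(4 * \<bar>\<eta>\<bar> + 15) * (K\<kappa> + 2 * \<alpha> * K * area + 2 * \<alpha> * \<epsilon> * (2 * sqrt hmax * sqrt area) * S) * S\<^sup>2
        = a2 * S\<^sup>2 + a3 * ((\<epsilon> * S) * S\<^sup>2)"
      unfolding a2_def a3_def by (simp only: distrib_left distrib_right mult_ac)
    ultimately show ?thesis unfolding growth_def by simp
  qed
  moreover have "growth_constant K K\<kappa> * S\<^sup>2 = 2 * (a1 * S\<^sup>2 + a2 * S\<^sup>2 + a3 * S\<^sup>2 + a4 * S\<^sup>2) + 2 * \<bar>\<eta>\<bar> * Ln * S\<^sup>2 + S\<^sup>2"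
    unfolding growth_constant_def a1_def[symmetric] a2_def[symmetric] a3_def[symmetric] a4_def[symmetric]
    by (simp add: algebra_simps)
  moreover have "g < gc" if "x4 \<le> b4" "x3 \<le> b3" "g = 2 * (b1 + b2 + x3 + x4) + z" "gc = 2 * (b1 + b2 + b3 + b4) + z + q" "1 \<le> q"
    for g gc x3 x4 b1 b2 b3 b4 z q :: real
    using that by simp
  ultimately show ?thesis using SS(2) by blast
qed

text \<open>The barrier \<open>A exp (k t)\<close> satisfies the smallness condition on \<open>[0,T]\<close> by assumption, and the energy can leave this regime only by crossing it.\<close>

lemma remainder_bound:
  assumes A: "A \<ge> 1" "E 0 < A" and \<epsilon>: "\<epsilon> \<le> 1" "\<epsilon> * sqrt (A * exp (growth_constant K K\<kappa> * T)) \<le> 1"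
    and K: "K \<ge> 0" "\<And>t m. 0 \<le> t \<Longrightarrow> t \<le> T \<Longrightarrow> norm m = 1 \<Longrightarrow> \<bar>corr \<epsilon> t m\<bar> \<le> K \<and> norm (corr_flux \<epsilon> t m) \<le> K \<and> \<bar>df3 t m\<bar> \<le> K"
    and K\<kappa>: "K\<kappa> \<ge> 0" "\<And>v. norm (\<kappa> *v v) \<le> K\<kappa> * norm v"
    and t: "0 \<le> t" "t \<le> T"
  shows "sphere_Hm1_norm (rem t) \<le> ereal (sqrt (A * exp (growth_constant K K\<kappa> * T)) * sqrt hmax)"
proof -
  let ?k = "growth_constant K K\<kappa>"
  let ?y = "\<lambda>t. A * exp (?k * t)"
  have k: "?k > 0" by (rule growth_constant_pos[OF K(1) K\<kappa>(1)])
  have y1: "1 \<le> sqrt (?y t)" "sqrt (?y t) \<le> sqrt (?y T)" if "0 \<le> t" "t \<le> T" for t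
  proof -
    have "1 * 1 \<le> A * exp (?k * t)" using A k that by (intro mult_mono) auto
    then show "1 \<le> sqrt (?y t)" by simp
    show "sqrt (?y t) \<le> sqrt (?y T)" using A k that by (intro real_sqrt_le_mono mult_left_mono) auto
  qed
  have "E t < ?y t"
  proof (rule comparison[where E=E and y="?y" and T=T and \<Phi>="\<lambda>x. growth K K\<kappa> (sqrt x)" and y'="\<lambda>t. A * (exp (?k * t) * ?k)"])
    show "E 0 < A * exp (?k * 0)" using A by simp
    show "\<forall>\<^sub>F s in at_right 0. E (t + s) \<le> E t + e" if "0 \<le> t" "t < T" "e > 0" for t e by (rule E_right[OF that(1,3)])
    show "\<forall>\<^sub>F s in at_right 0. E t - E (t - s) \<le> s * (growth K K\<kappa> (sqrt (E t)) + e)" if "0 < t" "t \<le> T" "e > 0" for t e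
      by (rule E_left[OF that(1,3) K(1) K(2) K\<kappa>]) (use that in auto)
    show "((\<lambda>t. A * exp (?k * t)) has_real_derivative A * (exp (?k * t) * ?k)) (at t)" for t
      by (auto intro!: derivative_eq_intros)
    show "growth K K\<kappa> (sqrt (?y t)) < A * (exp (?k * t) * ?k)" if "0 \<le> t" "t \<le> T" for t
    proof -
      have "\<epsilon> * sqrt (?y t) \<le> \<epsilon> * sqrt (?y T)" using y1(2)[OF that] eps by (intro mult_left_mono) auto
      then have "growth K K\<kappa> (sqrt (?y t)) < ?k * (sqrt (?y t))\<^sup>2"
        using \<epsilon> by (intro growth_less y1 that K(1) K\<kappa>(1)) auto
      also have "\<dots> = A * (exp (?k * t) * ?k)" using A by simp
      finally show ?thesis .
    qed
  qed (rule t)+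
  then have "sqrt (E t) \<le> sqrt (?y T)" using y1(2)[OF t] by (meson less_imp_le order_trans real_sqrt_le_mono)
  then have "sqrt (E t) * sqrt hmax \<le> sqrt (?y T) * sqrt hmax" using hmax by (intro mult_right_mono) auto
  then show ?thesis
    using dual.Hm1_norm_le[OF dual_rem[OF t(1)]] unfolding E_def[symmetric] by (meson ereal_less_eq(3) order_trans)
qed

lemma initial_energy:
  assumes "AE m in surf. p 0 m = approx \<epsilon> 0 m + \<epsilon>\<^sup>2 * r0 m" and r0: "sphere_Hm1_norm r0 \<le> ereal C"
  shows "E 0 \<le> (2 * \<bar>C\<bar>)\<^sup>2 / hmin"
proof -
  interpret dual "h 0" hmin hmax "rem 0" by (rule dual_rem) simp
  have L: "L2 r0" using r0 unfolding sphere_Hm1_norm_def sphere_L2_iff by (auto split: if_splits)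
  have ae: "AE m in surf. r0 m = rem 0 m" using assms(1) by eventually_elim (use eps in \<open>simp add: rem_def\<close>)
  have eq: "(LINT m|surf. r0 m * \<phi> m) = (LINT m|surf. rem 0 m * \<phi> m)" if "\<phi> \<in> borel_measurable surf" for \<phi>
    using ae L2_measurable[OF L] L2_measurable[OF r] that by (intro integral_cong_AE) auto
  have m0: "(LINT m|surf. r0 m) = 0" using eq[of "\<lambda>m. 1"] mean by simp
  have "\<bar>LINT m|surf. rem 0 m * \<phi> m\<bar> \<le> (2 * \<bar>C\<bar>) * l2norm (rgrad \<phi>)" if \<phi>: "sphere_smooth \<phi>" for \<phi>
    using sphere_Hm1_normD[OF r0 m0 \<phi>] eq[OF L2_measurable[OF L2_smooth[OF \<phi>]]] by simp
  then show ?thesis unfolding E_def by (intro dual_energy_le action_le) auto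
qed

end

text \<open>The equation determines \<open>n \<times> n'\<close> only, but \<open>n'\<close> is orthogonal to the unit vector \<open>n\<close>, so both have the same length.\<close>

lemma director_lipschitz:
  assumes dir: "director_solution D \<Omega> lam n0 n"
  obtains L where "L \<ge> 0" "\<And>s t. s \<ge> 0 \<Longrightarrow> t \<ge> 0 \<Longrightarrow> norm (n t - n s) \<le> L * \<bar>t - s\<bar>"
proof -
  obtain KD where KD: "KD \<ge> 0" "\<And>v. norm (D *v v) \<le> KD * norm v" using matrix_bound[of D] by blast
  obtain K\<Omega> where K\<Omega>: "K\<Omega> \<ge> 0" "\<And>v. norm (\<Omega> *v v) \<le> K\<Omega> * norm v" using matrix_bound[of \<Omega>] by blast
  define L where "L = K\<Omega> + \<bar>lam\<bar> * KD"
  have unit: "norm (n t) = 1" if "t \<ge> 0" for t using dir that by (simp add: director_solution_def)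
  have "\<exists>n'. (n has_vector_derivative n') (at t within {0..}) \<and> norm n' \<le> L" if t: "t \<ge> 0" for t
  proof -
    obtain n' where n': "(n has_vector_derivative n') (at t within {0..})" "cross3 (n t) (n' + \<Omega> *v n t - lam *\<^sub>R (D *v n t)) = 0"
      using dir t unfolding director_solution_def by blast
    have "at_right t \<le> at t within {0..}" using t by (intro at_le) auto
    then have nb: "at t within {0..} \<noteq> bot" using trivial_limit_at_right_real[of t] by (metis bot.extremum_uniqueI)
    have "((\<lambda>s. n s \<bullet> n s) has_vector_derivative (n t \<bullet> n' + n' \<bullet> n t)) (at t within {0..})"
      using bounded_bilinear.has_vector_derivative[OF bounded_bilinear_inner n'(1) n'(1)] .
    moreover have "((\<lambda>s. n s \<bullet> n s) has_vector_derivative 0) (at t within {0..})"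
    proof (rule has_vector_derivative_transform[of t "{0..}" _ "\<lambda>s. 1"])
      show "n s \<bullet> n s = 1" if "s \<in> {0..}" for s using unit[of s] that by (simp add: dot_square_norm)
    qed (use t in auto)
    ultimately have "n t \<bullet> n' + n' \<bullet> n t = 0" by (rule vector_derivative_unique_within[OF nb])
    then have o: "n t \<bullet> n' = 0" by (simp add: inner_commute)
    have "(norm (cross3 (n t) n'))\<^sup>2 = (norm n')\<^sup>2" unfolding norm_cross using o unit[OF t] by simp
    then have "norm n' = norm (cross3 (n t) n')" by (simp add: power2_eq_iff_nonneg)
    also have "cross3 (n t) n' = cross3 (n t) (lam *\<^sub>R (D *v n t) - \<Omega> *v n t)"
    proof -
      have "cross3 a (b + c - d) = cross3 a b - cross3 a (d - c)" for a b c d by (simp add: cross3_simps forall_3)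
      then show ?thesis using n'(2) by simp
    qed
    also have "norm \<dots> \<le> norm (lam *\<^sub>R (D *v n t) - \<Omega> *v n t)" using norm_cross3_le[of "n t"] unit[OF t] by simp
    also have "\<dots> \<le> \<bar>lam\<bar> * norm (D *v n t) + norm (\<Omega> *v n t)" by (rule order_trans[OF norm_triangle_ineq4]) simp
    also have "\<dots> \<le> \<bar>lam\<bar> * KD + K\<Omega>" using KD(2)[of "n t"] K\<Omega>(2)[of "n t"] unit[OF t] by (intro add_mono mult_left_mono) auto
    finally show ?thesis using n'(1) by (auto simp: L_def add.commute)
  qed
  then obtain n' where n': "\<And>t. t \<ge> 0 \<Longrightarrow> (n has_vector_derivative n' t) (at t within {0..})" "\<And>t. t \<ge> 0 \<Longrightarrow> norm (n' t) \<le> L" by metis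
  show thesis
  proof (rule that[of L])
    show "L \<ge> 0" using KD K\<Omega> by (simp add: L_def)
    fix s t :: real assume st: "s \<ge> 0" "t \<ge> 0"
    have "norm (n t - n s) \<le> L * norm (t - s)"
    proof (rule differentiable_bound[where f=n and S="{0..}" and f'="\<lambda>t x. x *\<^sub>R n' t"])
      show "(n has_derivative (\<lambda>x. x *\<^sub>R n' t)) (at t within {0..})" if "t \<in> {0..}" for t
        using n'(1)[of t] that by (simp add: has_vector_derivative_def)
      show "onorm (\<lambda>x. x *\<^sub>R n' t) \<le> L" if "t \<in> {0..}" for t
      proof (rule onorm_le)
        show "norm (x *\<^sub>R n' t) \<le> L * norm x" for x :: real
          using mult_left_mono[OF n'(2)[of t], of "\<bar>x\<bar>"] that by (simp add: mult.commute)
      qed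
    qed (use st in auto)
    then show "norm (n t - n s) \<le> L * \<bar>t - s\<bar>" by simp
  qed
qed

lemma strain_vorticity: "strain \<kappa> - vorticity \<kappa> = \<kappa>"
  unfolding strain_def vorticity_def scaleR_diff_right[symmetric] by (simp add: scaleR_2[symmetric])

theorem theorem2p1:
  fixes \<alpha> \<eta> lam C \<epsilon>\<^sub>1 :: real
    and \<kappa> D \<Omega> :: "real^3^3"
    and n0 :: "real^3"
    and n :: "real \<Rightarrow> real^3"
    and u0 g0 :: "real \<Rightarrow> real"
    and f :: "nat \<Rightarrow> real \<Rightarrow> real^3 \<Rightarrow> real"
    and f0 fR0 :: "real \<Rightarrow> real^3 \<Rightarrow> real"
  assumes "\<alpha> > 0"
    and "D = strain \<kappa>" and "\<Omega> = vorticity \<kappa>"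
    and "n0 \<in> S2"
    and "critical_point \<alpha> (equilibrium \<eta> n0)"
    and "stable_point \<alpha> (equilibrium \<eta> n0)"
    and "angular_profile n0 (mean_field \<alpha> (equilibrium \<eta> n0)) u0"
    and "solves_g0_equation u0 g0"
    and "lam = avg (equilibrium \<eta> n0) (\<lambda>m. 3 * (m \<bullet> n0)\<^sup>2 - 1) /
             avg (equilibrium \<eta> n0) (\<lambda>m. g0 (arccos (m \<bullet> n0)) * deriv u0 (arccos (m \<bullet> n0)))"
    and "director_solution D \<Omega> lam n0 n"
    and "hilbert_expansion \<alpha> \<eta> \<kappa> n f"
    and "\<epsilon>\<^sub>1 > 0"
    and "\<And>\<epsilon>. 0 < \<epsilon> \<Longrightarrow> \<epsilon> < \<epsilon>\<^sub>1 \<Longrightarrow>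
           sphere_H1 (f0 \<epsilon>) \<and> (LINT m|surf. f0 \<epsilon> m) = 1 \<and>
           (AE m in surf. f0 \<epsilon> m = equilibrium \<eta> n0 m + (\<Sum>k=1..3. \<epsilon> ^ k * f k 0 m)
                                  + \<epsilon>\<^sup>2 * fR0 \<epsilon> m) \<and>
           sphere_Hm1_norm (fR0 \<epsilon>) \<le> ereal C"
  shows "\<forall>T>0. \<exists>\<epsilon>\<^sub>0>0. \<exists>C'. \<forall>\<epsilon>. 0 < \<epsilon> \<and> \<epsilon> < \<epsilon>\<^sub>0 \<longrightarrow>
           (\<forall>f\<epsilon>. kinetic_solution \<alpha> (D - \<Omega>) \<epsilon> (f0 \<epsilon>) f\<epsilon> \<longrightarrow>
              (\<exists>fR. \<forall>t\<in>{0..T}.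
                 (AE m in surf. f\<epsilon> t m = equilibrium \<eta> (n t) m + (\<Sum>k=1..3. \<epsilon> ^ k * f k t m)
                                         + \<epsilon>\<^sup>2 * fR t m) \<and>
                 sphere_Hm1_norm (fR t) \<le> ereal C'))"
proof (intro allI impI)
  fix T :: real assume T: "T > 0"
  have unit: "norm (n t) = 1" if "t \<ge> 0" for t using assms(10) that by (simp add: director_solution_def)
  have n00: "n 0 = n0" using assms(10) by (simp add: director_solution_def)
  have n0: "norm n0 = 1" using assms(4) by simp
  obtain L where L: "L \<ge> 0" "\<And>s t. s \<ge> 0 \<Longrightarrow> t \<ge> 0 \<Longrightarrow> norm (n t - n s) \<le> L * \<bar>t - s\<bar>"
    by (rule director_lipschitz[OF assms(10)]) (rule that)
  interpret doi_expansion \<alpha> \<eta> L \<kappa> n f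
    by unfold_locales
      (use assms(1,11) unit L critical_point_rotate[OF assms(5) n0] stable_point_rotate[OF assms(6) n0] in auto)
  obtain K where K: "K \<ge> 0" "\<And>\<epsilon> t m. 0 < \<epsilon> \<Longrightarrow> \<epsilon> \<le> 1 \<Longrightarrow> 0 \<le> t \<Longrightarrow> t \<le> T \<Longrightarrow> norm m = 1 \<Longrightarrow>
      \<bar>corr \<epsilon> t m\<bar> \<le> K \<and> norm (corr_flux \<epsilon> t m) \<le> K \<and> \<bar>df3 t m\<bar> \<le> K"
    using coefficient_bounds[of T] by blast
  obtain K\<kappa> where K\<kappa>: "K\<kappa> \<ge> 0" "\<And>v. norm (\<kappa> *v v) \<le> K\<kappa> * norm v" using matrix_bound[of \<kappa>] by blast
  (* the summand 1 makes the initial energy strictly smaller than A, and A at least 1 *)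
  define A where "A = (2 * \<bar>C\<bar>)\<^sup>2 / hmin + 1"
  have A: "A \<ge> 1" "(2 * \<bar>C\<bar>)\<^sup>2 / hmin < A" using hmin by (auto simp: A_def)
  define Y where "Y = sqrt (A * exp (growth_constant K K\<kappa> * T))"
  have Y: "Y > 0" using A by (simp add: Y_def)
  (* the condition on Y makes the cubic term harmless up to time T *)
  define \<epsilon>\<^sub>0 where "\<epsilon>\<^sub>0 = min \<epsilon>\<^sub>1 (min 1 (1 / Y))"
  show "\<exists>\<epsilon>\<^sub>0>0. \<exists>C'. \<forall>\<epsilon>. 0 < \<epsilon> \<and> \<epsilon> < \<epsilon>\<^sub>0 \<longrightarrow>
           (\<forall>f\<epsilon>. kinetic_solution \<alpha> (D - \<Omega>) \<epsilon> (f0 \<epsilon>) f\<epsilon> \<longrightarrow>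
              (\<exists>fR. \<forall>t\<in>{0..T}.
                 (AE m in surf. f\<epsilon> t m = equilibrium \<eta> (n t) m + (\<Sum>k=1..3. \<epsilon> ^ k * f k t m)
                                         + \<epsilon>\<^sup>2 * fR t m) \<and>
                 sphere_Hm1_norm (fR t) \<le> ereal C'))"
  proof (rule exI[of _ \<epsilon>\<^sub>0], rule conjI, simp add: \<epsilon>\<^sub>0_def assms(12) Y, rule exI[of _ "Y * sqrt hmax"], intro allI impI)
    fix \<epsilon> p assume "0 < \<epsilon> \<and> \<epsilon> < \<epsilon>\<^sub>0" and sol: "kinetic_solution \<alpha> (D - \<Omega>) \<epsilon> (f0 \<epsilon>) p"
    then have \<epsilon>: "0 < \<epsilon>" "\<epsilon> < \<epsilon>\<^sub>1" "\<epsilon> \<le> 1" "\<epsilon> \<le> 1 / Y" by (auto simp: \<epsilon>\<^sub>0_def)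
    have init: "(LINT m|surf. f0 \<epsilon> m) = 1"
      "AE m in surf. f0 \<epsilon> m = equilibrium \<eta> n0 m + (\<Sum>k=1..3. \<epsilon> ^ k * f k 0 m) + \<epsilon>\<^sup>2 * fR0 \<epsilon> m"
      "sphere_Hm1_norm (fR0 \<epsilon>) \<le> ereal C"
      using assms(13)[OF \<epsilon>(1,2)] by blast+
    interpret kinetic \<alpha> \<eta> L \<kappa> n f \<epsilon> "f0 \<epsilon>" p
      by unfold_locales (use \<epsilon> sol init in \<open>auto simp: assms(2,3) strain_vorticity\<close>)
    have "AE m in surf. p 0 m = f0 \<epsilon> m" using sol by (simp add: kinetic_solution_def)
    then have "AE m in surf. p 0 m = approx \<epsilon> 0 m + \<epsilon>\<^sup>2 * fR0 \<epsilon> m"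
      using init(2) by eventually_elim (simp add: approx_def n00)
    then have E0: "E 0 < A" using initial_energy[OF _ init(3)] A by fastforce
    have "\<epsilon> * Y \<le> 1" using \<epsilon>(4) Y by (simp add: field_simps)
    then have bound: "sphere_Hm1_norm (rem t) \<le> ereal (Y * sqrt hmax)" if "0 \<le> t" "t \<le> T" for t
      unfolding Y_def by (intro remainder_bound A(1) E0 \<epsilon> K K\<kappa> that)
    show "\<exists>fR. \<forall>t\<in>{0..T}.
        (AE m in surf. p t m = equilibrium \<eta> (n t) m + (\<Sum>k=1..3. \<epsilon> ^ k * f k t m) + \<epsilon>\<^sup>2 * fR t m) \<and>
        sphere_Hm1_norm (fR t) \<le> ereal (Y * sqrt hmax)"
    proof (intro exI[of _ rem] ballI conjI AE_I2)
      fix t m assume "t \<in> {0..T}"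
      show "p t m = equilibrium \<eta> (n t) m + (\<Sum>k=1..3. \<epsilon> ^ k * f k t m) + \<epsilon>\<^sup>2 * rem t m"
        using p_eq[of t m] by (simp only: approx_def)
    qed (auto intro: bound)
  qed
qed

end
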